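(* Let $\mathfrak{M}$ be an instrument in a separable Hilbert space $\mathcal{H}$ with outcome set $\{X,\mathcal{F}\}$, and let $\mu$, $\mathcal{D}$, $\{x\mapsto V_k(x)\}_k$ be a Kraus-type representation of $\mathfrak{M}$, normalized as described in the context, i.e. in particular $$\langle\varphi|\mathfrak{M}^*(F)[A]\varphi\rangle=\int_F\sum_k\langle V_k(x)\varphi|AV_k(x)\varphi\rangle\,\mu(dx),\quad \varphi\in\mathcal{D},\ F\in\mathcal{F},\ A\in\mathfrak{B}(\mathcal{H}).$$ If $\mathfrak{M}$ is not efficient, then there exists a subset $F_s$ of $X$ such that $\mathfrak{M}(F_s)\neq0$ and $V_2(x)\neq0$ for all $x\in F_s$. If the instrument $\mathfrak{M}$ is irreducible but not efficient, then for $\mu$-almost all $x$ in $F_s$ all the nonzero operators $V_k(x)$ have the same one-dimensional range (depending on $x$), that is, $V_k(x)|\varphi\rangle=\omega_k(x)[\varphi]\,|\psi_x\rangle$ for all $\varphi\in\mathcal{D}$, where $\omega_k(x)$ is a linear functional defined on $\mathcal{D}$ (not necessarily bounded) and $\psi_x$ is a unit vector in $\mathcal{H}$ (not depending on $\varphi$). This means that $$\langle\varphi|\mathfrak{M}^*(F)[A]\varphi\rangle=\int_F\langle\psi_x|A\psi_x\rangle\sum_k|\omega_k(x)[\varphi]|^2\,\mu(dx)$$ for any $\varphi\in\mathcal{D}$, $A\in\mathfrak{B}(\mathcal{H})$ and $F\in\mathcal{F}$ such that $F\subseteq F_s$. It follows that for an arbitrary a priori state $\rho$ the posteriori state is $\rho_x=|\psi_x\rangle\langle\psi_x|$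 for $\mu_\rho$-almost all $x\in F_s$ (that is, $\rho_x$ does not depend on $\rho$).
   Context: $\mathfrak{B}(\mathcal{H})$, $\mathfrak{T}(\mathcal{H})$, $\mathfrak{S}(\mathcal{H})$ denote bounded operators, trace-class operators and states (density operators). An instrument $\mathfrak{M}$ in $\mathcal{H}$ with outcome set a measurable space $\{X,\mathcal{F}\}$ is a $\sigma$-additive map $F\mapsto\mathfrak{M}(F)$ from $\mathcal{F}$ to completely positive trace-non-increasing linear maps $\mathfrak{T}(\mathcal{H})\to\mathfrak{T}(\mathcal{H})$ such that $\mathfrak{M}(X)$ is trace preserving; $\mathfrak{M}^*(F):\mathfrak{B}(\mathcal{H})\to\mathfrak{B}(\mathcal{H})$ is the dual map. For an a priori state $\rho$, the posteriori measure is $\mu_\rho(F)=\mathrm{Tr}\,\mathfrak{M}(F)[\rho]$, and a family of posteriori states is a family $\{\rho_x\}_{x\in X}$ of states, defined for $\mu_\rho$-almost all $x$, with $x\mapsto\mathrm{Tr}A\rho_x$ measurable for all $A\in\mathfrak{B}(\mathcal{H})$ and $\int_F\rho_x\,\mu_\rho(dx)=\mathfrak{M}(F)[\rho]$ for all $F\in\mathcal{F}$. $\mathfrak{M}$ is irreducible if for every pure a priori state $\rho$ the posteriori states $\rho_x$ are pure for $\mu_\rho$-almost all $x$. Every instrument can be written as $\mathfrak{M}^*(F)[A]=V^*(A\otimes P(F))V$ with an isometry $V:\mathcal{H}\to\mathcal{H}\otimes\mathcal{H}_0$ and a spectral (projection-valued) measure $P$ on $\{X,\mathcal{F}\}$ in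 a Hilbert space $\mathcal{H}_0$; $\mathfrak{M}$ is efficient if it has such a representation with $P$ of multiplicity one. Kraus-type representation (Holevo): for an arbitrary instrument $\mathfrak{M}$ there exist a positive $\sigma$-finite measure $\mu$ on $\{X,\mathcal{F}\}$, a dense domain $\mathcal{D}\subset\mathcal{H}$ and a countable family of functions $x\mapsto V_k(x)$ ($k=1,2,\dots$) defined for $\mu$-almost all $x$, such that $V_k(x)$ is a linear operator from $\mathcal{D}$ to $\mathcal{H}$ and the first displayed formula for $\langle\varphi|\mathfrak{M}^*(F)[A]\varphi\rangle$ holds. Normalization: for each $x$, the nonzero operators of the family $\{V_k(x)\}_k$ are not proportional to each other (if $V_{k'}(x_0)=\lambda V_k(x_0)$ for some $x_0$ and $\lambda\in\mathbb{C}$, one replaces $V_k(x_0)$ by $\sqrt{1+|\lambda|^2}\,V_k(x_0)$ and $V_{k'}(x_0)$ by $0$), and if $V_k(x)=0$ then $V_{k'}(x)=0$ for all $k'>k$. With this normalization, $\mathfrak{M}$ is efficient if and only if $V_k(x)=0$ for $k>1$ and $\mu$-almost all $x$.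
   Formalization: "For μ-almost all x in F_s, V_k(x)φ = ω_k(x)[φ]ψ_x for all φ∈D" and the common one-dimensional range are false for general dense D; they are proved when D is the span of a countable set, and for general D the identity is proved with a null set that may depend on φ. *)

theory Defs
  imports "HOL-Analysis.Analysis"
begin

text \<open>The scalar product is linear in the second argument, as in Dirac notation. Building on
  \<open>real_inner\<close> (with the real part of the scalar product) makes the norm, the topology and
  the completeness those of the library.\<close>

class complex_hilbert = real_inner + complete_space +
  fixes scaleC :: "complex \<Rightarrow> 'a \<Rightarrow> 'a" (infixr "*\<^sub>C" 75)
    and cinner :: "'a \<Rightarrow> 'a \<Rightarrow> complex"
  assumes scaleC_add_right: "c *\<^sub>C (x + y) = c *\<^sub>C x + c *\<^sub>C y"
    and scaleC_add_left: "(c + d) *\<^sub>C x = c *\<^sub>C x + d *\<^sub>C x"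
    and scaleC_scaleC: "c *\<^sub>C d *\<^sub>C x = (c * d) *\<^sub>C x"
    and scaleR_scaleC: "scaleR r x = complex_of_real r *\<^sub>C x"
    and cinner_commute: "cinner x y = cnj (cinner y x)"
    and cinner_add_right: "cinner x (y + z) = cinner x y + cinner x z"
    and cinner_scaleC_right: "cinner x (c *\<^sub>C y) = c * cinner x y"
    and Re_cinner: "Re (cinner x y) = inner x y"

global_interpretation complex_vector: vector_space "scaleC :: complex \<Rightarrow> 'a \<Rightarrow> 'a::complex_hilbert"
  defines csubspace = complex_vector.subspace
    and cspan = complex_vector.span
proof
  fix c d :: complex and x y :: 'a
  show "c *\<^sub>C (x + y) = c *\<^sub>C x + c *\<^sub>C y" by (rule scaleC_add_right)
  show "(c + d) *\<^sub>C x = c *\<^sub>C x + d *\<^sub>C x" by (rule scaleC_add_left)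
  show "c *\<^sub>C d *\<^sub>C x = (c * d) *\<^sub>C x" by (rule scaleC_scaleC)
  show "1 *\<^sub>C x = x" using scaleR_scaleC[of 1 x] by simp
qed

lemma cinner_self: "cinner x x = complex_of_real ((norm (x::'a::complex_hilbert))\<^sup>2)"
proof (rule complex_eqI)
  show "Re (cinner x x) = Re (complex_of_real ((norm x)\<^sup>2))"
    by (simp add: Re_cinner power2_norm_eq_inner)
  have "Im (cinner x x) = - Im (cinner x x)"
    using arg_cong[OF cinner_commute[of x x], of Im] by simp
  then show "Im (cinner x x) = Im (complex_of_real ((norm x)\<^sup>2))" by simp
qed

lemma norm_scaleC: "norm (c *\<^sub>C (x::'a::complex_hilbert)) = cmod c * norm x"
proof -
  have "cinner (c *\<^sub>C x) (c *\<^sub>C x) = c * cnj c * cinner x x"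
    using cinner_commute[of "c *\<^sub>C x" x] cinner_commute[of x x]
    by (simp only: cinner_scaleC_right complex_cnj_mult mult.assoc)
  then have "complex_of_real ((norm (c *\<^sub>C x))\<^sup>2) = complex_of_real ((cmod c * norm x)\<^sup>2)"
    unfolding cinner_self complex_norm_square[symmetric] power_mult_distrib of_real_mult .
  then have "(norm (c *\<^sub>C x))\<^sup>2 = (cmod c * norm x)\<^sup>2" by (simp only: of_real_eq_iff)
  then show ?thesis by (simp add: power2_eq_iff_nonneg)
qed

instantiation complex :: complex_hilbert
begin
definition scaleC_complex :: "complex \<Rightarrow> complex \<Rightarrow> complex" where "scaleC_complex c x = c * x"
definition cinner_complex :: "complex \<Rightarrow> complex \<Rightarrow> complex" where "cinner_complex x y = cnj x * y"
instance
  by standard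
    (simp_all add: scaleC_complex_def cinner_complex_def algebra_simps scaleR_conv_of_real inner_complex_def)
end

typedef (overloaded) ('i, 'a) l2 =
  "{f :: 'i \<Rightarrow> 'a::complex_hilbert. (\<lambda>i. (norm (f i))\<^sup>2) summable_on UNIV}"
  by (rule exI[of _ "\<lambda>_. 0"]) simp

setup_lifting type_definition_l2

lemma l2_add: fixes f g :: "'i \<Rightarrow> 'a::real_inner"
  assumes "(\<lambda>i. (norm (f i))\<^sup>2) summable_on UNIV" "(\<lambda>i. (norm (g i))\<^sup>2) summable_on UNIV"
  shows "(\<lambda>i. (norm (f i + g i))\<^sup>2) summable_on UNIV"
proof (rule summable_on_comparison_test)
  show "(\<lambda>i. 2 * (norm (f i))\<^sup>2 + 2 * (norm (g i))\<^sup>2) summable_on UNIV"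
    by (intro summable_on_add summable_on_cmult_right assms)
  fix i
  have "(norm (f i + g i))\<^sup>2 \<le> (norm (f i) + norm (g i))\<^sup>2"
    by (simp add: norm_triangle_ineq power_mono)
  also have "\<dots> \<le> 2 * (norm (f i))\<^sup>2 + 2 * (norm (g i))\<^sup>2"
    using sum_squares_bound[of "norm (f i)" "norm (g i)"] by (simp add: power2_sum)
  finally show "(norm (f i + g i))\<^sup>2 \<le> 2 * (norm (f i))\<^sup>2 + 2 * (norm (g i))\<^sup>2" .
qed simp

lemma l2_scale: fixes f :: "'i \<Rightarrow> 'a::complex_hilbert"
  assumes "(\<lambda>i. (norm (f i))\<^sup>2) summable_on UNIV"
  shows "(\<lambda>i. (norm (c *\<^sub>C f i))\<^sup>2) summable_on UNIV"
  by (simp add: norm_scaleC power_mult_distrib summable_on_cmult_right assms)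

lemma cmod_cinner_le: "cmod (cinner x y) \<le> norm x * norm (y::'a::complex_hilbert)"
proof (cases "cinner x y = 0")
  case False
  define u where "u = cnj (sgn (cinner x y))"
  have u: "cmod u = 1" using False by (simp add: u_def norm_sgn)
  have "cinner x (u *\<^sub>C y) = complex_of_real (cmod (cinner x y))"
    using False complex_norm_square[of "cinner x y"] unfolding cinner_scaleC_right u_def
    by (simp add: sgn_eq power2_eq_square mult.commute divide_eq_eq)
  then have "cmod (cinner x y) = inner x (u *\<^sub>C y)" by (metis Re_cinner Re_complex_of_real)
  also have "\<dots> \<le> norm x * norm (u *\<^sub>C y)" by (rule norm_cauchy_schwarz)
  finally show ?thesis by (simp add: norm_scaleC u)
qed simp

lemma l2_cinner: fixes f g :: "'i \<Rightarrow> 'a::complex_hilbert"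
  assumes "(\<lambda>i. (norm (f i))\<^sup>2) summable_on UNIV" "(\<lambda>i. (norm (g i))\<^sup>2) summable_on UNIV"
  shows "(\<lambda>i. cinner (f i) (g i)) summable_on UNIV"
proof (rule abs_summable_summable, rule summable_on_comparison_test)
  show "(\<lambda>i. (norm (f i))\<^sup>2 + (norm (g i))\<^sup>2) summable_on UNIV"
    by (intro summable_on_add assms)
  fix i
  have "cmod (cinner (f i) (g i)) \<le> norm (f i) * norm (g i)" by (rule cmod_cinner_le)
  also have "\<dots> \<le> (norm (f i))\<^sup>2 + (norm (g i))\<^sup>2"
    using sum_squares_bound[of "norm (f i)" "norm (g i)"]
      mult_nonneg_nonneg[OF norm_ge_zero norm_ge_zero, of "f i" "g i"] by linarith
  finally show "norm (cinner (f i) (g i)) \<le> (norm (f i))\<^sup>2 + (norm (g i))\<^sup>2" .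
qed simp

lemma l2_inner: fixes f g :: "'i \<Rightarrow> 'a::complex_hilbert"
  assumes "(\<lambda>i. (norm (f i))\<^sup>2) summable_on UNIV" "(\<lambda>i. (norm (g i))\<^sup>2) summable_on UNIV"
  shows "(\<lambda>i. inner (f i) (g i)) summable_on UNIV"
  using summable_on_Re[OF l2_cinner[OF assms]] by (simp add: Re_cinner)

lemma scaleC_minus1: "(-1) *\<^sub>C (x::'a::complex_hilbert) = - x"
  using scaleR_scaleC[of "-1" x] by simp

instantiation l2 :: (type, complex_hilbert) real_inner
begin

lift_definition zero_l2 :: "('a, 'b) l2" is "\<lambda>_. 0" by simp
lift_definition plus_l2 :: "('a, 'b) l2 \<Rightarrow> ('a, 'b) l2 \<Rightarrow> ('a, 'b) l2" is "\<lambda>f g i. f i + g i"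
  by (rule l2_add)
lift_definition uminus_l2 :: "('a, 'b) l2 \<Rightarrow> ('a, 'b) l2" is "\<lambda>f i. - f i" by simp
lift_definition minus_l2 :: "('a, 'b) l2 \<Rightarrow> ('a, 'b) l2 \<Rightarrow> ('a, 'b) l2" is "\<lambda>f g i. f i - g i"
  subgoal for f g using l2_add[of f "\<lambda>i. - g i"] by simp done
lift_definition scaleR_l2 :: "real \<Rightarrow> ('a, 'b) l2 \<Rightarrow> ('a, 'b) l2" is "\<lambda>r f i. r *\<^sub>R f i"
  unfolding scaleR_scaleC by (rule l2_scale)
lift_definition inner_l2 :: "('a, 'b) l2 \<Rightarrow> ('a, 'b) l2 \<Rightarrow> real"
  is "\<lambda>f g. \<Sum>\<^sub>\<infinity>i. inner (f i) (g i)" .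
definition norm_l2 :: "('a, 'b) l2 \<Rightarrow> real" where "norm_l2 f = sqrt (inner f f)"
definition dist_l2 :: "('a, 'b) l2 \<Rightarrow> ('a, 'b) l2 \<Rightarrow> real" where "dist_l2 f g = norm (f - g)"
definition sgn_l2 :: "('a, 'b) l2 \<Rightarrow> ('a, 'b) l2" where "sgn_l2 f = inverse (norm f) *\<^sub>R f"
definition uniformity_l2 :: "(('a, 'b) l2 \<times> ('a, 'b) l2) filter" where
  "uniformity_l2 = (INF e\<in>{0<..}. principal {(x, y). dist x y < e})"
definition open_l2 :: "('a, 'b) l2 set \<Rightarrow> bool" where
  "open_l2 U = (\<forall>x\<in>U. eventually (\<lambda>(x', y). x' = x \<longrightarrow> y \<in> U) uniformity)"

instance
proof
  fix f g h :: "('a, 'b) l2" and r s :: real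
  show "f + g + h = f + (g + h)" by transfer (simp add: add.assoc)
  show "f + g = g + f" by transfer (simp add: add.commute)
  show "0 + f = f" by transfer simp
  show "- f + f = 0" by transfer simp
  show "f - g = f + - g" by transfer simp
  show "r *\<^sub>R (f + g) = r *\<^sub>R f + r *\<^sub>R g" by transfer (simp add: scaleR_add_right)
  show "(r + s) *\<^sub>R f = r *\<^sub>R f + s *\<^sub>R f" by transfer (simp add: scaleR_add_left)
  show "r *\<^sub>R s *\<^sub>R f = (r * s) *\<^sub>R f" by transfer simp
  show "1 *\<^sub>R f = f" by transfer simp
  show "dist f g = norm (f - g)" by (rule dist_l2_def)
  show "sgn f = inverse (norm f) *\<^sub>R f" by (rule sgn_l2_def)
  show "(uniformity :: (('a, 'b) l2 \<times> ('a, 'b) l2) filter) =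
      (INF e\<in>{0<..}. principal {(x, y). dist x y < e})" by (rule uniformity_l2_def)
  show "open U = (\<forall>x\<in>U. \<forall>\<^sub>F (x', y) in uniformity. x' = x \<longrightarrow> y \<in> U)" for U :: "('a, 'b) l2 set"
    by (rule open_l2_def)
  show "inner f g = inner g f" by transfer (simp add: inner_commute)
  show "inner (f + g) h = inner f h + inner g h"
    by transfer (simp add: inner_add_left infsum_add l2_inner)
  show "inner (r *\<^sub>R f) g = r * inner f g"
    by transfer (simp add: infsum_cmult_right l2_inner)
  show "0 \<le> inner f f" by transfer (simp add: infsum_nonneg)
  show "(inner f f = 0) = (f = 0)"
  proof
    assume "inner f f = 0"
    then show "f = 0"
    proof transfer
      fix f :: "'a \<Rightarrow> 'b"
      assume s: "(\<lambda>i. (norm (f i))\<^sup>2) summable_on UNIV" and z: "(\<Sum>\<^sub>\<infinity>i. inner (f i) (f i)) = 0"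
      have "inner (f i) (f i) = 0" for i
        by (rule nonneg_infsum_le_0D[of _ UNIV])
          (use z l2_inner[OF s s] in auto)
      then show "f = (\<lambda>_. 0)" by auto
    qed
  next
    assume "f = 0" then show "inner f f = 0" by (simp, transfer, simp)
  qed
  show "norm f = sqrt (inner f f)" by (rule norm_l2_def)
qed

end

lemma sum_norm_l2_le:
  assumes "finite I"
  shows "(\<Sum>i\<in>I. (norm (Rep_l2 f i))\<^sup>2) \<le> (norm f)\<^sup>2"
proof -
  have "(norm f)\<^sup>2 = (\<Sum>\<^sub>\<infinity>i. (norm (Rep_l2 f i))\<^sup>2)"
    by (simp add: power2_norm_eq_inner inner_l2.rep_eq)
  moreover have "(\<Sum>i\<in>I. (norm (Rep_l2 f i))\<^sup>2) \<le> (\<Sum>\<^sub>\<infinity>i. (norm (Rep_l2 f i))\<^sup>2)"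
    by (rule finite_sum_le_infsum) (use Rep_l2[of f] assms in auto)
  ultimately show ?thesis by simp
qed

lemma norm_l2_leI:
  assumes "0 \<le> e" "\<And>I. finite I \<Longrightarrow> (\<Sum>i\<in>I. (norm (Rep_l2 f i))\<^sup>2) \<le> e\<^sup>2"
  shows "norm f \<le> e"
proof -
  have "(norm f)\<^sup>2 = (\<Sum>\<^sub>\<infinity>i. (norm (Rep_l2 f i))\<^sup>2)"
    by (simp add: power2_norm_eq_inner inner_l2.rep_eq)
  also have "\<dots> \<le> e\<^sup>2"
    by (rule infsum_le_finite_sums) (use Rep_l2[of f] assms in auto)
  finally show ?thesis using assms(1) by (simp add: power2_le_iff_abs_le)
qed

lemma l2_Cauchy_convergent:
  fixes X :: "nat \<Rightarrow> ('i, 'a::complex_hilbert) l2"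
  assumes X: "Cauchy X"
  shows "convergent X"
proof -
  have le: "norm (Rep_l2 f i) \<le> norm f" for f :: "('i, 'a) l2" and i
    using sum_norm_l2_le[of "{i}" f] by (simp add: power2_le_iff_abs_le)
  have "Cauchy (\<lambda>n. Rep_l2 (X n) i)" for i
  proof (rule metric_CauchyI)
    fix e :: real assume "0 < e"
    then obtain N where "\<And>m n. m \<ge> N \<Longrightarrow> n \<ge> N \<Longrightarrow> dist (X m) (X n) < e"
      using metric_CauchyD[OF X] by blast
    moreover have "dist (Rep_l2 (X m) i) (Rep_l2 (X n) i) \<le> dist (X m) (X n)" for m n
      using le[of "X m - X n" i] by (simp add: dist_norm minus_l2.rep_eq)
    ultimately have "dist (Rep_l2 (X m) i) (Rep_l2 (X n) i) < e" if "m \<ge> N" "n \<ge> N" for m n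
      using that by (rule_tac le_less_trans)
    then show "\<exists>N. \<forall>m\<ge>N. \<forall>n\<ge>N. dist (Rep_l2 (X m) i) (Rep_l2 (X n) i) < e" by blast
  qed
  then have "\<exists>l. (\<lambda>n. Rep_l2 (X n) i) \<longlonglongrightarrow> l" for i
    using Cauchy_convergent convergent_def by blast
  then obtain L where L: "\<And>i. (\<lambda>n. Rep_l2 (X n) i) \<longlonglongrightarrow> L i" by metis
  have tail: "(\<Sum>i\<in>I. (norm (Rep_l2 (X m) i - L i))\<^sup>2) \<le> e\<^sup>2"
    if fin: "finite I" and small: "\<And>n. n \<ge> N \<Longrightarrow> norm (X m - X n) \<le> e" for I m N e
  proof (rule LIMSEQ_le_const2)
    show "(\<lambda>n. \<Sum>i\<in>I. (norm (Rep_l2 (X m) i - Rep_l2 (X n) i))\<^sup>2)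
        \<longlonglongrightarrow> (\<Sum>i\<in>I. (norm (Rep_l2 (X m) i - L i))\<^sup>2)"
      by (intro tendsto_intros L)
    have "(\<Sum>i\<in>I. (norm (Rep_l2 (X m) i - Rep_l2 (X n) i))\<^sup>2) \<le> e\<^sup>2" if "n \<ge> N" for n
      using sum_norm_l2_le[OF fin, of "X m - X n"] power_mono[OF small[OF that] norm_ge_zero, of 2]
      by (simp add: minus_l2.rep_eq)
    then show "\<exists>N. \<forall>n\<ge>N. (\<Sum>i\<in>I. (norm (Rep_l2 (X m) i - Rep_l2 (X n) i))\<^sup>2) \<le> e\<^sup>2"
      by blast
  qed
  have cauchy: "\<exists>N. \<forall>m\<ge>N. \<forall>n\<ge>N. norm (X m - X n) \<le> e" if "e > 0" for e
    using metric_CauchyD[OF X that] unfolding dist_norm by (blast intro: less_imp_le)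
  obtain N where N: "\<And>n. n \<ge> N \<Longrightarrow> norm (X N - X n) \<le> 1"
    using cauchy[of 1] by auto
  have "(\<lambda>i. (norm (Rep_l2 (X N) i - L i))\<^sup>2) summable_on UNIV"
  proof (rule nonneg_bdd_above_summable_on)
    show "bdd_above (sum (\<lambda>i. (norm (Rep_l2 (X N) i - L i))\<^sup>2) ` {F. F \<subseteq> UNIV \<and> finite F})"
      using tail[OF _ N] by (intro bdd_aboveI2[where M = "1\<^sup>2"]) auto
  qed simp
  then have "(\<lambda>i. (norm (Rep_l2 (X N) i + - (Rep_l2 (X N) i - L i)))\<^sup>2) summable_on UNIV"
    using Rep_l2[of "X N"] by (intro l2_add) (auto simp del: minus_diff_eq)
  then have "(\<lambda>i. (norm (L i))\<^sup>2) summable_on UNIV" by simp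
  then have L': "Rep_l2 (Abs_l2 L) = L" by (simp add: Abs_l2_inverse)
  have "X \<longlonglongrightarrow> Abs_l2 L"
  proof (rule metric_LIMSEQ_I)
    fix r :: real assume "0 < r"
    then obtain K where K: "\<And>m n. m \<ge> K \<Longrightarrow> n \<ge> K \<Longrightarrow> norm (X m - X n) \<le> r / 2"
      using cauchy[of "r / 2"] by auto
    have "norm (X m - Abs_l2 L) \<le> r / 2" if "m \<ge> K" for m
      using tail[OF _ K[OF that]] \<open>0 < r\<close> by (intro norm_l2_leI) (auto simp: minus_l2.rep_eq L')
    moreover have "r / 2 < r" using \<open>0 < r\<close> by simp
    ultimately have "dist (X m) (Abs_l2 L) < r" if "m \<ge> K" for m
      using that unfolding dist_norm by (rule_tac le_less_trans)
    then show "\<exists>N. \<forall>m\<ge>N. dist (X m) (Abs_l2 L) < r" by blast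
  qed
  then show ?thesis by (auto simp: convergent_def)
qed

instance l2 :: (type, complex_hilbert) complete_space
  by standard (rule l2_Cauchy_convergent)

instantiation l2 :: (type, complex_hilbert) complex_hilbert
begin

lift_definition scaleC_l2 :: "complex \<Rightarrow> ('a, 'b) l2 \<Rightarrow> ('a, 'b) l2" is "\<lambda>c f i. c *\<^sub>C f i"
  by (rule l2_scale)
lift_definition cinner_l2 :: "('a, 'b) l2 \<Rightarrow> ('a, 'b) l2 \<Rightarrow> complex"
  is "\<lambda>f g. \<Sum>\<^sub>\<infinity>i. cinner (f i) (g i)" .

instance
proof
  fix f g h :: "('a, 'b) l2" and c d :: complex and r :: real
  show "c *\<^sub>C (f + g) = c *\<^sub>C f + c *\<^sub>C g" by transfer (simp add: scaleC_add_right)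
  show "(c + d) *\<^sub>C f = c *\<^sub>C f + d *\<^sub>C f" by transfer (simp add: scaleC_add_left)
  show "c *\<^sub>C d *\<^sub>C f = (c * d) *\<^sub>C f" by transfer (simp add: scaleC_scaleC)
  show "r *\<^sub>R f = complex_of_real r *\<^sub>C f" by transfer (simp add: scaleR_scaleC)
  show "cinner f g = cnj (cinner g f)"
    by transfer (simp add: infsum_cnj[symmetric] cinner_commute[symmetric])
  show "cinner f (g + h) = cinner f g + cinner f h"
    by transfer (simp add: cinner_add_right infsum_add l2_cinner)
  show "cinner f (c *\<^sub>C g) = c * cinner f g"
    by transfer (simp add: cinner_scaleC_right infsum_cmult_right l2_cinner)
  show "Re (cinner f g) = inner f g"
    by transfer (simp add: infsum_Re[symmetric] l2_cinner Re_cinner)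
qed

end


definition bounded_op :: "('a::complex_hilbert \<Rightarrow> 'b::complex_hilbert) \<Rightarrow> bool" where
  "bounded_op A \<longleftrightarrow> bounded_linear A \<and> (\<forall>c x. A (c *\<^sub>C x) = c *\<^sub>C A x)"

definition clinear_on :: "'a::complex_hilbert set \<Rightarrow> ('a \<Rightarrow> 'b::complex_hilbert) \<Rightarrow> bool" where
  "clinear_on D f \<longleftrightarrow>
    (\<forall>x\<in>D. \<forall>y\<in>D. f (x + y) = f x + f y) \<and> (\<forall>c. \<forall>x\<in>D. f (c *\<^sub>C x) = c *\<^sub>C f x)"

definition cadjoint :: "('a::complex_hilbert \<Rightarrow> 'b::complex_hilbert) \<Rightarrow> 'b \<Rightarrow> 'a" where
  "cadjoint A = (THE B. bounded_op B \<and> (\<forall>x y. cinner (A x) y = cinner x (B y)))"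

definition positive_op :: "('a::complex_hilbert \<Rightarrow> 'a) \<Rightarrow> bool" where
  "positive_op A \<longleftrightarrow> (\<forall>x. cinner x (A x) \<in> \<real>\<^sub>\<ge>\<^sub>0)"

definition isometry_op :: "('a::complex_hilbert \<Rightarrow> 'b::complex_hilbert) \<Rightarrow> bool" where
  "isometry_op V \<longleftrightarrow> bounded_op V \<and> (\<forall>x. norm (V x) = norm x)"

definition projection_op :: "('a::complex_hilbert \<Rightarrow> 'a) \<Rightarrow> bool" where
  "projection_op P \<longleftrightarrow>
    bounded_op P \<and> P \<circ> P = P \<and> (\<forall>x y. cinner (P x) y = cinner x (P y))"

definition ket_bra :: "'a::complex_hilbert \<Rightarrow> 'a \<Rightarrow> 'a \<Rightarrow> 'a" where
  "ket_bra a b = (\<lambda>x. cinner b x *\<^sub>C a)"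

definition is_onb :: "'a::complex_hilbert set \<Rightarrow> bool" where
  "is_onb E \<longleftrightarrow>
    (\<forall>e\<in>E. \<forall>f\<in>E. cinner e f = (if e = f then 1 else 0)) \<and> closure (cspan E) = UNIV"

text \<open>On a Hilbert space the trace class operators are the nuclear ones: those of the form
  \<open>\<Sum>\<^sub>n |a\<^sub>n\<rangle>\<langle>b\<^sub>n|\<close> with \<open>\<Sum>\<^sub>n \<parallel>a\<^sub>n\<parallel> \<parallel>b\<^sub>n\<parallel> < \<infinity>\<close>.\<close>

definition trace_class :: "('a::complex_hilbert \<Rightarrow> 'a) \<Rightarrow> bool" where
  "trace_class T \<longleftrightarrow> bounded_op T \<and>
    (\<exists>a b :: nat \<Rightarrow> 'a. summable (\<lambda>n. norm (a n) * norm (b n)) \<and>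
      (\<forall>x. (\<lambda>n. ket_bra (a n) (b n) x) sums T x))"

definition trace :: "('a::complex_hilbert \<Rightarrow> 'a) \<Rightarrow> complex" where
  "trace T = (\<Sum>\<^sub>\<infinity>e\<in>(SOME E. is_onb E). cinner e (T e))"

definition state :: "('a::complex_hilbert \<Rightarrow> 'a) \<Rightarrow> bool" where
  "state \<rho> \<longleftrightarrow> trace_class \<rho> \<and> positive_op \<rho> \<and> trace \<rho> = 1"

definition pure_state :: "('a::complex_hilbert \<Rightarrow> 'a) \<Rightarrow> bool" where
  "pure_state \<rho> \<longleftrightarrow> (\<exists>\<psi>. norm \<psi> = 1 \<and> \<rho> = ket_bra \<psi> \<psi>)"

text \<open>Maps on the trace class are functions on all operators of which only the values on trace
  class operators matter.\<close>

definition superop_linear :: "(('a::complex_hilbert \<Rightarrow> 'a) \<Rightarrow> ('a \<Rightarrow> 'a)) \<Rightarrow> bool" where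
  "superop_linear \<Phi> \<longleftrightarrow>
    (\<forall>T. trace_class T \<longrightarrow> trace_class (\<Phi> T)) \<and>
    (\<forall>S T. trace_class S \<and> trace_class T \<longrightarrow> \<Phi> (\<lambda>x. S x + T x) = (\<lambda>x. \<Phi> S x + \<Phi> T x)) \<and>
    (\<forall>c T. trace_class T \<longrightarrow> \<Phi> (\<lambda>x. c *\<^sub>C T x) = (\<lambda>x. c *\<^sub>C \<Phi> T x))"

text \<open>Complete positivity: for every \<open>n\<close>, positivity of \<open>\<Phi> \<otimes> id\<close> on the
  \<open>n \<times> n\<close> block matrices of trace class operators.\<close>

definition block_positive :: "nat \<Rightarrow> (nat \<Rightarrow> nat \<Rightarrow> 'a::complex_hilbert \<Rightarrow> 'a) \<Rightarrow> bool" where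
  "block_positive n T \<longleftrightarrow>
    (\<forall>\<phi>. (\<Sum>i<n. \<Sum>j<n. cinner (\<phi> i) (T i j (\<phi> j))) \<in> \<real>\<^sub>\<ge>\<^sub>0)"

definition completely_positive :: "(('a::complex_hilbert \<Rightarrow> 'a) \<Rightarrow> ('a \<Rightarrow> 'a)) \<Rightarrow> bool" where
  "completely_positive \<Phi> \<longleftrightarrow>
    (\<forall>n T. (\<forall>i<n. \<forall>j<n. trace_class (T i j)) \<and> block_positive n T \<longrightarrow>
      block_positive n (\<lambda>i j. \<Phi> (T i j)))"

definition dual_map ::
  "(('a::complex_hilbert \<Rightarrow> 'a) \<Rightarrow> ('a \<Rightarrow> 'a)) \<Rightarrow> ('a \<Rightarrow> 'a) \<Rightarrow> ('a \<Rightarrow> 'a)" where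
  "dual_map \<Phi> A =
    (THE B. bounded_op B \<and> (\<forall>T. trace_class T \<longrightarrow> trace (A \<circ> \<Phi> T) = trace (B \<circ> T)))"

text \<open>The outcome space is the measurable space of \<open>X\<close>; the measure of \<open>X\<close> is irrelevant. The
  \<open>\<sigma>\<close>-additivity is in the weak topology given by the duality with bounded operators, where
  by the Orlicz-Pettis theorem it is the same as in trace norm.\<close>

definition instrument ::
  "'x measure \<Rightarrow> ('x set \<Rightarrow> ('a::complex_hilbert \<Rightarrow> 'a) \<Rightarrow> ('a \<Rightarrow> 'a)) \<Rightarrow> bool" where
  "instrument X M \<longleftrightarrow>
    (\<forall>F\<in>sets X. superop_linear (M F) \<and> completely_positive (M F) \<and>
      (\<forall>T. trace_class T \<and> positive_op T \<longrightarrow> Re (trace (M F T)) \<le> Re (trace T))) \<and>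
    (\<forall>F. disjoint_family F \<and> range F \<subseteq> sets X \<longrightarrow>
      (\<forall>A T. bounded_op A \<and> trace_class T \<longrightarrow>
        (\<lambda>n::nat. trace (A \<circ> M (F n) T)) sums trace (A \<circ> M (\<Union>n. F n) T))) \<and>
    (\<forall>T. trace_class T \<longrightarrow> trace (M (space X) T) = trace T)"

definition posteriori_measure ::
  "'x measure \<Rightarrow> ('x set \<Rightarrow> ('a::complex_hilbert \<Rightarrow> 'a) \<Rightarrow> ('a \<Rightarrow> 'a)) \<Rightarrow> ('a \<Rightarrow> 'a) \<Rightarrow> 'x measure"
  where "posteriori_measure X M \<rho> =
    measure_of (space X) (sets X) (\<lambda>F. ennreal (Re (trace (M F \<rho>))))"

text \<open>Here and below, functions that are defined almost everywhere are total functions with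
  arbitrary values on some null set. Their measurability and their integrals refer to the completed
  measure, so that these values play no role. The integral of the states is the weak one, tested
  on bounded operators.\<close>

definition posteriori_states ::
  "'x measure \<Rightarrow> ('x set \<Rightarrow> ('a::complex_hilbert \<Rightarrow> 'a) \<Rightarrow> ('a \<Rightarrow> 'a)) \<Rightarrow> ('a \<Rightarrow> 'a) \<Rightarrow>
    ('x \<Rightarrow> 'a \<Rightarrow> 'a) \<Rightarrow> bool" where
  "posteriori_states X M \<rho> r \<longleftrightarrow>
    (AE x in posteriori_measure X M \<rho>. state (r x)) \<and>
    (\<forall>A. bounded_op A \<longrightarrow>
      (\<lambda>x. trace (A \<circ> r x)) \<in> borel_measurable (completion (posteriori_measure X M \<rho>)) \<and>
      (\<forall>F\<in>sets X. has_bochner_integral (completion (posteriori_measure X M \<rho>))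
        (\<lambda>x. indicator F x *\<^sub>R trace (A \<circ> r x)) (trace (A \<circ> M F \<rho>))))"

definition irreducible_instrument ::
  "'x measure \<Rightarrow> ('x set \<Rightarrow> ('a::complex_hilbert \<Rightarrow> 'a) \<Rightarrow> ('a \<Rightarrow> 'a)) \<Rightarrow> bool" where
  "irreducible_instrument X M \<longleftrightarrow>
    (\<forall>\<rho> r. pure_state \<rho> \<and> posteriori_states X M \<rho> r \<longrightarrow>
      (AE x in posteriori_measure X M \<rho>. pure_state (r x)))"

text \<open>The tensor product of \<open>H\<close> and \<open>\<ell>\<^sup>2(I)\<close> is \<open>\<ell>\<^sup>2(I; H)\<close>, with
  \<open>(\<phi> \<otimes> \<xi>)\<^sub>i = \<xi>\<^sub>i \<phi>\<close>; the tensor product of \<open>H\<close> with a closed subspace \<open>H0\<close> of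
  \<open>\<ell>\<^sup>2(I)\<close> is a closed subspace of it.\<close>

lift_definition tensor_vec :: "'a::complex_hilbert \<Rightarrow> ('i, complex) l2 \<Rightarrow> ('i, 'a) l2"
  is "\<lambda>\<phi> \<xi> i. \<xi> i *\<^sub>C \<phi>"
  by (simp add: norm_scaleC power_mult_distrib summable_on_cmult_left)

definition tensor_space :: "('i, complex) l2 set \<Rightarrow> ('i, 'a::complex_hilbert) l2 set" where
  "tensor_space H0 = closure (cspan {tensor_vec \<phi> \<xi> |\<phi> \<xi>. \<xi> \<in> H0})"

definition tensor_op :: "('a::complex_hilbert \<Rightarrow> 'a) \<Rightarrow> (('i, complex) l2 \<Rightarrow> ('i, complex) l2) \<Rightarrow>
    ('i, 'a) l2 \<Rightarrow> ('i, 'a) l2" where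
  "tensor_op A B =
    (THE T. bounded_op T \<and> (\<forall>\<phi> \<xi>. T (tensor_vec \<phi> \<xi>) = tensor_vec (A \<phi>) (B \<xi>)))"

text \<open>A spectral measure in a closed subspace \<open>H0\<close>, every \<open>P F\<close> being extended by zero to the
  orthogonal complement of \<open>H0\<close>.\<close>

definition spectral_measure :: "'x measure \<Rightarrow> 'a::complex_hilbert set \<Rightarrow> ('x set \<Rightarrow> 'a \<Rightarrow> 'a) \<Rightarrow> bool"
  where "spectral_measure X H0 P \<longleftrightarrow>
    (\<forall>F\<in>sets X. projection_op (P F) \<and> range (P F) \<subseteq> H0) \<and>
    range (P (space X)) = H0 \<and>
    (\<forall>F. disjoint_family F \<and> range F \<subseteq> sets X \<longrightarrow>
      (\<forall>\<xi>. (\<lambda>n::nat. P (F n) \<xi>) sums P (\<Union>n. F n) \<xi>))"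

text \<open>Multiplicity one means that there is a cyclic vector.\<close>

definition multiplicity_one :: "'x measure \<Rightarrow> 'a::complex_hilbert set \<Rightarrow> ('x set \<Rightarrow> 'a \<Rightarrow> 'a) \<Rightarrow> bool"
  where "multiplicity_one X H0 P \<longleftrightarrow>
    (\<exists>\<xi>\<in>H0. closure (cspan {P F \<xi> |F. F \<in> sets X}) = H0)"

text \<open>The auxiliary Hilbert space \<open>H0\<close> ranges over the closed subspaces of \<open>\<ell>\<^sup>2(I)\<close>
  where \<open>I\<close> is the type of complex functions on the outcome type. This is no restriction up to
  isomorphism: a cyclic vector forces the dimension of \<open>H0\<close> to be at most the number of
  measurable sets, and these embed into \<open>I\<close> via their indicator functions.\<close>

definition efficient ::
  "'x measure \<Rightarrow> ('x set \<Rightarrow> ('a::complex_hilbert \<Rightarrow> 'a) \<Rightarrow> ('a \<Rightarrow> 'a)) \<Rightarrow> bool" where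
  "efficient X M \<longleftrightarrow>
    (\<exists>(H0 :: ('x \<Rightarrow> complex, complex) l2 set) P (V :: 'a \<Rightarrow> ('x \<Rightarrow> complex, 'a) l2).
      csubspace H0 \<and> closed H0 \<and> spectral_measure X H0 P \<and> multiplicity_one X H0 P \<and>
      isometry_op V \<and> range V \<subseteq> tensor_space H0 \<and>
      (\<forall>F\<in>sets X. \<forall>A. bounded_op A \<longrightarrow>
        dual_map (M F) A = cadjoint V \<circ> tensor_op A (P F) \<circ> V))"

text \<open>The operators \<open>V k x\<close> are indexed by \<open>k \<ge> 1\<close>; only their values on \<open>D\<close> matter.\<close>

definition kraus_representation ::
  "'x measure \<Rightarrow> ('x set \<Rightarrow> ('a::complex_hilbert \<Rightarrow> 'a) \<Rightarrow> ('a \<Rightarrow> 'a)) \<Rightarrow>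
    'x measure \<Rightarrow> 'a set \<Rightarrow> (nat \<Rightarrow> 'x \<Rightarrow> 'a \<Rightarrow> 'a) \<Rightarrow> bool" where
  "kraus_representation X M \<mu> D V \<longleftrightarrow>
    space \<mu> = space X \<and> sets \<mu> = sets X \<and> sigma_finite_measure \<mu> \<and>
    csubspace D \<and> closure D = UNIV \<and>
    (AE x in \<mu>. \<forall>k\<ge>1. clinear_on D (V k x)) \<and>
    (\<forall>\<phi>\<in>D.
      (AE x in \<mu>. (\<lambda>k. (norm (V k x \<phi>))\<^sup>2) summable_on {1..}) \<and>
      (\<forall>F\<in>sets X. \<forall>A. bounded_op A \<longrightarrow>
        has_bochner_integral (completion \<mu>)
          (\<lambda>x. indicator F x *\<^sub>R (\<Sum>\<^sub>\<infinity>k\<in>{1..}. cinner (V k x \<phi>) (A (V k x \<phi>))))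
          (cinner \<phi> (dual_map (M F) A \<phi>))))"

definition nonzero_on :: "'a set \<Rightarrow> ('a \<Rightarrow> 'b::zero) \<Rightarrow> bool" where
  "nonzero_on D f \<longleftrightarrow> (\<exists>x\<in>D. f x \<noteq> 0)"

definition kraus_normalized ::
  "'x measure \<Rightarrow> 'a::complex_hilbert set \<Rightarrow> (nat \<Rightarrow> 'x \<Rightarrow> 'a \<Rightarrow> 'a) \<Rightarrow> bool" where
  "kraus_normalized \<mu> D V \<longleftrightarrow> (AE x in \<mu>.
    (\<forall>k\<ge>1. \<forall>k'\<ge>1. k \<noteq> k' \<and> nonzero_on D (V k x) \<and> nonzero_on D (V k' x) \<longrightarrow>
      \<not> (\<exists>c. \<forall>\<phi>\<in>D. V k' x \<phi> = c *\<^sub>C V k x \<phi>)) \<and>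
    (\<forall>k\<ge>1. \<not> nonzero_on D (V k x) \<longrightarrow> (\<forall>k'>k. \<not> nonzero_on D (V k' x))))"

end

theory Submission
  imports Defs
begin

text \<open>A vector \<open>\<phi>\<close> of \<open>D\<close> and an outcome \<open>x\<close> determine the vector
  \<open>\<VV>\<^sub>x\<phi> = (V\<^sub>k(x)\<phi>)\<^sub>k\<close> of \<open>\<ell>\<^sup>2(\<nat>; H)\<close>, and the sums over \<open>k\<close> in
  the Kraus representation are sesquilinear forms in it; they, unlike the single operators
  \<open>V\<^sub>k(x)\<close>, depend measurably on \<open>x\<close>. Fix a countable orthonormal basis \<open>B \<subseteq> D\<close>. If almost
  everywhere the \<open>V\<^sub>k(x)\<close> are proportional on \<open>B\<close>, then they can be replaced by one operator
  depending measurably on \<open>x\<close>, and \<open>\<phi> \<mapsto> V(\<cdot>)\<phi>\<close> is an isometry into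
  \<open>L\<^sup>2(\<nu>) \<otimes> H\<close>, where multiplication by indicators is a spectral measure with the cyclic
  vector \<open>1\<close>: the instrument is efficient. Otherwise proportionality fails on a set \<open>F\<^sub>s\<close> of
  positive measure. For an irreducible instrument the posteriori states
  \<open>\<Sum>\<^sub>k |V\<^sub>k(x)\<phi>\<rangle>\<langle>V\<^sub>k(x)\<phi>|\<close> are pure up to a factor, so \<open>\<VV>\<^sub>x\<phi> = y \<otimes> \<alpha>\<close> is an
  elementary tensor for each \<open>\<phi>\<close>. As sums of elementary tensors are elementary only if the
  summands share a factor, and on \<open>F\<^sub>s\<close> not all \<open>\<alpha>\<close> are parallel, all \<open>y\<close> lie on one line, which
  is spanned by \<open>\<psi>\<^sub>x\<close>.\<close>

section \<open>Hilbert spaces\<close>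

\<comment> \<open>Null sets shape the details. The Kraus data constrain each vector of
  \<open>D\<close> only off a null set of its own, so simultaneous statements are made for countably
  many vectors at a time, such as \<open>B\<close> with one vector added. Nor is a measurable choice
  of \<open>\<psi>\<close> at hand: conditions on it are rewritten through the measurable forms of
  \<open>VV x b\<close> with \<open>b\<close> in \<open>B\<close>. For an arbitrary a priori state,
  which need not be built from vectors of \<open>D\<close>, the posteriori states are not computed
  but squeezed: where \<open>\<langle>\<psi> x|A \<psi> x\<rangle> \<le> t\<close>, an inequality
  between the dual maps of \<open>A\<close> and \<open>1\<close> passes from \<open>D\<close> to the
  whole space by continuity, and suitable rank one \<open>A\<close> with rational \<open>t\<close>
  then determine the state. Adjoints, dual maps and tensor products of operators are definite
  descriptions, so their existence has to be proved before any of their properties can be used. The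
  measure \<open>\<mu>\<close> is only \<sigma>-finite; it is replaced by a finite one with
  compensating rescaling of the operators, so that the constant \<open>1\<close> is
  square-integrable and can be the cyclic vector.\<close>
subclass (in complex_hilbert) banach ..

lemma cinner_add_left: "cinner (x + y) z = cinner x z + cinner (y::'a::complex_hilbert) z"
  by (metis cinner_commute cinner_add_right complex_cnj_add)

lemma cinner_scaleC_left: "cinner (c *\<^sub>C x) y = cnj c * cinner x (y::'a::complex_hilbert)"
  by (metis cinner_commute cinner_scaleC_right complex_cnj_mult)

lemma scaleC_one [simp]: "1 *\<^sub>C x = (x::'a::complex_hilbert)"
  by (rule complex_vector.scale_one)

lemma cinner_bilinear: "bounded_bilinear (cinner :: 'a::complex_hilbert \<Rightarrow> 'a \<Rightarrow> complex)"
  by unfold_locales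
    (auto simp: cinner_add_left cinner_add_right scaleR_scaleC cinner_scaleC_left
      cinner_scaleC_right scaleR_conv_of_real scaleC_complex_def intro!: exI[of _ 1] cmod_cinner_le)

lemma scaleC_bilinear: "bounded_bilinear (scaleC :: complex \<Rightarrow> 'a::complex_hilbert \<Rightarrow> 'a)"
  by unfold_locales
    (auto simp: scaleC_add_left scaleC_add_right scaleR_scaleC scaleC_scaleC norm_scaleC
      scaleC_complex_def mult.commute intro!: exI[of _ 1])

lemmas cinner_zero_left [simp] = bounded_bilinear.zero_left[OF cinner_bilinear]
  and cinner_zero_right [simp] = bounded_bilinear.zero_right[OF cinner_bilinear]
  and cinner_diff_left = bounded_bilinear.diff_left[OF cinner_bilinear]
  and cinner_diff_right = bounded_bilinear.diff_right[OF cinner_bilinear]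
  and cinner_sum_left = bounded_bilinear.sum_left[OF cinner_bilinear]
  and cinner_sum_right = bounded_bilinear.sum_right[OF cinner_bilinear]
  and tendsto_cinner [tendsto_intros] = bounded_bilinear.tendsto[OF cinner_bilinear]
  and continuous_on_cinner [continuous_intros] = bounded_bilinear.continuous_on[OF cinner_bilinear]
  and bounded_linear_cinner_right = bounded_bilinear.bounded_linear_right[OF cinner_bilinear]
  and scaleC_zero_left [simp] = bounded_bilinear.zero_left[OF scaleC_bilinear]
  and scaleC_zero_right [simp] = bounded_bilinear.zero_right[OF scaleC_bilinear]
  and tendsto_scaleC [tendsto_intros] = bounded_bilinear.tendsto[OF scaleC_bilinear]
  and bounded_linear_scaleC_right = bounded_bilinear.bounded_linear_right[OF scaleC_bilinear]

lemma cinner_eq_zero_iff [simp]: "cinner x x = 0 \<longleftrightarrow> x = (0::'a::complex_hilbert)"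
  by (simp add: cinner_self)

lemma cinner_eq_zero_commute: "cinner x y = 0 \<longleftrightarrow> cinner y (x::'a::complex_hilbert) = 0"
  by (metis cinner_commute complex_cnj_zero)

lemma cinner_ext: "(\<And>z. cinner z x = cinner z y) \<Longrightarrow> x = (y::'a::complex_hilbert)"
  by (metis cinner_diff_right cinner_eq_zero_iff eq_iff_diff_eq_0)

lemma cmod_cinner_commute: "cmod (cinner x y) = cmod (cinner y (x::'a::complex_hilbert))"
  by (metis cinner_commute complex_mod_cnj)

lemma cinner_mult_commute:
  "cinner x y * cinner y (x::'a::complex_hilbert) = complex_of_real ((cmod (cinner x y))\<^sup>2)"
  by (metis cinner_commute complex_norm_square)

section \<open>Orthogonal projection onto closed subspaces\<close>

lemma csubspace_closure: 
  fixes S :: "'a::complex_hilbert set"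
  assumes "csubspace S" shows "csubspace (closure S)"
proof (unfold complex_vector.subspace_def, safe)
  show "0 \<in> closure S" using assms closure_subset complex_vector.subspace_0 by blast
next
  fix x y assume "x \<in> closure S" "y \<in> closure S"
  then obtain f g where "\<forall>n. f n \<in> S" "f \<longlonglongrightarrow> x" "\<forall>n. g n \<in> S" "g \<longlonglongrightarrow> y"
    unfolding closure_sequential by blast
  then show "x + y \<in> closure S"
    using assms unfolding closure_sequential 
    by (intro exI[of _ "\<lambda>n. f n + g n"]) (auto intro: tendsto_intros complex_vector.subspace_add)
next
  fix c x assume "x \<in> closure S"
  then obtain f where "\<forall>n. f n \<in> S" "f \<longlonglongrightarrow> x"
    unfolding closure_sequential by blast
  then show "c *\<^sub>C x \<in> closure S"
    using assms unfolding closure_sequential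
    by (intro exI[of _ "\<lambda>n. c *\<^sub>C f n"]) (auto intro: tendsto_intros complex_vector.subspace_scale)
qed

lemma parallelogram: "(norm (x + y))\<^sup>2 + (norm (x - y))\<^sup>2 = 2 * (norm x)\<^sup>2 + 2 * (norm (y::'a::real_inner))\<^sup>2"
  by (simp add: power2_norm_eq_inner algebra_simps inner_commute)

text \<open>A sequence in \<open>S\<close> minimizing the distance to \<open>x\<close> is Cauchy by
  the parallelogram law, and at its limit no displacement inside \<open>S\<close> can shorten the
  distance, which forces orthogonality.\<close>

lemma projection_exists:
  fixes S :: "'a::complex_hilbert set"
  assumes S: "csubspace S" "closed S"
  obtains p where "p \<in> S" "\<And>s. s \<in> S \<Longrightarrow> cinner s (x - p) = 0"
proof -
  have S0: "0 \<in> S" using S(1) complex_vector.subspace_0 by blast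
  define d where "d = (INF s\<in>S. (norm (x - s))\<^sup>2)"
  have bdd: "bdd_below ((\<lambda>s. (norm (x - s))\<^sup>2) ` S)" by (auto intro!: bdd_belowI2[of _ 0])
  have d_le: "d \<le> (norm (x - s))\<^sup>2" if "s \<in> S" for s
    unfolding d_def using bdd that by (intro cINF_lower) auto
  have "\<exists>s\<in>S. (norm (x - s))\<^sup>2 < d + inverse (real (Suc n))" for n
  proof -
    have "d < d + inverse (real (Suc n))" by simp
    then show ?thesis
      using cINF_less_iff[OF _ bdd, of "d + inverse (real (Suc n))"] S0 unfolding d_def by blast
  qed
  then obtain f where f: "\<And>n. f n \<in> S" "\<And>n. (norm (x - f n))\<^sup>2 < d + inverse (real (Suc n))"
    by metis
  \<comment> \<open>The midpoint of \<open>f m\<close> and \<open>f n\<close> lies in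
    \<open>S\<close>, so its squared distance from \<open>x\<close> is at least \<open>d\<close>;
    the parallelogram law leaves only the two excesses over \<open>d\<close> for the
    difference.\<close>
  have gap: "(norm (f m - f n))\<^sup>2 \<le> 2 * inverse (real (Suc m)) + 2 * inverse (real (Suc n))" for m n
  proof -
    have "(1/2) *\<^sub>R (f m + f n) \<in> S"
      unfolding scaleR_scaleC using S(1) f(1) by (intro complex_vector.subspace_scale complex_vector.subspace_add)
    then have "d \<le> (norm (x - (1/2) *\<^sub>R (f m + f n)))\<^sup>2" by (rule d_le)
    also have "x - (1/2) *\<^sub>R (f m + f n) = (1/2) *\<^sub>R ((x - f m) + (x - f n))"
      by (simp add: algebra_simps flip: scaleR_add_left)
    also have "(norm \<dots>)\<^sup>2 = (norm ((x - f m) + (x - f n)))\<^sup>2 / 4"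
      by (simp add: power_divide)
    finally have "4 * d \<le> (norm ((x - f m) + (x - f n)))\<^sup>2" by simp
    moreover have "(norm ((x - f m) - (x - f n)))\<^sup>2 = (norm (f m - f n))\<^sup>2"
      by (simp add: norm_minus_commute)
    ultimately show ?thesis
      using parallelogram[of "x - f m" "x - f n"] f(2)[of m] f(2)[of n] by linarith
  qed
  have "Cauchy f"
  proof (rule metric_CauchyI)
    fix e :: real assume e: "e > 0"
    then obtain N where N: "inverse (real (Suc N)) < e\<^sup>2 / 4"
      using reals_Archimedean[of "e\<^sup>2 / 4"] by auto
    have "dist (f m) (f n) < e" if "m \<ge> N" "n \<ge> N" for m n
    proof -
      have "inverse (real (Suc m)) \<le> inverse (real (Suc N))" "inverse (real (Suc n)) \<le> inverse (real (Suc N))"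
        using that by (auto intro!: le_imp_inverse_le)
      then have "(norm (f m - f n))\<^sup>2 < e\<^sup>2" using gap[of m n] N by linarith
      then show ?thesis using e by (simp add: dist_norm power2_less_imp_less)
    qed
    then show "\<exists>N. \<forall>m\<ge>N. \<forall>n\<ge>N. dist (f m) (f n) < e" by blast
  qed
  then obtain p where p: "f \<longlonglongrightarrow> p" using Cauchy_convergent convergent_def by blast
  have pS: "p \<in> S" using S(2) f(1) p closed_sequentially by blast
  have min: "(norm (x - p))\<^sup>2 \<le> d"
  proof (rule LIMSEQ_le)
    show "(\<lambda>n. (norm (x - f n))\<^sup>2) \<longlonglongrightarrow> (norm (x - p))\<^sup>2" by (intro tendsto_intros p)
    show "(\<lambda>n. d + inverse (real (Suc n))) \<longlonglongrightarrow> d"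
      using tendsto_add[OF tendsto_const LIMSEQ_inverse_real_of_nat, of d] by simp
    show "\<exists>N. \<forall>n\<ge>N. (norm (x - f n))\<^sup>2 \<le> d + inverse (real (Suc n))"
      using f(2) less_imp_le by blast
  qed
  have "cinner s (x - p) = 0" if s: "s \<in> S" for s
  proof (cases "s = 0")
    case False
    \<comment> \<open>The best multiple of \<open>s\<close> to move by: the squared distance drops
      by exactly \<open>|\<langle>s, x - p\<rangle>|^2 / \<parallel>s\<parallel>^2\<close>, which
      minimality forces to be zero.\<close>
    define c where "c = cinner s (x - p) / complex_of_real ((norm s)\<^sup>2)"
    have "p + c *\<^sub>C s \<in> S"
      using S(1) pS s by (intro complex_vector.subspace_scale complex_vector.subspace_add)
    then have le: "(norm (x - p))\<^sup>2 \<le> (norm (x - (p + c *\<^sub>C s)))\<^sup>2"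
      using d_le min by (meson order_trans)
    have "complex_of_real ((norm (x - (p + c *\<^sub>C s)))\<^sup>2) = cinner ((x - p) - c *\<^sub>C s) ((x - p) - c *\<^sub>C s)"
      by (simp add: cinner_self algebra_simps)
    also have "\<dots> = cinner (x - p) (x - p) - c * cinner (x - p) s - cnj c * (cinner s (x - p) - c * cinner s s)"
      by (simp only: cinner_diff_left[of "x-p"] cinner_diff_right[of _ "x-p"] cinner_scaleC_left cinner_scaleC_right)
        (simp add: algebra_simps)
    also have "cinner s (x - p) - c * cinner s s = 0"
      using False by (simp add: c_def cinner_self)
    also have "c * cinner (x - p) s = complex_of_real ((cmod (cinner s (x - p)))\<^sup>2 / (norm s)\<^sup>2)"
      using cinner_mult_commute[of s "x - p"] by (simp add: c_def)
    finally have "complex_of_real ((norm (x - (p + c *\<^sub>C s)))\<^sup>2)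
        = complex_of_real ((norm (x - p))\<^sup>2 - (cmod (cinner s (x - p)))\<^sup>2 / (norm s)\<^sup>2)"
      by (simp add: cinner_self)
    then have "(norm (x - (p + c *\<^sub>C s)))\<^sup>2 = (norm (x - p))\<^sup>2 - (cmod (cinner s (x - p)))\<^sup>2 / (norm s)\<^sup>2"
      using of_real_eq_iff by blast
    with le have "(cmod (cinner s (x - p)))\<^sup>2 / (norm s)\<^sup>2 \<le> 0" by linarith
    then show ?thesis using False by (simp add: divide_le_0_iff)
  qed simp
  with pS that show thesis by blast
qed

text \<open>The defect of projecting a point of \<open>T\<close> onto the closed span lies in
  \<open>T\<close> and is orthogonal to \<open>S\<close>. The criterion serves to recognize the
  cyclic vector.\<close>

lemma closure_cspan_eqI:
  fixes S T :: "'a::complex_hilbert set"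
  assumes "S \<subseteq> T" "csubspace T" "closed T"
    and "\<And>z. z \<in> T \<Longrightarrow> (\<And>s. s \<in> S \<Longrightarrow> cinner s z = 0) \<Longrightarrow> z = 0"
  shows "closure (cspan S) = T"
proof
  show le: "closure (cspan S) \<subseteq> T"
    using assms(1-3) by (intro closure_minimal complex_vector.span_minimal)
  show "T \<subseteq> closure (cspan S)"
  proof
    fix x assume x: "x \<in> T"
    obtain p where p: "p \<in> closure (cspan S)" "\<And>s. s \<in> closure (cspan S) \<Longrightarrow> cinner s (x - p) = 0"
      using projection_exists[of "closure (cspan S)" x]
        csubspace_closure[OF complex_vector.subspace_span] by blast
    have "S \<subseteq> closure (cspan S)" 
      using closure_subset[of "cspan S"] complex_vector.span_superset[of S] by blast
    moreover have "x - p \<in> T"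
      using assms(2) x p(1) le by (intro complex_vector.subspace_diff) auto
    ultimately have "x - p = 0" using assms(4) p(2) by blast
    with p(1) show "x \<in> closure (cspan S)" by simp
  qed
qed

section \<open>Bounded operators, Riesz representation and adjoints\<close>

lemma bounded_op_bounded_linear: "bounded_op A \<Longrightarrow> bounded_linear A"
  and bounded_op_scaleC: "bounded_op A \<Longrightarrow> A (c *\<^sub>C x) = c *\<^sub>C A x"
  by (simp_all add: bounded_op_def)

lemmas bounded_op_linear = bounded_linear.linear[OF bounded_op_bounded_linear]
lemmas bounded_op_add = linear_add[OF bounded_op_linear]
  and bounded_op_diff = linear_diff[OF bounded_op_linear]
  and bounded_op_zero = linear_0[OF bounded_op_linear]

lemma bounded_opI:
  assumes "\<And>x y. A (x + y) = A x + A y" "\<And>c x. A (c *\<^sub>C x) = c *\<^sub>C A x"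
    "\<And>x. norm (A x) \<le> K * norm x"
  shows "bounded_op A"
  unfolding bounded_op_def using assms
  by (auto intro!: bounded_linear_intro[where K = K] simp: scaleR_scaleC mult.commute)

lemma bounded_op_bound:
  assumes "bounded_op A"
  obtains K where "K > 0" "\<And>x. norm (A x) \<le> K * norm x"
  using bounded_linear.pos_bounded[OF bounded_op_bounded_linear[OF assms]] by (metis mult.commute)

lemma bounded_op_compose: "bounded_op A \<Longrightarrow> bounded_op B \<Longrightarrow> bounded_op (A \<circ> B)"
  unfolding bounded_op_def by (auto simp: o_def intro: bounded_linear_compose)

lemma bounded_op_id: "bounded_op (\<lambda>x. x)"
  by (simp add: bounded_op_def bounded_linear_ident)

lemma bounded_op_comp_scaleC: "bounded_op A \<Longrightarrow> bounded_op (\<lambda>x. c *\<^sub>C A x)"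
  unfolding bounded_op_def
  by (auto intro: bounded_linear_compose[OF bounded_linear_scaleC_right] simp: scaleC_scaleC mult.commute)

lemma bounded_op_plus: "bounded_op A \<Longrightarrow> bounded_op B \<Longrightarrow> bounded_op (\<lambda>x. A x + B x)"
  unfolding bounded_op_def by (auto intro: bounded_linear_add simp: scaleC_add_right)

lemma bounded_op_ket_bra: "bounded_op (ket_bra a b)"
  unfolding ket_bra_def
  by (rule bounded_opI[where K = "norm a * norm b"])
    (auto simp: cinner_add_right cinner_scaleC_right scaleC_add_left scaleC_scaleC norm_scaleC
      intro!: mult_right_mono[THEN order_trans, OF cmod_cinner_le] )

text \<open>The orthogonal complement of the kernel is spanned by one vector \<open>w\<close>, the
  defect of projecting some \<open>z\<close> with \<open>f z \<noteq> 0\<close>. The bound on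
  \<open>y\<close> belongs to the conclusion because it becomes the operator bound wherever an
  operator is assembled from Riesz vectors.\<close>

lemma riesz:
  fixes f :: "'a::complex_hilbert \<Rightarrow> complex"
  assumes add: "\<And>x y. f (x + y) = f x + f y" and scale: "\<And>c x. f (c *\<^sub>C x) = c * f x"
    and bound: "\<And>x. cmod (f x) \<le> K * norm x" and "0 \<le> K"
  obtains y where "\<And>x. f x = cinner y x" "norm y \<le> K"
proof -
  have bl: "bounded_linear f"
    by (rule bounded_linear_intro[where K = K])
      (auto simp: add scale scaleR_scaleC scaleC_complex_def bound mult.commute)
  have f0: "f 0 = 0" using bl by (simp add: linear_simps)
  define S where "S = {x. f x = 0}"
  have S: "csubspace S" unfolding complex_vector.subspace_def S_def by (auto simp: add scale f0)
  have "closed S" unfolding S_def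
    using bl by (intro closed_Collect_eq) (auto simp: linear_continuous_on)
  have ex: "\<exists>y. \<forall>x. f x = cinner y x"
  proof (cases "\<exists>z. f z \<noteq> 0")
    case False
    then show ?thesis by (intro exI[of _ 0]) auto
  next
    case True
    then obtain z where z: "f z \<noteq> 0" by blast
    obtain p where p: "p \<in> S" "\<And>s. s \<in> S \<Longrightarrow> cinner s (z - p) = 0"
      using projection_exists[OF S \<open>closed S\<close>] by blast
    define w where "w = z - p"
    have fw: "f w = f z" using bl p(1) by (simp add: w_def S_def linear_simps)
    have w0: "cinner w w \<noteq> 0" using fw z f0 by auto
    have "f x = cinner (cnj (f w / cinner w w) *\<^sub>C w) x" for x
    proof -
      \<comment> \<open>Subtracting the right multiple of \<open>w\<close> moves any
        \<open>x\<close> into the kernel, to which \<open>w\<close> is orthogonal.\<close>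
      have "x - (f x / f w) *\<^sub>C w \<in> S"
        using fw z bl by (simp add: S_def linear_simps scale)
      then have "cinner w (x - (f x / f w) *\<^sub>C w) = 0"
        using p(2) w_def cinner_eq_zero_commute by blast
      then have "cinner w x = f x / f w * cinner w w"
        by (simp add: cinner_diff_right cinner_scaleC_right)
      then show ?thesis using w0 fw z by (simp add: cinner_scaleC_left)
    qed
    then show ?thesis by blast
  qed
  then obtain y where y: "\<And>x. f x = cinner y x" by blast
  have "norm y \<le> K"
  proof (cases "y = 0")
    case True
    with \<open>0 \<le> K\<close> show ?thesis by simp
  next
    case False
    have "norm y * norm y \<le> K * norm y"
      using bound[of y] y[of y] by (simp add: cinner_self power2_eq_square norm_mult)
    with False show ?thesis by simp
  qed
  with y that show thesis by blast
qed
lemma cadjoint_exists: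
  assumes A: "bounded_op (A :: 'a::complex_hilbert \<Rightarrow> 'b::complex_hilbert)"
  shows "\<exists>B. bounded_op B \<and> (\<forall>x y. cinner (A x) y = cinner x (B y))"
proof -
  obtain K where K: "K > 0" "\<And>x. norm (A x) \<le> K * norm x" using bounded_op_bound[OF A] by blast
  have "\<exists>z. (\<forall>x. cinner y (A x) = cinner z x) \<and> norm z \<le> norm y * K" for y
  proof (rule riesz[of "\<lambda>x. cinner y (A x)" "norm y * K"])
    show "cmod (cinner y (A x)) \<le> norm y * K * norm x" for x
      using cmod_cinner_le[of y "A x"] mult_left_mono[OF K(2)[of x] norm_ge_zero[of y]] by (simp add: mult.assoc)
  qed (use K in \<open>auto simp: bounded_op_add[OF A] bounded_op_scaleC[OF A] cinner_add_right cinner_scaleC_right\<close>)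
  then obtain B where B: "\<And>x y. cinner y (A x) = cinner (B y) x" "\<And>y. norm (B y) \<le> norm y * K" by metis
  have B': "cinner (A x) y = cinner x (B y)" for x y
    using B(1)[of y x] by (metis cinner_commute)
  have "bounded_op B"
  proof (rule bounded_opI)
    show "B (x + y) = B x + B y" for x y
      by (rule cinner_ext) (simp add: cinner_add_right flip: B')
    show "B (c *\<^sub>C x) = c *\<^sub>C B x" for c x
      by (rule cinner_ext) (simp add: cinner_scaleC_right flip: B')
    show "norm (B x) \<le> K * norm x" for x using B(2)[of x] by (simp add: mult.commute)
  qed
  with B' show ?thesis by blast
qed

text \<open>\<open>cadjoint\<close> is a definite description: these properties rest on the
  existence of an adjoint and on the fact that a second one would have the same matrix
  elements.\<close>

lemma
  assumes A: "bounded_op (A :: 'a::complex_hilbert \<Rightarrow> 'b::complex_hilbert)"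
  shows bounded_op_cadjoint: "bounded_op (cadjoint A)"
    and cinner_cadjoint: "cinner (A x) y = cinner x (cadjoint A y)"
proof -
  obtain B where B: "bounded_op B" "\<And>x y. cinner (A x) y = cinner x (B y)"
    using cadjoint_exists[OF A] by blast
  have "cadjoint A = B" unfolding cadjoint_def
  proof (rule the_equality)
    fix B' assume "bounded_op B' \<and> (\<forall>x y. cinner (A x) y = cinner x (B' y))"
    then have "cinner z (B' y) = cinner z (B y)" for z y by (metis B(2))
    then show "B' = B" using cinner_ext by blast
  qed (use B in blast)
  with B show "bounded_op (cadjoint A)" "cinner (A x) y = cinner x (cadjoint A y)" by auto
qed

lemma cinner_cadjoint_left:
  assumes "bounded_op A" shows "cinner (cadjoint A x) y = cinner x (A y)"
  by (metis cinner_commute cinner_cadjoint[OF assms])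

lemma sesquilinear_operator_exists:
  fixes s :: "'a::complex_hilbert \<Rightarrow> 'b::complex_hilbert \<Rightarrow> complex"
  assumes "\<And>x y z. s (x + y) z = s x z + s y z" "\<And>c x y. s (c *\<^sub>C x) y = cnj c * s x y"
    and "\<And>x y z. s x (y + z) = s x y + s x z" "\<And>c x y. s x (c *\<^sub>C y) = c * s x y"
    and bound: "\<And>x y. cmod (s x y) \<le> K * norm x * norm y" and K: "0 \<le> K"
  obtains B where "bounded_op B" "\<And>x y. s x y = cinner x (B y)"
proof -
  \<comment> \<open>Riesz asks for a linear functional, while \<open>s\<close> is antilinear in its
    first argument; hence the conjugate.\<close>
  have "\<exists>z. (\<forall>x. cnj (s x y) = cinner z x) \<and> norm z \<le> K * norm y" for y
    by (rule riesz[of "\<lambda>x. cnj (s x y)" "K * norm y"])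
      (use bound[of _ y] K in \<open>auto simp: assms(1,2) mult_ac\<close>)
  then obtain B where B: "\<And>x y. cnj (s x y) = cinner (B y) x" "\<And>y. norm (B y) \<le> K * norm y" by metis
  have B': "s x y = cinner x (B y)" for x y
    by (metis B(1) cinner_commute complex_cnj_cnj)
  have "bounded_op B"
  proof (rule bounded_opI)
    show "B (x + y) = B x + B y" for x y
      by (rule cinner_ext) (simp add: cinner_add_right assms(3) flip: B')
    show "B (c *\<^sub>C x) = c *\<^sub>C B x" for c x
      by (rule cinner_ext) (simp add: cinner_scaleC_right assms(4) flip: B')
  qed (rule B(2))
  with B' that show thesis by blast
qed

text \<open>All terms but the first are written as \<open>x + c *\<^sub>C y\<close>, minus signs
  included, so that one family of facts indexed by \<open>c\<close> covers them;
  \<open>scaleC_one\<close> relates the first to the same form.\<close>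

lemma cpolarization:
  fixes s :: "'a::complex_hilbert \<Rightarrow> 'a \<Rightarrow> complex"
  assumes "\<And>x y z. s (x + y) z = s x z + s y z" "\<And>c x y. s (c *\<^sub>C x) y = cnj c * s x y"
    and "\<And>x y z. s x (y + z) = s x y + s x z" "\<And>c x y. s x (c *\<^sub>C y) = c * s x y"
  shows "s x y = (s (x + y) (x + y) - s (x + (-1) *\<^sub>C y) (x + (-1) *\<^sub>C y)
    - \<i> * s (x + \<i> *\<^sub>C y) (x + \<i> *\<^sub>C y) + \<i> * s (x + (- \<i>) *\<^sub>C y) (x + (- \<i>) *\<^sub>C y)) / 4"
  by (simp only: assms) (simp add: algebra_simps)

lemma cinner_op_polarization:
  assumes "bounded_op A"
  shows "cinner x (A y) = (cinner (x + y) (A (x + y)) - cinner (x + (-1) *\<^sub>C y) (A (x + (-1) *\<^sub>C y))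
    - \<i> * cinner (x + \<i> *\<^sub>C y) (A (x + \<i> *\<^sub>C y)) + \<i> * cinner (x + (- \<i>) *\<^sub>C y) (A (x + (- \<i>) *\<^sub>C y))) / 4"
  by (rule cpolarization[of "\<lambda>x y. cinner x (A y)"])
    (simp_all add: cinner_add_left cinner_scaleC_left bounded_op_add[OF assms] cinner_add_right
      bounded_op_scaleC[OF assms] cinner_scaleC_right)

lemma continuous_on_bounded_op: "bounded_op A \<Longrightarrow> continuous_on S A"
  using bounded_op_bounded_linear by (rule linear_continuous_on)

lemma bounded_op_eq_on_dense:
  assumes A: "bounded_op A" and B: "bounded_op B" and D: "closure (cspan E) = UNIV"
    and eq: "\<And>x. x \<in> E \<Longrightarrow> A x = B x"
  shows "A = (B :: 'a::complex_hilbert \<Rightarrow> 'b::complex_hilbert)"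
proof
  fix x
  have "closed {x. A x = B x}"
    using A B by (intro closed_Collect_eq continuous_on_bounded_op)
  moreover have "cspan E \<subseteq> {x. A x = B x}"
    by (rule complex_vector.span_minimal)
      (auto simp: eq complex_vector.subspace_def bounded_op_zero[OF A] bounded_op_zero[OF B]
        bounded_op_add[OF A] bounded_op_add[OF B] bounded_op_scaleC[OF A] bounded_op_scaleC[OF B])
  ultimately show "A x = B x" using closure_minimal[of "cspan E"] D by blast
qed

lemma cinner_ext_dense:
  assumes "closure (cspan E) = UNIV" "\<And>z. z \<in> E \<Longrightarrow> cinner z x = cinner z (y::'a::complex_hilbert)"
  shows "x = y"
proof -
  have b: "bounded_op (\<lambda>z. cinner w z)" for w :: 'a
    using bounded_linear_cinner_right[of w]
    by (auto simp: bounded_op_def cinner_scaleC_right scaleC_complex_def)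
  have "cinner x = cinner y"
  proof (rule bounded_op_eq_on_dense[OF b b assms(1)])
    fix z assume "z \<in> E" then show "cinner x z = cinner y z" by (metis assms(2) cinner_commute)
  qed
  then show ?thesis by (metis cinner_commute cinner_ext)
qed

lemma bounded_op_eq_on_dense_matrix:
  assumes A: "bounded_op A" and B: "bounded_op B" and D: "closure (cspan E) = UNIV"
    and eq: "\<And>x y. x \<in> E \<Longrightarrow> y \<in> E \<Longrightarrow> cinner x (A y) = cinner x (B y)"
  shows "A = (B :: 'a::complex_hilbert \<Rightarrow> 'a)"
  using cinner_ext_dense[OF D] eq by (intro bounded_op_eq_on_dense[OF A B D]) blast

text \<open>Polarization stays inside \<open>S\<close> because \<open>S\<close> is a subspace. This
  is how operator identities are drawn from a Kraus representation, which gives only quadratic forms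
  on \<open>D\<close>.\<close>

lemma bounded_op_eq_on_dense_form:
  assumes A: "bounded_op A" and B: "bounded_op B" and S: "csubspace S" and D: "closure S = UNIV"
    and eq: "\<And>x. x \<in> S \<Longrightarrow> cinner x (A x) = cinner x (B x)"
  shows "A = (B :: 'a::complex_hilbert \<Rightarrow> 'a)"
proof (rule bounded_op_eq_on_dense_matrix[OF A B, of S])
  show "closure (cspan S) = UNIV" using S D by (metis complex_vector.span_eq_iff cspan_def csubspace_def)
  fix x y assume "x \<in> S" "y \<in> S"
  then have "x + c *\<^sub>C y \<in> S" "x + y \<in> S" for c
    using S by (auto intro: complex_vector.subspace_add complex_vector.subspace_scale)
  note eqs = this[THEN eq]
  show "cinner x (A y) = cinner x (B y)"
    unfolding cinner_op_polarization[OF A, of x] cinner_op_polarization[OF B, of x] eqs ..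
qed

section \<open>Orthonormal bases\<close>

lemma bessel:
  assumes "finite G" and "\<And>e f. e \<in> G \<Longrightarrow> f \<in> G \<Longrightarrow> cinner e f = (if e = f then 1 else 0)"
  shows "(norm (x - (\<Sum>e\<in>G. cinner e x *\<^sub>C e)))\<^sup>2 = (norm x)\<^sup>2 - (\<Sum>e\<in>G. (cmod (cinner e x))\<^sup>2)"
    and "y \<in> cspan G \<Longrightarrow> norm (x - (\<Sum>e\<in>G. cinner e x *\<^sub>C e)) \<le> norm (x - y)"
proof -
  define p where "p = (\<Sum>e\<in>G. cinner e x *\<^sub>C e)"
  have ep: "cinner e p = cinner e x" if "e \<in> G" for e
  proof -
    have "cinner e p = (\<Sum>f\<in>G. cinner f x * cinner e f)"
      by (simp add: p_def cinner_sum_right cinner_scaleC_right)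
    also have "\<dots> = (\<Sum>f\<in>G. if f = e then cinner f x else 0)"
      using assms(2) that by (intro sum.cong) auto
    finally show ?thesis using that assms(1) by simp
  qed
  have orth: "cinner y (x - p) = 0" if "y \<in> cspan G" for y
    using that
  proof (induction rule: complex_vector.span_induct)
    case base
    show ?case by (auto simp: complex_vector.subspace_def cinner_add_left cinner_scaleC_left)
  next
    case (step e) then show ?case by (simp add: cinner_diff_right ep)
  qed
  have p: "p \<in> cspan G"
    unfolding p_def by (intro complex_vector.span_sum complex_vector.span_scale complex_vector.span_base)
  \<comment> \<open>\<open>p\<close> is the foot of the perpendicular from \<open>x\<close> to
    \<open>cspan G\<close>. Taking \<open>y = 0\<close> gives the identity of norms, a general
    \<open>y\<close> the best approximation.\<close>
  have pyth: "(norm (x - y))\<^sup>2 = (norm (x - p))\<^sup>2 + (norm (p - y))\<^sup>2" if "y \<in> cspan G" for y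
  proof -
    have "cinner (p - y) (x - p) = 0" using orth complex_vector.span_diff[OF p that] by simp
    then have "inner (x - p) (p - y) = 0" by (metis Re_cinner inner_commute zero_complex.sel(1))
    moreover have "x - y = (x - p) + (p - y)" by simp
    ultimately show ?thesis by (metis norm_add_Pythagorean orthogonal_def)
  qed
  show "norm (x - (\<Sum>e\<in>G. cinner e x *\<^sub>C e)) \<le> norm (x - y)" if "y \<in> cspan G"
    unfolding p_def[symmetric] by (rule power2_le_imp_le) (use pyth[OF that] in auto)
  have "cinner p p = (\<Sum>e\<in>G. complex_of_real ((cmod (cinner e x))\<^sup>2))"
    unfolding p_def cinner_sum_left[of _ G] cinner_scaleC_left
    by (intro sum.cong refl) (simp only: ep[unfolded p_def] complex_norm_square mult.commute)
  then have "complex_of_real ((norm p)\<^sup>2) = complex_of_real (\<Sum>e\<in>G. (cmod (cinner e x))\<^sup>2)"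
    by (simp add: cinner_self)
  then have "(norm p)\<^sup>2 = (\<Sum>e\<in>G. (cmod (cinner e x))\<^sup>2)" using of_real_eq_iff by blast
  with pyth[OF complex_vector.span_zero]
  show "(norm (x - (\<Sum>e\<in>G. cinner e x *\<^sub>C e)))\<^sup>2 = (norm x)\<^sup>2 - (\<Sum>e\<in>G. (cmod (cinner e x))\<^sup>2)"
    by (simp flip: p_def)
qed

text \<open>Some finite combination of basis vectors comes within \<open>r\<close> of
  \<open>x\<close>; by best approximation the Fourier sum over any larger finite set is at least as
  close. This is unordered convergence.\<close>

lemma onb_expansion:
  assumes E: "is_onb E"
  shows "((\<lambda>e. cinner e x *\<^sub>C e) has_sum (x::'a::complex_hilbert)) E"
  unfolding has_sum_def tendsto_iff eventually_finite_subsets_at_top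
proof safe
  fix r :: real assume r: "r > 0"
  have "x \<in> closure (cspan E)" using E by (simp add: is_onb_def)
  then obtain y where y: "y \<in> cspan E" "dist y x < r" using r closure_approachable by blast
  obtain F c where F: "finite F" "F \<subseteq> E" and yF: "y = (\<Sum>a\<in>F. c a *\<^sub>C a)"
    using y(1) unfolding complex_vector.span_explicit by blast
  have yF: "y \<in> cspan F"
    unfolding yF by (intro complex_vector.span_sum complex_vector.span_scale complex_vector.span_base)
  show "\<exists>F. finite F \<and> F \<subseteq> E \<and>
      (\<forall>G. finite G \<and> F \<subseteq> G \<and> G \<subseteq> E \<longrightarrow> dist (\<Sum>e\<in>G. cinner e x *\<^sub>C e) x < r)"
  proof (intro exI[of _ F] conjI allI impI F)
    fix G assume G: "finite G \<and> F \<subseteq> G \<and> G \<subseteq> E"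
    then have "y \<in> cspan G" using yF complex_vector.span_mono by blast
    moreover have "cinner e f = (if e = f then 1 else 0)" if "e \<in> G" "f \<in> G" for e f
      using that G E unfolding is_onb_def by blast
    ultimately have "norm (x - (\<Sum>e\<in>G. cinner e x *\<^sub>C e)) \<le> norm (x - y)"
      using G by (intro bessel(2)) auto
    with y(2) show "dist (\<Sum>e\<in>G. cinner e x *\<^sub>C e) x < r"
      by (simp add: dist_norm norm_minus_commute)
  qed
qed

lemma parseval:
  assumes E: "is_onb E"
  shows "((\<lambda>e. cinner x e * cinner e y) has_sum cinner x (y::'a::complex_hilbert)) E"
  using has_sum_bounded_linear[OF bounded_linear_cinner_right onb_expansion[OF E], of x y]
  by (simp add: cinner_scaleC_right mult.commute o_def)

lemma parseval_norm:
  assumes E: "is_onb E"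
  shows "((\<lambda>e. (cmod (cinner e x))\<^sup>2) has_sum (norm (x::'a::complex_hilbert))\<^sup>2) E"
proof -
  have "((\<lambda>e. Re (cinner x e * cinner e x)) has_sum Re (cinner x x)) E"
    by (intro has_sum_Re parseval[OF E])
  then show ?thesis by (simp add: cinner_mult_commute cinner_self cmod_cinner_commute[of x] flip: of_real_power)
qed

text \<open>Gram-Schmidt on a dense sequence of vectors of \<open>D\<close>; the basis stays in
  \<open>D\<close> because only finite combinations are formed. This matters since the Kraus
  operators act only there.\<close>

lemma onb_exists_in_dense:
  fixes D :: "'a::{complex_hilbert, second_countable_topology} set"
  assumes D: "csubspace D" "closure D = UNIV"
  obtains B where "countable B" "B \<subseteq> D" "is_onb B"
proof -
  obtain \<B> :: "'a set set" where \<B>: "countable \<B>" "topological_basis \<B>"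
    using ex_countable_basis by blast
  define Q where "Q = (\<lambda>U. SOME d. d \<in> U \<and> d \<in> D) ` \<B>"
  have in_D: "(SOME d. d \<in> U \<and> d \<in> D) \<in> U \<inter> D" if "open U" "U \<noteq> {}" for U
  proof -
    have "U \<inter> D \<noteq> {}" using D(2) that open_Int_closure_eq_empty[of U D] by auto
    then have "\<exists>d. d \<in> U \<and> d \<in> D" by blast
    then show ?thesis by (rule someI2_ex) blast
  qed
  \<comment> \<open>The choice made for an empty basis set is arbitrary and may leave
    \<open>D\<close>; such entries are replaced by \<open>0\<close>.\<close>
  define d where "d n = (let q = (from_nat_into Q n) in if q \<in> D then q else 0)" for n
  have Q: "countable Q" using \<B>(1) by (simp add: Q_def)
  have dD: "d n \<in> D" for n using D(1) complex_vector.subspace_0 by (auto simp: d_def Let_def)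
  have d_dense: "closure (range d) = UNIV"
  proof (rule ccontr)
    assume "closure (range d) \<noteq> UNIV"
    then have "- closure (range d) \<noteq> {}" "open (- closure (range d))" by auto
    then obtain U where U: "U \<in> \<B>" "U \<noteq> {}" "U \<subseteq> - closure (range d)"
      using topological_basisE[OF \<B>(2)] by (metis all_not_in_conv empty_iff)
    define q where "q = (SOME d. d \<in> U \<and> d \<in> D)"
    have q: "q \<in> U" "q \<in> D" using in_D[of U] U \<B>(2) topological_basis_open unfolding q_def by blast+
    have "q \<in> Q" using U(1) by (auto simp: Q_def q_def)
    then obtain n where "from_nat_into Q n = q" using from_nat_into_surj[OF Q] by metis
    then have "d n = q" using q(2) by (simp add: d_def)
    then have "q \<in> closure (range d)" using closure_subset[of "range d"] by (metis rangeI subsetD)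
    then show False using q(1) U(3) by auto
  qed
  define step where "step v e n = v - (\<Sum>m<n. cinner (e m) v *\<^sub>C e m)"
    for v :: 'a and e :: "nat \<Rightarrow> 'a" and n
  \<comment> \<open>\<open>e n\<close> depends on all earlier values, hence the well-founded
    recursion. If \<open>d n\<close> depends linearly on them, the division by the norm
    \<open>0\<close> yields \<open>e n = 0\<close>; these zeros are dropped from
    \<open>B\<close>.\<close>
  have "\<exists>e. \<forall>n. e n = step (d n) e n /\<^sub>R norm (step (d n) e n)"
  proof -
    define F where "F f n = step (d n) f n /\<^sub>R norm (step (d n) f n)" for f :: "nat \<Rightarrow> 'a" and n
    have "step (d n) f n = step (d n) g n" if "\<And>m. m < n \<Longrightarrow> f m = g m" for f g n
      unfolding step_def by (intro arg_cong[where f = "\<lambda>x. d n - x"] sum.cong) (auto simp: that)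
    then have "adm_wf less_than F"
      unfolding adm_wf_def F_def by (metis in_measure less_than_iff)
    then have "\<forall>n. wfrec less_than F n = F (wfrec less_than F) n"
      using wfrec_fixpoint[of less_than F] by (simp add: fun_eq_iff)
    then show ?thesis unfolding F_def by blast
  qed
  then obtain e where e: "\<And>n. e n = step (d n) e n /\<^sub>R norm (step (d n) e n)" by blast
  have norm_e: "norm (e n) = 1" if "e n \<noteq> 0" for n
  proof -
    have "step (d n) e n \<noteq> 0" using that e[of n] by auto
    then show ?thesis by (simp add: e[of n])
  qed
  have orth: "cinner (e m) (e n) = 0" if "m < n" for m n
    using that
  proof (induction n arbitrary: m rule: less_induct)
    case (less n)
    have "cinner (e m) (\<Sum>k<n. cinner (e k) (d n) *\<^sub>C e k)
        = (\<Sum>k<n. if k = m then cinner (e m) (d n) * cinner (e m) (e m) else 0)"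
      unfolding cinner_sum_right
    proof (rule sum.cong[OF refl])
      fix k assume k: "k \<in> {..<n}"
      have "cinner (e m) (e k) = 0" if "k \<noteq> m"
        using less.IH[of k m] less.IH[of m k] less.prems k that cinner_eq_zero_commute
        by (metis lessThan_iff nat_neq_iff)
      then show "cinner (e m) (cinner (e k) (d n) *\<^sub>C e k)
          = (if k = m then cinner (e m) (d n) * cinner (e m) (e m) else 0)"
        by (simp add: cinner_scaleC_right)
    qed
    also have "\<dots> = cinner (e m) (d n) * cinner (e m) (e m)" using less.prems by simp
    also have "\<dots> = cinner (e m) (d n)"
      by (cases "e m = 0") (simp_all add: cinner_self norm_e)
    finally have "cinner (e m) (step (d n) e n) = 0" by (simp add: step_def cinner_diff_right)
    then show ?case by (subst e[of n]) (simp add: scaleR_scaleC cinner_scaleC_right)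
  qed
  have eD: "e n \<in> D" for n
  proof (induction n rule: less_induct)
    case (less n)
    have "step (d n) e n \<in> D"
      unfolding step_def using less dD D(1)
      by (intro complex_vector.subspace_diff complex_vector.subspace_sum complex_vector.subspace_scale) auto
    then show ?case
      using D(1) by (subst e) (auto simp: scaleR_scaleC intro: complex_vector.subspace_scale)
  qed
  define B where "B = range e - {0}"
  have span_e: "e n \<in> cspan B" for n
    using complex_vector.span_base[of "e n" B] complex_vector.span_zero by (cases "e n = 0") (auto simp: B_def)
  have "d n \<in> cspan B" for n
  proof -
    have "step (d n) e n = norm (step (d n) e n) *\<^sub>R e n"
      using arg_cong[OF e[of n], of "scaleR (norm (step (d n) e n))"]
      by (cases "step (d n) e n = 0") (simp_all del: scaleR_cancel_left)
    then have "d n = complex_of_real (norm (step (d n) e n)) *\<^sub>C e n + (\<Sum>m<n. cinner (e m) (d n) *\<^sub>C e m)"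
      by (simp add: step_def scaleR_scaleC algebra_simps)
    moreover have "\<dots> \<in> cspan B"
      by (intro complex_vector.span_add complex_vector.span_scale complex_vector.span_sum span_e)
    ultimately show ?thesis by simp
  qed
  then have "closure (cspan B) = UNIV" using d_dense closure_mono[of "range d" "cspan B"] by blast
  moreover have "cinner x y = (if x = y then 1 else 0)" if xy: "x \<in> B" "y \<in> B" for x y
  proof -
    obtain m n where mn: "x = e m" "y = e n" "x \<noteq> 0" "y \<noteq> 0" using xy by (auto simp: B_def)
    show ?thesis
    proof (cases "x = y")
      case True then show ?thesis using mn norm_e[of m] by (simp add: cinner_self)
    next
      case False
      then have "m < n \<or> n < m" using mn nat_neq_iff by blast
      then show ?thesis using orth[of m n] orth[of n m] mn False cinner_eq_zero_commute by auto
    qed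
  qed
  ultimately have "is_onb B" unfolding is_onb_def by blast
  moreover have "countable B" "B \<subseteq> D" using eD by (auto simp: B_def)
  ultimately show thesis using that by blast
qed

section \<open>Square-summable families and tensor products\<close>

text \<open>Only finite sums are estimated, by Cauchy-Schwarz for \<open>L2_set\<close> and
  Parseval. The bound, uniform over finite sets, supplies absolute summability for
  \<open>onb_swap\<close> and later a dominating function.\<close>

lemma onb_cauchy_schwarz:
  assumes E: "is_onb E"
  shows "(\<lambda>e. norm (cinner x e * cinner e (y::'a::complex_hilbert))) summable_on E"
    and "(\<Sum>\<^sub>\<infinity>e\<in>E. norm (cinner x e * cinner e y)) \<le> norm x * norm y"
proof -
  have fin: "(\<Sum>e\<in>G. norm (cinner x e * cinner e y)) \<le> norm x * norm y" if "finite G" "G \<subseteq> E" for G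
  proof -
    have L2: "L2_set (\<lambda>e. cmod (cinner e z)) G \<le> norm z" for z
    proof -
      have "(\<Sum>e\<in>G. (cmod (cinner e z))\<^sup>2) \<le> (norm z)\<^sup>2"
        using finite_sum_le_has_sum[OF parseval_norm[OF E]] that by auto
      then show ?thesis unfolding L2_set_def by (simp add: real_le_lsqrt sum_nonneg)
    qed
    have "(\<Sum>e\<in>G. norm (cinner x e * cinner e y)) = (\<Sum>e\<in>G. \<bar>cmod (cinner e x)\<bar> * \<bar>cmod (cinner e y)\<bar>)"
      by (simp add: norm_mult cmod_cinner_commute[of x])
    also have "\<dots> \<le> L2_set (\<lambda>e. cmod (cinner e x)) G * L2_set (\<lambda>e. cmod (cinner e y)) G"
      by (rule L2_set_mult_ineq)
    also have "\<dots> \<le> norm x * norm y" using L2 by (intro mult_mono) auto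
    finally show ?thesis .
  qed
  show 1: "(\<lambda>e. norm (cinner x e * cinner e y)) summable_on E"
    by (rule nonneg_bdd_above_summable_on) (auto intro!: bdd_aboveI2 fin)
  show "(\<Sum>\<^sub>\<infinity>e\<in>E. norm (cinner x e * cinner e y)) \<le> norm x * norm y"
    using 1 fin by (rule infsum_le_finite_sums)
qed

text \<open>Fubini for the double family \<open>F\<close>: absolute summability comes from
  \<open>onb_cauchy_schwarz\<close> in the basis index and from the hypothesis in the other. It
  yields both the value of the trace of a nuclear series and Parseval for slices.\<close>

lemma onb_swap:
  fixes f g :: "'i \<Rightarrow> 'a::complex_hilbert"
  assumes E: "is_onb E" and s: "(\<lambda>i. norm (f i) * norm (g i)) summable_on I"
  shows "((\<lambda>e. \<Sum>\<^sub>\<infinity>i\<in>I. cinner (f i) e * cinner e (g i)) has_sum (\<Sum>\<^sub>\<infinity>i\<in>I. cinner (f i) (g i))) E"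
proof -
  define F where "F = (\<lambda>(i, e). cinner (f i) e * cinner e (g i))"
  have "(\<lambda>p. norm (F p)) summable_on I \<times> E"
    unfolding Infinite_Sum.abs_summable_on_Sigma_iff
  proof
    show "\<forall>i\<in>I. (\<lambda>e. norm (F (i, e))) summable_on E"
      using onb_cauchy_schwarz(1)[OF E] by (simp add: F_def)
    show "(\<lambda>i. norm (\<Sum>\<^sub>\<infinity>e\<in>E. norm (F (i, e)))) summable_on I"
    proof (rule Infinite_Sum.abs_summable_on_comparison_test'[OF s])
      fix i assume "i \<in> I"
      show "norm (\<Sum>\<^sub>\<infinity>e\<in>E. norm (F (i, e))) \<le> norm (f i) * norm (g i)"
        using onb_cauchy_schwarz(2)[OF E, of "f i" "g i"] by (simp add: F_def infsum_nonneg)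
    qed
  qed
  then have sF: "F summable_on I \<times> E" by (rule Infinite_Sum.abs_summable_summable)
  have "((\<lambda>i. cinner (f i) (g i)) has_sum infsum F (I \<times> E)) I"
    by (rule has_sum_SigmaD[OF has_sum_infsum[OF sF]]) (simp add: F_def parseval[OF E])
  then have eq: "(\<Sum>\<^sub>\<infinity>i\<in>I. cinner (f i) (g i)) = infsum F (I \<times> E)" by (rule infsumI)
  have sw: "((\<lambda>(e, i). F (i, e)) has_sum infsum F (I \<times> E)) (E \<times> I)"
    using has_sum_infsum[OF sF] by (simp add: has_sum_swap[of F])
  show ?thesis unfolding eq
  proof (rule has_sum_SigmaD[OF sw])
    fix e assume e: "e \<in> E"
    have "(\<lambda>i. F (i, e)) summable_on I"
      using summable_on_SigmaD1[of "\<lambda>e i. F (i, e)" E "\<lambda>_. I" e] sw e by (auto simp: summable_on_def)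
    then show "((\<lambda>i. (\<lambda>(e, i). F (i, e)) (e, i)) has_sum (\<Sum>\<^sub>\<infinity>i\<in>I. cinner (f i) e * cinner e (g i))) I"
      by (simp add: F_def)
  qed
qed

section \<open>Square-summable families and their slices\<close>

lemma summable_Rep_l2: "(\<lambda>i. (norm (Rep_l2 f i))\<^sup>2) summable_on UNIV"
  using Rep_l2[of f] by simp

lemma Rep_Abs_l2: "(\<lambda>i. (norm (f i))\<^sup>2) summable_on UNIV \<Longrightarrow> Rep_l2 (Abs_l2 f) = f"
  by (simp add: Abs_l2_inverse)

lemma l2_eqI: "(\<And>i. Rep_l2 f i = Rep_l2 g i) \<Longrightarrow> f = g"
  by (metis Rep_l2_inject ext)

lemma has_sum_cinner_l2: "((\<lambda>i. cinner (Rep_l2 f i) (Rep_l2 g i)) has_sum cinner f g) UNIV"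
  unfolding cinner_l2.rep_eq by (intro has_sum_infsum l2_cinner summable_Rep_l2)

lemma has_sum_norm_l2: "((\<lambda>i. (norm (Rep_l2 f i))\<^sup>2) has_sum (norm f)\<^sup>2) UNIV"
proof -
  have "((\<lambda>i. Re (cinner (Rep_l2 f i) (Rep_l2 f i))) has_sum Re (cinner f f)) UNIV"
    by (intro has_sum_Re has_sum_cinner_l2)
  then show ?thesis by (simp add: cinner_self flip: of_real_power)
qed

lemma summable_l2_comparison:
  assumes "(\<lambda>i. (norm (f i))\<^sup>2) summable_on UNIV" "\<And>i. norm (g i) \<le> K * norm (f i)"
  shows "(\<lambda>i. (norm (g i))\<^sup>2) summable_on UNIV"
proof (rule summable_on_comparison_test)
  show "(\<lambda>i. K\<^sup>2 * (norm (f i))\<^sup>2) summable_on UNIV" by (intro summable_on_cmult_right assms)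
  show "(norm (g i))\<^sup>2 \<le> K\<^sup>2 * (norm (f i))\<^sup>2" for i
    using power_mono[OF assms(2) norm_ge_zero, of i 2] by (simp add: power_mult_distrib)
qed simp

text \<open>The operator \<open>A \<otimes> 1\<close> on
  \<open>H \<otimes> \<ell>\<^sup>2(I)\<close>. It is explicit, whereas \<open>tensor_op\<close> is
  a description that becomes usable only through \<open>tensor_op_eq\<close>.\<close>

definition amplify :: "('a::complex_hilbert \<Rightarrow> 'b::complex_hilbert) \<Rightarrow> ('i, 'a) l2 \<Rightarrow> ('i, 'b) l2" where
  "amplify A f = Abs_l2 (\<lambda>i. A (Rep_l2 f i))"

lemma Rep_amplify:
  assumes "bounded_op A" shows "Rep_l2 (amplify A f) i = A (Rep_l2 f i)"
proof -
  obtain K where "\<And>x. norm (A x) \<le> K * norm x" using bounded_op_bound[OF assms] by blast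
  then have "(\<lambda>i. (norm (A (Rep_l2 f i)))\<^sup>2) summable_on UNIV"
    by (rule summable_l2_comparison[OF summable_Rep_l2])
  then show ?thesis by (simp add: amplify_def Rep_Abs_l2)
qed

lemma bounded_op_amplify:
  fixes A :: "'a::complex_hilbert \<Rightarrow> 'b::complex_hilbert"
  assumes A: "bounded_op A" shows "bounded_op (amplify A :: ('i, 'a) l2 \<Rightarrow> ('i, 'b) l2)"
proof -
  obtain K where K: "K > 0" "\<And>x. norm (A x) \<le> K * norm x" using bounded_op_bound[OF A] by blast
  show ?thesis
  proof (rule bounded_opI)
    show "amplify A (f + g) = amplify A f + amplify A g" for f g :: "('i, 'a) l2"
      by (rule l2_eqI) (simp add: Rep_amplify A plus_l2.rep_eq bounded_op_add)
    show "amplify A (c *\<^sub>C f) = c *\<^sub>C amplify A f" for c and f :: "('i, 'a) l2"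
      by (rule l2_eqI) (simp add: Rep_amplify A scaleC_l2.rep_eq bounded_op_scaleC)
    show "norm (amplify A f) \<le> K * norm f" for f :: "('i, 'a) l2"
    proof (rule norm_l2_leI)
      fix I :: "'i set" assume I: "finite I"
      have "(\<Sum>i\<in>I. (norm (Rep_l2 (amplify A f) i))\<^sup>2) \<le> (\<Sum>i\<in>I. K\<^sup>2 * (norm (Rep_l2 f i))\<^sup>2)"
        using power_mono[OF K(2) norm_ge_zero, of _ 2]
        by (intro sum_mono) (simp add: Rep_amplify A power_mult_distrib)
      also have "\<dots> \<le> K\<^sup>2 * (norm f)\<^sup>2"
        using sum_norm_l2_le[OF I, of f] by (simp add: mult_left_mono flip: sum_distrib_left)
      finally show "(\<Sum>i\<in>I. (norm (Rep_l2 (amplify A f) i))\<^sup>2) \<le> (K * norm f)\<^sup>2"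
        by (simp add: power_mult_distrib)
    qed (use K in simp)
  qed
qed

lemma amplify_id: "amplify (\<lambda>x. x) f = f"
  by (simp add: amplify_def Rep_l2_inverse)

text \<open>The partial scalar product \<open>\<langle>c| \<otimes> 1\<close>, antilinear in
  \<open>c\<close>. Working slice by slice reduces vector-valued questions to scalar ones.\<close>

lift_definition slice :: "'a::complex_hilbert \<Rightarrow> ('i, 'a) l2 \<Rightarrow> ('i, complex) l2"
  is "\<lambda>c f i. cinner c (f i)"
  subgoal for c f by (rule summable_l2_comparison[of f _ "norm c"]) (auto intro: cmod_cinner_le)
  done

lemma norm_slice_le:
  fixes f :: "('i, 'a::complex_hilbert) l2"
  shows "norm (slice c f) \<le> norm c * norm f"
proof (rule norm_l2_leI)
  fix I :: "'i set" assume I: "finite I"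
  have "(\<Sum>i\<in>I. (norm (Rep_l2 (slice c f) i))\<^sup>2) \<le> (\<Sum>i\<in>I. (norm c)\<^sup>2 * (norm (Rep_l2 f i))\<^sup>2)"
    using power_mono[OF cmod_cinner_le norm_ge_zero, of c _ 2]
    by (intro sum_mono) (simp add: slice.rep_eq power_mult_distrib)
  also have "\<dots> \<le> (norm c)\<^sup>2 * (norm f)\<^sup>2"
    using sum_norm_l2_le[OF I, of f] by (simp add: mult_left_mono flip: sum_distrib_left)
  finally show "(\<Sum>i\<in>I. (norm (Rep_l2 (slice c f) i))\<^sup>2) \<le> (norm c * norm f)\<^sup>2"
    by (simp add: power_mult_distrib)
qed simp

lemma slice_add: "slice c (f + g) = slice c f + slice c g"
  by transfer (simp add: cinner_add_right)
lemma slice_scaleC: "slice c (a *\<^sub>C f) = a *\<^sub>C slice c f"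
  by transfer (simp add: cinner_scaleC_right scaleC_complex_def)
lemma slice_add_left: "slice (c + d) f = slice c f + slice d f"
  by transfer (simp add: cinner_add_left)
lemma slice_scaleC_left: "slice (a *\<^sub>C c) f = cnj a *\<^sub>C slice c f"
  by transfer (simp add: cinner_scaleC_left scaleC_complex_def)

lemma bounded_op_slice: "bounded_op (slice c)"
  by (rule bounded_opI[OF slice_add slice_scaleC norm_slice_le])

lemma slice_zero [simp]: "slice c 0 = 0" "slice 0 f = 0"
  by (transfer, simp)+

lemma l2_eq_slicesI:
  assumes "is_onb E" "\<And>e. e \<in> E \<Longrightarrow> slice e f = slice e g"
  shows "f = g"
proof (rule l2_eqI)
  fix i
  show "Rep_l2 f i = Rep_l2 g i"
  proof (rule cinner_ext_dense[of E])
    show "closure (cspan E) = UNIV" using assms(1) by (simp add: is_onb_def)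
    show "cinner e (Rep_l2 f i) = cinner e (Rep_l2 g i)" if "e \<in> E" for e
      using arg_cong[OF assms(2)[OF that], of "\<lambda>f. Rep_l2 f i"] by (simp add: slice.rep_eq)
  qed
qed

text \<open>Parseval in the factor \<open>H\<close> at each coordinate, followed by an exchange of
  the two sums.\<close>

lemma has_sum_cinner_slices:
  assumes "is_onb E"
  shows "((\<lambda>e. cinner (slice e f) (slice e g)) has_sum cinner f g) E"
proof -
  have "(\<lambda>i. norm (Rep_l2 f i) * norm (Rep_l2 g i)) summable_on UNIV"
  proof (rule summable_on_comparison_test)
    show "(\<lambda>i. (norm (Rep_l2 f i))\<^sup>2 + (norm (Rep_l2 g i))\<^sup>2) summable_on UNIV"
      by (intro summable_on_add summable_Rep_l2)
    show "norm (Rep_l2 f i) * norm (Rep_l2 g i) \<le> (norm (Rep_l2 f i))\<^sup>2 + (norm (Rep_l2 g i))\<^sup>2" for i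
      using sum_squares_bound[of "norm (Rep_l2 f i)" "norm (Rep_l2 g i)"]
        mult_nonneg_nonneg[OF norm_ge_zero norm_ge_zero, of "Rep_l2 f i" "Rep_l2 g i"] by linarith
  qed simp
  from onb_swap[OF assms this] show ?thesis
    by (simp add: cinner_l2.rep_eq slice.rep_eq cinner_complex_def cinner_commute[symmetric])
qed

lemma has_sum_norm_slices:
  assumes "is_onb E"
  shows "((\<lambda>e. (norm (slice e f))\<^sup>2) has_sum (norm f)\<^sup>2) E"
proof -
  have "((\<lambda>e. Re (cinner (slice e f) (slice e f))) has_sum Re (cinner f f)) E"
    by (intro has_sum_Re has_sum_cinner_slices assms)
  then show ?thesis by (simp add: cinner_self flip: of_real_power)
qed

section \<open>Elementary tensors and tensor products of operators\<close>

lemma tensor_vec_add_left: "tensor_vec (x + y) \<xi> = tensor_vec x \<xi> + tensor_vec y \<xi>"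
  by transfer (simp add: scaleC_add_right)
lemma tensor_vec_scaleC_left: "tensor_vec (c *\<^sub>C x) \<xi> = c *\<^sub>C tensor_vec x \<xi>"
  by transfer (simp add: scaleC_scaleC mult.commute)
lemma tensor_vec_scaleC_right: "tensor_vec x (c *\<^sub>C \<xi>) = c *\<^sub>C tensor_vec x \<xi>"
  by transfer (simp add: scaleC_scaleC scaleC_complex_def)
lemma tensor_vec_zero [simp]: "tensor_vec 0 \<xi> = 0" "tensor_vec x 0 = 0"
  by (transfer, simp)+

lemma slice_tensor_vec: "slice c (tensor_vec x \<xi>) = cinner c x *\<^sub>C \<xi>"
  by transfer (simp add: cinner_scaleC_right scaleC_complex_def mult.commute)

lemma cinner_tensor_vec_left: "cinner (tensor_vec x \<xi>) f = cinner \<xi> (slice x f)"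
  by (simp add: cinner_l2.rep_eq tensor_vec.rep_eq slice.rep_eq cinner_scaleC_left cinner_complex_def)

lemma cinner_tensor_vec: "cinner (tensor_vec x \<xi>) (tensor_vec y \<eta>) = cinner x y * cinner \<xi> \<eta>"
  by (simp add: cinner_tensor_vec_left slice_tensor_vec cinner_scaleC_right)

lemma norm_tensor_vec: "norm (tensor_vec x \<xi>) = norm x * norm \<xi>"
proof -
  have "complex_of_real ((norm (tensor_vec x \<xi>))\<^sup>2) = complex_of_real ((norm x * norm \<xi>)\<^sup>2)"
    using cinner_tensor_vec[of x \<xi> x \<xi>] by (simp add: cinner_self power_mult_distrib)
  then have "(norm (tensor_vec x \<xi>))\<^sup>2 = (norm x * norm \<xi>)\<^sup>2" using of_real_eq_iff by blast
  then show ?thesis by (simp add: power2_eq_iff_nonneg)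
qed

lemma bounded_op_tensor_vec_left: "bounded_op (\<lambda>x. tensor_vec x \<xi>)"
  by (rule bounded_opI[where K = "norm \<xi>"])
    (simp_all add: tensor_vec_add_left tensor_vec_scaleC_left norm_tensor_vec)

lemma amplify_tensor_vec: "bounded_op A \<Longrightarrow> amplify A (tensor_vec x \<xi>) = tensor_vec (A x) \<xi>"
  by (rule l2_eqI) (simp add: Rep_amplify tensor_vec.rep_eq bounded_op_scaleC)

lift_definition unit_l2 :: "'i \<Rightarrow> ('i, complex) l2" is "\<lambda>i j. if j = i then 1 else 0"
  subgoal for i by (rule finite_nonzero_values_imp_summable_on) (rule finite_subset[of _ "{i}"], auto)
  done

lemma cinner_unit_l2: "cinner (unit_l2 i) \<xi> = Rep_l2 \<xi> i"
proof -
  have "((\<lambda>j. cinner (Rep_l2 (unit_l2 i) j) (Rep_l2 \<xi> j)) has_sum Rep_l2 \<xi> i) UNIV"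
    by (rule has_sum_finite_neutralI[of "{i}"]) (auto simp: unit_l2.rep_eq cinner_complex_def)
  then show ?thesis using has_sum_cinner_l2 has_sum_unique by blast
qed

lemma l2_eq_tensorI:
  assumes "\<And>x i. cinner (tensor_vec x (unit_l2 i)) f = cinner (tensor_vec x (unit_l2 i)) g"
  shows "f = g"
  using assms
  by (intro l2_eqI) (rule cinner_ext, simp add: cinner_tensor_vec_left cinner_unit_l2 slice.rep_eq)

text \<open>Reads a vector of \<open>H \<otimes> \<ell>\<^sup>2(I)\<close> with the factors
  exchanged, as a family over \<open>E\<close>; since \<open>l2\<close> is indexed by a whole type,
  the family is padded by \<open>0\<close> outside \<open>E\<close>.\<close>

definition slices :: "'a set \<Rightarrow> ('i, 'a::complex_hilbert) l2 \<Rightarrow> ('a, ('i, complex) l2) l2" where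
  "slices E f = Abs_l2 (\<lambda>e. if e \<in> E then slice e f else 0)"

lemma Rep_slices:
  assumes "is_onb E" shows "Rep_l2 (slices E f) e = (if e \<in> E then slice e f else 0)"
proof -
  have "(\<lambda>e. (norm (slice e f))\<^sup>2) summable_on E"
    using has_sum_norm_slices[OF assms] by (auto simp: summable_on_def)
  then have "(\<lambda>e. (norm (if e \<in> E then slice e f else 0))\<^sup>2) summable_on UNIV"
    by (rule summable_on_cong_neutral[THEN iffD1, rotated -1]) auto
  then show ?thesis by (simp add: slices_def Rep_Abs_l2)
qed

lemma cinner_slices:
  assumes "is_onb E" shows "cinner (slices E f) (slices E g) = cinner f g"
proof -
  have "((\<lambda>e. cinner (Rep_l2 (slices E f) e) (Rep_l2 (slices E g) e)) has_sum cinner f g) UNIV"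
    using has_sum_cinner_slices[OF assms, of f g]
    by (rule has_sum_cong_neutral[THEN iffD1, rotated -1]) (auto simp: Rep_slices[OF assms])
  then show ?thesis using has_sum_cinner_l2 has_sum_unique by blast
qed

lemma bounded_op_slices:
  assumes E: "is_onb E" shows "bounded_op (slices E)"
proof (rule bounded_opI[where K = 1])
  show "slices E (f + g) = slices E f + slices E g" for f g
    by (rule l2_eqI) (simp add: Rep_slices[OF E] plus_l2.rep_eq slice_add)
  show "slices E (c *\<^sub>C f) = c *\<^sub>C slices E f" for c f
    by (rule l2_eqI) (simp add: Rep_slices[OF E] scaleC_l2.rep_eq slice_scaleC)
  show "norm (slices E f) \<le> 1 * norm f" for f
  proof -
    have "complex_of_real ((norm (slices E f))\<^sup>2) = complex_of_real ((norm f)\<^sup>2)"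
      using cinner_slices[OF E, of f f] by (simp only: cinner_self)
    then have "(norm (slices E f))\<^sup>2 = (norm f)\<^sup>2" using of_real_eq_iff by blast
    then show ?thesis by (simp add: power2_eq_iff_nonneg)
  qed
qed

lemma cadjoint_slices_slices:
  assumes E: "is_onb E" shows "cadjoint (slices E) (slices E f) = f"
  by (rule cinner_ext)
    (simp add: cinner_slices[OF E] flip: cinner_cadjoint[OF bounded_op_slices[OF E]])

text \<open>The adjoint of \<open>slices\<close> assembles a vector with prescribed slices;
  \<open>vcoef\<close> is built in this way.\<close>

lemma slice_cadjoint_slices:
  assumes E: "is_onb E" and e: "e \<in> E"
  shows "slice e (cadjoint (slices E) Z) = Rep_l2 Z e"
proof (rule cinner_ext)
  fix \<xi>
  have "cinner \<xi> (slice e (cadjoint (slices E) Z)) = cinner (slices E (tensor_vec e \<xi>)) Z"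
    by (simp add: cinner_cadjoint[OF bounded_op_slices[OF E]] flip: cinner_tensor_vec_left)
  moreover have "((\<lambda>h. cinner (Rep_l2 (slices E (tensor_vec e \<xi>)) h) (Rep_l2 Z h))
      has_sum cinner \<xi> (Rep_l2 Z e)) UNIV"
    using E e by (intro has_sum_finite_neutralI[of "{e}"])
      (auto simp: Rep_slices[OF E] slice_tensor_vec is_onb_def)
  ultimately show "cinner \<xi> (slice e (cadjoint (slices E) Z)) = cinner \<xi> (Rep_l2 Z e)"
    using has_sum_cinner_l2 has_sum_unique by metis
qed

text \<open>Identifying a vector of \<open>\<ell>\<^sup>2(I; H)\<close> with the family of its slices along an orthonormal basis
  of \<open>H\<close> turns \<open>1 \<otimes> B\<close> into the componentwise application of \<open>B\<close>.\<close>

lemma tensor_op_eq: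
  fixes A :: "'a::complex_hilbert \<Rightarrow> 'a" and B :: "('i, complex) l2 \<Rightarrow> ('i, complex) l2"
  assumes E: "is_onb E" and A: "bounded_op A" and B: "bounded_op B"
  shows "tensor_op A B = amplify A \<circ> (cadjoint (slices E) \<circ> amplify B \<circ> slices E)" (is "_ = ?T")
  unfolding tensor_op_def
proof (rule the_equality)
  have bT: "bounded_op ?T"
    using A B E by (intro bounded_op_compose bounded_op_amplify bounded_op_slices bounded_op_cadjoint)
  have T: "?T (tensor_vec x \<xi>) = tensor_vec (A x) (B \<xi>)" for x \<xi>
  proof -
    have "amplify B (slices E (tensor_vec x \<xi>)) = slices E (tensor_vec x (B \<xi>))"
      by (rule l2_eqI) (simp add: Rep_amplify[OF B] Rep_slices[OF E] slice_tensor_vec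
        bounded_op_scaleC[OF B] bounded_op_zero[OF B])
    then show ?thesis by (simp add: cadjoint_slices_slices[OF E] amplify_tensor_vec[OF A])
  qed
  show "bounded_op ?T \<and> (\<forall>\<phi> \<xi>. ?T (tensor_vec \<phi> \<xi>) = tensor_vec (A \<phi>) (B \<xi>))"
    using bT T by blast
  fix T' :: "('i, 'a) l2 \<Rightarrow> ('i, 'a) l2"
  assume T': "bounded_op T' \<and> (\<forall>\<phi> \<xi>. T' (tensor_vec \<phi> \<xi>) = tensor_vec (A \<phi>) (B \<xi>))"
  have "T' f = ?T f" for f
  proof (rule cinner_ext)
    fix g
    \<comment> \<open>Comparing adjoints lets elementary tensors with unit vectors of
      \<open>\<ell>\<^sup>2\<close> suffice: their scalar products with a vector recover its
      coordinates, so no density of their span has to be shown.\<close>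
    have "cadjoint T' g = cadjoint ?T g"
    proof (rule l2_eq_tensorI)
      fix x i
      show "cinner (tensor_vec x (unit_l2 i)) (cadjoint T' g) = cinner (tensor_vec x (unit_l2 i)) (cadjoint ?T g)"
        using T T' cinner_cadjoint[of T'] cinner_cadjoint[OF bT] by metis
    qed
    then show "cinner g (T' f) = cinner g (?T f)"
      using T' cinner_cadjoint_left[of T'] cinner_cadjoint_left[OF bT] by metis
  qed
  then show "T' = ?T" by blast
qed

text \<open>The operator \<open>1 \<otimes> \<langle>u|\<close>, the counterpart of
  \<open>slice\<close> in the other factor.\<close>

definition contract :: "('i, complex) l2 \<Rightarrow> ('i, 'a::complex_hilbert) l2 \<Rightarrow> 'a" where
  "contract u = cadjoint (\<lambda>x. tensor_vec x u)"

lemma cinner_contract: "cinner x (contract u f) = cinner u (slice x f)"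
  unfolding contract_def
  by (simp add: cinner_tensor_vec_left flip: cinner_cadjoint[OF bounded_op_tensor_vec_left])

lemma tensor_vec_contract:
  assumes "is_onb E" "\<And>e. e \<in> E \<Longrightarrow> slice e f = cinner u (slice e f) *\<^sub>C u"
  shows "tensor_vec (contract u f) u = f"
  by (rule l2_eq_slicesI[OF assms(1)]) (simp add: slice_tensor_vec cinner_contract assms(2)[symmetric])

section \<open>Trace class operators\<close>

text \<open>Makes the witnesses of \<open>trace_class\<close> explicit; boundedness is a
  consequence, derived in \<open>nuclear_rep_bounded_op\<close>.\<close>

definition nuclear_rep :: "('a::complex_hilbert \<Rightarrow> 'a) \<Rightarrow> (nat \<Rightarrow> 'a) \<Rightarrow> (nat \<Rightarrow> 'a) \<Rightarrow> bool" where
  "nuclear_rep T a b \<longleftrightarrow> summable (\<lambda>n. norm (a n) * norm (b n)) \<and>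
    (\<forall>x. (\<lambda>n. ket_bra (a n) (b n) x) sums T x)"

lemma norm_ket_bra_le: "norm (ket_bra a b x) \<le> norm a * norm b * norm x"
  using mult_right_mono[OF cmod_cinner_le[of b x] norm_ge_zero[of a]]
  by (simp add: ket_bra_def norm_scaleC mult_ac)

lemma nuclear_rep_norm_summable:
  assumes "summable (\<lambda>n. norm (a n) * norm (b n))"
  shows "summable (\<lambda>n. norm (ket_bra (a n) (b n) x))"
  by (rule summable_comparison_test'[OF summable_mult2[OF assms, of "norm x"]])
    (simp add: norm_ket_bra_le)

lemma nuclear_rep_bounded_op:
  assumes "nuclear_rep T a b" shows "bounded_op T"
proof (rule bounded_opI)
  have s: "(\<lambda>n. ket_bra (a n) (b n) x) sums T x" for x
    using assms by (simp add: nuclear_rep_def)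
  show "T (x + y) = T x + T y" for x y
    using sums_add[OF s[of x] s[of y]] s[of "x + y"]
    by (simp add: bounded_op_add[OF bounded_op_ket_bra] sums_unique2)
  show "T (c *\<^sub>C x) = c *\<^sub>C T x" for c x
    using bounded_linear.sums[OF bounded_linear_scaleC_right s, of c x] s[of "c *\<^sub>C x"]
    by (simp add: bounded_op_scaleC[OF bounded_op_ket_bra] sums_unique2)
  have ab: "summable (\<lambda>n. norm (a n) * norm (b n))" using assms by (simp add: nuclear_rep_def)
  show "norm (T x) \<le> (\<Sum>n. norm (a n) * norm (b n)) * norm x" for x
  proof -
    have "norm (T x) \<le> (\<Sum>n. norm (ket_bra (a n) (b n) x))"
      using summable_norm[OF nuclear_rep_norm_summable[OF ab]] s sums_unique by metis
    also have "\<dots> \<le> (\<Sum>n. norm (a n) * norm (b n) * norm x)"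
      by (intro suminf_le nuclear_rep_norm_summable[OF ab] summable_mult2[OF ab] norm_ket_bra_le)
    also have "\<dots> = (\<Sum>n. norm (a n) * norm (b n)) * norm x"
      by (rule suminf_mult2[OF ab, symmetric])
    finally show ?thesis .
  qed
qed

lemma trace_class_iff: "trace_class T \<longleftrightarrow> (\<exists>a b. nuclear_rep T a b)"
  using nuclear_rep_bounded_op unfolding trace_class_def nuclear_rep_def by blast

lemma nuclear_rep_exists:
  assumes "summable (\<lambda>n. norm (a n) * norm (b n))"
  shows "nuclear_rep (\<lambda>x. \<Sum>n. ket_bra (a n) (b n) x) a b"
  unfolding nuclear_rep_def
  using assms summable_norm_cancel[OF nuclear_rep_norm_summable[OF assms]] summable_sums by blast

lemma nuclear_rep_has_sum:
  assumes "nuclear_rep T a b"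
  shows "((\<lambda>n. cinner y (a n) * cinner (b n) x) has_sum cinner y (T x)) UNIV"
proof -
  have "((\<lambda>n. ket_bra (a n) (b n) x) has_sum T x) UNIV"
    using assms nuclear_rep_norm_summable by (intro norm_summable_imp_has_sum) (auto simp: nuclear_rep_def)
  from has_sum_bounded_linear[OF bounded_linear_cinner_right this, of y] show ?thesis
    by (simp add: o_def ket_bra_def cinner_scaleC_right mult.commute)
qed

lemma nuclear_rep_compose:
  assumes A: "bounded_op A" and T: "nuclear_rep T a b"
  shows "nuclear_rep (A \<circ> T) (\<lambda>n. A (a n)) b"
  unfolding nuclear_rep_def
proof
  obtain K where K: "K > 0" "\<And>x. norm (A x) \<le> K * norm x" using bounded_op_bound[OF A] by blast
  have "summable (\<lambda>n. K * (norm (a n) * norm (b n)))"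
    using T by (intro summable_mult) (simp add: nuclear_rep_def)
  then show "summable (\<lambda>n. norm (A (a n)) * norm (b n))"
    by (rule summable_comparison_test') (simp add: mult_right_mono K flip: mult.assoc)
  show "\<forall>x. (\<lambda>n. ket_bra (A (a n)) (b n) x) sums (A \<circ> T) x"
    using bounded_linear.sums[OF bounded_op_bounded_linear[OF A]] T
    by (fastforce simp: nuclear_rep_def ket_bra_def bounded_op_scaleC[OF A])
qed

lemma nuclear_rep_ket_bra:
  "nuclear_rep (ket_bra a b) (\<lambda>n. if n = 0 then a else 0) (\<lambda>n. if n = 0 then b else 0)"
proof -
  have 1: "(\<lambda>n::nat. norm (if n = 0 then a else 0) * norm (if n = 0 then b else 0))
      = (\<lambda>n. if n = 0 then norm a * norm b else 0)" by auto
  have 2: "(\<lambda>n::nat. ket_bra (if n = 0 then a else 0) (if n = 0 then b else 0) x)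
      = (\<lambda>n. if n = 0 then ket_bra a b x else 0)" for x by (auto simp: ket_bra_def)
  have "(\<lambda>n::nat. if n = 0 then ket_bra a b x else 0) sums ket_bra a b x" for x
    using sums_single[of 0 "\<lambda>_. ket_bra a b x"] by simp
  moreover have "summable (\<lambda>n::nat. if n = 0 then norm a * norm b else 0)"
    using sums_single[of 0 "\<lambda>_. norm a * norm b"] by (simp add: summable_def)
  ultimately show ?thesis
    unfolding nuclear_rep_def 1 2 by blast
qed

text \<open>Two nuclear series are merged into one on even and odd indices, unordered summation
  making the rearrangement legitimate. This is why trace class operators are closed under
  addition.\<close>

lemma has_sum_interleave:
  fixes f g :: "nat \<Rightarrow> 'a::{topological_comm_monoid_add, t2_space}"
  assumes "(f has_sum s) UNIV" "(g has_sum t) UNIV"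
  shows "((\<lambda>n. if even n then f (n div 2) else g (n div 2)) has_sum s + t) UNIV" (is "(?h has_sum _) _")
proof -
  have "(?h has_sum s) (range (\<lambda>n. 2 * n))" "(?h has_sum t) (range (\<lambda>n. 2 * n + 1))"
    using assms by (auto simp: has_sum_reindex inj_on_def o_def)
  moreover have "range (\<lambda>n::nat. 2 * n) \<inter> range (\<lambda>n. 2 * n + 1) = {}" by auto presburger
  ultimately have "(?h has_sum s + t) (range (\<lambda>n. 2 * n) \<union> range (\<lambda>n. 2 * n + 1))"
    by (rule has_sum_Un_disjoint)
  moreover have "range (\<lambda>n::nat. 2 * n) \<union> range (\<lambda>n. 2 * n + 1) = UNIV"
    by (auto simp: image_iff) presburger
  ultimately show ?thesis by simp
qed

lemma nuclear_rep_add: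
  assumes "nuclear_rep S a b" "nuclear_rep T c d"
  shows "nuclear_rep (\<lambda>x. S x + T x) (\<lambda>n. if even n then a (n div 2) else c (n div 2))
    (\<lambda>n. if even n then b (n div 2) else d (n div 2))" (is "nuclear_rep _ ?a ?b")
  unfolding nuclear_rep_def
proof (intro conjI allI)
  have "(\<lambda>n. if even n then norm (a (n div 2)) * norm (b (n div 2)) else norm (c (n div 2)) * norm (d (n div 2)))
      summable_on UNIV"
    unfolding summable_on_def
    by (rule exI, rule has_sum_interleave[of "\<lambda>n. norm (a n) * norm (b n)" _ "\<lambda>n. norm (c n) * norm (d n)"];
        rule has_sum_infsum, rule norm_summable_imp_summable_on)
      (use assms in \<open>simp_all add: nuclear_rep_def\<close>)
  then have "summable (\<lambda>n. if even n then norm (a (n div 2)) * norm (b (n div 2)) else norm (c (n div 2)) * norm (d (n div 2)))"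
    by (rule summable_on_imp_summable)
  then show "summable (\<lambda>n. norm (?a n) * norm (?b n))"
    by (rule back_subst[where P = summable]) auto
  fix x
  have "((\<lambda>n. if even n then ket_bra (a (n div 2)) (b (n div 2)) x else ket_bra (c (n div 2)) (d (n div 2)) x)
      has_sum (S x + T x)) UNIV"
    using assms nuclear_rep_norm_summable unfolding nuclear_rep_def
    by (intro has_sum_interleave[of "\<lambda>n. ket_bra (a n) (b n) x" _ "\<lambda>n. ket_bra (c n) (d n) x"]
        norm_summable_imp_has_sum) auto
  then have "(\<lambda>n. if even n then ket_bra (a (n div 2)) (b (n div 2)) x else ket_bra (c (n div 2)) (d (n div 2)) x)
      sums (S x + T x)"
    by (rule has_sum_imp_sums)
  then show "(\<lambda>n. ket_bra (?a n) (?b n) x) sums (S x + T x)"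
    by (rule back_subst[where P = "\<lambda>f. f sums _"]) auto
qed

lemma nuclear_rep_scaleC: "nuclear_rep T a b \<Longrightarrow> nuclear_rep (\<lambda>x. c *\<^sub>C T x) (\<lambda>n. c *\<^sub>C a n) b"
  using nuclear_rep_compose[OF bounded_op_comp_scaleC[OF bounded_op_id], of T a b c]
  by (simp add: o_def)

lemma trace_class_add: "trace_class S \<Longrightarrow> trace_class T \<Longrightarrow> trace_class (\<lambda>x. S x + T x)"
  using nuclear_rep_add unfolding trace_class_iff by blast

lemma trace_class_scaleC: "trace_class T \<Longrightarrow> trace_class (\<lambda>x. c *\<^sub>C T x)"
  using nuclear_rep_scaleC unfolding trace_class_iff by blast

lemma trace_class_compose: "bounded_op A \<Longrightarrow> trace_class T \<Longrightarrow> trace_class (A \<circ> T)"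
  using nuclear_rep_compose unfolding trace_class_iff by blast

lemma trace_class_ket_bra: "trace_class (ket_bra a b)"
  using nuclear_rep_ket_bra unfolding trace_class_iff by blast

lemma trace_class_bounded_op: "trace_class T \<Longrightarrow> bounded_op T"
  by (simp add: trace_class_def)

lemma onb_some: "is_onb (SOME E :: 'h::{complex_hilbert, second_countable_topology} set. is_onb E)"
proof -
  have "\<exists>E :: 'h set. is_onb E"
    using onb_exists_in_dense[of "UNIV :: 'h set"] by (auto simp: complex_vector.subspace_UNIV)
  then show ?thesis by (rule someI_ex)
qed

text \<open>The trace is defined by one chosen basis. Exchanging the sums over the basis and over
  the nuclear series gives a value in terms of \<open>a\<close> and \<open>b\<close> alone, from
  which traces are computed below.\<close>

lemma nuclear_rep_trace:
  fixes T :: "'h::{complex_hilbert, second_countable_topology} \<Rightarrow> 'h"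
  assumes "nuclear_rep T a b"
  shows "((\<lambda>e. cinner e (T e)) has_sum trace T) (SOME E. is_onb E)"
    and "(\<lambda>n. cinner (b n) (a n)) sums trace T"
proof -
  have s: "summable (\<lambda>n. norm (b n) * norm (a n))"
    using assms by (simp add: nuclear_rep_def mult.commute)
  then have "(\<lambda>n. norm (b n) * norm (a n)) summable_on UNIV"
    by (intro norm_summable_imp_summable_on) simp
  from onb_swap[OF onb_some this]
  have hs: "((\<lambda>e. cinner e (T e)) has_sum (\<Sum>\<^sub>\<infinity>n. cinner (b n) (a n))) (SOME E. is_onb E)"
    unfolding infsumI[OF nuclear_rep_has_sum[OF assms], symmetric] by (simp add: mult.commute)
  then have tr: "trace T = (\<Sum>\<^sub>\<infinity>n. cinner (b n) (a n))" unfolding trace_def by (rule infsumI)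
  with hs show "((\<lambda>e. cinner e (T e)) has_sum trace T) (SOME E. is_onb E)" by simp
  have "summable (\<lambda>n. norm (cinner (b n) (a n)))"
    by (rule summable_comparison_test'[OF s]) (simp add: cmod_cinner_le)
  then have "(\<lambda>n. cinner (b n) (a n)) summable_on UNIV" by (rule norm_summable_imp_summable_on)
  then show "(\<lambda>n. cinner (b n) (a n)) sums trace T" 
    unfolding tr by (intro has_sum_imp_sums has_sum_infsum)
qed

context
  fixes T :: "'h::{complex_hilbert, second_countable_topology} \<Rightarrow> 'h"
  assumes T: "trace_class T"
begin

lemma has_sum_trace: "((\<lambda>e. cinner e (T e)) has_sum trace T) (SOME E. is_onb E)"
  using T nuclear_rep_trace(1) unfolding trace_class_iff by blast

lemma trace_add: "trace_class S \<Longrightarrow> trace (\<lambda>x. T x + S x) = trace T + trace S"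
  using has_sum_add[OF has_sum_trace, of "\<lambda>e. cinner e (S e)" "trace S"] T
    nuclear_rep_trace(1) unfolding trace_class_iff
  by (auto simp: trace_def cinner_add_right intro!: infsumI)

lemma trace_scaleC: "trace (\<lambda>x. c *\<^sub>C T x) = c * trace T"
  using has_sum_cmult_right[OF has_sum_trace, of c]
  by (simp add: trace_def cinner_scaleC_right infsumI)

end

lemma trace_compose_ket_bra:
  fixes A :: "'h::{complex_hilbert, second_countable_topology} \<Rightarrow> 'h"
  assumes "bounded_op A" shows "trace (A \<circ> ket_bra a b) = cinner b (A a)"
proof -
  have "(\<lambda>n. cinner (if n = 0 then b else 0) (A (if n = 0 then a else 0))) sums trace (A \<circ> ket_bra a b)"
    by (intro nuclear_rep_trace(2) nuclear_rep_compose assms nuclear_rep_ket_bra)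
  moreover have "(\<lambda>n::nat. cinner (if n = 0 then b else 0) (A (if n = 0 then a else 0)))
      = (\<lambda>n. if n = 0 then cinner b (A a) else 0)" by auto
  moreover have "(\<lambda>n::nat. if n = 0 then cinner b (A a) else 0) sums cinner b (A a)"
    using sums_single[of 0 "\<lambda>_. cinner b (A a)"] by simp
  ultimately show ?thesis using sums_unique2 by metis
qed

lemma trace_ket_bra:
  fixes a b :: "'h::{complex_hilbert, second_countable_topology}"
  shows "trace (ket_bra a b) = cinner b a"
  using trace_compose_ket_bra[OF bounded_op_id] by (simp add: o_def)

section \<open>Positive operators and their decomposition\<close>

lemma nonneg_complex_iff: "z \<in> \<real>\<^sub>\<ge>\<^sub>0 \<longleftrightarrow> Im z = 0 \<and> 0 \<le> Re z"
  by (auto simp: complex_nonneg_Reals_iff)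

text \<open>A real quadratic form coincides with that of the adjoint, and over the complex numbers
  the quadratic form determines the operator.\<close>

lemma positive_op_selfadjoint:
  assumes Q: "bounded_op Q" "positive_op Q"
  shows "cinner (Q x) y = cinner x (Q y)"
proof -
  have "cadjoint Q = Q"
  proof (rule bounded_op_eq_on_dense_form[OF bounded_op_cadjoint[OF Q(1)] Q(1), where S = UNIV])
    fix x
    have "cinner x (cadjoint Q x) = cnj (cinner x (Q x))"
      using cinner_cadjoint[OF Q(1)] cinner_commute by metis
    also have "\<dots> = cinner x (Q x)"
      using Q(2) by (simp add: positive_op_def nonneg_complex_iff complex_eq_iff)
    finally show "cinner x (cadjoint Q x) = cinner x (Q x)" .
  qed (auto simp: Q complex_vector.subspace_UNIV)
  then show ?thesis using cinner_cadjoint[OF Q(1)] by simp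
qed

lemma positive_op_cauchy_schwarz:
  assumes Q: "bounded_op Q" "positive_op Q"
  shows "(cmod (cinner x (Q y)))\<^sup>2 \<le> Re (cinner x (Q x)) * Re (cinner y (Q y))"
proof -
  let ?a = "Re (cinner x (Q x))" and ?b = "Re (cinner y (Q y))" and ?s = "cinner x (Q y)"
  have pos: "0 \<le> Re (cinner z (Q z))" for z using Q(2) by (auto simp: positive_op_def nonneg_complex_iff)
  have yx: "cinner y (Q x) = cnj ?s"
    using positive_op_selfadjoint[OF Q] cinner_commute by metis
  \<comment> \<open>Positivity of the form at \<open>x + c *\<^sub>C y\<close>, with the phase of
    \<open>c\<close> chosen so that the cross terms add up to the real number
    \<open>- 2 * t * |?s|^2\<close>.\<close>
  have quad: "0 \<le> ?a - 2 * t * (cmod ?s)\<^sup>2 + t\<^sup>2 * (cmod ?s)\<^sup>2 * ?b" for t :: real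
  proof -
    define c where "c = - complex_of_real t * cnj ?s"
    have "cinner (x + c *\<^sub>C y) (Q (x + c *\<^sub>C y))
      = cinner x (Q x) + c * ?s + cnj c * cnj ?s + cnj c * c * cinner y (Q y)"
      by (simp add: bounded_op_add[OF Q(1)] bounded_op_scaleC[OF Q(1)] cinner_add_left cinner_add_right
        cinner_scaleC_left cinner_scaleC_right yx algebra_simps)
    moreover have "c * ?s = complex_of_real (- t * (cmod ?s)\<^sup>2)" "cnj c * cnj ?s = complex_of_real (- t * (cmod ?s)\<^sup>2)"
      "cnj c * c = complex_of_real (t\<^sup>2 * (cmod ?s)\<^sup>2)"
      unfolding of_real_mult complex_norm_square c_def by (simp_all add: power2_eq_square)
    ultimately have "Re (cinner (x + c *\<^sub>C y) (Q (x + c *\<^sub>C y))) = ?a - 2 * t * (cmod ?s)\<^sup>2 + t\<^sup>2 * (cmod ?s)\<^sup>2 * ?b"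
      by simp
    then show ?thesis using pos by metis
  qed
  show ?thesis
  proof (cases "?b = 0")
    case True
    have "(cmod ?s)\<^sup>2 = 0"
    proof (rule ccontr)
      assume nz: "(cmod ?s)\<^sup>2 \<noteq> 0"
      \<comment> \<open>Without a quadratic term the bound is affine in \<open>t\<close>; this
        \<open>t\<close> makes the right side \<open>- ?a - 2\<close>, which is negative.\<close>
      have "0 \<le> ?a - 2 * ((?a + 1) / (cmod ?s)\<^sup>2) * (cmod ?s)\<^sup>2" using quad[of "(?a + 1) / (cmod ?s)\<^sup>2"] True by simp
      then show False using nz pos[of x] by simp
    qed
    then show ?thesis using True by simp
  next
    case False
    then have b: "?b > 0" using pos[of y] by simp
    \<comment> \<open>\<open>1 / ?b\<close> is the value of \<open>t\<close> that minimizes the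
      quadratic polynomial.\<close>
    have "0 \<le> ?a - 2 * (1 / ?b) * (cmod ?s)\<^sup>2 + (1 / ?b)\<^sup>2 * (cmod ?s)\<^sup>2 * ?b" by (rule quad)
    also have "\<dots> = ?a - (cmod ?s)\<^sup>2 / ?b" using b by (simp add: field_simps power2_eq_square)
    finally show ?thesis using b by (simp add: field_simps)
  qed
qed

text \<open>An infinite Cholesky decomposition along a dense sequence: it replaces the spectral theorem
  for positive trace class operators.\<close>

lemma cholesky_step:
  fixes R :: "'a::complex_hilbert \<Rightarrow> 'a"
  assumes R: "bounded_op R" "positive_op R"
  obtains q where "bounded_op (\<lambda>x. R x - cinner q x *\<^sub>C q)" "positive_op (\<lambda>x. R x - cinner q x *\<^sub>C q)"
    "R d = cinner q d *\<^sub>C q" "\<And>y. R y = 0 \<Longrightarrow> cinner q y = 0"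
proof -
  define r where "r = Re (cinner d (R d))"
  have rr: "cinner d (R d) = complex_of_real r" and r0: "0 \<le> r"
    using R(2) by (auto simp: r_def positive_op_def nonneg_complex_iff complex_eq_iff)
  \<comment> \<open>For \<open>r = 0\<close> the division gives \<open>q = 0\<close>, which is right
    because Cauchy-Schwarz then forces \<open>R d = 0\<close>.\<close>
  define q where "q = complex_of_real (1 / sqrt r) *\<^sub>C R d"
  have Rd0: "R d = 0" if "r = 0"
  proof -
    have "(cmod (cinner (R d) (R d)))\<^sup>2 \<le> 0"
      using positive_op_cauchy_schwarz[OF R, of "R d" d] that by (simp add: r_def)
    then show ?thesis by simp
  qed
  have qx: "cinner q x = complex_of_real (1 / sqrt r) * cinner d (R x)" for x
    by (simp only: q_def cinner_scaleC_left positive_op_selfadjoint[OF R]) simp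
  have sub: "(\<lambda>x. R x - cinner q x *\<^sub>C q) = (\<lambda>x. R x + (- 1) *\<^sub>C ket_bra q q x)"
    by (simp add: ket_bra_def scaleC_minus1)
  show thesis
  proof (rule that[of q])
    show "bounded_op (\<lambda>x. R x - cinner q x *\<^sub>C q)"
      unfolding sub by (intro bounded_op_plus R bounded_op_comp_scaleC bounded_op_ket_bra)
    show "positive_op (\<lambda>x. R x - cinner q x *\<^sub>C q)"
      unfolding positive_op_def
    proof
      fix x
      have Rx: "cinner x (R x) = complex_of_real (Re (cinner x (R x)))"
        using R(2) by (auto simp: positive_op_def nonneg_complex_iff complex_eq_iff)
      \<comment> \<open>Positivity of the remainder is the Cauchy-Schwarz inequality for
        \<open>R\<close> between \<open>d\<close> and \<open>x\<close>.\<close>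
      have "(cmod (cinner q x))\<^sup>2 \<le> Re (cinner x (R x))"
      proof (cases "r = 0")
        case True
        then show ?thesis using R(2) by (simp add: q_def Rd0 positive_op_def nonneg_complex_iff)
      next
        case False
        have "(cmod (cinner q x))\<^sup>2 = (cmod (cinner d (R x)))\<^sup>2 / r"
          using r0 by (simp add: qx norm_mult power_mult_distrib norm_divide power_divide)
        also have "\<dots> \<le> Re (cinner x (R x))"
          using positive_op_cauchy_schwarz[OF R, of d x] r0 False by (simp add: divide_le_eq mult.commute flip: r_def)
        finally show ?thesis .
      qed
      moreover have "cinner x (R x - cinner q x *\<^sub>C q) = complex_of_real (Re (cinner x (R x)) - (cmod (cinner q x))\<^sup>2)"
        using Rx cinner_mult_commute[of q x] by (simp add: cinner_diff_right cinner_scaleC_right)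
      ultimately show "cinner x (R x - cinner q x *\<^sub>C q) \<in> \<real>\<^sub>\<ge>\<^sub>0"
        by (simp add: nonneg_complex_iff)
    qed
    show "R d = cinner q d *\<^sub>C q"
    proof (cases "r = 0")
      case True then show ?thesis by (simp add: q_def Rd0)
    next
      case False
      have "complex_of_real (1 / sqrt r) * complex_of_real r * complex_of_real (1 / sqrt r) = 1"
        using r0 False by (simp flip: of_real_mult of_real_divide add: field_simps)
      then show ?thesis
        by (simp only: qx rr) (simp add: q_def scaleC_scaleC)
    qed
    show "cinner q y = 0" if "R y = 0" for y using that by (simp add: qx)
  qed
qed

text \<open>After \<open>n\<close> steps the remainder \<open>R n\<close> annihilates
  \<open>d 0, ..., d (n - 1)\<close>, while its form stays nonnegative and bounded by
  \<open>K\<close> times the squared norm. Hence its form at \<open>x\<close> equals that at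
  \<open>x - d m\<close>, which is small once \<open>d m\<close> is near \<open>x\<close>.\<close>

lemma positive_op_decomposition:
  fixes Q :: "'h::{complex_hilbert, second_countable_topology} \<Rightarrow> 'h"
  assumes Q: "bounded_op Q" "positive_op Q"
  obtains q :: "nat \<Rightarrow> 'h" where "\<And>x. (\<lambda>n. (cmod (cinner (q n) x))\<^sup>2) sums Re (cinner x (Q x))"
proof -
  obtain S :: "'h set" where S: "countable S" "\<And>U. open U \<Longrightarrow> U \<noteq> {} \<Longrightarrow> \<exists>d\<in>S. d \<in> U"
    using countable_dense_exists[where 'a = 'h] by auto
  have "S \<noteq> {}" using S(2)[of UNIV] by auto
  define d where "d = from_nat_into S"
  have d: "\<exists>m. dist (d m) x < e" if "e > 0" for x e
  proof -
    have "ball x e \<noteq> {}" using that by simp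
    then obtain y where y: "y \<in> S" "y \<in> ball x e" using S(2)[OF open_ball] by blast
    moreover obtain m where "d m = y" unfolding d_def using from_nat_into_surj[OF S(1) y(1)] by metis
    ultimately show ?thesis by (auto simp: dist_commute)
  qed
  define good where "good R d q \<longleftrightarrow> bounded_op (\<lambda>x. R x - cinner q x *\<^sub>C q) \<and> 
      positive_op (\<lambda>x. R x - cinner q x *\<^sub>C q) \<and> R d = cinner q d *\<^sub>C q \<and> (\<forall>y. R y = 0 \<longrightarrow> cinner q y = 0)"
    for R and d q :: 'h
  have "\<exists>q. good R d q" if "bounded_op R" "positive_op R" for R d
    using cholesky_step[OF that, of d] unfolding good_def by metis
  then have good: "good R d (SOME q. good R d q)" if "bounded_op R" "positive_op R" for R d
    using that by (metis someI_ex)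
  define R where "R = rec_nat Q (\<lambda>n R x. R x - cinner (SOME q. good R (d n) q) x *\<^sub>C (SOME q. good R (d n) q))"
  define q where "q n = (SOME q. good (R n) (d n) q)" for n
  have R_Suc: "R (Suc n) = (\<lambda>x. R n x - cinner (q n) x *\<^sub>C q n)" for n
    by (simp add: R_def q_def)
  have R0: "R 0 = Q" by (simp add: R_def)
  have R: "bounded_op (R n)" "positive_op (R n)" for n
  proof (induction n)
    case (Suc n)
    { case 1 show ?case using good[OF Suc, of "d n"] unfolding R_Suc q_def good_def by blast }
    { case 2 show ?case using good[OF Suc, of "d n"] unfolding R_Suc q_def good_def by blast }
  qed (simp_all add: R0 Q)
  have g: "good (R n) (d n) (q n)" for n unfolding q_def by (rule good[OF R])
  have kill: "R n (d m) = 0" if "m < n" for m n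
    using that
  proof (induction n)
    case (Suc n)
    show ?case
    proof (cases "m = n")
      case True then show ?thesis using g[of n] by (simp add: R_Suc good_def)
    next
      \<comment> \<open>A vector killed by \<open>R n\<close> is orthogonal to \<open>q n\<close>,
        so the next remainder kills it too.\<close>
      case False then show ?thesis using Suc g[of n] by (simp add: R_Suc good_def)
    qed
  qed simp
  have partial: "(\<Sum>k<n. (cmod (cinner (q k) x))\<^sup>2) = Re (cinner x (Q x)) - Re (cinner x (R n x))" for n x
  proof (induction n)
    case (Suc n)
    have "cinner x (R (Suc n) x) = cinner x (R n x) - complex_of_real ((cmod (cinner (q n) x))\<^sup>2)"
      using cinner_mult_commute[of "q n" x] by (simp add: R_Suc cinner_diff_right cinner_scaleC_right)
    with Suc show ?case by simp
  qed (simp add: R0)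
  have pos: "0 \<le> Re (cinner x (R n x))" for x n
    using R(2)[of n] by (auto simp: positive_op_def nonneg_complex_iff)
  obtain K where K: "K > 0" "\<And>x. norm (Q x) \<le> K * norm x" using bounded_op_bound[OF Q(1)] by blast
  have small: "Re (cinner x (R n x)) \<le> K * (norm x)\<^sup>2" for x n
  proof -
    have "Re (cinner x (R n x)) \<le> Re (cinner x (Q x))"
      using partial[where n = n and x = x] by (metis diff_ge_0_iff_ge sum_nonneg zero_le_power2)
    also have "\<dots> \<le> norm x * norm (Q x)" using cmod_cinner_le[of x "Q x"] complex_Re_le_cmod order_trans by blast
    also have "\<dots> \<le> norm x * (K * norm x)" by (intro mult_left_mono K) simp
    finally show ?thesis by (simp add: power2_eq_square mult_ac)
  qed
  have "(\<lambda>n. Re (cinner x (R n x))) \<longlonglongrightarrow> 0" for x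
  proof (rule metric_LIMSEQ_I)
    fix e :: real assume e: "e > 0"
    then obtain m where m: "dist (d m) x < sqrt (e / K)" using d[of "sqrt (e / K)" x] K by auto
    have "(norm (x - d m))\<^sup>2 < e / K"
      using m e K by (metis dist_commute dist_norm norm_ge_zero real_less_rsqrt real_sqrt_less_iff real_sqrt_abs abs_norm_cancel)
    then have lt: "K * (norm (x - d m))\<^sup>2 < e" using K by (simp add: field_simps)
    have "dist (Re (cinner x (R n x))) 0 < e" if n: "n \<ge> Suc m" for n
    proof -
      have Rd: "R n (d m) = 0" using kill n by simp
      have "cinner (x - d m) (R n (x - d m)) = cinner x (R n x) - cinner (d m) (R n x)"
        by (simp add: bounded_op_diff[OF R(1)] Rd cinner_diff_left)
      also have "cinner (d m) (R n x) = 0"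
        using positive_op_selfadjoint[OF R] Rd by (metis cinner_zero_left)
      finally have "Re (cinner x (R n x)) \<le> K * (norm (x - d m))\<^sup>2"
        using small[where x = "x - d m" and n = n] by simp
      then show ?thesis using lt pos[where x = x and n = n] by simp
    qed
    then show "\<exists>N. \<forall>n\<ge>N. dist (Re (cinner x (R n x))) 0 < e" by blast
  qed
  then have "(\<lambda>n. Re (cinner x (Q x)) - Re (cinner x (R n x))) \<longlonglongrightarrow> Re (cinner x (Q x)) - 0" for x
    by (intro tendsto_diff tendsto_const)
  then have "(\<lambda>n. (cmod (cinner (q n) x))\<^sup>2) sums Re (cinner x (Q x))" for x
    unfolding sums_def partial by simp
  with that show thesis by blast
qed

section \<open>The dual map\<close>

lemma has_sum_sum:
  fixes f :: "'i \<Rightarrow> 'b \<Rightarrow> 'a::topological_comm_monoid_add"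
  assumes "finite I" "\<And>i. i \<in> I \<Longrightarrow> (f i has_sum s i) A"
  shows "((\<lambda>x. \<Sum>i\<in>I. f i x) has_sum (\<Sum>i\<in>I. s i)) A"
  using assms by (induction I rule: finite_induct) (auto intro: has_sum_add)

text \<open>Summing the forms over a basis bounds the partial sums of
  \<open>\<parallel>q n\<parallel>^2\<close> by the trace. The series, which so far converged only
  as a quadratic form, is therefore nuclear, with both families equal.\<close>

lemma positive_trace_class_decomposition:
  fixes Q :: "'h::{complex_hilbert, second_countable_topology} \<Rightarrow> 'h"
  assumes Q: "trace_class Q" "positive_op Q"
  obtains q where "nuclear_rep Q q q" "(\<lambda>n. (norm (q n))\<^sup>2) sums Re (trace Q)"
proof -
  define E where "E = (SOME E :: 'h set. is_onb E)"
  have E: "is_onb E" unfolding E_def by (rule onb_some)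
  obtain q :: "nat \<Rightarrow> 'h" where q: "\<And>x. (\<lambda>n. (cmod (cinner (q n) x))\<^sup>2) sums Re (cinner x (Q x))"
    using positive_op_decomposition[OF trace_class_bounded_op[OF Q(1)] Q(2)] by blast
  have le: "(\<Sum>n<N. (norm (q n))\<^sup>2) \<le> Re (trace Q)" for N
  proof (rule has_sum_mono)
    show "((\<lambda>e. \<Sum>n<N. (cmod (cinner e (q n)))\<^sup>2) has_sum (\<Sum>n<N. (norm (q n))\<^sup>2)) E"
      by (rule has_sum_sum) (auto intro: parseval_norm[OF E])
    show "((\<lambda>e. Re (cinner e (Q e))) has_sum Re (trace Q)) E"
      unfolding E_def by (intro has_sum_Re has_sum_trace Q(1))
    show "(\<Sum>n<N. (cmod (cinner e (q n)))\<^sup>2) \<le> Re (cinner e (Q e))" for e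
      using q[of e] sum_le_suminf[of "\<lambda>n. (cmod (cinner (q n) e))\<^sup>2" "{..<N}"]
      by (simp add: sums_iff cmod_cinner_commute[of e])
  qed
  have s: "summable (\<lambda>n. (norm (q n))\<^sup>2)"
    using le by (intro summableI_nonneg_bounded) auto
  then have s': "summable (\<lambda>n. norm (q n) * norm (q n))" by (simp add: power2_eq_square)
  define T where "T x = (\<Sum>n. ket_bra (q n) (q n) x)" for x
  have T: "nuclear_rep T q q" unfolding T_def by (rule nuclear_rep_exists[OF s'])
  have "T = Q"
  proof (rule bounded_op_eq_on_dense_form[OF nuclear_rep_bounded_op[OF T] trace_class_bounded_op[OF Q(1)], where S = UNIV])
    fix x
    have "(\<lambda>n. cinner x (q n) * cinner (q n) x) sums cinner x (T x)"
      by (intro has_sum_imp_sums nuclear_rep_has_sum T)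
    then have "(\<lambda>n. complex_of_real ((cmod (cinner (q n) x))\<^sup>2)) sums cinner x (T x)"
      by (simp only: cinner_mult_commute cmod_cinner_commute[of x])
    moreover have "(\<lambda>n. complex_of_real ((cmod (cinner (q n) x))\<^sup>2)) sums complex_of_real (Re (cinner x (Q x)))"
      using q[of x] by (rule sums_of_real)
    ultimately have "cinner x (T x) = complex_of_real (Re (cinner x (Q x)))" by (rule sums_unique2)
    also have "\<dots> = cinner x (Q x)"
      using Q(2) by (auto simp: positive_op_def nonneg_complex_iff complex_eq_iff)
    finally show "cinner x (T x) = cinner x (Q x)" .
  qed (auto simp: complex_vector.subspace_UNIV)
  with T have rep: "nuclear_rep Q q q" by simp
  have "(\<lambda>n. Re (cinner (q n) (q n))) sums Re (trace Q)"
    by (intro sums_Re nuclear_rep_trace(2) rep)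
  then have "(\<lambda>n. (norm (q n))\<^sup>2) sums Re (trace Q)" by (simp add: cinner_self flip: of_real_power)
  with rep that show thesis by blast
qed

lemma Re_trace_nonneg:
  fixes Q :: "'h::{complex_hilbert, second_countable_topology} \<Rightarrow> 'h"
  assumes Q: "trace_class Q" "positive_op Q"
  shows "0 \<le> Re (trace Q)"
proof -
  obtain q where "nuclear_rep Q q q" and q: "(\<lambda>n. (norm (q n))\<^sup>2) sums Re (trace Q)"
    using positive_trace_class_decomposition[OF Q] by blast
  have "0 \<le> (\<Sum>n. (norm (q n))\<^sup>2)" using sums_summable[OF q] by (rule suminf_nonneg) simp
  then show ?thesis using sums_unique[OF q] by simp
qed

text \<open>This estimate on positive operators takes the place of a trace norm bound when the dual
  map is constructed.\<close>

lemma cmod_trace_compose_le: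
  fixes Q :: "'h::{complex_hilbert, second_countable_topology} \<Rightarrow> 'h"
  assumes Q: "trace_class Q" "positive_op Q" and A: "bounded_op A" "\<And>x. norm (A x) \<le> K * norm x"
  shows "cmod (trace (A \<circ> Q)) \<le> K * Re (trace Q)"
proof -
  obtain q where q: "nuclear_rep Q q q" "(\<lambda>n. (norm (q n))\<^sup>2) sums Re (trace Q)"
    using positive_trace_class_decomposition[OF Q] by blast
  have tr: "(\<lambda>n. cinner (q n) (A (q n))) sums trace (A \<circ> Q)"
    by (intro nuclear_rep_trace(2) nuclear_rep_compose A q)
  have le: "cmod (cinner (q n) (A (q n))) \<le> K * (norm (q n))\<^sup>2" for n
    using cmod_cinner_le[of "q n" "A (q n)"] mult_left_mono[OF A(2)[of "q n"] norm_ge_zero[of "q n"]]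
    by (simp add: power2_eq_square mult_ac)
  have sK: "(\<lambda>n. K * (norm (q n))\<^sup>2) sums (K * Re (trace Q))" by (intro sums_mult q)
  have "summable (\<lambda>n. cmod (cinner (q n) (A (q n))))"
    by (rule summable_comparison_test'[OF sums_summable[OF sK]]) (simp add: le)
  then have "cmod (trace (A \<circ> Q)) \<le> (\<Sum>n. cmod (cinner (q n) (A (q n))))"
    using tr summable_norm sums_unique by metis
  also have "\<dots> \<le> (\<Sum>n. K * (norm (q n))\<^sup>2)"
    using \<open>summable (\<lambda>n. cmod _)\<close> sK le by (intro suminf_le) (auto simp: sums_iff)
  also have "\<dots> = K * Re (trace Q)" using sK by (simp add: sums_iff)
  finally show ?thesis .
qed

text \<open>Scaling \<open>a n\<close> by \<open>t n\<close> and \<open>b n\<close> by its inverse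
  does not change \<open>ket_bra\<close>. This \<open>t\<close> gives both vectors the squared norm
  \<open>\<parallel>a n\<parallel> \<parallel>b n\<parallel>\<close>; if one of them vanishes, then
  \<open>t n = 0\<close> and both scaled vectors are \<open>0\<close>.\<close>

lemma nuclear_rep_balanced:
  assumes "nuclear_rep T a b"
  obtains a' b' where "nuclear_rep T a' b'" "summable (\<lambda>n. (norm (a' n))\<^sup>2)" "summable (\<lambda>n. (norm (b' n))\<^sup>2)"
proof -
  define t where "t n = sqrt (norm (b n) / norm (a n))" for n
  define a' where "a' n = complex_of_real (t n) *\<^sub>C a n" for n
  define b' where "b' n = complex_of_real (1 / t n) *\<^sub>C b n" for n
  have t2: "(t n)\<^sup>2 = norm (b n) / norm (a n)" for n by (simp add: t_def)
  have na: "(norm (a' n))\<^sup>2 = norm (a n) * norm (b n)" for n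
    by (simp add: a'_def norm_scaleC power_mult_distrib t2) (simp add: power2_eq_square)
  have nb: "(norm (b' n))\<^sup>2 = norm (a n) * norm (b n)" for n
    by (simp add: b'_def norm_scaleC power_mult_distrib norm_divide power_divide t2) (simp add: power2_eq_square)
  have ab: "ket_bra (a' n) (b' n) x = ket_bra (a n) (b n) x" for n x
  proof (cases "a n = 0 \<or> b n = 0")
    case True then show ?thesis by (auto simp: ket_bra_def a'_def b'_def)
  next
    case False
    then have "t n \<noteq> 0" by (simp add: t_def)
    then show ?thesis
      by (simp add: ket_bra_def a'_def b'_def cinner_scaleC_left scaleC_scaleC)
  qed
  have s: "summable (\<lambda>n. norm (a n) * norm (b n))" using assms by (simp add: nuclear_rep_def)
  have sa: "summable (\<lambda>n. (norm (a' n))\<^sup>2)" using s by (simp add: na)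
  have sb: "summable (\<lambda>n. (norm (b' n))\<^sup>2)" using s by (simp add: nb)
  have "summable (\<lambda>n. norm (a' n) * norm (b' n))"
  proof (rule summable_comparison_test'[OF summable_add[OF sa sb]])
    show "norm (norm (a' n) * norm (b' n)) \<le> (norm (a' n))\<^sup>2 + (norm (b' n))\<^sup>2" for n
      using sum_squares_bound[of "norm (a' n)" "norm (b' n)"]
        mult_nonneg_nonneg[OF norm_ge_zero norm_ge_zero, of "a' n" "b' n"]
      unfolding norm_mult real_norm_def abs_norm_cancel by linarith
  qed
  then have "nuclear_rep T a' b'" using assms by (simp add: nuclear_rep_def ab)
  with sa sb that show thesis by blast
qed

lemma positive_op_nuclear_rep:
  assumes "nuclear_rep T a a" shows "positive_op T"
  unfolding positive_op_def
proof
  fix x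
  have "((\<lambda>n. complex_of_real ((cmod (cinner x (a n)))\<^sup>2)) has_sum cinner x (T x)) UNIV"
    using nuclear_rep_has_sum[OF assms, of x x] by (simp only: cinner_mult_commute)
  from has_sum_Re[OF this] has_sum_Im[OF this]
  have "((\<lambda>n. (cmod (cinner x (a n)))\<^sup>2) has_sum Re (cinner x (T x))) UNIV"
    "((\<lambda>n::nat. 0::real) has_sum Im (cinner x (T x))) UNIV" by (simp_all del: of_real_power)
  then have "0 \<le> Re (cinner x (T x))" "Im (cinner x (T x)) = 0"
    by (auto intro: has_sum_nonneg has_sum_unique[OF _ has_sum_0_simp])
  then show "cinner x (T x) \<in> \<real>\<^sub>\<ge>\<^sub>0" by (simp add: nonneg_complex_iff)
qed

text \<open>Polarization extends bounds on the positive cone to all nuclear operators.\<close>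

lemma functional_bound_nuclear:
  fixes f :: "('h::{complex_hilbert, second_countable_topology} \<Rightarrow> 'h) \<Rightarrow> complex"
  assumes add: "\<And>S T. trace_class S \<Longrightarrow> trace_class T \<Longrightarrow> f (\<lambda>x. S x + T x) = f S + f T"
    and scale: "\<And>c T. trace_class T \<Longrightarrow> f (\<lambda>x. c *\<^sub>C T x) = c * f T"
    and bound: "\<And>T. trace_class T \<Longrightarrow> positive_op T \<Longrightarrow> cmod (f T) \<le> K * Re (trace T)"
    and T: "nuclear_rep T a b" and sa: "summable (\<lambda>n. (norm (a n))\<^sup>2)" and sb: "summable (\<lambda>n. (norm (b n))\<^sup>2)"
    and K: "0 \<le> K"
  shows "cmod (f T) \<le> 2 * K * ((\<Sum>n. (norm (a n))\<^sup>2) + (\<Sum>n. (norm (b n))\<^sup>2))"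
proof -
  define R where "R z x = (\<Sum>n. ket_bra (a n + z *\<^sub>C b n) (a n + z *\<^sub>C b n) x)" for z x
  let ?s = "(\<Sum>n. (norm (a n))\<^sup>2) + (\<Sum>n. (norm (b n))\<^sup>2)"
  \<comment> \<open>The parallelogram law with one of its two terms dropped.\<close>
  have le: "(norm (a n + z *\<^sub>C b n))\<^sup>2 \<le> 2 * ((norm (a n))\<^sup>2 + (norm (b n))\<^sup>2)" if "cmod z = 1" for z n
  proof -
    have "norm (z *\<^sub>C b n) = norm (b n)" using that by (simp add: norm_scaleC)
    have "(norm (a n + z *\<^sub>C b n))\<^sup>2 \<le> (norm (a n + z *\<^sub>C b n))\<^sup>2 + (norm (a n - z *\<^sub>C b n))\<^sup>2" by simp
    also have "\<dots> = 2 * ((norm (a n))\<^sup>2 + (norm (b n))\<^sup>2)"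
      unfolding parallelogram \<open>norm (z *\<^sub>C b n) = norm (b n)\<close> by simp
    finally show ?thesis .
  qed
  have sab: "(\<lambda>n. 2 * ((norm (a n))\<^sup>2 + (norm (b n))\<^sup>2)) sums (2 * ?s)"
    by (intro sums_mult sums_add summable_sums sa sb)
  have sz: "summable (\<lambda>n. (norm (a n + z *\<^sub>C b n))\<^sup>2)" if "cmod z = 1" for z
    by (rule summable_comparison_test'[OF sums_summable[OF sab]]) (use le[OF that] in simp)
  have rep: "nuclear_rep (R z) (\<lambda>n. a n + z *\<^sub>C b n) (\<lambda>n. a n + z *\<^sub>C b n)" if "cmod z = 1" for z
    unfolding R_def using sz[OF that] by (intro nuclear_rep_exists) (simp add: power2_eq_square)
  then have tc: "trace_class (R z)" if "cmod z = 1" for z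
    using that unfolding trace_class_iff by blast
  have fR: "cmod (f (R z)) \<le> K * (2 * ?s)" if z: "cmod z = 1" for z
  proof -
    have "(\<lambda>n. Re (cinner (a n + z *\<^sub>C b n) (a n + z *\<^sub>C b n))) sums Re (trace (R z))"
      by (intro sums_Re nuclear_rep_trace(2) rep z)
    then have "(\<lambda>n. (norm (a n + z *\<^sub>C b n))\<^sup>2) sums Re (trace (R z))"
      by (simp add: cinner_self flip: of_real_power)
    then have "Re (trace (R z)) \<le> 2 * ?s" by (rule sums_le[OF le[OF z] _ sab])
    moreover have "cmod (f (R z)) \<le> K * Re (trace (R z))"
      by (intro bound tc z positive_op_nuclear_rep[OF rep])
    ultimately show ?thesis using K by (meson mult_left_mono order_trans)
  qed
  \<comment> \<open>The four terms of polarization are grouped in two pairs, since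
    \<open>add\<close> handles two trace class operators at a time.\<close>
  define U where "U = (\<lambda>x. (1/4) *\<^sub>C R 1 x + (-1/4) *\<^sub>C R (-1) x)"
  define W where "W = (\<lambda>x. (\<i>/4) *\<^sub>C R \<i> x + (-\<i>/4) *\<^sub>C R (-\<i>) x)"
  have tcU: "trace_class U" and tcW: "trace_class W"
    unfolding U_def W_def by (intro trace_class_add trace_class_scaleC tc; simp)+
  have fU: "f U = (1/4) * f (R 1) + (-1/4) * f (R (-1))"
    unfolding U_def by (simp only: add scale tc trace_class_scaleC norm_one norm_minus_cancel)
  have fW: "f W = (\<i>/4) * f (R \<i>) + (-\<i>/4) * f (R (-\<i>))"
    unfolding W_def by (simp only: add scale tc trace_class_scaleC norm_ii norm_minus_cancel)
  have "T = (\<lambda>x. U x + W x)"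
  proof
    fix x
    have kb: "(\<lambda>n. ket_bra (a n + z *\<^sub>C b n) (a n + z *\<^sub>C b n) x) sums R z x" if "cmod z = 1" for z
      using rep[OF that] by (simp add: nuclear_rep_def)
    have "(\<lambda>n. ((1/4) *\<^sub>C ket_bra (a n + 1 *\<^sub>C b n) (a n + 1 *\<^sub>C b n) x
        + (-1/4) *\<^sub>C ket_bra (a n + (-1) *\<^sub>C b n) (a n + (-1) *\<^sub>C b n) x)
        + ((\<i>/4) *\<^sub>C ket_bra (a n + \<i> *\<^sub>C b n) (a n + \<i> *\<^sub>C b n) x
        + (-\<i>/4) *\<^sub>C ket_bra (a n + (-\<i>) *\<^sub>C b n) (a n + (-\<i>) *\<^sub>C b n) x)) sums (U x + W x)"
      unfolding U_def W_def
      by (intro sums_add bounded_linear.sums[OF bounded_linear_scaleC_right] kb) simp_all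
    moreover have "((1/4) *\<^sub>C ket_bra (p + 1 *\<^sub>C r) (p + 1 *\<^sub>C r) x
        + (-1/4) *\<^sub>C ket_bra (p + (-1) *\<^sub>C r) (p + (-1) *\<^sub>C r) x)
        + ((\<i>/4) *\<^sub>C ket_bra (p + \<i> *\<^sub>C r) (p + \<i> *\<^sub>C r) x
        + (-\<i>/4) *\<^sub>C ket_bra (p + (-\<i>) *\<^sub>C r) (p + (-\<i>) *\<^sub>C r) x) = ket_bra p r x" for p r
      by (rule cinner_ext)
        (simp only: ket_bra_def cinner_add_left cinner_add_right cinner_scaleC_left cinner_scaleC_right,
          simp add: algebra_simps)
    ultimately have 1: "(\<lambda>n. ket_bra (a n) (b n) x) sums (U x + W x)" by (simp only:)
    have 2: "(\<lambda>n. ket_bra (a n) (b n) x) sums T x" using T by (simp add: nuclear_rep_def)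
    show "T x = U x + W x" by (rule sums_unique2[OF 2 1])
  qed
  then have "f T = f U + f W" using add[OF tcU tcW] by simp
  then have "cmod (f T) \<le> cmod ((1/4) * f (R 1)) + cmod ((-1/4) * f (R (-1)))
      + (cmod ((\<i>/4) * f (R \<i>)) + cmod ((-\<i>/4) * f (R (-\<i>))))"
    unfolding fU fW
    by (metis order_trans[OF norm_triangle_ineq add_mono[OF norm_triangle_ineq norm_triangle_ineq]])
  \<comment> \<open>Four terms of weight \<open>1/4\<close>, each bounded by
    \<open>K * (2 * ?s)\<close>.\<close>
  also have "\<dots> \<le> 2 * K * ?s"
    using fR[of 1] fR[of "-1"] fR[of \<i>] fR[of "-\<i>"] by (simp add: norm_mult norm_divide algebra_simps)
  finally show ?thesis .
qed

text \<open>The values of \<open>f\<close> on rank one operators form a bounded sesquilinear form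
  and so give \<open>B\<close>. On a nuclear series \<open>f\<close> and the trace against
  \<open>B\<close> differ by \<open>f\<close> of a tail, which tends to \<open>0\<close> by
  \<open>functional_bound_nuclear\<close>.\<close>

lemma trace_functional_representation:
  fixes f :: "('h::{complex_hilbert, second_countable_topology} \<Rightarrow> 'h) \<Rightarrow> complex"
  assumes add: "\<And>S T. trace_class S \<Longrightarrow> trace_class T \<Longrightarrow> f (\<lambda>x. S x + T x) = f S + f T"
    and scale: "\<And>c T. trace_class T \<Longrightarrow> f (\<lambda>x. c *\<^sub>C T x) = c * f T"
    and bound: "\<And>T. trace_class T \<Longrightarrow> positive_op T \<Longrightarrow> cmod (f T) \<le> K * Re (trace T)"
    and K: "0 \<le> K"
  obtains B where "bounded_op B" "\<And>T. trace_class T \<Longrightarrow> f T = trace (B \<circ> T)"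
proof -
  have fb: "cmod (f T) \<le> 2 * K * ((\<Sum>n. (norm (a n))\<^sup>2) + (\<Sum>n. (norm (b n))\<^sup>2))"
    if "nuclear_rep T a b" "summable (\<lambda>n. (norm (a n))\<^sup>2)" "summable (\<lambda>n. (norm (b n))\<^sup>2)" for T a b
    by (rule functional_bound_nuclear[of f K]) (fact assms that)+
  have kb: "cmod (f (ket_bra a b)) \<le> 2 * K * ((norm a)\<^sup>2 + (norm b)\<^sup>2)" for a b
  proof -
    have s: "(\<lambda>n::nat. (norm (if n = 0 then c else 0))\<^sup>2) sums (norm c)\<^sup>2" for c :: 'h
      using sums_single[of 0 "\<lambda>_. (norm c)\<^sup>2"] by (rule back_subst[where P = "\<lambda>f. f sums _"]) auto
    show ?thesis
      using fb[OF nuclear_rep_ket_bra, of a b] s[of a] s[of b] by (simp add: sums_iff)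
  qed
  define s where "s x y = f (ket_bra y x)" for x y
  have s1: "s (x + y) z = s x z + s y z" for x y z
  proof -
    have "ket_bra z (x + y) = (\<lambda>u. ket_bra z x u + ket_bra z y u)"
      by (simp add: ket_bra_def cinner_add_left scaleC_add_left)
    then show ?thesis by (simp add: s_def add trace_class_ket_bra)
  qed
  have s2: "s (c *\<^sub>C x) y = cnj c * s x y" for c x y
  proof -
    have "ket_bra y (c *\<^sub>C x) = (\<lambda>u. cnj c *\<^sub>C ket_bra y x u)"
      by (simp add: ket_bra_def cinner_scaleC_left scaleC_scaleC)
    then show ?thesis by (simp add: s_def scale trace_class_ket_bra)
  qed
  have s3: "s x (y + z) = s x y + s x z" for x y z
  proof -
    have "ket_bra (y + z) x = (\<lambda>u. ket_bra y x u + ket_bra z x u)"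
      by (simp add: ket_bra_def scaleC_add_right)
    then show ?thesis by (simp add: s_def add trace_class_ket_bra)
  qed
  have s4: "s x (c *\<^sub>C y) = c * s x y" for c x y
  proof -
    have "ket_bra (c *\<^sub>C y) x = (\<lambda>u. c *\<^sub>C ket_bra y x u)"
      by (simp add: ket_bra_def scaleC_scaleC mult.commute)
    then show ?thesis by (simp add: s_def scale trace_class_ket_bra)
  qed
  \<comment> \<open>\<open>kb\<close> bounds \<open>s\<close> by squares of norms; at unit vectors
    this is \<open>4 * K\<close>, and homogeneity turns it into a product bound.\<close>
  have s5: "cmod (s x y) \<le> 4 * K * norm x * norm y" for x y
  proof (cases "x = 0 \<or> y = 0")
    case True
    have "s 0 y = 0" "s x 0 = 0" using s2[of 0 x y] s4[of x 0 y] by simp_all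
    with True show ?thesis by auto
  next
    case False
    define u v where "u = complex_of_real (inverse (norm x)) *\<^sub>C x" and "v = complex_of_real (inverse (norm y)) *\<^sub>C y"
    have "norm u = 1" "norm v = 1" using False by (simp_all add: u_def v_def norm_scaleC norm_inverse)
    then have "cmod (s u v) \<le> 4 * K" using kb[of v u] by (simp add: s_def)
    moreover have "x = complex_of_real (norm x) *\<^sub>C u" "y = complex_of_real (norm y) *\<^sub>C v"
      using False by (simp_all add: u_def v_def scaleC_scaleC flip: of_real_mult)
    then have "s x y = norm x * (norm y * s u v)" by (metis s2 s4 complex_cnj_complex_of_real)
    then have "cmod (s x y) = norm x * norm y * cmod (s u v)" by (simp add: norm_mult)
    ultimately show ?thesis
      using mult_left_mono[of "cmod (s u v)" "4 * K" "norm x * norm y"] by (simp add: mult_ac)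
  qed
  obtain B where B: "bounded_op B" "\<And>x y. s x y = cinner x (B y)"
    using sesquilinear_operator_exists[of s "4 * K", OF s1 s2 s3 s4 s5] K by auto
  have "f T = trace (B \<circ> T)" if tc: "trace_class T" for T
  proof -
    obtain a b where T: "nuclear_rep T a b" and sa: "summable (\<lambda>n. (norm (a n))\<^sup>2)" and sb: "summable (\<lambda>n. (norm (b n))\<^sup>2)"
      using tc nuclear_rep_balanced unfolding trace_class_iff by metis
    define R where "R N x = (\<Sum>n. ket_bra (a (n + N)) (b (n + N)) x)" for N x
    have R: "nuclear_rep (R N) (\<lambda>n. a (n + N)) (\<lambda>n. b (n + N))" for N
      unfolding R_def using T
      by (intro nuclear_rep_exists) (simp add: nuclear_rep_def summable_iff_shift[of "\<lambda>n. norm (a n) * norm (b n)"])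
    have R_Suc: "R N = (\<lambda>x. ket_bra (a N) (b N) x + R (Suc N) x)" for N
    proof
      fix x
      have "summable (\<lambda>n. ket_bra (a (n + N)) (b (n + N)) x)"
        using R[of N] by (auto simp: nuclear_rep_def sums_iff)
      from suminf_split_head[OF this] show "R N x = ket_bra (a N) (b N) x + R (Suc N) x" by (simp add: R_def)
    qed
    have tcR: "trace_class (R N)" for N using R unfolding trace_class_iff by blast
    have part: "f (R 0) = (\<Sum>n<N. cinner (b n) (B (a n))) + f (R N)" for N
    proof (induction N)
      case (Suc N)
      have "f (R N) = f (ket_bra (a N) (b N)) + f (R (Suc N))"
        by (subst R_Suc) (rule add[OF trace_class_ket_bra tcR])
      also have "f (ket_bra (a N) (b N)) = cinner (b N) (B (a N))" using B(2) by (simp add: s_def)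
      finally show ?case using Suc by simp
    qed simp
    have "R 0 = T"
      using T by (auto simp: R_def nuclear_rep_def sums_iff fun_eq_iff)
    have "(\<lambda>N. f (R N)) \<longlonglongrightarrow> 0"
    proof (rule Lim_null_comparison)
      show "\<forall>\<^sub>F N in sequentially. norm (f (R N)) \<le>
          2 * K * ((\<Sum>n. (norm (a (n + N)))\<^sup>2) + (\<Sum>n. (norm (b (n + N)))\<^sup>2))"
        using sa sb by (intro always_eventually allI fb R) (simp_all add: summable_iff_shift[of "\<lambda>n. (norm (_ n))\<^sup>2"])
      show "(\<lambda>N. 2 * K * ((\<Sum>n. (norm (a (n + N)))\<^sup>2) + (\<Sum>n. (norm (b (n + N)))\<^sup>2))) \<longlonglongrightarrow> 0"
        using tendsto_mult_left[OF tendsto_add[OF suminf_exist_split2[OF sa] suminf_exist_split2[OF sb]], of "2 * K"]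
        by simp
    qed
    then have "(\<lambda>N. f (R 0) - f (R N)) \<longlonglongrightarrow> f (R 0) - 0" by (intro tendsto_diff tendsto_const)
    then have "(\<lambda>n. cinner (b n) (B (a n))) sums f T"
      using part \<open>R 0 = T\<close> unfolding sums_def by (metis (no_types, lifting) ext add_diff_cancel_right' diff_zero)
    moreover have "(\<lambda>n. cinner (b n) (B (a n))) sums trace (B \<circ> T)"
      by (intro nuclear_rep_trace(2) nuclear_rep_compose B T)
    ultimately show ?thesis by (rule sums_unique2)
  qed
  with B(1) that show thesis by blast
qed

lemma completely_positive_positive:
  assumes cp: "completely_positive \<Phi>" and T: "trace_class T" "positive_op T"
  shows "positive_op (\<Phi> T)"
proof -
  have "block_positive 1 (\<lambda>i j. T)" using T(2) by (simp add: block_positive_def positive_op_def)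
  then have "block_positive 1 (\<lambda>i j. \<Phi> T)"
    using cp T(1) unfolding completely_positive_def by (elim allE[of _ 1] allE[of _ "\<lambda>i j. T"]) auto
  then show ?thesis unfolding block_positive_def positive_op_def
    by (auto dest: spec[of _ "\<lambda>_. x" for x])
qed

text \<open>\<open>dual_map\<close> is a definite description. Existence comes from representing
  \<open>T \<mapsto> trace (A \<circ> \<Phi> T)\<close>, which is bounded on positive operators
  since \<open>\<Phi>\<close> does not increase their trace; uniqueness comes from rank one
  operators.\<close>

lemma
  fixes \<Phi> :: "('h::{complex_hilbert, second_countable_topology} \<Rightarrow> 'h) \<Rightarrow> 'h \<Rightarrow> 'h"
  assumes lin: "superop_linear \<Phi>" and cp: "completely_positive \<Phi>"
    and le: "\<And>T. trace_class T \<Longrightarrow> positive_op T \<Longrightarrow> Re (trace (\<Phi> T)) \<le> Re (trace T)"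
    and A: "bounded_op A"
  shows bounded_op_dual_map: "bounded_op (dual_map \<Phi> A)"
    and trace_dual_map: "trace_class T \<Longrightarrow> trace (A \<circ> \<Phi> T) = trace (dual_map \<Phi> A \<circ> T)"
proof -
  obtain K where K: "K > 0" "\<And>x. norm (A x) \<le> K * norm x" using bounded_op_bound[OF A] by blast
  have tc: "trace_class (\<Phi> T)" if "trace_class T" for T using lin that by (simp add: superop_linear_def)
  have "\<exists>B. bounded_op B \<and> (\<forall>T. trace_class T \<longrightarrow> trace (A \<circ> \<Phi> T) = trace (B \<circ> T))"
  proof (rule trace_functional_representation[of "\<lambda>T. trace (A \<circ> \<Phi> T)" K])
    fix S T :: "'h \<Rightarrow> 'h" assume ST: "trace_class S" "trace_class T"
    have "A \<circ> \<Phi> (\<lambda>x. S x + T x) = (\<lambda>x. (A \<circ> \<Phi> S) x + (A \<circ> \<Phi> T) x)"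
      using lin ST by (auto simp: superop_linear_def fun_eq_iff bounded_op_add[OF A])
    then show "trace (A \<circ> \<Phi> (\<lambda>x. S x + T x)) = trace (A \<circ> \<Phi> S) + trace (A \<circ> \<Phi> T)"
      by (simp only:) (intro trace_add trace_class_compose A tc ST)
  next
    fix c and T :: "'h \<Rightarrow> 'h" assume T: "trace_class T"
    have "A \<circ> \<Phi> (\<lambda>x. c *\<^sub>C T x) = (\<lambda>x. c *\<^sub>C (A \<circ> \<Phi> T) x)"
      using lin T by (auto simp: superop_linear_def fun_eq_iff bounded_op_scaleC[OF A])
    then show "trace (A \<circ> \<Phi> (\<lambda>x. c *\<^sub>C T x)) = c * trace (A \<circ> \<Phi> T)"
      by (simp only:) (intro trace_scaleC trace_class_compose A tc T)
  next
    fix T :: "'h \<Rightarrow> 'h" assume T: "trace_class T" "positive_op T"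
    have "cmod (trace (A \<circ> \<Phi> T)) \<le> K * Re (trace (\<Phi> T))"
      by (intro cmod_trace_compose_le tc T completely_positive_positive[OF cp] A K)
    also have "\<dots> \<le> K * Re (trace T)" using K le[OF T] by simp
    finally show "cmod (trace (A \<circ> \<Phi> T)) \<le> K * Re (trace T)" .
  qed (use K in auto)
  then obtain B where B: "bounded_op B" "\<And>T. trace_class T \<Longrightarrow> trace (A \<circ> \<Phi> T) = trace (B \<circ> T)" by blast
  have "dual_map \<Phi> A = B" unfolding dual_map_def
  proof (rule the_equality)
    show "bounded_op B \<and> (\<forall>T. trace_class T \<longrightarrow> trace (A \<circ> \<Phi> T) = trace (B \<circ> T))" using B by blast
    fix B' assume B': "bounded_op B' \<and> (\<forall>T. trace_class T \<longrightarrow> trace (A \<circ> \<Phi> T) = trace (B' \<circ> T))"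
    have "cinner y (B' x) = cinner y (B x)" for x y
      using B B' trace_class_ket_bra[of x y] trace_compose_ket_bra[of B x y] trace_compose_ket_bra[of B' x y] by metis
    then show "B' = B" using cinner_ext by blast
  qed
  with B show "bounded_op (dual_map \<Phi> A)"
    "trace_class T \<Longrightarrow> trace (A \<circ> \<Phi> T) = trace (dual_map \<Phi> A \<circ> T)" by auto
qed

section \<open>Square-integrable functions\<close>

text \<open>Elements are functions rather than classes; almost everywhere equal ones are identified
  only after passing to \<open>coef\<close>.\<close>

definition L2_fun :: "'x measure \<Rightarrow> ('x \<Rightarrow> complex) set" where
  "L2_fun \<nu> = {f. f \<in> borel_measurable \<nu> \<and> integrable \<nu> (\<lambda>x. (cmod (f x))\<^sup>2)}"

definition L2_inner :: "'x measure \<Rightarrow> ('x \<Rightarrow> complex) \<Rightarrow> ('x \<Rightarrow> complex) \<Rightarrow> complex" where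
  "L2_inner \<nu> f g = (LINT x|\<nu>. cnj (f x) * g x)"

definition L2_normsq :: "'x measure \<Rightarrow> ('x \<Rightarrow> complex) \<Rightarrow> real" where
  "L2_normsq \<nu> f = (LINT x|\<nu>. (cmod (f x))\<^sup>2)"

lemma borel_measurable_cnj [measurable (raw)]:
  "f \<in> borel_measurable M \<Longrightarrow> (\<lambda>x. cnj (f x)) \<in> borel_measurable M"
  by (rule borel_measurable_continuous_on[OF _, of cnj]) (auto intro: continuous_intros)

lemma L2_measurable: "f \<in> L2_fun \<nu> \<Longrightarrow> f \<in> borel_measurable \<nu>"
  and L2_integrable: "f \<in> L2_fun \<nu> \<Longrightarrow> integrable \<nu> (\<lambda>x. (cmod (f x))\<^sup>2)"
  by (auto simp: L2_fun_def)

lemma L2_cinner_integrable: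
  assumes "f \<in> L2_fun \<nu>" "g \<in> L2_fun \<nu>"
  shows "integrable \<nu> (\<lambda>x. cnj (f x) * g x)"
proof (rule Bochner_Integration.integrable_bound)
  show "integrable \<nu> (\<lambda>x. (cmod (f x))\<^sup>2 + (cmod (g x))\<^sup>2)"
    using assms by (intro Bochner_Integration.integrable_add L2_integrable)
  have [measurable]: "f \<in> borel_measurable \<nu>" "g \<in> borel_measurable \<nu>" using assms by (auto intro: L2_measurable)
  show "(\<lambda>x. cnj (f x) * g x) \<in> borel_measurable \<nu>" by measurable
  show "AE x in \<nu>. norm (cnj (f x) * g x) \<le> norm ((cmod (f x))\<^sup>2 + (cmod (g x))\<^sup>2)"
  proof (rule AE_I2)
    fix x
    have "cmod (f x) * cmod (g x) \<le> (cmod (f x))\<^sup>2 + (cmod (g x))\<^sup>2"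
      using sum_squares_bound[of "cmod (f x)" "cmod (g x)"]
        mult_nonneg_nonneg[OF norm_ge_zero norm_ge_zero, of "f x" "g x"] by linarith
    then show "norm (cnj (f x) * g x) \<le> norm ((cmod (f x))\<^sup>2 + (cmod (g x))\<^sup>2)" by (simp add: norm_mult)
  qed
qed

lemma L2_add:
  assumes "f \<in> L2_fun \<nu>" "g \<in> L2_fun \<nu>" shows "(\<lambda>x. f x + g x) \<in> L2_fun \<nu>"
  unfolding L2_fun_def
proof safe
  have [measurable]: "f \<in> borel_measurable \<nu>" "g \<in> borel_measurable \<nu>" using assms by (auto intro: L2_measurable)
  show "(\<lambda>x. f x + g x) \<in> borel_measurable \<nu>" by measurable
  show "integrable \<nu> (\<lambda>x. (cmod (f x + g x))\<^sup>2)"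
  proof (rule Bochner_Integration.integrable_bound)
    show "integrable \<nu> (\<lambda>x. 2 * (cmod (f x))\<^sup>2 + 2 * (cmod (g x))\<^sup>2)"
      using assms by (intro Bochner_Integration.integrable_add integrable_mult_right L2_integrable)
    show "AE x in \<nu>. norm ((cmod (f x + g x))\<^sup>2) \<le> norm (2 * (cmod (f x))\<^sup>2 + 2 * (cmod (g x))\<^sup>2)"
    proof (rule AE_I2)
      fix x
      have "(cmod (f x + g x))\<^sup>2 \<le> (cmod (f x + g x))\<^sup>2 + (cmod (f x - g x))\<^sup>2" by simp
      also have "\<dots> = 2 * (cmod (f x))\<^sup>2 + 2 * (cmod (g x))\<^sup>2" by (rule parallelogram)
      finally show "norm ((cmod (f x + g x))\<^sup>2) \<le> norm (2 * (cmod (f x))\<^sup>2 + 2 * (cmod (g x))\<^sup>2)" by simp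
    qed
  qed measurable
qed

lemma L2_cmult: "f \<in> L2_fun \<nu> \<Longrightarrow> (\<lambda>x. c * f x) \<in> L2_fun \<nu>"
  unfolding L2_fun_def by (auto simp: norm_mult power_mult_distrib)

lemma L2_zero: "(\<lambda>x. 0) \<in> L2_fun \<nu>"
  by (simp add: L2_fun_def)

lemma L2_diff: "f \<in> L2_fun \<nu> \<Longrightarrow> g \<in> L2_fun \<nu> \<Longrightarrow> (\<lambda>x. f x - g x) \<in> L2_fun \<nu>"
  using L2_add[of f \<nu> "\<lambda>x. (-1) * g x"] L2_cmult[of g \<nu> "-1"] by simp

lemma L2_sum: "(\<And>i. i \<in> I \<Longrightarrow> f i \<in> L2_fun \<nu>) \<Longrightarrow> (\<lambda>x. \<Sum>i\<in>I. f i x) \<in> L2_fun \<nu>"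
  by (induction I rule: infinite_finite_induct) (auto intro: L2_zero L2_add)

lemma L2_indicator:
  assumes "f \<in> L2_fun \<nu>" "F \<in> sets \<nu>" shows "(\<lambda>x. indicator F x * f x) \<in> L2_fun \<nu>"
  unfolding L2_fun_def
proof safe
  have [measurable]: "f \<in> borel_measurable \<nu>" "F \<in> sets \<nu>" using assms by (auto intro: L2_measurable)
  show "(\<lambda>x. indicator F x * f x) \<in> borel_measurable \<nu>" by measurable
  show "integrable \<nu> (\<lambda>x. (cmod (indicator F x * f x))\<^sup>2)"
    by (rule Bochner_Integration.integrable_bound[OF L2_integrable[OF assms(1)]])
      (measurable, auto simp: norm_mult indicator_def)
qed

lemma L2_inner_add_right: "f \<in> L2_fun \<nu> \<Longrightarrow> g \<in> L2_fun \<nu> \<Longrightarrow> h \<in> L2_fun \<nu> \<Longrightarrow>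
    L2_inner \<nu> f (\<lambda>x. g x + h x) = L2_inner \<nu> f g + L2_inner \<nu> f h"
  by (simp add: L2_inner_def distrib_left L2_cinner_integrable)

lemma L2_inner_diff_right: "f \<in> L2_fun \<nu> \<Longrightarrow> g \<in> L2_fun \<nu> \<Longrightarrow> h \<in> L2_fun \<nu> \<Longrightarrow>
    L2_inner \<nu> f (\<lambda>x. g x - h x) = L2_inner \<nu> f g - L2_inner \<nu> f h"
  by (simp add: L2_inner_def right_diff_distrib L2_cinner_integrable)

lemma L2_inner_diff_left: "f \<in> L2_fun \<nu> \<Longrightarrow> g \<in> L2_fun \<nu> \<Longrightarrow> h \<in> L2_fun \<nu> \<Longrightarrow>
    L2_inner \<nu> (\<lambda>x. g x - h x) f = L2_inner \<nu> g f - L2_inner \<nu> h f"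
  by (simp add: L2_inner_def left_diff_distrib L2_cinner_integrable)

lemma L2_inner_cmult_right: "L2_inner \<nu> f (\<lambda>x. c * g x) = c * L2_inner \<nu> f g"
  by (simp add: L2_inner_def mult.left_commute)

lemma L2_inner_commute: "L2_inner \<nu> f g = cnj (L2_inner \<nu> g f)"
  unfolding L2_inner_def by (simp add: mult.commute flip: Bochner_Integration.integral_cnj)

lemma L2_inner_sum_right: "f \<in> L2_fun \<nu> \<Longrightarrow> (\<And>i. i \<in> I \<Longrightarrow> g i \<in> L2_fun \<nu>) \<Longrightarrow>
    L2_inner \<nu> f (\<lambda>x. \<Sum>i\<in>I. g i x) = (\<Sum>i\<in>I. L2_inner \<nu> f (g i))"
  by (simp add: L2_inner_def sum_distrib_left L2_cinner_integrable)

lemma L2_inner_self: "L2_inner \<nu> f f = complex_of_real (L2_normsq \<nu> f)"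
  unfolding L2_inner_def L2_normsq_def
  by (simp add: complex_mult_cnj cmod_def mult.commute flip: integral_complex_of_real of_real_power)

lemma L2_normsq_nonneg: "0 \<le> L2_normsq \<nu> f"
  by (simp add: L2_normsq_def)

lemma L2_normsq_diff:
  assumes "f \<in> L2_fun \<nu>" "g \<in> L2_fun \<nu>"
  shows "complex_of_real (L2_normsq \<nu> (\<lambda>x. f x - g x))
    = complex_of_real (L2_normsq \<nu> f) - L2_inner \<nu> f g - L2_inner \<nu> g f + complex_of_real (L2_normsq \<nu> g)"
  using assms
  by (simp add: L2_inner_diff_right L2_inner_diff_left L2_diff flip: L2_inner_self)

lemma L2_normsq_eq_zero_iff:
  assumes "f \<in> L2_fun \<nu>" shows "L2_normsq \<nu> f = 0 \<longleftrightarrow> (AE x in \<nu>. f x = 0)"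
  unfolding L2_normsq_def
  by (subst integral_nonneg_eq_0_iff_AE) (use L2_integrable[OF assms] in auto)

lemma L2_inner_cong_AE:
  assumes "f \<in> L2_fun \<nu>" "g \<in> L2_fun \<nu>" "h \<in> L2_fun \<nu>" "AE x in \<nu>. g x = h x"
  shows "L2_inner \<nu> f g = L2_inner \<nu> f h"
  unfolding L2_inner_def
proof (rule integral_cong_AE)
  have [measurable]: "f \<in> borel_measurable \<nu>" "g \<in> borel_measurable \<nu>" "h \<in> borel_measurable \<nu>"
    using assms by (auto intro: L2_measurable)
  show "(\<lambda>x. cnj (f x) * g x) \<in> borel_measurable \<nu>" "(\<lambda>x. cnj (f x) * h x) \<in> borel_measurable \<nu>"
    by measurable
qed (use assms(4) in auto)

text \<open>The weighted inequality \<open>2 a b \<le> r a^2 + b^2 / r\<close> replaces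
  Cauchy-Schwarz; a small \<open>r\<close> controls the first term as long as the norm of
  \<open>g\<close> is smaller still.\<close>

lemma cmod_L2_inner_le:
  assumes "f \<in> L2_fun \<nu>" "g \<in> L2_fun \<nu>" "0 < r"
  shows "cmod (L2_inner \<nu> f g) \<le> r * L2_normsq \<nu> f + L2_normsq \<nu> g / r"
proof -
  have "cmod (L2_inner \<nu> f g) \<le> (LINT x|\<nu>. cmod (cnj (f x) * g x))"
    unfolding L2_inner_def by (rule integral_norm_bound)
  also have "\<dots> \<le> (LINT x|\<nu>. r * (cmod (f x))\<^sup>2 + (cmod (g x))\<^sup>2 / r)"
  proof (rule integral_mono)
    show "integrable \<nu> (\<lambda>x. cmod (cnj (f x) * g x))"
      using L2_cinner_integrable[OF assms(1,2)] by (rule integrable_norm)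
    show "integrable \<nu> (\<lambda>x. r * (cmod (f x))\<^sup>2 + (cmod (g x))\<^sup>2 / r)"
      using assms by (intro Bochner_Integration.integrable_add integrable_mult_right integrable_divide L2_integrable)
    fix x
    have "2 * (sqrt r * cmod (f x)) * (cmod (g x) / sqrt r) \<le> (sqrt r * cmod (f x))\<^sup>2 + (cmod (g x) / sqrt r)\<^sup>2"
      by (rule sum_squares_bound)
    then have "2 * (cmod (f x) * cmod (g x)) \<le> r * (cmod (f x))\<^sup>2 + (cmod (g x))\<^sup>2 / r"
      using assms(3) by (simp add: power_mult_distrib power_divide)
    moreover have "0 \<le> cmod (f x) * cmod (g x)" by simp
    ultimately show "cmod (cnj (f x) * g x) \<le> r * (cmod (f x))\<^sup>2 + (cmod (g x))\<^sup>2 / r"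
      unfolding norm_mult complex_mod_cnj by linarith
  qed
  also have "\<dots> = r * L2_normsq \<nu> f + L2_normsq \<nu> g / r"
    unfolding L2_normsq_def
    using assms by (simp add: L2_integrable)
  finally show ?thesis .
qed

text \<open>Riesz--Fischer for a finite measure, where square-summability of the increments yields
  absolute summability almost everywhere.\<close>

lemma (in finite_measure) L2_complete:
  assumes f: "\<And>n. f n \<in> L2_fun M"
    and le: "\<And>m n. n \<le> m \<Longrightarrow> L2_normsq M (\<lambda>x. f n x - f m x) \<le> (1/4) ^ n"
  obtains g where "g \<in> L2_fun M" "\<And>n. L2_normsq M (\<lambda>x. f n x - g x) \<le> (1/4) ^ n"
proof -
  have [measurable]: "f n \<in> borel_measurable M" for n using f by (rule L2_measurable)
  have nn: "(\<integral>\<^sup>+x. ennreal ((cmod (h x))\<^sup>2) \<partial>M) = ennreal (L2_normsq M h)" if "h \<in> L2_fun M" for h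
    unfolding L2_normsq_def using L2_integrable[OF that] by (intro nn_integral_eq_integral) auto
  have inc: "(\<integral>\<^sup>+x. ennreal (cmod (f (Suc n) x - f n x)) \<partial>M) \<le> ennreal ((measure M (space M) + 1) * (1/2) ^ n)" for n
  proof -
    have d: "(\<lambda>x. f n x - f (Suc n) x) \<in> L2_fun M" using f by (intro L2_diff)
    have "(\<integral>\<^sup>+x. ennreal (cmod (f (Suc n) x - f n x)) \<partial>M)
        \<le> (\<integral>\<^sup>+x. ennreal ((1/2) ^ n) + ennreal (2 ^ n) * ennreal ((cmod (f n x - f (Suc n) x))\<^sup>2) \<partial>M)"
    proof (rule nn_integral_mono)
      fix x
      define t where "t = cmod (f n x - f (Suc n) x)"
      \<comment> \<open>Turns the bound \<open>(1/4) ^ n\<close> on squares into a summable bound on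
        absolute values: above the threshold \<open>(1/2) ^ n\<close>, the square times
        \<open>2 ^ n\<close> dominates \<open>t\<close>.\<close>
      have "t \<le> (1/2) ^ n + 2 ^ n * t\<^sup>2"
      proof (cases "t \<le> (1/2) ^ n")
        case True then show ?thesis by (simp add: add_increasing2)
      next
        case False
        then have "1 \<le> 2 ^ n * t" by (simp add: power_divide field_simps)
        then have "t \<le> 2 ^ n * t * t" using mult_right_mono[of 1 "2 ^ n * t" t] by (simp add: t_def)
        then show ?thesis by (simp add: power2_eq_square add_increasing mult.assoc)
      qed
      then show "ennreal (cmod (f (Suc n) x - f n x))
          \<le> ennreal ((1/2) ^ n) + ennreal (2 ^ n) * ennreal ((cmod (f n x - f (Suc n) x))\<^sup>2)"
        by (simp add: t_def norm_minus_commute ennreal_leI flip: ennreal_plus ennreal_mult)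
    qed
    also have "\<dots> = ennreal ((1/2) ^ n) * emeasure M (space M) + ennreal (2 ^ n) * ennreal (L2_normsq M (\<lambda>x. f n x - f (Suc n) x))"
      by (subst nn_integral_add) (auto simp: nn_integral_cmult nn[OF d])
    also have "\<dots> \<le> ennreal ((1/2) ^ n) * emeasure M (space M) + ennreal (2 ^ n) * ennreal ((1/4) ^ n)"
      using le[of n "Suc n"] by (intro add_mono mult_left_mono ennreal_leI) auto
    also have "\<dots> = ennreal ((measure M (space M) + 1) * (1/2) ^ n)"
      by (simp add: emeasure_eq_measure algebra_simps flip: ennreal_plus ennreal_mult power_mult_distrib)
    finally show ?thesis .
  qed
  have "(\<integral>\<^sup>+x. (\<Sum>n. ennreal (cmod (f (Suc n) x - f n x))) \<partial>M) = (\<Sum>n. \<integral>\<^sup>+x. ennreal (cmod (f (Suc n) x - f n x)) \<partial>M)"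
    by (rule nn_integral_suminf) measurable
  also have "\<dots> \<le> (\<Sum>n. ennreal ((measure M (space M) + 1) * (1/2) ^ n))"
    by (intro suminf_le inc) auto
  also have "\<dots> = ennreal (\<Sum>n. (measure M (space M) + 1) * (1/2) ^ n)"
    by (intro suminf_ennreal2) (auto intro: summable_mult summable_geometric)
  also have "\<dots> < \<infinity>" by simp
  finally have "(\<integral>\<^sup>+x. (\<Sum>n. ennreal (cmod (f (Suc n) x - f n x))) \<partial>M) \<noteq> \<infinity>" by simp
  then have "AE x in M. (\<Sum>n. ennreal (cmod (f (Suc n) x - f n x))) \<noteq> \<infinity>"
    by (intro nn_integral_PInf_AE) auto
  then have conv: "AE x in M. convergent (\<lambda>n. f n x)"
  proof eventually_elim
    case (elim x)
    then have "summable (\<lambda>n. cmod (f (Suc n) x - f n x))"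
      by (intro summable_suminf_not_top) auto
    then have "summable (\<lambda>n. f (Suc n) x - f n x)" by (rule summable_norm_cancel)
    then have "convergent (\<lambda>n. \<Sum>i<n. f (Suc i) x - f i x)"
      by (simp add: summable_iff_convergent)
    then have "convergent (\<lambda>n. f n x - f 0 x)" by (simp add: sum_lessThan_telescope[of "\<lambda>n. f n x"])
    then have "convergent (\<lambda>n. (f n x - f 0 x) + f 0 x)" by (intro convergent_add convergent_const)
    then show ?case by simp
  qed
  define g where "g x = lim (\<lambda>n. f n x)" for x
  have [measurable]: "g \<in> borel_measurable M"
    unfolding g_def by (rule borel_measurable_lim_metric) simp
  have gap: "(\<integral>\<^sup>+x. ennreal ((cmod (f n x - g x))\<^sup>2) \<partial>M) \<le> ennreal ((1/4) ^ n)" for n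
  proof -
    have "(\<integral>\<^sup>+x. ennreal ((cmod (f n x - g x))\<^sup>2) \<partial>M)
        = (\<integral>\<^sup>+x. liminf (\<lambda>m. ennreal ((cmod (f n x - f m x))\<^sup>2)) \<partial>M)"
    proof (rule nn_integral_cong_AE)
      show "AE x in M. ennreal ((cmod (f n x - g x))\<^sup>2) = liminf (\<lambda>m. ennreal ((cmod (f n x - f m x))\<^sup>2))"
        using conv
      proof eventually_elim
        case (elim x)
        then have "(\<lambda>m. f m x) \<longlonglongrightarrow> g x" by (simp add: g_def convergent_LIMSEQ_iff)
        then have "(\<lambda>m. ennreal ((cmod (f n x - f m x))\<^sup>2)) \<longlonglongrightarrow> ennreal ((cmod (f n x - g x))\<^sup>2)"
          by (intro tendsto_ennrealI tendsto_intros)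
        then show ?case by (intro lim_imp_Liminf[symmetric]) auto
      qed
    qed
    \<comment> \<open>Fatou's lemma: the limit inherits the rate of the sequence.\<close>
    also have "\<dots> \<le> liminf (\<lambda>m. \<integral>\<^sup>+x. ennreal ((cmod (f n x - f m x))\<^sup>2) \<partial>M)"
      by (rule nn_integral_liminf) measurable
    also have "\<dots> \<le> limsup (\<lambda>m. \<integral>\<^sup>+x. ennreal ((cmod (f n x - f m x))\<^sup>2) \<partial>M)"
      by (rule Liminf_le_Limsup) simp
    also have "\<dots> \<le> ennreal ((1/4) ^ n)"
    proof (rule Limsup_bounded)
      show "\<forall>\<^sub>F m in sequentially. (\<integral>\<^sup>+x. ennreal ((cmod (f n x - f m x))\<^sup>2) \<partial>M) \<le> ennreal ((1/4) ^ n)"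
        using le[of n] by (intro eventually_sequentiallyI[of n]) (simp add: nn L2_diff f ennreal_leI)
    qed
    finally show ?thesis .
  qed
  have fg: "(\<lambda>x. f n x - g x) \<in> L2_fun M" for n
    unfolding L2_fun_def using gap[of n]
    by (auto intro!: integrableI_bounded simp: less_top[symmetric] top_unique)
  have "g \<in> L2_fun M" using L2_diff[OF f[of 0] fg[of 0]] by simp
  moreover have "L2_normsq M (\<lambda>x. f n x - g x) \<le> (1/4) ^ n" for n
    using gap[of n] nn[OF fg] by (simp add: ennreal_le_iff)
  ultimately show thesis using that by blast
qed

text \<open>The basis functions themselves serve as indices, so \<open>L\<^sup>2(\<nu>)\<close> is
  carried into \<open>\<ell>\<^sup>2\<close> over the index type prescribed by
  \<open>efficient\<close>. The basis may be uncountable.\<close>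

locale L2_basis = finite_measure \<nu> for \<nu> :: "'x measure" +
  fixes E :: "('x \<Rightarrow> complex) set"
  assumes E_L2: "E \<subseteq> L2_fun \<nu>"
    and E_orthonormal: "\<And>e f. e \<in> E \<Longrightarrow> f \<in> E \<Longrightarrow> L2_inner \<nu> e f = (if e = f then 1 else 0)"
    and E_total: "\<And>f. f \<in> L2_fun \<nu> \<Longrightarrow> (\<And>e. e \<in> E \<Longrightarrow> L2_inner \<nu> e f = 0) \<Longrightarrow> AE x in \<nu>. f x = 0"

text \<open>Zorn's lemma on orthonormal sets ordered by inclusion: a function orthogonal to a
  maximal set and not null could be normalized and adjoined.\<close>

lemma (in finite_measure) L2_basis_exists: "\<exists>E. L2_basis M E"
proof -
  define ON where "ON E \<longleftrightarrow> E \<subseteq> L2_fun M \<and>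
    (\<forall>e\<in>E. \<forall>f\<in>E. L2_inner M e f = (if e = f then 1 else 0))" for E
  have "\<exists>E\<in>{E. ON E}. \<forall>E'\<in>{E. ON E}. E \<subseteq> E' \<longrightarrow> E' = E"
  proof (rule subset_Zorn_nonempty)
    have "ON {}" by (simp add: ON_def)
    then show "{E. ON E} \<noteq> {}" by blast
    fix \<C> assume C: "\<C> \<noteq> {}" "subset.chain {E. ON E} \<C>"
    have "L2_inner M e f = (if e = f then 1 else 0)" if ef: "e \<in> \<Union>\<C>" "f \<in> \<Union>\<C>" for e f
    proof -
      obtain A B where AB: "A \<in> \<C>" "e \<in> A" "B \<in> \<C>" "f \<in> B" using ef by blast
      then have "A \<subseteq> B \<or> B \<subseteq> A" "ON A" "ON B" using C(2) by (auto simp: subset.chain_def)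
      with AB show ?thesis unfolding ON_def by blast
    qed
    moreover have "\<Union>\<C> \<subseteq> L2_fun M" using C(2) by (auto simp: subset.chain_def ON_def)
    ultimately show "\<Union>\<C> \<in> {E. ON E}" by (simp add: ON_def)
  qed
  then obtain E where E: "ON E" "\<And>E'. ON E' \<Longrightarrow> E \<subseteq> E' \<Longrightarrow> E' = E" by blast
  have "AE x in M. f x = 0" if f: "f \<in> L2_fun M" "\<And>e. e \<in> E \<Longrightarrow> L2_inner M e f = 0" for f
  proof (rule ccontr)
    assume "\<not> (AE x in M. f x = 0)"
    then have N: "L2_normsq M f > 0"
      using L2_normsq_eq_zero_iff[OF f(1)] L2_normsq_nonneg[of M f] by simp
    define c where "c = complex_of_real (1 / sqrt (L2_normsq M f))"
    define e0 where "e0 = (\<lambda>x. c * f x)"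
    have e0: "e0 \<in> L2_fun M" unfolding e0_def by (rule L2_cmult[OF f(1)])
    have orth: "L2_inner M e e0 = 0" "L2_inner M e0 e = 0" if "e \<in> E" for e
      using f(2)[OF that] L2_inner_commute[of M e0 e] by (simp_all add: e0_def L2_inner_cmult_right)
    have "L2_inner M e0 e0 = c * cnj c * L2_inner M f f"
      unfolding e0_def L2_inner_cmult_right L2_inner_commute[of M "\<lambda>x. c * f x" f]
      by (subst (2) L2_inner_commute) simp
    also have "\<dots> = 1"
      using N by (simp add: L2_inner_self c_def flip: of_real_mult)
    finally have one: "L2_inner M e0 e0 = 1" .
    have "ON (insert e0 E)"
      using E(1) e0 one orth unfolding ON_def by (auto split: if_splits)
    then have "e0 \<in> E" using E(2)[of "insert e0 E"] by blast
    then show False using orth(1) one by simp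
  qed
  then have "L2_basis M E"
    using E(1) finite_measure_axioms unfolding ON_def
    by (intro L2_basis.intro L2_basis_axioms.intro) auto
  then show ?thesis by blast
qed

context L2_basis
begin

definition coef :: "('x \<Rightarrow> complex) \<Rightarrow> ('x \<Rightarrow> complex, complex) l2" where
  "coef f = Abs_l2 (\<lambda>e. if e \<in> E then L2_inner \<nu> e f else 0)"

text \<open>The image of \<open>coef\<close>, as \<open>coef_surj_aux\<close> shows. It will be the
  space \<open>H0\<close> of the efficient representation.\<close>

definition supported :: "('x \<Rightarrow> complex, complex) l2 set" where
  "supported = {\<eta>. \<forall>e. e \<notin> E \<longrightarrow> Rep_l2 \<eta> e = 0}"

lemma L2_normsq_expansion:
  assumes "finite G" "G \<subseteq> E" and f: "f \<in> L2_fun \<nu>"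
  shows "L2_normsq \<nu> (\<lambda>x. (\<Sum>e\<in>G. L2_inner \<nu> e f * e x) - f x)
    = L2_normsq \<nu> f - (\<Sum>e\<in>G. (cmod (L2_inner \<nu> e f))\<^sup>2)"
proof -
  define p where "p = (\<lambda>x. \<Sum>e\<in>G. L2_inner \<nu> e f * e x)"
  have G: "e \<in> L2_fun \<nu>" if "e \<in> G" for e using that assms(2) E_L2 by blast
  have p: "p \<in> L2_fun \<nu>" unfolding p_def by (intro L2_sum L2_cmult G)
  have s: "L2_inner \<nu> g p = (\<Sum>e\<in>G. L2_inner \<nu> e f * L2_inner \<nu> g e)" if "g \<in> L2_fun \<nu>" for g
    unfolding p_def using that G by (simp add: L2_inner_sum_right L2_cmult L2_inner_cmult_right)
  have fp: "L2_inner \<nu> f p = complex_of_real (\<Sum>e\<in>G. (cmod (L2_inner \<nu> e f))\<^sup>2)"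
    unfolding s[OF f] of_real_sum complex_norm_square by (intro sum.cong refl) (metis L2_inner_commute)
  have ep: "L2_inner \<nu> e p = L2_inner \<nu> e f" if e: "e \<in> G" for e
  proof -
    have "L2_inner \<nu> e p = (\<Sum>e'\<in>G. if e' = e then L2_inner \<nu> e' f else 0)"
      unfolding s[OF G[OF e]] using assms(2) e by (intro sum.cong) (auto simp: E_orthonormal subset_iff)
    then show ?thesis using assms(1) e by simp
  qed
  have "L2_inner \<nu> p p = (\<Sum>e\<in>G. L2_inner \<nu> e f * L2_inner \<nu> p e)" by (rule s[OF p])
  also have "\<dots> = complex_of_real (\<Sum>e\<in>G. (cmod (L2_inner \<nu> e f))\<^sup>2)"
    unfolding of_real_sum complex_norm_square by (intro sum.cong refl) (metis L2_inner_commute ep)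
  finally have pp: "L2_normsq \<nu> p = (\<Sum>e\<in>G. (cmod (L2_inner \<nu> e f))\<^sup>2)"
    unfolding L2_inner_self of_real_eq_iff .
  have pf: "L2_inner \<nu> p f = complex_of_real (\<Sum>e\<in>G. (cmod (L2_inner \<nu> e f))\<^sup>2)"
    using L2_inner_commute[of \<nu> p f] fp by simp
  have "complex_of_real (L2_normsq \<nu> (\<lambda>x. p x - f x))
    = complex_of_real (L2_normsq \<nu> f - (\<Sum>e\<in>G. (cmod (L2_inner \<nu> e f))\<^sup>2))"
    unfolding L2_normsq_diff[OF p f] fp pf pp by simp
  then show ?thesis unfolding of_real_eq_iff p_def .
qed

lemma Rep_coef:
  assumes "f \<in> L2_fun \<nu>" shows "Rep_l2 (coef f) e = (if e \<in> E then L2_inner \<nu> e f else 0)"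
proof -
  have "(\<lambda>e. (cmod (L2_inner \<nu> e f))\<^sup>2) summable_on E"
  proof (rule nonneg_bdd_above_summable_on)
    show "bdd_above (sum (\<lambda>e. (cmod (L2_inner \<nu> e f))\<^sup>2) ` {F. F \<subseteq> E \<and> finite F})"
    proof (rule bdd_aboveI2)
      fix G assume "G \<in> {F. F \<subseteq> E \<and> finite F}"
      then show "(\<Sum>e\<in>G. (cmod (L2_inner \<nu> e f))\<^sup>2) \<le> L2_normsq \<nu> f"
        using L2_normsq_expansion[of G f] assms
          L2_normsq_nonneg[of \<nu> "\<lambda>x. (\<Sum>e\<in>G. L2_inner \<nu> e f * e x) - f x"] by auto
    qed
  qed simp
  then have "(\<lambda>e. (norm (if e \<in> E then L2_inner \<nu> e f else 0))\<^sup>2) summable_on UNIV"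
    by (rule summable_on_cong_neutral[THEN iffD1, rotated -1]) auto
  then show ?thesis by (simp add: coef_def Rep_Abs_l2)
qed

lemma coef_supported: "f \<in> L2_fun \<nu> \<Longrightarrow> coef f \<in> supported"
  by (simp add: supported_def Rep_coef)

lemma coef_add: "f \<in> L2_fun \<nu> \<Longrightarrow> g \<in> L2_fun \<nu> \<Longrightarrow> coef (\<lambda>x. f x + g x) = coef f + coef g"
  using E_L2 by (intro l2_eqI) (auto simp: Rep_coef L2_add plus_l2.rep_eq L2_inner_add_right)

lemma coef_cmult: "f \<in> L2_fun \<nu> \<Longrightarrow> coef (\<lambda>x. c * f x) = c *\<^sub>C coef f"
  by (intro l2_eqI) (auto simp: Rep_coef L2_cmult scaleC_l2.rep_eq L2_inner_cmult_right scaleC_complex_def)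

lemma coef_cong_AE: "f \<in> L2_fun \<nu> \<Longrightarrow> g \<in> L2_fun \<nu> \<Longrightarrow> (AE x in \<nu>. f x = g x) \<Longrightarrow> coef f = coef g"
  using E_L2 by (intro l2_eqI) (auto simp: Rep_coef intro: L2_inner_cong_AE)

lemma coef_eq_AE:
  assumes f: "f \<in> L2_fun \<nu>" and g: "g \<in> L2_fun \<nu>" and eq: "coef f = coef g"
  shows "AE x in \<nu>. f x = g x"
proof -
  have "L2_inner \<nu> e (\<lambda>x. f x - g x) = 0" if "e \<in> E" for e
  proof -
    have "L2_inner \<nu> e f = L2_inner \<nu> e g"
      using arg_cong[OF eq, of "\<lambda>\<eta>. Rep_l2 \<eta> e"] that by (simp add: Rep_coef f g)
    then show ?thesis using that E_L2 f g by (subst L2_inner_diff_right) auto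
  qed
  then have "AE x in \<nu>. f x - g x = 0" by (intro E_total L2_diff f g)
  then show ?thesis by simp
qed

text \<open>Riesz-Fischer. The finite sets \<open>G n\<close> increase and miss at most
  \<open>(1/4) ^ n / 2\<close> of the square sum, so the partial sums \<open>f n\<close> satisfy the
  rate demanded by \<open>L2_complete\<close>.\<close>

lemma coef_surj_aux:
  assumes \<eta>: "\<eta> \<in> supported"
  obtains g where "g \<in> L2_fun \<nu>" "coef g = \<eta>" "L2_normsq \<nu> g = (norm \<eta>)\<^sup>2"
proof -
  have hs: "((\<lambda>e. (cmod (Rep_l2 \<eta> e))\<^sup>2) has_sum (norm \<eta>)\<^sup>2) UNIV" by (rule has_sum_norm_l2)
  define \<sigma> where "\<sigma> G = (\<Sum>e\<in>G. (cmod (Rep_l2 \<eta> e))\<^sup>2)" for G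
  have ex: "\<exists>G. finite G \<and> (norm \<eta>)\<^sup>2 - \<sigma> G \<le> (1/4) ^ n / 2" for n :: nat
  proof -
    obtain G where "finite G" "dist (\<sigma> G) ((norm \<eta>)\<^sup>2) \<le> (1/4) ^ n / 2"
      using has_sum_finite_approximation[OF hs, of "(1/4) ^ n / 2"] by (auto simp: \<sigma>_def)
    then show ?thesis unfolding dist_real_def by (intro exI[of _ G] conjI) linarith+
  qed
  then obtain G0 where G0: "\<And>n. finite (G0 n)" "\<And>n::nat. (norm \<eta>)\<^sup>2 - \<sigma> (G0 n) \<le> (1/4) ^ n / 2" by metis
  define G where "G n = (\<Union>k\<le>n. G0 k) \<inter> E" for n
  have G: "finite (G n)" "G n \<subseteq> E" "mono G" for n using G0(1) by (auto simp: G_def mono_def intro: order_trans)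
  have \<sigma>E: "\<sigma> (A \<inter> E) = \<sigma> A" if "finite A" for A
    unfolding \<sigma>_def using \<eta> that by (intro sum.mono_neutral_left) (auto simp: supported_def)
  have \<sigma>_le: "\<sigma> A \<le> (norm \<eta>)\<^sup>2" if "finite A" for A
    unfolding \<sigma>_def using that by (rule sum_norm_l2_le)
  have tail: "(norm \<eta>)\<^sup>2 - \<sigma> (G n) \<le> (1/4) ^ n / 2" for n
  proof -
    have "\<sigma> (G0 n) \<le> \<sigma> (\<Union>k\<le>n. G0 k)" unfolding \<sigma>_def using G0(1) by (intro sum_mono2) auto
    also have "\<dots> = \<sigma> (G n)" using \<sigma>E[of "\<Union>k\<le>n. G0 k"] G0(1) by (simp add: G_def)
    finally show ?thesis using G0(2)[of n] by simp
  qed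
  define f where "f n = (\<lambda>x. \<Sum>e\<in>G n. Rep_l2 \<eta> e * e x)" for n
  have GL2: "e \<in> L2_fun \<nu>" if "e \<in> G n" for e n using that G(2)[of n] E_L2 by blast
  have f: "f n \<in> L2_fun \<nu>" for n unfolding f_def by (intro L2_sum L2_cmult GL2)
  have inner_f: "L2_inner \<nu> e (f n) = (if e \<in> G n then Rep_l2 \<eta> e else 0)" if e: "e \<in> E" for e n
  proof -
    have "L2_inner \<nu> e (f n) = (\<Sum>e'\<in>G n. Rep_l2 \<eta> e' * L2_inner \<nu> e e')"
      unfolding f_def using e E_L2 GL2 by (subst L2_inner_sum_right) (auto simp: L2_cmult L2_inner_cmult_right)
    also have "\<dots> = (\<Sum>e'\<in>G n. if e' = e then Rep_l2 \<eta> e' else 0)"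
      using e G(2)[of n] by (intro sum.cong) (auto simp: E_orthonormal subset_iff)
    finally show ?thesis using G(1)[of n] by simp
  qed
  have normf: "L2_normsq \<nu> (\<lambda>x. f n x - h x) = L2_normsq \<nu> h - \<sigma> (G n)"
    if "h \<in> L2_fun \<nu>" "\<And>e. e \<in> G n \<Longrightarrow> L2_inner \<nu> e h = Rep_l2 \<eta> e" for h n
    using L2_normsq_expansion[OF G(1,2) that(1), of n] that(2) by (simp add: f_def \<sigma>_def cong: sum.cong)
  have "L2_normsq \<nu> (\<lambda>x. f n x - f m x) \<le> (1/4) ^ n" if "n \<le> m" for n m
  proof -
    have sub: "G n \<subseteq> G m" using that G(3) by (simp add: mono_def)
    have "L2_normsq \<nu> (f m) = \<sigma> (G m)"
      using normf[of "f m" m] f G(2)[of m] inner_f by (auto simp: L2_normsq_def subset_iff)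
    moreover have "L2_normsq \<nu> (\<lambda>x. f n x - f m x) = L2_normsq \<nu> (f m) - \<sigma> (G n)"
      using f G(2)[of m] sub inner_f by (intro normf) (auto simp: subset_iff)
    moreover have "0 \<le> (1/4::real) ^ n" by simp
    ultimately show ?thesis using tail[of n] \<sigma>_le[OF G(1), of m] by linarith
  qed
  from L2_complete[of f, OF f this] obtain g
    where g: "g \<in> L2_fun \<nu>" "\<And>n. L2_normsq \<nu> (\<lambda>x. f n x - g x) \<le> (1/4) ^ n" by blast
  have inner_g: "L2_inner \<nu> e g = Rep_l2 \<eta> e" if e: "e \<in> E" for e
  proof -
    have eL: "e \<in> L2_fun \<nu>" using e E_L2 by blast
    have "(\<lambda>n. L2_inner \<nu> e (\<lambda>x. f n x - g x)) \<longlonglongrightarrow> 0"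
    proof (rule Lim_null_comparison)
      show "\<forall>\<^sub>F n in sequentially. norm (L2_inner \<nu> e (\<lambda>x. f n x - g x)) \<le> (1/2) ^ n * L2_normsq \<nu> e + (1/2) ^ n"
      proof (intro always_eventually allI)
        fix n
        have "norm (L2_inner \<nu> e (\<lambda>x. f n x - g x))
            \<le> (1/2) ^ n * L2_normsq \<nu> e + L2_normsq \<nu> (\<lambda>x. f n x - g x) / (1/2) ^ n"
          by (intro cmod_L2_inner_le eL L2_diff f g) simp
        also have "\<dots> \<le> (1/2) ^ n * L2_normsq \<nu> e + (1/4) ^ n / (1/2) ^ n"
          using g(2)[of n] by (intro add_left_mono divide_right_mono) auto
        also have "(1/4) ^ n / (1/2) ^ n = ((1/2) ^ n :: real)" by (simp flip: power_divide)
        finally show "norm (L2_inner \<nu> e (\<lambda>x. f n x - g x)) \<le> (1/2) ^ n * L2_normsq \<nu> e + (1/2) ^ n" .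
      qed
      have "(\<lambda>n. (1/2) ^ n * L2_normsq \<nu> e + (1/2) ^ n) \<longlonglongrightarrow> 0 * L2_normsq \<nu> e + 0"
        by (intro tendsto_intros LIMSEQ_power_zero) auto
      then show "(\<lambda>n. (1/2) ^ n * L2_normsq \<nu> e + (1/2) ^ n) \<longlonglongrightarrow> 0" by simp
    qed
    then have "(\<lambda>n. (if e \<in> G n then Rep_l2 \<eta> e else 0) - L2_inner \<nu> e g) \<longlonglongrightarrow> 0"
      using eL f g by (simp add: L2_inner_diff_right inner_f e)
    then have 1: "(\<lambda>n. if e \<in> G n then Rep_l2 \<eta> e else 0) \<longlonglongrightarrow> L2_inner \<nu> e g"
      by (rule LIM_zero_cancel)
    have 2: "(\<lambda>n. if e \<in> G n then Rep_l2 \<eta> e else 0) \<longlonglongrightarrow> Rep_l2 \<eta> e"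
    proof (cases "\<exists>N. e \<in> G N")
      case True
      then obtain N where "e \<in> G N" by blast
      then have "e \<in> G n" if "n \<ge> N" for n using that G(3) by (auto simp: mono_def)
      then show ?thesis by (intro tendsto_eventually eventually_sequentiallyI[of N]) simp
    next
      \<comment> \<open>An index in no \<open>G n\<close> could be added to each of them without
        exceeding the total square sum, so its coefficient is bounded by every tail and
        vanishes.\<close>
      case False
      have "(cmod (Rep_l2 \<eta> e))\<^sup>2 \<le> (1/4) ^ n / 2" for n :: nat
      proof -
        have "\<sigma> (insert e (G n)) = (cmod (Rep_l2 \<eta> e))\<^sup>2 + \<sigma> (G n)" using False G(1)[of n] by (simp add: \<sigma>_def)
        then show ?thesis using tail[of n] \<sigma>_le[of "insert e (G n)"] G(1)[of n] by simp
      qed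
      then have "(cmod (Rep_l2 \<eta> e))\<^sup>2 \<le> 0"
        by (intro LIMSEQ_le_const[of "\<lambda>n. (1/4) ^ n / (2::real)"]) (auto intro!: tendsto_eq_intros LIMSEQ_power_zero)
      then show ?thesis by (simp cong: if_cong)
    qed
    from 1 2 show ?thesis by (rule LIMSEQ_unique)
  qed
  have "coef g = \<eta>"
    using \<eta> by (intro l2_eqI) (auto simp: Rep_coef g inner_g supported_def)
  moreover have "L2_normsq \<nu> g = (norm \<eta>)\<^sup>2"
  proof -
    have eq: "L2_normsq \<nu> (\<lambda>x. f n x - g x) = L2_normsq \<nu> g - \<sigma> (G n)" for n
      using G(2)[of n] inner_g by (intro normf g) auto
    have le: "\<bar>L2_normsq \<nu> g - (norm \<eta>)\<^sup>2\<bar> \<le> 2 * (1/4) ^ n" for n :: nat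
    proof -
      have "0 \<le> (1/4::real) ^ n" by simp
      then show ?thesis
        using L2_normsq_nonneg[of \<nu> "\<lambda>x. f n x - g x"] g(2)[of n] tail[of n] \<sigma>_le[OF G(1), of n]
        unfolding eq abs_le_iff by linarith
    qed
    have "(\<lambda>n. 2 * (1/4::real) ^ n) \<longlonglongrightarrow> 2 * 0" by (intro tendsto_mult tendsto_const LIMSEQ_power_zero) auto
    then have "\<bar>L2_normsq \<nu> g - (norm \<eta>)\<^sup>2\<bar> \<le> 2 * 0" 
      by (rule LIMSEQ_le_const) (use le in blast)
    then show ?thesis by simp
  qed
  ultimately show thesis using that g(1) by blast
qed

text \<open>\<open>coef_surj_aux\<close> gives some function with the same coefficients and the
  right norm; by totality it agrees with \<open>f\<close> almost everywhere.\<close>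

lemma norm_coef: "f \<in> L2_fun \<nu> \<Longrightarrow> (norm (coef f))\<^sup>2 = L2_normsq \<nu> f"
proof -
  assume f: "f \<in> L2_fun \<nu>"
  obtain g where g: "g \<in> L2_fun \<nu>" "coef g = coef f" "L2_normsq \<nu> g = (norm (coef f))\<^sup>2"
    using coef_surj_aux[OF coef_supported[OF f]] by blast
  have "AE x in \<nu>. g x = f x" by (rule coef_eq_AE[OF g(1) f g(2)])
  then have "L2_inner \<nu> f f = L2_inner \<nu> g g"
    by (metis (mono_tags, lifting) L2_inner_commute L2_inner_cong_AE f g(1))
  then have "L2_normsq \<nu> f = L2_normsq \<nu> g" unfolding L2_inner_self of_real_eq_iff .
  then show ?thesis using g(3) by simp
qed

lemma cinner_coef:
  assumes f: "f \<in> L2_fun \<nu>" and g: "g \<in> L2_fun \<nu>"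
  shows "cinner (coef f) (coef g) = L2_inner \<nu> f g"
proof -
  have fg: "(\<lambda>x. f x + c * g x) \<in> L2_fun \<nu>" for c by (intro L2_add L2_cmult f g)
  have n: "cinner (coef f + c *\<^sub>C coef g) (coef f + c *\<^sub>C coef g) = (LINT x|\<nu>. complex_of_real ((cmod (f x + c * g x))\<^sup>2))" for c
  proof -
    have "coef f + c *\<^sub>C coef g = coef (\<lambda>x. f x + c * g x)" by (simp add: coef_add coef_cmult L2_cmult f g)
    then show ?thesis
      by (simp only: cinner_self norm_coef[OF fg] L2_normsq_def integral_complex_of_real)
  qed
  have i: "integrable \<nu> (\<lambda>x. complex_of_real ((cmod (f x + c * g x))\<^sup>2))" for c
    using L2_integrable[OF fg] by (simp only: complex_of_real_integrable_eq)
  have int4: "(LINT x|\<nu>. (a x - b x - \<i> * c x + \<i> * d x) / 4)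
      = ((LINT x|\<nu>. a x) - (LINT x|\<nu>. b x) - \<i> * (LINT x|\<nu>. c x) + \<i> * (LINT x|\<nu>. d x)) / 4"
    if "integrable \<nu> a" "integrable \<nu> b" "integrable \<nu> c" "integrable \<nu> d" for a b c d :: "'x \<Rightarrow> complex"
    using that by simp
  have pt: "cnj a * b = (complex_of_real ((cmod (a + 1 * b))\<^sup>2) - complex_of_real ((cmod (a + (-1) * b))\<^sup>2)
      - \<i> * complex_of_real ((cmod (a + \<i> * b))\<^sup>2) + \<i> * complex_of_real ((cmod (a + (- \<i>) * b))\<^sup>2)) / 4" for a b
    unfolding complex_norm_square by (simp add: algebra_simps)
  have "L2_inner \<nu> f g = (LINT x|\<nu>. (complex_of_real ((cmod (f x + 1 * g x))\<^sup>2) - complex_of_real ((cmod (f x + (-1) * g x))\<^sup>2)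
      - \<i> * complex_of_real ((cmod (f x + \<i> * g x))\<^sup>2) + \<i> * complex_of_real ((cmod (f x + (- \<i>) * g x))\<^sup>2)) / 4)"
    unfolding L2_inner_def by (intro Bochner_Integration.integral_cong refl pt)
  also have "\<dots> = ((LINT x|\<nu>. complex_of_real ((cmod (f x + 1 * g x))\<^sup>2)) - (LINT x|\<nu>. complex_of_real ((cmod (f x + (-1) * g x))\<^sup>2))
      - \<i> * (LINT x|\<nu>. complex_of_real ((cmod (f x + \<i> * g x))\<^sup>2)) + \<i> * (LINT x|\<nu>. complex_of_real ((cmod (f x + (- \<i>) * g x))\<^sup>2))) / 4"
    by (rule int4) (rule i)+
  also have "\<dots> = cinner (coef f) (coef g)"
    unfolding n[symmetric] cinner_op_polarization[OF bounded_op_id, of "coef f" "coef g"] by simp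
  finally show ?thesis by simp
qed

text \<open>The orthogonal projection onto \<open>supported\<close>. Through it, operators on
  \<open>L\<^sup>2(\<nu>)\<close> become total operators vanishing on the complement, the convention
  of \<open>spectral_measure\<close>.\<close>

definition restr :: "('x \<Rightarrow> complex, complex) l2 \<Rightarrow> ('x \<Rightarrow> complex, complex) l2" where
  "restr \<eta> = Abs_l2 (\<lambda>e. if e \<in> E then Rep_l2 \<eta> e else 0)"

lemma Rep_restr: "Rep_l2 (restr \<eta>) e = (if e \<in> E then Rep_l2 \<eta> e else 0)"
proof -
  have "(\<lambda>e. (norm (if e \<in> E then Rep_l2 \<eta> e else 0))\<^sup>2) summable_on UNIV"
    by (rule summable_l2_comparison[OF summable_Rep_l2[of \<eta>], of _ 1]) auto
  then show ?thesis by (simp add: restr_def Rep_Abs_l2)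
qed

lemma restr_supported: "restr \<eta> \<in> supported"
  by (simp add: supported_def Rep_restr)

lemma restr_id: "\<eta> \<in> supported \<Longrightarrow> restr \<eta> = \<eta>"
  by (intro l2_eqI) (auto simp: supported_def Rep_restr)

lemma restr_add: "restr (\<eta> + \<zeta>) = restr \<eta> + restr \<zeta>"
  by (intro l2_eqI) (simp add: Rep_restr plus_l2.rep_eq)

lemma restr_scaleC: "restr (c *\<^sub>C \<eta>) = c *\<^sub>C restr \<eta>"
  by (intro l2_eqI) (simp add: Rep_restr scaleC_l2.rep_eq)

lemma cinner_restr: "cinner (restr \<eta>) \<zeta> = cinner \<eta> (restr \<zeta>)"
  unfolding cinner_l2.rep_eq by (intro infsum_cong) (simp add: Rep_restr)

lemma norm_restr_le: "norm (restr \<eta>) \<le> norm \<eta>"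
proof (rule norm_l2_leI)
  fix I :: "('x \<Rightarrow> complex) set" assume I: "finite I"
  have "(\<Sum>i\<in>I. (norm (Rep_l2 (restr \<eta>) i))\<^sup>2) \<le> (\<Sum>i\<in>I. (norm (Rep_l2 \<eta> i))\<^sup>2)"
    by (intro sum_mono) (simp add: Rep_restr)
  then show "(\<Sum>i\<in>I. (norm (Rep_l2 (restr \<eta>) i))\<^sup>2) \<le> (norm \<eta>)\<^sup>2"
    using sum_norm_l2_le[OF I, of \<eta>] by linarith
qed simp

text \<open>A chosen representative. By \<open>mult_proj_eq\<close> any other function with the same
  coefficients gives the same \<open>mult_proj\<close>, so linearity survives the choice.\<close>

definition lift_L2 :: "('x \<Rightarrow> complex, complex) l2 \<Rightarrow> 'x \<Rightarrow> complex" where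
  "lift_L2 \<eta> = (SOME g. g \<in> L2_fun \<nu> \<and> coef g = restr \<eta>)"

lemma lift_L2: "lift_L2 \<eta> \<in> L2_fun \<nu>" "coef (lift_L2 \<eta>) = restr \<eta>"
proof -
  have "\<exists>g. g \<in> L2_fun \<nu> \<and> coef g = restr \<eta>" using coef_surj_aux[OF restr_supported] by metis
  then have "lift_L2 \<eta> \<in> L2_fun \<nu> \<and> coef (lift_L2 \<eta>) = restr \<eta>" unfolding lift_L2_def by (rule someI_ex)
  then show "lift_L2 \<eta> \<in> L2_fun \<nu>" "coef (lift_L2 \<eta>) = restr \<eta>" by auto
qed

definition mult_proj :: "'x set \<Rightarrow> ('x \<Rightarrow> complex, complex) l2 \<Rightarrow> ('x \<Rightarrow> complex, complex) l2" where
  "mult_proj F \<eta> = coef (\<lambda>x. indicator F x * lift_L2 \<eta> x)"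

lemma mult_proj_eq:
  assumes F: "F \<in> sets \<nu>" and f: "f \<in> L2_fun \<nu>" "coef f = restr \<eta>"
  shows "mult_proj F \<eta> = coef (\<lambda>x. indicator F x * f x)"
proof -
  have "AE x in \<nu>. lift_L2 \<eta> x = f x" by (rule coef_eq_AE[OF lift_L2(1) f(1)]) (simp add: lift_L2(2) f(2))
  then show ?thesis unfolding mult_proj_def by (intro coef_cong_AE L2_indicator lift_L2(1) f(1) F) auto
qed

lemma mult_proj_coef:
  "F \<in> sets \<nu> \<Longrightarrow> f \<in> L2_fun \<nu> \<Longrightarrow> mult_proj F (coef f) = coef (\<lambda>x. indicator F x * f x)"
  by (rule mult_proj_eq) (auto simp: restr_id coef_supported)

lemma mult_proj_supported: "F \<in> sets \<nu> \<Longrightarrow> mult_proj F \<eta> \<in> supported"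
  unfolding mult_proj_def by (intro coef_supported L2_indicator lift_L2(1))

lemma norm_mult_proj:
  assumes F: "F \<in> sets \<nu>"
  shows "(norm (mult_proj F \<eta>))\<^sup>2 = (LINT x|\<nu>. indicator F x * (cmod (lift_L2 \<eta> x))\<^sup>2)"
proof -
  have "(norm (mult_proj F \<eta>))\<^sup>2 = L2_normsq \<nu> (\<lambda>x. indicator F x * lift_L2 \<eta> x)"
    unfolding mult_proj_def by (intro norm_coef L2_indicator lift_L2(1) F)
  also have "\<dots> = (LINT x|\<nu>. indicator F x * (cmod (lift_L2 \<eta> x))\<^sup>2)"
    unfolding L2_normsq_def by (intro Bochner_Integration.integral_cong) (auto simp: indicator_def)
  finally show ?thesis .
qed

lemma bounded_op_mult_proj:
  assumes F: "F \<in> sets \<nu>" shows "bounded_op (mult_proj F)"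
proof (rule bounded_opI[where K = 1])
  fix \<eta> \<zeta> :: "('x \<Rightarrow> complex, complex) l2"
  have "mult_proj F (\<eta> + \<zeta>) = coef (\<lambda>x. indicator F x * (lift_L2 \<eta> x + lift_L2 \<zeta> x))"
    by (rule mult_proj_eq[OF F]) (auto intro: L2_add lift_L2(1) simp: coef_add lift_L2 restr_add)
  also have "\<dots> = mult_proj F \<eta> + mult_proj F \<zeta>"
    unfolding mult_proj_def distrib_left by (intro coef_add L2_indicator lift_L2(1) F)
  finally show "mult_proj F (\<eta> + \<zeta>) = mult_proj F \<eta> + mult_proj F \<zeta>" .
next
  fix c and \<eta> :: "('x \<Rightarrow> complex, complex) l2"
  have "mult_proj F (c *\<^sub>C \<eta>) = coef (\<lambda>x. indicator F x * (c * lift_L2 \<eta> x))"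
    by (rule mult_proj_eq[OF F]) (auto intro: L2_cmult lift_L2(1) simp: coef_cmult lift_L2 restr_scaleC)
  also have "\<dots> = c *\<^sub>C mult_proj F \<eta>"
    unfolding mult_proj_def mult.left_commute[of _ c] by (intro coef_cmult L2_indicator lift_L2(1) F)
  finally show "mult_proj F (c *\<^sub>C \<eta>) = c *\<^sub>C mult_proj F \<eta>" .
next
  fix \<eta> :: "('x \<Rightarrow> complex, complex) l2"
  have "(norm (mult_proj F \<eta>))\<^sup>2 \<le> (norm (restr \<eta>))\<^sup>2"
    unfolding norm_mult_proj[OF F] lift_L2(2)[symmetric] norm_coef[OF lift_L2(1)] L2_normsq_def
  proof (rule integral_mono)
    have [measurable]: "lift_L2 \<eta> \<in> borel_measurable \<nu>" "F \<in> sets \<nu>" using F by (auto intro: L2_measurable lift_L2)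
    show "integrable \<nu> (\<lambda>x. indicator F x * (cmod (lift_L2 \<eta> x))\<^sup>2)"
      using L2_integrable[OF lift_L2(1)] by (rule Bochner_Integration.integrable_bound) (auto simp: indicator_def)
  qed (auto simp: indicator_def L2_integrable lift_L2(1))
  then have "norm (mult_proj F \<eta>) \<le> norm (restr \<eta>)" by (rule power2_le_imp_le) simp
  then show "norm (mult_proj F \<eta>) \<le> 1 * norm \<eta>" using norm_restr_le[of \<eta>] by simp
qed

lemma cinner_mult_proj_selfadjoint:
  assumes F: "F \<in> sets \<nu>" shows "cinner (mult_proj F \<eta>) \<zeta> = cinner \<eta> (mult_proj F \<zeta>)"
proof -
  have "cinner (mult_proj F \<eta>) \<zeta> = cinner (mult_proj F \<eta>) (coef (lift_L2 \<zeta>))"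
    using cinner_restr[of "mult_proj F \<eta>" \<zeta>] by (simp add: lift_L2 restr_id mult_proj_supported F)
  also have "\<dots> = cinner (coef (lift_L2 \<eta>)) (mult_proj F \<zeta>)"
    unfolding mult_proj_def
    by (simp add: cinner_coef L2_indicator lift_L2(1) F L2_inner_def) (intro Bochner_Integration.integral_cong, auto simp: indicator_def)
  also have "\<dots> = cinner \<eta> (mult_proj F \<zeta>)"
    by (simp add: lift_L2 cinner_restr restr_id mult_proj_supported F)
  finally show ?thesis .
qed

lemma projection_op_mult_proj:
  assumes F: "F \<in> sets \<nu>" shows "projection_op (mult_proj F)"
proof -
  have "mult_proj F (mult_proj F \<eta>) = mult_proj F \<eta>" for \<eta>
  proof -
    have "mult_proj F (mult_proj F \<eta>) = coef (\<lambda>x. indicator F x * (indicator F x * lift_L2 \<eta> x))"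
      unfolding mult_proj_def[of F \<eta>] by (intro mult_proj_coef L2_indicator lift_L2(1) F)
    also have "\<dots> = mult_proj F \<eta>"
      unfolding mult_proj_def by (rule arg_cong[where f = coef]) (auto simp: indicator_def)
    finally show ?thesis .
  qed
  then show ?thesis
    using bounded_op_mult_proj[OF F] cinner_mult_proj_selfadjoint[OF F]
    by (auto simp: projection_op_def fun_eq_iff)
qed

lemma mult_proj_space: "mult_proj (space \<nu>) \<eta> = restr \<eta>"
  unfolding mult_proj_def lift_L2(2)[symmetric]
  by (intro coef_cong_AE L2_indicator lift_L2(1)) auto

lemma mult_proj_union:
  assumes "A \<in> sets \<nu>" "B \<in> sets \<nu>" "A \<inter> B = {}"
  shows "mult_proj (A \<union> B) \<eta> = mult_proj A \<eta> + mult_proj B \<eta>"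
proof -
  have "mult_proj A \<eta> + mult_proj B \<eta> = coef (\<lambda>x. indicator A x * lift_L2 \<eta> x + indicator B x * lift_L2 \<eta> x)"
    unfolding mult_proj_def by (intro coef_add[symmetric] L2_indicator lift_L2(1) assms)
  also have "\<dots> = mult_proj (A \<union> B) \<eta>"
    unfolding mult_proj_def using assms(3) by (intro arg_cong[where f = coef] ext) (auto simp: indicator_def)
  finally show ?thesis by simp
qed

text \<open>The remainder after \<open>N\<close> terms is the projection of the tail union
  \<open>R N\<close>. Tail unions of disjoint sets shrink to the empty set, so dominated convergence
  sends its norm to \<open>0\<close>.\<close>

lemma mult_proj_sums:
  assumes F: "disjoint_family F" "range F \<subseteq> sets \<nu>"
  shows "(\<lambda>n::nat. mult_proj (F n) \<eta>) sums mult_proj (\<Union>n. F n) \<eta>"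
proof -
  define R where "R N = (\<Union>n\<in>{N..}. F n)" for N
  have [measurable]: "F n \<in> sets \<nu>" "R n \<in> sets \<nu>" "lift_L2 \<eta> \<in> borel_measurable \<nu>" for n
    using F(2) by (auto simp: R_def intro!: sets.countable_UN'' L2_measurable lift_L2)
  have part: "mult_proj (\<Union>n. F n) \<eta> = (\<Sum>n<N. mult_proj (F n) \<eta>) + mult_proj (R N) \<eta>" for N
  proof (induction N)
    case 0 then show ?case by (simp add: R_def)
  next
    case (Suc N)
    have "R N = F N \<union> R (Suc N)"
      unfolding R_def using atLeast_Suc_greaterThan ivl_disj_un_singleton(1)[of N] by (metis UN_insert insert_is_Un)
    moreover have "F N \<inter> R (Suc N) = {}"
    proof -
      have "F N \<inter> F n = {}" if "Suc N \<le> n" for n using F(1) that by (simp add: disjoint_family_on_def)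
      then show ?thesis by (auto simp: R_def)
    qed
    ultimately have "mult_proj (R N) \<eta> = mult_proj (F N) \<eta> + mult_proj (R (Suc N)) \<eta>"
      by (simp add: mult_proj_union)
    with Suc show ?case by simp
  qed
  have "(\<lambda>N. LINT x|\<nu>. indicator (R N) x * (cmod (lift_L2 \<eta> x))\<^sup>2) \<longlonglongrightarrow> (LINT x|\<nu>. 0)"
  proof (rule integral_dominated_convergence[where w = "\<lambda>x. (cmod (lift_L2 \<eta> x))\<^sup>2"])
    show "AE x in \<nu>. (\<lambda>N. indicator (R N) x * (cmod (lift_L2 \<eta> x))\<^sup>2) \<longlonglongrightarrow> 0"
    proof (rule AE_I2)
      fix x
      have "\<exists>N. \<forall>n\<ge>N. x \<notin> R n"
      proof (cases "\<exists>m. x \<in> F m")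
        case True
        then obtain m where m: "x \<in> F m" by blast
        have "x \<notin> R n" if "n \<ge> Suc m" for n
        proof -
          have "F m \<inter> F k = {}" if "n \<le> k" for k
            using F(1) that \<open>n \<ge> Suc m\<close> by (simp add: disjoint_family_on_def)
          then show ?thesis using m by (auto simp: R_def)
        qed
        then show ?thesis by blast
      qed (auto simp: R_def)
      then obtain N where "\<And>n. n \<ge> N \<Longrightarrow> x \<notin> R n" by blast
      then show "(\<lambda>N. indicator (R N) x * (cmod (lift_L2 \<eta> x))\<^sup>2) \<longlonglongrightarrow> 0"
        by (intro tendsto_eventually eventually_sequentiallyI[of N]) simp
    qed
  qed (auto simp: indicator_def L2_integrable lift_L2(1))
  then have "(\<lambda>N. (norm (mult_proj (R N) \<eta>))\<^sup>2) \<longlonglongrightarrow> 0"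
    by (simp add: norm_mult_proj)
  then have "(\<lambda>N. sqrt ((norm (mult_proj (R N) \<eta>))\<^sup>2)) \<longlonglongrightarrow> sqrt 0" by (intro tendsto_real_sqrt)
  then have "(\<lambda>N. mult_proj (R N) \<eta>) \<longlonglongrightarrow> 0" by (simp add: tendsto_norm_zero_iff)
  then have "(\<lambda>N. mult_proj (\<Union>n. F n) \<eta> - mult_proj (R N) \<eta>) \<longlonglongrightarrow> mult_proj (\<Union>n. F n) \<eta> - 0"
    by (intro tendsto_diff tendsto_const)
  moreover have "mult_proj (\<Union>n. F n) \<eta> - mult_proj (R N) \<eta> = (\<Sum>n<N. mult_proj (F n) \<eta>)" for N
    using part[of N] by simp
  ultimately show ?thesis by (simp add: sums_def)
qed

lemma csubspace_supported: "csubspace supported"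
  by (auto simp: complex_vector.subspace_def supported_def zero_l2.rep_eq plus_l2.rep_eq scaleC_l2.rep_eq)

lemma closed_supported: "closed supported"
proof -
  have "supported = (\<Inter>e\<in>- E. {\<eta>. cinner (unit_l2 e) \<eta> = 0})"
    by (auto simp: supported_def cinner_unit_l2)
  also have "closed \<dots>"
    by (intro closed_INT ballI closed_Collect_eq continuous_intros)
  finally show ?thesis .
qed

lemma spectral_measure_mult_proj:
  assumes "sets X \<subseteq> sets \<nu>" "space X = space \<nu>"
  shows "spectral_measure X supported mult_proj"
  unfolding spectral_measure_def
proof (intro conjI ballI allI impI)
  fix F assume "F \<in> sets X"
  then show "projection_op (mult_proj F)" "range (mult_proj F) \<subseteq> supported"
    using assms by (auto intro: projection_op_mult_proj mult_proj_supported)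
next
  show "range (mult_proj (space X)) = supported"
    unfolding assms(2) mult_proj_space[abs_def] using restr_supported restr_id by (metis image_subsetI rangeI subsetI subset_antisym)
next
  fix F :: "nat \<Rightarrow> 'x set" and \<xi> assume "disjoint_family F \<and> range F \<subseteq> sets X"
  then show "(\<lambda>n. mult_proj (F n) \<xi>) sums mult_proj (\<Union>n. F n) \<xi>"
    using assms(1) by (intro mult_proj_sums) auto
qed

lemma L2_const: "(\<lambda>x. c) \<in> L2_fun \<nu>"
  by (simp add: L2_fun_def)

text \<open>A function orthogonal to all indicators has vanishing integral over every measurable set
  and is null. The hypothesis \<open>ex\<close> bridges the larger sigma-algebra of
  \<open>\<nu>\<close> and the sets of \<open>X\<close> that index the spectral measure.\<close>

lemma multiplicity_one_mult_proj:
  assumes X: "sets X \<subseteq> sets \<nu>"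
    and ex: "\<And>F. F \<in> sets \<nu> \<Longrightarrow> \<exists>F'\<in>sets X. AE x in \<nu>. x \<in> F \<longleftrightarrow> x \<in> F'"
  shows "multiplicity_one X supported mult_proj"
  unfolding multiplicity_one_def
proof (intro bexI[of _ "coef (\<lambda>x. 1)"] closure_cspan_eqI csubspace_supported closed_supported)
  show "coef (\<lambda>x. 1) \<in> supported" by (intro coef_supported L2_const)
  show "{mult_proj F (coef (\<lambda>x. 1)) |F. F \<in> sets X} \<subseteq> supported"
    using X by (auto intro: mult_proj_supported)
  fix z assume z: "z \<in> supported" and orth: "\<And>s. s \<in> {mult_proj F (coef (\<lambda>x. 1)) |F. F \<in> sets X} \<Longrightarrow> cinner s z = 0"
  obtain g where g: "g \<in> L2_fun \<nu>" "coef g = z" using coef_surj_aux[OF z] by blast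
  have [measurable]: "g \<in> borel_measurable \<nu>" using g by (auto intro: L2_measurable)
  have ig: "integrable \<nu> g" using L2_cinner_integrable[OF L2_const g(1), of 1] by simp
  have zero: "set_lebesgue_integral \<nu> F g = 0" if F: "F \<in> sets \<nu>" for F
  proof -
    obtain F' where F': "F' \<in> sets X" "AE x in \<nu>. x \<in> F \<longleftrightarrow> x \<in> F'" using ex[OF F] by blast
    have F'\<nu>: "F' \<in> sets \<nu>" using F'(1) X by blast
    have "mult_proj F' (coef (\<lambda>x. 1)) = coef (\<lambda>x. indicator F' x * 1)" using F'\<nu> by (intro mult_proj_coef L2_const)
    then have "cinner (coef (\<lambda>x. indicator F' x * 1)) (coef g) = 0"
      unfolding g(2) by (intro orth) (use F'(1) in \<open>metis (mono_tags, lifting) mem_Collect_eq\<close>)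
    then have "L2_inner \<nu> (\<lambda>x. indicator F' x * 1) g = 0"
      by (simp only: cinner_coef[OF L2_indicator[OF L2_const F'\<nu>] g(1)])
    moreover have "L2_inner \<nu> (\<lambda>x. indicator F' x * 1) g = set_lebesgue_integral \<nu> F g"
      unfolding L2_inner_def set_lebesgue_integral_def
    proof (rule integral_cong_AE)
      show "AE x in \<nu>. cnj (indicator F' x * 1) * g x = indicator F x *\<^sub>R g x"
        using F'(2) by eventually_elim (auto simp: indicator_def)
    qed (use F F'\<nu> in measurable)
    ultimately show ?thesis by simp
  qed
  have "AE x in \<nu>. g x = 0" using density_zero[OF ig zero] .
  then have "coef g = coef (\<lambda>x. 0)" by (intro coef_cong_AE g L2_zero) auto
  then show "z = 0" using g(2) coef_cmult[OF L2_zero, of 0] by simp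
qed

end

section \<open>Efficient instruments\<close>

text \<open>\<open>C\<close> and \<open>C'\<close> take coefficients with respect to
  \<open>B\<close> and to the family \<open>u\<close>; \<open>V\<close> is \<open>C\<close> followed
  by the adjoint of \<open>C'\<close>. This extends \<open>u\<close> from the basis without
  discussing series in the target.\<close>

lemma isometry_from_onb:
  fixes u :: "'a::complex_hilbert \<Rightarrow> 'b::complex_hilbert"
  assumes B: "is_onb B" and u: "\<And>b c. b \<in> B \<Longrightarrow> c \<in> B \<Longrightarrow> cinner (u b) (u c) = cinner b c"
  obtains V where "isometry_op V" "\<And>b. b \<in> B \<Longrightarrow> V b = u b"
proof -
  have dB: "cinner b c = (if b = c then 1 else 0)" if "b \<in> B" "c \<in> B" for b c
    using B that by (simp add: is_onb_def)
  have dense: "closure (cspan B) = UNIV" using B by (simp add: is_onb_def)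
  define C where "C x = Abs_l2 (\<lambda>b. if b \<in> B then cinner b x else 0)" for x
  define C' where "C' y = Abs_l2 (\<lambda>b. if b \<in> B then cinner (u b) y else 0)" for y
  have Rep_C: "Rep_l2 (C x) b = (if b \<in> B then cinner b x else 0)" for x b
  proof -
    have "(\<lambda>b. (cmod (cinner b x))\<^sup>2) summable_on B"
      using parseval_norm[OF B] by (auto simp: summable_on_def)
    then have "(\<lambda>b. (norm (if b \<in> B then cinner b x else 0))\<^sup>2) summable_on UNIV"
      by (rule summable_on_cong_neutral[THEN iffD1, rotated -1]) auto
    then show ?thesis by (simp add: C_def Rep_Abs_l2)
  qed
  have bessel': "(\<Sum>b\<in>G. (cmod (cinner (u b) y))\<^sup>2) \<le> (norm y)\<^sup>2" if G: "finite G" "G \<subseteq> B" for G y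
  proof -
    have inj: "inj_on u G"
    proof (rule inj_onI)
      fix b c assume "b \<in> G" "c \<in> G" and eq: "u b = u c"
      then have bc: "b \<in> B" "c \<in> B" using G(2) by auto
      have "cinner b c = cinner (u b) (u c)" using u[OF bc] by simp
      also have "\<dots> = cinner b b" using u[OF bc(1) bc(1)] eq by simp
      finally show "b = c" using dB[OF bc] dB[OF bc(1) bc(1)] by (simp split: if_splits)
    qed
    have on: "cinner e f = (if e = f then 1 else 0)" if "e \<in> u ` G" "f \<in> u ` G" for e f
      using that u dB G(2) inj by (auto simp: subset_iff inj_on_eq_iff)
    have "(\<Sum>e\<in>u ` G. (cmod (cinner e y))\<^sup>2) \<le> (norm y)\<^sup>2"
      using bessel(1)[of "u ` G" y, OF _ on] G(1) zero_le_power2[of "norm (y - (\<Sum>e\<in>u ` G. cinner e y *\<^sub>C e))"]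
      by (simp del: zero_le_power2)
    then show ?thesis by (simp add: sum.reindex[OF inj])
  qed
  have Rep_C': "Rep_l2 (C' y) b = (if b \<in> B then cinner (u b) y else 0)" for y b
  proof -
    have "(\<lambda>b. (cmod (cinner (u b) y))\<^sup>2) summable_on B"
      by (rule nonneg_bdd_above_summable_on) (auto intro!: bdd_aboveI2 bessel')
    then have "(\<lambda>b. (norm (if b \<in> B then cinner (u b) y else 0))\<^sup>2) summable_on UNIV"
      by (rule summable_on_cong_neutral[THEN iffD1, rotated -1]) auto
    then show ?thesis by (simp add: C'_def Rep_Abs_l2)
  qed
  have nC: "norm (C x) = norm x" for x
  proof -
    have "((\<lambda>b. (norm (Rep_l2 (C x) b))\<^sup>2) has_sum (norm x)\<^sup>2) UNIV"
      by (rule has_sum_cong_neutral[THEN iffD1, OF _ _ _ parseval_norm[OF B]]) (auto simp: Rep_C)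
    then have "(norm (C x))\<^sup>2 = (norm x)\<^sup>2" using has_sum_norm_l2 has_sum_unique by blast
    then show ?thesis by (simp add: power2_eq_iff_nonneg)
  qed
  have bC: "bounded_op C"
  proof (rule bounded_opI[where K = 1])
    show "C (x + y) = C x + C y" for x y
      by (rule l2_eqI) (simp add: Rep_C plus_l2.rep_eq cinner_add_right)
    show "C (c *\<^sub>C x) = c *\<^sub>C C x" for c x
      by (rule l2_eqI) (simp add: Rep_C scaleC_l2.rep_eq cinner_scaleC_right scaleC_complex_def)
  qed (simp add: nC)
  have bC': "bounded_op C'"
  proof (rule bounded_opI[where K = 1])
    show "C' (x + y) = C' x + C' y" for x y
      by (rule l2_eqI) (simp add: Rep_C' plus_l2.rep_eq cinner_add_right)
    show "C' (c *\<^sub>C x) = c *\<^sub>C C' x" for c x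
      by (rule l2_eqI) (simp add: Rep_C' scaleC_l2.rep_eq cinner_scaleC_right scaleC_complex_def)
    show "norm (C' y) \<le> 1 * norm y" for y
    proof (rule norm_l2_leI)
      fix I :: "'a set" assume I: "finite I"
      have "(\<Sum>b\<in>I. (norm (Rep_l2 (C' y) b))\<^sup>2) = (\<Sum>b\<in>I \<inter> B. (cmod (cinner (u b) y))\<^sup>2)"
        by (rule sum.mono_neutral_cong_right) (auto simp: Rep_C' I)
      then show "(\<Sum>b\<in>I. (norm (Rep_l2 (C' y) b))\<^sup>2) \<le> (1 * norm y)\<^sup>2" using bessel'[of "I \<inter> B" y] I by simp
    qed simp
  qed
  define V where "V = cadjoint C' \<circ> C"
  have bV: "bounded_op V" unfolding V_def by (intro bounded_op_compose bounded_op_cadjoint bC bC')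
  have Vb: "V b = u b" if b: "b \<in> B" for b
  proof (rule cinner_ext)
    fix y
    have "cinner y (V b) = cinner (C' y) (C b)" by (simp add: V_def cinner_cadjoint[OF bC'])
    moreover have "((\<lambda>c. cinner (Rep_l2 (C' y) c) (Rep_l2 (C b) c)) has_sum cinner y (u b)) UNIV"
      using b dB by (intro has_sum_finite_neutralI[of "{b}"])
        (auto simp: Rep_C Rep_C' cinner_complex_def cinner_commute[of y "u b"])
    ultimately show "cinner y (V b) = cinner y (u b)"
      using has_sum_cinner_l2 has_sum_unique by metis
  qed
  have "cadjoint V \<circ> V = (\<lambda>x. x)"
  proof (rule bounded_op_eq_on_dense_matrix[OF bounded_op_compose[OF bounded_op_cadjoint[OF bV] bV] bounded_op_id dense])
    fix b c assume "b \<in> B" "c \<in> B"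
    then show "cinner b ((cadjoint V \<circ> V) c) = cinner b c"
      by (simp add: Vb u flip: cinner_cadjoint[OF bV])
  qed
  then have "cinner (V x) (V x) = cinner x x" for x
    by (metis cinner_cadjoint[OF bV] comp_apply)
  then have "(norm (V x))\<^sup>2 = (norm x)\<^sup>2" for x
    unfolding cinner_self of_real_eq_iff .
  then have "isometry_op V" using bV by (simp add: isometry_op_def power2_eq_iff_nonneg)
  with Vb that show thesis by blast
qed

text \<open>Limit theorems for integrals concern sequences; a sum over \<open>B\<close> is therefore
  enumerated, with \<open>0\<close> at numbers that enumerate nothing.\<close>

lemma has_sum_countable_imp_sums:
  assumes "countable B" "(f has_sum s) B"
  shows "(\<lambda>n. if n \<in> to_nat_on B ` B then f (from_nat_into B n) else 0) sums s"
proof (rule has_sum_imp_sums)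
  have "(f \<circ> from_nat_into B has_sum s) (to_nat_on B ` B)"
    using assms by (subst has_sum_reindex) (auto simp: o_def inj_on_to_nat_on cong: has_sum_cong)
  then show "((\<lambda>n. if n \<in> to_nat_on B ` B then f (from_nat_into B n) else 0) has_sum s) UNIV"
    by (rule has_sum_cong_neutral[THEN iffD1, rotated -1]) auto
qed

text \<open>Representatives of elements of \<open>L\<^sup>2(\<nu>; H)\<close>. Measurability is
  imposed on scalar components because these are what the Kraus data provide.\<close>

definition weak_L2 :: "'x measure \<Rightarrow> ('x \<Rightarrow> 'h::complex_hilbert) set" where
  "weak_L2 \<nu> = {g. (\<forall>c. (\<lambda>x. cinner c (g x)) \<in> borel_measurable \<nu>) \<and> integrable \<nu> (\<lambda>x. (norm (g x))\<^sup>2)}"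

context
  fixes B :: "'h::complex_hilbert set"
  assumes B: "is_onb B" "countable B"
begin

text \<open>Limit and uniform bound of the partial sums are the two inputs of dominated convergence
  in \<open>cinner_vcoef\<close>.\<close>

lemma onb_partial_sums:
  defines "b \<equiv> \<lambda>n. from_nat_into B n"
  defines "T \<equiv> \<lambda>x y n. if n \<in> to_nat_on B ` B then cinner x (b n) * cinner (b n) y else 0"
  shows "T x y sums cinner x y" "cmod (\<Sum>n<N. T x y n) \<le> norm x * norm y"
proof -
  show "T x y sums cinner x y"
    unfolding T_def b_def using has_sum_countable_imp_sums[OF B(2) parseval[OF B(1), of x y]] .
  have "cmod (\<Sum>n<N. T x y n) \<le> (\<Sum>n<N. cmod (T x y n))" by (rule norm_sum)
  also have "\<dots> = (\<Sum>n\<in>{..<N} \<inter> to_nat_on B ` B. norm (cinner x (b n) * cinner (b n) y))"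
    by (rule sum.mono_neutral_cong_right) (auto simp: T_def)
  also have "\<dots> = (\<Sum>e\<in>b ` ({..<N} \<inter> to_nat_on B ` B). norm (cinner x e * cinner e y))"
    using B(2) by (subst sum.reindex) (auto simp: b_def inj_on_def)
  also have "\<dots> \<le> (\<Sum>\<^sub>\<infinity>e\<in>B. norm (cinner x e * cinner e y))"
    using B(2) by (intro finite_sum_le_infsum onb_cauchy_schwarz(1)[OF B(1)]) (auto simp: b_def)
  also have "\<dots> \<le> norm x * norm y" by (rule onb_cauchy_schwarz(2)[OF B(1)])
  finally show "cmod (\<Sum>n<N. T x y n) \<le> norm x * norm y" .
qed

lemma weak_measurable_cinner:
  assumes f: "\<And>c. c \<in> B \<Longrightarrow> (\<lambda>x. cinner c (f x)) \<in> borel_measurable \<nu>"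
    and g: "\<And>c. c \<in> B \<Longrightarrow> (\<lambda>x. cinner c (g x)) \<in> borel_measurable \<nu>"
  shows "(\<lambda>x. cinner (f x) (g x)) \<in> borel_measurable \<nu>"
proof (rule borel_measurable_LIMSEQ_metric)
  let ?b = "from_nat_into B"
  let ?T = "\<lambda>x y n. if n \<in> to_nat_on B ` B then cinner x (?b n) * cinner (?b n) y else 0"
  show "(\<lambda>x. \<Sum>n<N. ?T (f x) (g x) n) \<in> borel_measurable \<nu>" for N
  proof (rule borel_measurable_sum)
    fix n
    show "(\<lambda>x. ?T (f x) (g x) n) \<in> borel_measurable \<nu>"
    proof (cases "n \<in> to_nat_on B ` B")
      case True
      then have "?b n \<in> B" using B(2) by auto
      note [measurable] = f[OF this] g[OF this]
      have "(\<lambda>x. cnj (cinner (?b n) (f x)) * cinner (?b n) (g x)) \<in> borel_measurable \<nu>" by measurable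
      then show ?thesis using True by (simp add: cinner_commute[symmetric])
    qed simp
  qed
  show "(\<lambda>N. \<Sum>n<N. ?T (f x) (g x) n) \<longlonglongrightarrow> cinner (f x) (g x)" for x
    using onb_partial_sums(1)[of "f x" "g x"] by (simp add: sums_def)
qed

end

lemma (in L2_basis) weak_L2_component:
  fixes g :: "'x \<Rightarrow> 'h::complex_hilbert"
  assumes "g \<in> weak_L2 \<nu>" shows "(\<lambda>x. cinner c (g x)) \<in> L2_fun \<nu>"
  unfolding L2_fun_def
proof safe
  show m [measurable]: "(\<lambda>x. cinner c (g x)) \<in> borel_measurable \<nu>" using assms by (simp add: weak_L2_def)
  show "integrable \<nu> (\<lambda>x. (cmod (cinner c (g x)))\<^sup>2)"
  proof (rule Bochner_Integration.integrable_bound[of \<nu> "\<lambda>x. (norm c)\<^sup>2 * (norm (g x))\<^sup>2"])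
    show "integrable \<nu> (\<lambda>x. (norm c)\<^sup>2 * (norm (g x))\<^sup>2)"
      using assms by (intro integrable_mult_right) (simp add: weak_L2_def)
    show "AE x in \<nu>. norm ((cmod (cinner c (g x)))\<^sup>2) \<le> norm ((norm c)\<^sup>2 * (norm (g x))\<^sup>2)"
      using power_mono[OF cmod_cinner_le norm_ge_zero, of c _ 2] by (simp add: power_mult_distrib)
  qed measurable
qed

locale L2_tensor = L2_basis \<nu> E for \<nu> :: "'x measure" and E +
  fixes B :: "'h::complex_hilbert set"
  assumes B: "is_onb B" "countable B"
begin

text \<open>The isometry \<open>L\<^sup>2(\<nu>; H) \<rightarrow> \<ell>\<^sup>2(I; H)\<close> whose slices are \<open>coef\<close>.\<close>

definition vcoef :: "('x \<Rightarrow> 'h) \<Rightarrow> ('x \<Rightarrow> complex, 'h) l2" where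
  "vcoef g = cadjoint (slices B) (Abs_l2 (\<lambda>b. if b \<in> B then coef (\<lambda>x. cinner b (g x)) else 0))"

lemma slice_vcoef_basis:
  assumes g: "g \<in> weak_L2 \<nu>" and b: "b \<in> B"
  shows "slice b (vcoef g) = coef (\<lambda>x. cinner b (g x))"
proof -
  have "(\<lambda>b. (norm (coef (\<lambda>x. cinner b (g x))))\<^sup>2) summable_on B"
  proof (rule nonneg_bdd_above_summable_on)
    show "bdd_above (sum (\<lambda>b. (norm (coef (\<lambda>x. cinner b (g x))))\<^sup>2) ` {F. F \<subseteq> B \<and> finite F})"
    proof (rule bdd_aboveI2)
      fix G assume G: "G \<in> {F. F \<subseteq> B \<and> finite F}"
      have "(\<Sum>b\<in>G. (norm (coef (\<lambda>x. cinner b (g x))))\<^sup>2) = (LINT x|\<nu>. (\<Sum>b\<in>G. (cmod (cinner b (g x)))\<^sup>2))"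
        by (simp add: norm_coef weak_L2_component g L2_normsq_def L2_integrable)
      also have "\<dots> \<le> (LINT x|\<nu>. (norm (g x))\<^sup>2)"
      proof (rule integral_mono)
        show "(\<Sum>b\<in>G. (cmod (cinner b (g x)))\<^sup>2) \<le> (norm (g x))\<^sup>2" for x
          using finite_sum_le_has_sum[OF parseval_norm[OF B(1)]] G by auto
        show "integrable \<nu> (\<lambda>x. (norm (g x))\<^sup>2)" using g by (simp add: weak_L2_def)
      qed (intro Bochner_Integration.integrable_sum L2_integrable weak_L2_component g)
      finally show "(\<Sum>b\<in>G. (norm (coef (\<lambda>x. cinner b (g x))))\<^sup>2) \<le> (LINT x|\<nu>. (norm (g x))\<^sup>2)" .
    qed
  qed simp
  then have "(\<lambda>b. (norm (if b \<in> B then coef (\<lambda>x. cinner b (g x)) else 0))\<^sup>2) summable_on UNIV"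
    by (rule summable_on_cong_neutral[THEN iffD1, rotated -1]) auto
  then show ?thesis using b by (simp add: vcoef_def slice_cadjoint_slices[OF B(1)] Rep_Abs_l2)
qed

text \<open>The formula is known for \<open>c\<close> in \<open>B\<close>. Both \<open>slice\<close>
  and the first slot of the scalar product are antilinear, so the pairing with
  \<open>\<zeta>\<close> is linear and bounded in \<open>c\<close> and extends by density.\<close>

lemma slice_vcoef:
  assumes g: "g \<in> weak_L2 \<nu>"
  shows "slice c (vcoef g) = coef (\<lambda>x. cinner c (g x))"
proof (rule cinner_ext)
  fix \<zeta>
  have L: "(\<lambda>x. cinner c (g x)) \<in> L2_fun \<nu>" for c by (rule weak_L2_component[OF g])
  have dense: "closure (cspan B) = UNIV" using B(1) by (simp add: is_onb_def)
  have "(\<lambda>c. cinner (slice c (vcoef g)) \<zeta>) = (\<lambda>c. cinner (coef (\<lambda>x. cinner c (g x))) \<zeta>)"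
  proof (rule bounded_op_eq_on_dense[OF _ _ dense])
    show "bounded_op (\<lambda>c. cinner (slice c (vcoef g)) \<zeta>)"
    proof (rule bounded_opI[where K = "norm (vcoef g) * norm \<zeta>"])
      fix c
      have "cmod (cinner (slice c (vcoef g)) \<zeta>) \<le> norm (slice c (vcoef g)) * norm \<zeta>" by (rule cmod_cinner_le)
      also have "\<dots> \<le> (norm c * norm (vcoef g)) * norm \<zeta>" by (intro mult_right_mono norm_slice_le) simp
      finally show "norm (cinner (slice c (vcoef g)) \<zeta>) \<le> norm (vcoef g) * norm \<zeta> * norm c" by (simp add: mult_ac)
    qed (simp_all add: slice_add_left slice_scaleC_left cinner_add_left cinner_scaleC_left scaleC_complex_def)
    let ?N = "sqrt (LINT x|\<nu>. (norm (g x))\<^sup>2)"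
    have nc: "norm (coef (\<lambda>x. cinner c (g x))) \<le> norm c * ?N" for c
    proof (rule power2_le_imp_le)
      have "(norm (coef (\<lambda>x. cinner c (g x))))\<^sup>2 \<le> (LINT x|\<nu>. (norm c)\<^sup>2 * (norm (g x))\<^sup>2)"
        unfolding norm_coef[OF L] L2_normsq_def
      proof (rule integral_mono[OF L2_integrable[OF L]])
        show "integrable \<nu> (\<lambda>x. (norm c)\<^sup>2 * (norm (g x))\<^sup>2)" using g by (simp add: weak_L2_def)
        show "(cmod (cinner c (g x)))\<^sup>2 \<le> (norm c)\<^sup>2 * (norm (g x))\<^sup>2" for x
          using power_mono[OF cmod_cinner_le norm_ge_zero, of c "g x" 2] by (simp add: power_mult_distrib)
      qed
      then show "(norm (coef (\<lambda>x. cinner c (g x))))\<^sup>2 \<le> (norm c * ?N)\<^sup>2" by (simp add: power_mult_distrib)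
    qed simp
    show "bounded_op (\<lambda>c. cinner (coef (\<lambda>x. cinner c (g x))) \<zeta>)"
    proof (rule bounded_opI[where K = "?N * norm \<zeta>"])
      fix c
      have "cmod (cinner (coef (\<lambda>x. cinner c (g x))) \<zeta>) \<le> norm (coef (\<lambda>x. cinner c (g x))) * norm \<zeta>" by (rule cmod_cinner_le)
      also have "\<dots> \<le> (norm c * ?N) * norm \<zeta>" by (intro mult_right_mono nc) simp
      finally show "norm (cinner (coef (\<lambda>x. cinner c (g x))) \<zeta>) \<le> ?N * norm \<zeta> * norm c" by (simp add: mult_ac)
    next
      fix c d
      show "cinner (coef (\<lambda>x. cinner (c + d) (g x))) \<zeta>
        = cinner (coef (\<lambda>x. cinner c (g x))) \<zeta> + cinner (coef (\<lambda>x. cinner d (g x))) \<zeta>"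
        by (simp add: cinner_add_left coef_add L)
    next
      fix a c
      show "cinner (coef (\<lambda>x. cinner (a *\<^sub>C c) (g x))) \<zeta> = a *\<^sub>C cinner (coef (\<lambda>x. cinner c (g x))) \<zeta>"
        by (simp add: cinner_scaleC_left coef_cmult L scaleC_complex_def)
    qed
  qed (simp add: slice_vcoef_basis[OF g])
  then show "cinner \<zeta> (slice c (vcoef g)) = cinner \<zeta> (coef (\<lambda>x. cinner c (g x)))"
    by (metis cinner_commute)
qed

text \<open>The partial sums over \<open>B\<close> converge to the left side by Parseval for slices
  and to the right side by dominated convergence.\<close>

lemma cinner_vcoef:
  assumes f: "f \<in> weak_L2 \<nu>" and g: "g \<in> weak_L2 \<nu>"
  shows "cinner (vcoef f) (vcoef g) = (LINT x|\<nu>. cinner (f x) (g x))"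
proof (rule LIMSEQ_unique)
  let ?b = "from_nat_into B"
  let ?S = "to_nat_on B ` B"
  let ?T = "\<lambda>x y n. if n \<in> ?S then cinner x (?b n) * cinner (?b n) y else 0"
  have L: "(\<lambda>x. cinner c (f x)) \<in> L2_fun \<nu>" "(\<lambda>x. cinner c (g x)) \<in> L2_fun \<nu>" for c
    by (intro weak_L2_component f g)+
  have i: "integrable \<nu> (\<lambda>x. ?T (f x) (g x) n)" and e: "(LINT x|\<nu>. ?T (f x) (g x) n)
      = (if n \<in> ?S then cinner (slice (?b n) (vcoef f)) (slice (?b n) (vcoef g)) else 0)" for n
  proof -
    have "integrable \<nu> (\<lambda>x. cnj (cinner (?b n) (f x)) * cinner (?b n) (g x))"
      by (intro L2_cinner_integrable L)
    then show "integrable \<nu> (\<lambda>x. ?T (f x) (g x) n)"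
      by (cases "n \<in> ?S") (simp_all add: cinner_commute[symmetric])
    have "(LINT x|\<nu>. cnj (cinner (?b n) (f x)) * cinner (?b n) (g x)) = cinner (slice (?b n) (vcoef f)) (slice (?b n) (vcoef g))"
      by (simp only: slice_vcoef[OF f] slice_vcoef[OF g] cinner_coef[OF L] L2_inner_def)
    then show "(LINT x|\<nu>. ?T (f x) (g x) n)
        = (if n \<in> ?S then cinner (slice (?b n) (vcoef f)) (slice (?b n) (vcoef g)) else 0)"
      by (cases "n \<in> ?S") (simp_all add: cinner_commute[symmetric])
  qed
  show "(\<lambda>N. \<Sum>n<N. if n \<in> ?S then cinner (slice (?b n) (vcoef f)) (slice (?b n) (vcoef g)) else 0) \<longlonglongrightarrow> cinner (vcoef f) (vcoef g)"
    using has_sum_countable_imp_sums[OF B(2) has_sum_cinner_slices[OF B(1)]] unfolding sums_def .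
  have "(\<lambda>N. LINT x|\<nu>. (\<Sum>n<N. ?T (f x) (g x) n)) \<longlonglongrightarrow> (LINT x|\<nu>. cinner (f x) (g x))"
  proof (rule integral_dominated_convergence[where w = "\<lambda>x. (norm (f x))\<^sup>2 + (norm (g x))\<^sup>2"])
    show "(\<lambda>x. cinner (f x) (g x)) \<in> borel_measurable \<nu>"
      by (rule weak_measurable_cinner[OF B]) (use f g in \<open>simp_all add: weak_L2_def\<close>)
    show "(\<lambda>x. \<Sum>n<N. ?T (f x) (g x) n) \<in> borel_measurable \<nu>" for N
      by (intro borel_measurable_sum borel_measurable_integrable i)
    show "integrable \<nu> (\<lambda>x. (norm (f x))\<^sup>2 + (norm (g x))\<^sup>2)" using f g by (simp add: weak_L2_def)
    show "AE x in \<nu>. (\<lambda>N. \<Sum>n<N. ?T (f x) (g x) n) \<longlonglongrightarrow> cinner (f x) (g x)"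
      using onb_partial_sums(1)[OF B] by (simp add: sums_def)
    show "AE x in \<nu>. norm (\<Sum>n<N. ?T (f x) (g x) n) \<le> (norm (f x))\<^sup>2 + (norm (g x))\<^sup>2" for N
    proof (rule AE_I2)
      fix x
      have "norm (f x) * norm (g x) \<le> (norm (f x))\<^sup>2 + (norm (g x))\<^sup>2"
        using sum_squares_bound[of "norm (f x)" "norm (g x)"]
          mult_nonneg_nonneg[OF norm_ge_zero norm_ge_zero, of "f x" "g x"] by linarith
      with onb_partial_sums(2)[OF B, of "f x" "g x" N]
      show "norm (\<Sum>n<N. ?T (f x) (g x) n) \<le> (norm (f x))\<^sup>2 + (norm (g x))\<^sup>2" by linarith
    qed
  qed
  then show "(\<lambda>N. \<Sum>n<N. if n \<in> ?S then cinner (slice (?b n) (vcoef f)) (slice (?b n) (vcoef g)) else 0)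
      \<longlonglongrightarrow> (LINT x|\<nu>. cinner (f x) (g x))"
    by (simp only: Bochner_Integration.integral_sum[OF i] e)
qed

lemma weak_L2_op:
  fixes A :: "'h \<Rightarrow> 'h"
  assumes g: "g \<in> weak_L2 \<nu>" and A: "bounded_op A" and F: "F \<in> sets \<nu>"
  shows "(\<lambda>x. A (indicator F x *\<^sub>R g x)) \<in> weak_L2 \<nu>"
proof -
  obtain K where K: "K > 0" "\<And>x. norm (A x) \<le> K * norm x" using bounded_op_bound[OF A] by blast
  have m: "(\<lambda>x. cinner c (A (indicator F x *\<^sub>R g x))) \<in> borel_measurable \<nu>" for c
  proof -
    have [measurable]: "(\<lambda>x. cinner (cadjoint A c) (g x)) \<in> borel_measurable \<nu>" "F \<in> sets \<nu>"
      using g F by (simp_all add: weak_L2_def)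
    have "(\<lambda>x. indicator F x * cinner (cadjoint A c) (g x)) \<in> borel_measurable \<nu>" by measurable
    moreover have "cinner c (A (indicator F x *\<^sub>R g x)) = indicator F x * cinner (cadjoint A c) (g x)" for x
      by (simp add: cinner_cadjoint_left[OF A] indicator_def bounded_op_zero[OF A])
    ultimately show ?thesis by simp
  qed
  have "(\<lambda>x. cinner (A (indicator F x *\<^sub>R g x)) (A (indicator F x *\<^sub>R g x))) \<in> borel_measurable \<nu>"
    by (rule weak_measurable_cinner[OF B]; rule m)
  then have "(\<lambda>x. Re (cinner (A (indicator F x *\<^sub>R g x)) (A (indicator F x *\<^sub>R g x)))) \<in> borel_measurable \<nu>"
    by measurable
  then have mn: "(\<lambda>x. (norm (A (indicator F x *\<^sub>R g x)))\<^sup>2) \<in> borel_measurable \<nu>"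
    by (simp add: cinner_self flip: of_real_power)
  have "integrable \<nu> (\<lambda>x. (norm (A (indicator F x *\<^sub>R g x)))\<^sup>2)"
  proof (rule Bochner_Integration.integrable_bound[OF _ mn])
    show "integrable \<nu> (\<lambda>x. K\<^sup>2 * (norm (g x))\<^sup>2)" using g by (simp add: weak_L2_def)
    show "AE x in \<nu>. norm ((norm (A (indicator F x *\<^sub>R g x)))\<^sup>2) \<le> norm (K\<^sup>2 * (norm (g x))\<^sup>2)"
      using power_mono[OF K(2) norm_ge_zero, of _ 2]
      by (auto simp: indicator_def power_mult_distrib bounded_op_zero[OF A])
  qed
  with m show ?thesis by (simp add: weak_L2_def)
qed

text \<open>The projection acts on each slice as multiplication by the indicator; the action of
  \<open>A\<close> is moved to the slicing vector by \<open>cadjoint A\<close>.\<close>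

lemma tensor_op_vcoef:
  assumes g: "g \<in> weak_L2 \<nu>" and A: "bounded_op A" and F: "F \<in> sets \<nu>"
  shows "tensor_op A (mult_proj F) (vcoef g) = vcoef (\<lambda>x. A (indicator F x *\<^sub>R g x))"
proof (rule l2_eq_slicesI[OF B(1)])
  fix b assume b: "b \<in> B"
  have gF: "(\<lambda>x. indicator F x *\<^sub>R g x) \<in> weak_L2 \<nu>" using weak_L2_op[OF g bounded_op_id F] .
  have "cadjoint (slices B) (amplify (mult_proj F) (slices B (vcoef g))) = vcoef (\<lambda>x. indicator F x *\<^sub>R g x)"
  proof (rule l2_eq_slicesI[OF B(1)])
    fix c assume c: "c \<in> B"
    have "slice c (cadjoint (slices B) (amplify (mult_proj F) (slices B (vcoef g)))) = mult_proj F (coef (\<lambda>x. cinner c (g x)))"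
      using c by (simp add: slice_cadjoint_slices[OF B(1)] Rep_amplify[OF bounded_op_mult_proj[OF F]] Rep_slices[OF B(1)] slice_vcoef[OF g])
    also have "\<dots> = coef (\<lambda>x. indicator F x * cinner c (g x))" by (intro mult_proj_coef F weak_L2_component g)
    also have "\<dots> = slice c (vcoef (\<lambda>x. indicator F x *\<^sub>R g x))"
      unfolding slice_vcoef[OF gF] by (intro arg_cong[where f = coef]) (auto simp: indicator_def)
    finally show "slice c (cadjoint (slices B) (amplify (mult_proj F) (slices B (vcoef g))))
        = slice c (vcoef (\<lambda>x. indicator F x *\<^sub>R g x))" .
  qed
  then have eq: "tensor_op A (mult_proj F) (vcoef g) = amplify A (vcoef (\<lambda>x. indicator F x *\<^sub>R g x))"
    by (simp add: tensor_op_eq[OF B(1) A bounded_op_mult_proj[OF F]])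
  have "slice b (amplify A f) = slice (cadjoint A b) f" for f :: "('x \<Rightarrow> complex, 'h) l2"
    by (rule l2_eqI) (simp add: slice.rep_eq Rep_amplify[OF A] cinner_cadjoint_left[OF A])
  then show "slice b (tensor_op A (mult_proj F) (vcoef g)) = slice b (vcoef (\<lambda>x. A (indicator F x *\<^sub>R g x)))"
    unfolding eq by (simp add: slice_vcoef[OF gF] slice_vcoef[OF weak_L2_op[OF g A F]] cinner_cadjoint_left[OF A])
qed

lemma csubspace_tensor_space: "csubspace (tensor_space H0)"
  unfolding tensor_space_def by (rule csubspace_closure[OF complex_vector.subspace_span])

text \<open>The defect of projecting onto the tensor space has slices in \<open>supported\<close>.
  Tensoring \<open>b\<close> with the slice along \<open>b\<close> gives a member of that space,
  hence a vector orthogonal to the defect; so each slice is orthogonal to itself.\<close>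

lemma vcoef_in_tensor_space:
  assumes g: "g \<in> weak_L2 \<nu>" shows "vcoef g \<in> tensor_space supported"
proof -
  let ?T = "tensor_space supported :: ('x \<Rightarrow> complex, 'h) l2 set"
  have T: "csubspace ?T" "closed ?T" by (rule csubspace_tensor_space) (simp add: tensor_space_def)
  obtain p where p: "p \<in> ?T" "\<And>s. s \<in> ?T \<Longrightarrow> cinner s (vcoef g - p) = 0"
    using projection_exists[OF T] by blast
  define S :: "('x \<Rightarrow> complex, 'h) l2 set" where "S = {f. \<forall>c. slice c f \<in> supported}"
  have "?T \<subseteq> S"
    unfolding tensor_space_def
  proof (rule closure_minimal)
    show "cspan {tensor_vec \<phi> \<xi> |\<phi> \<xi>. \<xi> \<in> supported} \<subseteq> S"
    proof (rule complex_vector.span_minimal)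
      show "{tensor_vec \<phi> \<xi> |\<phi> \<xi>. \<xi> \<in> supported} \<subseteq> S"
        using complex_vector.subspace_scale[OF csubspace_supported] by (auto simp: slice_tensor_vec S_def)
      show "csubspace S"
        using csubspace_supported unfolding complex_vector.subspace_def S_def
        by (auto simp: slice_add slice_scaleC)
    qed
    have "S = (\<Inter>c. slice c -` supported)" by (auto simp: S_def)
    also have "closed \<dots>"
      by (intro closed_INT ballI closed_vimage closed_supported continuous_on_bounded_op bounded_op_slice)
    finally show "closed S" .
  qed
  then have p': "slice c p \<in> supported" for c using p(1) by (auto simp: S_def)
  have "vcoef g - p = 0"
  proof (rule l2_eq_slicesI[OF B(1)])
    fix b assume "b \<in> B"
    have s: "slice b (vcoef g - p) = slice b (vcoef g) - slice b p"
      by (rule bounded_op_diff[OF bounded_op_slice])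
    have "slice b (vcoef g - p) \<in> supported"
      unfolding s slice_vcoef[OF g]
      by (intro complex_vector.subspace_diff csubspace_supported coef_supported weak_L2_component g p')
    then have "tensor_vec b (slice b (vcoef g - p)) \<in> ?T"
      unfolding tensor_space_def
      by (intro closure_subset[THEN subsetD] complex_vector.span_base) blast
    then have "cinner (slice b (vcoef g - p)) (slice b (vcoef g - p)) = 0"
      using p(2) by (metis cinner_tensor_vec_left)
    then show "slice b (vcoef g - p) = slice b 0" by simp
  qed
  then show ?thesis using p(1) by simp
qed

end

text \<open>Only the values \<open>w b\<close> of a single Kraus operator on the basis are asked
  for. They fix an isometry, and the representation of \<open>dual_map\<close> then needs checking
  only on matrix elements over \<open>B\<close>.\<close>

lemma efficientI:
  fixes M :: "'x set \<Rightarrow> ('h::complex_hilbert \<Rightarrow> 'h) \<Rightarrow> ('h \<Rightarrow> 'h)" and w :: "'h \<Rightarrow> 'x \<Rightarrow> 'h"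
  assumes bnd: "\<And>F A. F \<in> sets X \<Longrightarrow> bounded_op A \<Longrightarrow> bounded_op (dual_map (M F) A)"
    and unital: "dual_map (M (space X)) (\<lambda>x. x) = (\<lambda>x. x)"
    and fin: "finite_measure \<nu>" and X: "sets X \<subseteq> sets \<nu>" "space X = space \<nu>"
    and approx: "\<And>F. F \<in> sets \<nu> \<Longrightarrow> \<exists>F'\<in>sets X. AE x in \<nu>. x \<in> F \<longleftrightarrow> x \<in> F'"
    and B: "is_onb B" "countable B"
    and meas: "\<And>b c. b \<in> B \<Longrightarrow> (\<lambda>x. cinner c (w b x)) \<in> borel_measurable \<nu>"
    and int: "\<And>b b' F A. b \<in> B \<Longrightarrow> b' \<in> B \<Longrightarrow> F \<in> sets X \<Longrightarrow> bounded_op A \<Longrightarrow>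
      has_bochner_integral \<nu> (\<lambda>x. indicator F x *\<^sub>R cinner (w b x) (A (w b' x))) (cinner b (dual_map (M F) A b'))"
  shows "efficient X M"
proof -
  obtain E where "L2_basis \<nu> E" using finite_measure.L2_basis_exists[OF fin] by blast
  then interpret L2_tensor \<nu> E B
    using B by (intro L2_tensor.intro L2_tensor_axioms.intro)
  have dB: "cinner b c = (if b = c then 1 else 0)" if "b \<in> B" "c \<in> B" for b c
    using B(1) that by (simp add: is_onb_def)
  have dense: "closure (cspan B) = UNIV" using B(1) by (simp add: is_onb_def)
  have wL: "w b \<in> weak_L2 \<nu>" if b: "b \<in> B" for b
  proof -
    have "integrable \<nu> (\<lambda>x. indicator (space X) x *\<^sub>R cinner (w b x) (w b x))"
      using int[OF b b sets.top bounded_op_id] by (auto simp: has_bochner_integral_iff)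
    then have "integrable \<nu> (\<lambda>x. Re (indicator (space X) x *\<^sub>R cinner (w b x) (w b x)))" by (rule integrable_Re)
    then have "integrable \<nu> (\<lambda>x. (norm (w b x))\<^sup>2)"
      by (rule Bochner_Integration.integrable_cong[THEN iffD1, rotated -1])
        (auto simp: X(2) cinner_self simp flip: of_real_power)
    then show ?thesis using meas[OF b] by (simp add: weak_L2_def)
  qed
  have u: "cinner (vcoef (w b)) (tensor_op A (mult_proj F) (vcoef (w c))) = cinner b (dual_map (M F) A c)"
    if "b \<in> B" "c \<in> B" "F \<in> sets X" "bounded_op A" for b c F A
  proof -
    have F: "F \<in> sets \<nu>" using that X by blast
    have "cinner (vcoef (w b)) (tensor_op A (mult_proj F) (vcoef (w c)))
        = (LINT x|\<nu>. cinner (w b x) (A (indicator F x *\<^sub>R w c x)))"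
      by (simp add: tensor_op_vcoef wL that F cinner_vcoef weak_L2_op)
    also have "\<dots> = (LINT x|\<nu>. indicator F x *\<^sub>R cinner (w b x) (A (w c x)))"
      by (intro Bochner_Integration.integral_cong) (auto simp: indicator_def bounded_op_zero that)
    also have "\<dots> = cinner b (dual_map (M F) A c)"
      using int[OF that] by (simp add: has_bochner_integral_iff)
    finally show ?thesis .
  qed
  \<comment> \<open>The identity operator and the whole space in \<open>u\<close>: unitality turns
    the formula into preservation of scalar products.\<close>
  have uu: "cinner (vcoef (w b)) (vcoef (w c)) = cinner b c" if "b \<in> B" "c \<in> B" for b c
  proof -
    have "tensor_op (\<lambda>x. x) (mult_proj (space X)) (vcoef (w c)) = vcoef (\<lambda>x. indicator (space X) x *\<^sub>R w c x)"
      using X by (intro tensor_op_vcoef wL that bounded_op_id) auto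
    moreover have "cinner (vcoef (w b)) (vcoef (\<lambda>x. indicator (space X) x *\<^sub>R w c x)) = cinner (vcoef (w b)) (vcoef (w c))"
      using that X weak_L2_op[OF wL[OF that(2)] bounded_op_id, of "space X"]
      by (simp add: cinner_vcoef wL) (intro Bochner_Integration.integral_cong, auto simp: X)
    ultimately show ?thesis using u[OF that sets.top bounded_op_id] by (simp add: unital)
  qed
  obtain V where V: "isometry_op V" "\<And>b. b \<in> B \<Longrightarrow> V b = vcoef (w b)"
    using isometry_from_onb[OF B(1) uu] by blast
  have bV: "bounded_op V" using V(1) by (simp add: isometry_op_def)
  let ?T = "tensor_space supported :: ('x \<Rightarrow> complex, 'h) l2 set"
  have "closure (cspan B) \<subseteq> V -` ?T"
  proof (rule closure_minimal)
    show "cspan B \<subseteq> V -` ?T"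
    proof (rule complex_vector.span_minimal)
      show "B \<subseteq> V -` ?T" using V(2) wL vcoef_in_tensor_space by auto
      show "complex_vector.subspace (V -` ?T)"
        using csubspace_tensor_space[of supported] unfolding complex_vector.subspace_def
        by (auto simp: bounded_op_zero[OF bV] bounded_op_add[OF bV] bounded_op_scaleC[OF bV])
    qed
    show "closed (V -` ?T)"
      by (intro closed_vimage continuous_on_bounded_op bV) (simp add: tensor_space_def)
  qed
  then have range: "range V \<subseteq> ?T" using dense by auto
  have rep: "dual_map (M F) A = cadjoint V \<circ> tensor_op A (mult_proj F) \<circ> V"
    if F: "F \<in> sets X" and A: "bounded_op A" for F A
  proof (rule bounded_op_eq_on_dense_matrix[OF bnd[OF F A] _ dense])
    have "F \<in> sets \<nu>" using F X by blast
    then have "bounded_op (tensor_op A (mult_proj F) :: ('x \<Rightarrow> complex, 'h) l2 \<Rightarrow> _)"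
      unfolding tensor_op_eq[OF B(1) A bounded_op_mult_proj[OF \<open>F \<in> sets \<nu>\<close>]]
      by (intro bounded_op_compose bounded_op_amplify bounded_op_cadjoint bounded_op_slices B A bounded_op_mult_proj)
    then show "bounded_op (cadjoint V \<circ> tensor_op A (mult_proj F) \<circ> V)"
      by (intro bounded_op_compose bounded_op_cadjoint bV)
    fix b c assume "b \<in> B" "c \<in> B"
    then show "cinner b (dual_map (M F) A c) = cinner b ((cadjoint V \<circ> tensor_op A (mult_proj F) \<circ> V) c)"
      by (simp add: V(2) u F A flip: cinner_cadjoint[OF bV])
  qed
  show ?thesis
    unfolding efficient_def
    using csubspace_supported closed_supported spectral_measure_mult_proj[OF X]
      multiplicity_one_mult_proj[OF X(1) approx] V(1) range rep by blast
qed

section \<open>Kraus representations\<close>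

text \<open>The completion makes every subset of a null set measurable, so functions may be changed
  on null sets freely; the replacement of Kraus sums by forms in \<open>VV\<close> relies on
  this.\<close>

lemma measurable_completion_AE:
  fixes f g :: "'a \<Rightarrow> 'b::topological_space"
  assumes f: "f \<in> borel_measurable (completion M)" and eq: "AE x in M. f x = g x"
  shows "g \<in> borel_measurable (completion M)"
proof (rule measurableI)
  fix A :: "'b set" assume A: "A \<in> sets borel"
  show "g -` A \<inter> space (completion M) \<in> sets (completion M)"
  proof (rule completion.in_sets_AE)
    show "f -` A \<inter> space (completion M) \<in> sets (completion M)" using f A by (rule measurable_sets)
    show "AE x in completion M. x \<in> f -` A \<inter> space (completion M) \<longleftrightarrow> x \<in> g -` A \<inter> space (completion M)"
      using eq by (intro AE_completion) (auto elim: eventually_mono)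
  qed auto
qed simp

lemma has_bochner_integral_completion_cong_AE:
  assumes f: "has_bochner_integral (completion M) f I" and eq: "AE x in M. f x = g x"
  shows "has_bochner_integral (completion M) g I"
proof -
  have m: "f \<in> borel_measurable (completion M)"
    using f by (auto simp: has_bochner_integral_iff)
  show ?thesis
    using has_bochner_integral_cong_AE[OF m measurable_completion_AE[OF m eq] AE_completion[OF eq]] f by simp
qed

lemma pred_countable_Ball:
  assumes I: "countable I" and P: "\<And>i. i \<in> I \<Longrightarrow> Measurable.pred M (P i)"
  shows "Measurable.pred M (\<lambda>x. \<forall>i\<in>I. P i x)"
proof (cases "I = {}")
  case False
  have "Measurable.pred M (\<lambda>x. \<forall>n. P (from_nat_into I n) x)"
    by (intro pred_intros_countable P from_nat_into False)
  moreover have "(\<forall>n. P (from_nat_into I n) x) \<longleftrightarrow> (\<forall>i\<in>I. P i x)" for x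
    using from_nat_into[OF False] from_nat_into_surj[OF I] by metis
  ultimately show ?thesis by simp
qed simp

lemma cauchy_schwarz_equality:
  fixes u v :: "'a::complex_hilbert"
  assumes "(cmod (cinner u v))\<^sup>2 = (norm u)\<^sup>2 * (norm v)\<^sup>2" and u: "norm u = 1"
  shows "v = cinner u v *\<^sub>C u"
proof -
  have on: "cinner e f = (if e = f then 1 else 0)" if "e \<in> {u}" "f \<in> {u}" for e f
    using that u by (simp add: cinner_self)
  have "(norm (v - (\<Sum>e\<in>{u}. cinner e v *\<^sub>C e)))\<^sup>2 = (norm v)\<^sup>2 - (\<Sum>e\<in>{u}. (cmod (cinner e v))\<^sup>2)"
    by (rule bessel(1)) (use on in auto)
  then have "(norm (v - cinner u v *\<^sub>C u))\<^sup>2 = 0" using assms by simp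
  then show ?thesis by simp
qed

text \<open>With \<open>A = |c\<rangle>\<langle>d|\<close> the forms given by the Kraus
  representation become scalar products of slices; this is how slices acquire measurability.\<close>

lemma cinner_amplify_ket_bra: "cinner f (amplify (ket_bra c d) g) = cinner (slice c f) (slice d g)"
  unfolding cinner_l2.rep_eq slice.rep_eq Rep_amplify[OF bounded_op_ket_bra]
  by (intro infsum_cong)
    (simp add: ket_bra_def cinner_scaleC_right cinner_complex_def cinner_commute[symmetric] mult.commute)

locale kraus =
  fixes X \<mu> :: "'x measure"
    and M :: "'x set \<Rightarrow> ('h::{complex_hilbert, second_countable_topology} \<Rightarrow> 'h) \<Rightarrow> ('h \<Rightarrow> 'h)"
    and D :: "'h set" and V :: "nat \<Rightarrow> 'x \<Rightarrow> 'h \<Rightarrow> 'h" and B :: "'h set"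
  assumes inst: "instrument X M" and rep: "kraus_representation X M \<mu> D V"
    and B: "is_onb B" "countable B" "B \<subseteq> D"
begin

section \<open>The vectors \<open>VV x \<phi>\<close> and their integrals\<close>

lemma D: "csubspace D" "closure D = UNIV"
  and sets_\<mu>: "sets \<mu> = sets X" and space_\<mu>: "space \<mu> = space X"
  and sigma_finite_\<mu>: "sigma_finite_measure \<mu>"
  using rep by (auto simp: kraus_representation_def)

lemma instrument_parts:
  assumes "F \<in> sets X"
  shows "superop_linear (M F)" "completely_positive (M F)"
    "\<And>T. trace_class T \<Longrightarrow> positive_op T \<Longrightarrow> Re (trace (M F T)) \<le> Re (trace T)"
    "\<And>T. trace_class T \<Longrightarrow> trace_class (M F T)"
  using inst assms by (auto simp: instrument_def superop_linear_def)

abbreviation dual :: "'x set \<Rightarrow> ('h \<Rightarrow> 'h) \<Rightarrow> 'h \<Rightarrow> 'h" where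
  "dual F \<equiv> dual_map (M F)"

lemma bounded_op_dual: "F \<in> sets X \<Longrightarrow> bounded_op A \<Longrightarrow> bounded_op (dual F A)"
  by (intro bounded_op_dual_map instrument_parts)

lemma trace_dual: "F \<in> sets X \<Longrightarrow> bounded_op A \<Longrightarrow> trace_class T \<Longrightarrow> trace (A \<circ> M F T) = trace (dual F A \<circ> T)"
  by (intro trace_dual_map instrument_parts)

lemma dual_unital: "dual (space X) (\<lambda>x. x) = (\<lambda>x. x)"
proof (intro ext, rule cinner_ext)
  fix a b
  have "cinner b (dual (space X) (\<lambda>x. x) a) = trace (dual (space X) (\<lambda>x. x) \<circ> ket_bra a b)"
    by (simp add: trace_compose_ket_bra bounded_op_dual bounded_op_id)
  also have "\<dots> = trace ((\<lambda>x. x) \<circ> M (space X) (ket_bra a b))"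
    by (rule trace_dual[symmetric]) (auto intro: bounded_op_id trace_class_ket_bra)
  also have "\<dots> = trace (ket_bra a b)"
    using inst trace_class_ket_bra[of a b] by (simp add: instrument_def o_def)
  finally show "cinner b (dual (space X) (\<lambda>x. x) a) = cinner b a" by (simp add: trace_ket_bra)
qed

text \<open>For fixed \<open>\<phi>\<close> in \<open>D\<close> this holds almost everywhere, but
  the null set depends on \<open>\<phi>\<close>; hence the condition is imposed vector by
  vector.\<close>

definition reg :: "'x \<Rightarrow> 'h \<Rightarrow> bool" where
  "reg x \<phi> \<longleftrightarrow> \<phi> \<in> D \<and> (\<forall>k\<ge>1. clinear_on D (V k x)) \<and> (\<lambda>k. (norm (V k x \<phi>))\<^sup>2) summable_on {1..}"

text \<open>Kraus operators are numbered from \<open>1\<close>, so coordinate \<open>0\<close> is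
  padded by \<open>0\<close>. Without square-summability the value is arbitrary, which
  \<open>reg\<close> excludes.\<close>

definition VV :: "'x \<Rightarrow> 'h \<Rightarrow> (nat, 'h) l2" where
  "VV x \<phi> = Abs_l2 (\<lambda>k. if 1 \<le> k then V k x \<phi> else 0)"

lemma AE_reg: "\<phi> \<in> D \<Longrightarrow> AE x in \<mu>. reg x \<phi>"
  using rep unfolding kraus_representation_def reg_def by auto

lemma Rep_VV:
  assumes "reg x \<phi>" shows "Rep_l2 (VV x \<phi>) k = (if 1 \<le> k then V k x \<phi> else 0)"
proof -
  have "(\<lambda>k. (norm (V k x \<phi>))\<^sup>2) summable_on {1..}" using assms by (simp add: reg_def)
  then have "(\<lambda>k. (norm (if 1 \<le> k then V k x \<phi> else 0))\<^sup>2) summable_on UNIV"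
    by (rule summable_on_cong_neutral[THEN iffD1, rotated -1]) auto
  then show ?thesis by (simp add: VV_def Rep_Abs_l2)
qed

lemma
  assumes "reg x \<phi>" "reg x \<psi>"
  shows reg_add: "reg x (\<phi> + \<psi>)" and VV_add: "VV x (\<phi> + \<psi>) = VV x \<phi> + VV x \<psi>"
proof -
  have lin: "V k x (\<phi> + \<psi>) = V k x \<phi> + V k x \<psi>" if "1 \<le> k" for k
    using assms that by (auto simp: reg_def clinear_on_def)
  have "(\<lambda>k. (norm (Rep_l2 (VV x \<phi> + VV x \<psi>) k))\<^sup>2) summable_on UNIV" by (rule summable_Rep_l2)
  then have "(\<lambda>k. (norm (V k x (\<phi> + \<psi>)))\<^sup>2) summable_on {1..}"
    by (rule summable_on_cong_neutral[THEN iffD1, rotated -1]) (auto simp: plus_l2.rep_eq Rep_VV assms lin)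
  then show r: "reg x (\<phi> + \<psi>)" using assms D(1) by (simp add: reg_def complex_vector.subspace_add)
  show "VV x (\<phi> + \<psi>) = VV x \<phi> + VV x \<psi>"
    by (rule l2_eqI) (simp add: Rep_VV r assms plus_l2.rep_eq lin)
qed

lemma
  assumes "reg x \<phi>"
  shows reg_scaleC: "reg x (c *\<^sub>C \<phi>)" and VV_scaleC: "VV x (c *\<^sub>C \<phi>) = c *\<^sub>C VV x \<phi>"
proof -
  have lin: "V k x (c *\<^sub>C \<phi>) = c *\<^sub>C V k x \<phi>" if "1 \<le> k" for k
    using assms that by (auto simp: reg_def clinear_on_def)
  have "(\<lambda>k. (norm (Rep_l2 (c *\<^sub>C VV x \<phi>) k))\<^sup>2) summable_on UNIV" by (rule summable_Rep_l2)
  then have "(\<lambda>k. (norm (V k x (c *\<^sub>C \<phi>)))\<^sup>2) summable_on {1..}"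
    by (rule summable_on_cong_neutral[THEN iffD1, rotated -1]) (auto simp: scaleC_l2.rep_eq Rep_VV assms lin)
  then show r: "reg x (c *\<^sub>C \<phi>)" using assms D(1) by (simp add: reg_def complex_vector.subspace_scale)
  show "VV x (c *\<^sub>C \<phi>) = c *\<^sub>C VV x \<phi>"
    by (rule l2_eqI) (simp add: Rep_VV r assms scaleC_l2.rep_eq lin)
qed

lemma infsum_VV:
  assumes "reg x \<phi>" "bounded_op A"
  shows "(\<Sum>\<^sub>\<infinity>k\<in>{1..}. cinner (V k x \<phi>) (A (V k x \<phi>))) = cinner (VV x \<phi>) (amplify A (VV x \<phi>))"
  unfolding cinner_l2.rep_eq
  by (rule infsum_cong_neutral) (auto simp: Rep_VV Rep_amplify assms)

lemma integral_VV_diag: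
  assumes "\<phi> \<in> D" "F \<in> sets X" "bounded_op A"
  shows "has_bochner_integral (completion \<mu>)
    (\<lambda>x. indicator F x *\<^sub>R cinner (VV x \<phi>) (amplify A (VV x \<phi>))) (cinner \<phi> (dual F A \<phi>))"
proof (rule has_bochner_integral_completion_cong_AE)
  show "has_bochner_integral (completion \<mu>)
      (\<lambda>x. indicator F x *\<^sub>R (\<Sum>\<^sub>\<infinity>k\<in>{1..}. cinner (V k x \<phi>) (A (V k x \<phi>)))) (cinner \<phi> (dual F A \<phi>))"
    using rep assms unfolding kraus_representation_def by blast
  show "AE x in \<mu>. indicator F x *\<^sub>R (\<Sum>\<^sub>\<infinity>k\<in>{1..}. cinner (V k x \<phi>) (A (V k x \<phi>)))
      = indicator F x *\<^sub>R cinner (VV x \<phi>) (amplify A (VV x \<phi>))"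
    using AE_reg[OF assms(1)] by eventually_elim (simp only: infsum_VV[OF _ assms(3)])
qed

text \<open>Polarization of \<open>integral_VV_diag\<close>; the integrand polarizes pointwise as
  well, at all outcomes where both vectors are \<open>reg\<close>.\<close>

lemma integral_VV:
  assumes \<phi>: "\<phi> \<in> D" and \<psi>: "\<psi> \<in> D" and F: "F \<in> sets X" and A: "bounded_op A"
  shows "has_bochner_integral (completion \<mu>)
    (\<lambda>x. indicator F x *\<^sub>R cinner (VV x \<phi>) (amplify A (VV x \<psi>))) (cinner \<phi> (dual F A \<psi>))"
proof (rule has_bochner_integral_completion_cong_AE)
  define k where "k c x = indicator F x *\<^sub>R cinner (VV x (\<phi> + c *\<^sub>C \<psi>)) (amplify A (VV x (\<phi> + c *\<^sub>C \<psi>)))" for c x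
  have "\<phi> + c *\<^sub>C \<psi> \<in> D" for c
    using D(1) \<phi> \<psi> by (intro complex_vector.subspace_add complex_vector.subspace_scale)
  then have k: "has_bochner_integral (completion \<mu>) (k c) (cinner (\<phi> + c *\<^sub>C \<psi>) (dual F A (\<phi> + c *\<^sub>C \<psi>)))" for c
    unfolding k_def using F A by (rule integral_VV_diag)
  have "has_bochner_integral (completion \<mu>) (\<lambda>x. (k 1 x - k (-1) x - \<i> * k \<i> x + \<i> * k (- \<i>) x) / 4)
    ((cinner (\<phi> + 1 *\<^sub>C \<psi>) (dual F A (\<phi> + 1 *\<^sub>C \<psi>)) - cinner (\<phi> + (-1) *\<^sub>C \<psi>) (dual F A (\<phi> + (-1) *\<^sub>C \<psi>))
    - \<i> * cinner (\<phi> + \<i> *\<^sub>C \<psi>) (dual F A (\<phi> + \<i> *\<^sub>C \<psi>)) + \<i> * cinner (\<phi> + (- \<i>) *\<^sub>C \<psi>) (dual F A (\<phi> + (- \<i>) *\<^sub>C \<psi>))) / 4)"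
    by (intro has_bochner_integral_divide has_bochner_integral_add has_bochner_integral_diff
      has_bochner_integral_mult_right k)
  then show "has_bochner_integral (completion \<mu>) (\<lambda>x. (k 1 x - k (-1) x - \<i> * k \<i> x + \<i> * k (- \<i>) x) / 4)
      (cinner \<phi> (dual F A \<psi>))"
    unfolding cinner_op_polarization[OF bounded_op_dual[OF F A], of \<phi> \<psi>] scaleC_one .
  show "AE x in \<mu>. (k 1 x - k (-1) x - \<i> * k \<i> x + \<i> * k (- \<i>) x) / 4
      = indicator F x *\<^sub>R cinner (VV x \<phi>) (amplify A (VV x \<psi>))"
    using AE_reg[OF \<phi>] AE_reg[OF \<psi>]
  proof eventually_elim
    case (elim x)
    have eq: "VV x (\<phi> + c *\<^sub>C \<psi>) = VV x \<phi> + c *\<^sub>C VV x \<psi>" for c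
      by (simp add: VV_add VV_scaleC reg_scaleC elim)
    show ?case
      unfolding k_def eq
      unfolding cinner_op_polarization[OF bounded_op_amplify[OF A], of "VV x \<phi>" "VV x \<psi>"] scaleC_one
      by (simp add: indicator_def)
  qed
qed

lemma measurable_VV:
  assumes "\<phi> \<in> D" "\<psi> \<in> D" "bounded_op A"
  shows "(\<lambda>x. cinner (VV x \<phi>) (amplify A (VV x \<psi>))) \<in> borel_measurable (completion \<mu>)"
proof -
  have "(\<lambda>x. indicator (space X) x *\<^sub>R cinner (VV x \<phi>) (amplify A (VV x \<psi>))) \<in> borel_measurable (completion \<mu>)"
    using integral_VV[OF assms(1,2) sets.top assms(3)] by (auto simp: has_bochner_integral_iff)
  then show ?thesis
    by (rule measurable_cong[THEN iffD1, rotated]) (simp add: space_\<mu>)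
qed

lemma measurable_slices:
  assumes "\<phi> \<in> D" "\<psi> \<in> D"
  shows "(\<lambda>x. cinner (slice c (VV x \<phi>)) (slice d (VV x \<psi>))) \<in> borel_measurable (completion \<mu>)"
  using measurable_VV[OF assms bounded_op_ket_bra[of c d]] by (simp add: cinner_amplify_ket_bra)

lemma measurable_norm_slice:
  assumes "\<phi> \<in> D"
  shows "(\<lambda>x. norm (slice c (VV x \<phi>))) \<in> borel_measurable (completion \<mu>)"
proof -
  note [measurable] = measurable_slices[OF assms assms, of c c]
  have "(\<lambda>x. sqrt (Re (cinner (slice c (VV x \<phi>)) (slice c (VV x \<phi>))))) \<in> borel_measurable (completion \<mu>)"
    by measurable
  then show ?thesis by (simp add: cinner_self flip: of_real_power)
qed

text \<open>The Cauchy--Schwarz equality for all slices says that all \<open>V k x\<close> are proportional on the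
  span of \<open>B\<close>.\<close>

definition rank_le_one :: "'x \<Rightarrow> bool" where
  "rank_le_one x \<longleftrightarrow> (\<forall>b\<in>B. \<forall>c\<in>B. \<forall>b'\<in>B. \<forall>c'\<in>B.
    (cmod (cinner (slice c (VV x b)) (slice c' (VV x b'))))\<^sup>2
      = (norm (slice c (VV x b)))\<^sup>2 * (norm (slice c' (VV x b')))\<^sup>2)"

lemma measurable_rank_le_one: "Measurable.pred (completion \<mu>) rank_le_one"
  unfolding rank_le_one_def
proof (intro pred_countable_Ball B(2))
  fix b c b' c' assume "b \<in> B" "c \<in> B" "b' \<in> B" "c' \<in> B"
  then have "b \<in> D" "b' \<in> D" using B(3) by auto
  note [measurable] = measurable_slices[OF this] measurable_norm_slice[OF this(1)] measurable_norm_slice[OF this(2)]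
  show "Measurable.pred (completion \<mu>) (\<lambda>x. (cmod (cinner (slice c (VV x b)) (slice c' (VV x b'))))\<^sup>2
      = (norm (slice c (VV x b)))\<^sup>2 * (norm (slice c' (VV x b')))\<^sup>2)"
    by measurable
qed

definition pivot :: "nat \<Rightarrow> 'x \<Rightarrow> (nat, complex) l2" where
  "pivot n x = slice (snd (from_nat_into (B \<times> B) n)) (VV x (fst (from_nat_into (B \<times> B) n)))"

definition pivot_index :: "'x \<Rightarrow> nat" where
  "pivot_index x = (LEAST n. pivot n x \<noteq> 0)"

text \<open>If all pivots vanish, \<open>pivot_index\<close> is arbitrary but the direction is
  \<open>0\<close>; otherwise it is a unit vector, selected by least index so that the index depends
  measurably on \<open>x\<close>.\<close>

definition direction :: "'x \<Rightarrow> (nat, complex) l2" where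
  "direction x = sgn (pivot (pivot_index x) x)"

text \<open>In the rank one case the single Kraus operator is recovered, up to a phase that depends
  measurably on \<open>x\<close>, by contraction with the direction of the first nonzero slice.\<close>

definition W :: "'h \<Rightarrow> 'x \<Rightarrow> 'h" where
  "W b x = contract (direction x) (VV x b)"

text \<open>Equality in Cauchy-Schwarz with a nonzero pivot puts every slice on the line of
  \<open>direction x\<close>; if the selected pivot vanishes, all slices along \<open>B\<close>
  do.\<close>

lemma tensor_vec_W:
  assumes "rank_le_one x" and b: "b \<in> B"
  shows "tensor_vec (W b x) (direction x) = VV x b"
  unfolding W_def
proof (rule tensor_vec_contract[OF B(1)])
  fix c assume c: "c \<in> B"
  let ?p = "from_nat_into (B \<times> B) (pivot_index x)"
  have BB: "B \<times> B \<noteq> {}" using b by auto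
  then have p: "fst ?p \<in> B" "snd ?p \<in> B" using from_nat_into[of "B \<times> B"] by (auto simp: mem_Times_iff)
  show "slice c (VV x b) = cinner (direction x) (slice c (VV x b)) *\<^sub>C direction x"
  proof (cases "pivot (pivot_index x) x = 0")
    case True
    obtain n where "from_nat_into (B \<times> B) n = (b, c)"
      using from_nat_into_surj[of "B \<times> B" "(b, c)"] B(2) b c by auto
    then have n: "pivot n x = slice c (VV x b)" by (simp add: pivot_def)
    have "slice c (VV x b) = 0"
    proof (rule ccontr)
      assume "slice c (VV x b) \<noteq> 0"
      then have "pivot (pivot_index x) x \<noteq> 0"
        unfolding pivot_index_def using n by (intro LeastI[of "\<lambda>n. pivot n x \<noteq> 0" n]) simp
      with True show False by simp
    qed
    then show ?thesis by simp
  next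
    case False
    let ?s = "pivot (pivot_index x) x"
    have dir: "direction x = inverse (norm ?s) *\<^sub>R ?s" by (simp add: direction_def sgn_div_norm)
    have nd: "norm (direction x) = 1" using False by (simp add: direction_def norm_sgn)
    have "(cmod (cinner ?s (slice c (VV x b))))\<^sup>2 = (norm ?s)\<^sup>2 * (norm (slice c (VV x b)))\<^sup>2"
      using assms(1) p b c unfolding rank_le_one_def pivot_def by blast
    then have "(cmod (cinner (direction x) (slice c (VV x b))))\<^sup>2 = (norm (direction x))\<^sup>2 * (norm (slice c (VV x b)))\<^sup>2"
      using False unfolding nd
      by (simp add: dir scaleR_scaleC cinner_scaleC_left norm_mult power_mult_distrib norm_inverse power_inverse)
    then show ?thesis using nd by (rule cauchy_schwarz_equality)
  qed
qed

lemma cinner_W: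
  assumes "rank_le_one x" and b: "b \<in> B" "b' \<in> B" and A: "bounded_op A"
  shows "cinner (VV x b) (amplify A (VV x b')) = cinner (W b x) (A (W b' x))"
proof -
  have "cinner (VV x b) (amplify A (VV x b')) = cinner (W b x) (A (W b' x)) * cinner (direction x) (direction x)"
    unfolding tensor_vec_W[OF assms(1) b(1), symmetric] tensor_vec_W[OF assms(1) b(2), symmetric]
    by (simp add: amplify_tensor_vec[OF A] cinner_tensor_vec)
  \<comment> \<open>The direction is a unit vector or \<open>0\<close>; in the second case both
    sides of the claim vanish.\<close>
  moreover have "cinner (direction x) (direction x) = 1 \<or> direction x = 0"
    by (auto simp: direction_def cinner_self norm_sgn)
  moreover have "W b x = 0" if "direction x = 0"
    by (rule cinner_ext) (simp add: W_def cinner_contract that)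
  ultimately show ?thesis by auto
qed

text \<open>A component of \<open>W b x\<close> is a scalar product of two slices divided by a norm,
  taken at the index \<open>pivot_index x\<close>. Each fixed index gives a measurable function, and
  the index is measurable with countably many values.\<close>

lemma measurable_W:
  assumes b: "b \<in> B" shows "(\<lambda>x. cinner c (W b x)) \<in> borel_measurable (completion \<mu>)"
proof -
  let ?p = "from_nat_into (B \<times> B)"
  have "B \<times> B \<noteq> {}" using b by auto
  then have "?p n \<in> B \<times> B" for n by (rule from_nat_into)
  then have p: "fst (?p n) \<in> D" for n using B(3) by (metis mem_Times_iff subsetD)
  have bD: "b \<in> D" using b B(3) by blast
  have [measurable]: "(\<lambda>x. norm (pivot n x)) \<in> borel_measurable (completion \<mu>)" for n
    unfolding pivot_def by (rule measurable_norm_slice[OF p])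
  have "Measurable.pred (completion \<mu>) (\<lambda>x. norm (pivot n x) \<noteq> 0)" for n by measurable
  then have [measurable]: "Measurable.pred (completion \<mu>) (\<lambda>x. pivot n x \<noteq> 0)" for n by simp
  have idx: "pivot_index \<in> completion \<mu> \<rightarrow>\<^sub>M count_space UNIV"
    unfolding pivot_index_def by measurable
  have comp: "(\<lambda>x. cinner d (W b x)) \<in> borel_measurable (completion \<mu>)" for d
  proof -
    have "cinner d (W b x) = inverse (norm (pivot (pivot_index x) x)) * cinner (pivot (pivot_index x) x) (slice d (VV x b))" for x
      by (simp add: W_def cinner_contract direction_def sgn_div_norm scaleR_scaleC cinner_scaleC_left)
    moreover have "(\<lambda>x. inverse (norm (pivot (pivot_index x) x)) * cinner (pivot (pivot_index x) x) (slice d (VV x b)))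
        \<in> borel_measurable (completion \<mu>)"
    proof (rule measurable_compose_countable[OF _ idx])
      fix n
      have [measurable]: "(\<lambda>x. cinner (pivot n x) (slice d (VV x b))) \<in> borel_measurable (completion \<mu>)"
        unfolding pivot_def by (rule measurable_slices[OF p bD])
      show "(\<lambda>x. complex_of_real (inverse (norm (pivot n x))) * cinner (pivot n x) (slice d (VV x b))) \<in> borel_measurable (completion \<mu>)"
        by measurable
    qed
    ultimately show ?thesis by simp
  qed
  show ?thesis by (rule comp)
qed

text \<open>Since \<open>\<mu>\<close> is only \<sigma>-finite, \<open>efficientI\<close> is applied
  to a finite measure with strictly positive density \<open>r\<close>; dividing the Kraus operator
  by \<open>sqrt r\<close> leaves all integrals unchanged.\<close>

lemma efficient_if_rank_le_one:
  assumes R: "AE x in \<mu>. rank_le_one x" shows "efficient X M"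
proof -
  interpret sigma_finite_measure \<mu> by (rule sigma_finite_\<mu>)
  obtain h where h: "h \<in> borel_measurable \<mu>" "integral\<^sup>N \<mu> h \<noteq> \<infinity>" "\<And>x. x \<in> space \<mu> \<Longrightarrow> 0 < h x \<and> h x < \<infinity>"
    using Ex_finite_integrable_function by blast
  define r where "r x = enn2real (h x)" for x
  have r_meas: "r \<in> borel_measurable (completion \<mu>)"
    unfolding r_def using h(1) by (intro measurable_completion borel_measurable_enn2real)
  have r_pos: "0 < r x" if "x \<in> space \<mu>" for x
    using h(3)[OF that] by (auto simp: r_def enn2real_positive_iff)
  have hr: "ennreal (r x) = h x" if "x \<in> space \<mu>" for x
    using h(3)[OF that] by (auto simp: r_def less_top)
  define \<nu> where "\<nu> = density (completion \<mu>) (\<lambda>x. ennreal (r x))"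
  have "emeasure \<nu> (space \<nu>) = (\<integral>\<^sup>+x. ennreal (r x) \<partial>completion \<mu>)"
    unfolding \<nu>_def using r_meas by (subst emeasure_density) (auto intro!: nn_integral_cong)
  also have "\<dots> = integral\<^sup>N \<mu> h"
    unfolding nn_integral_completion by (intro nn_integral_cong) (simp add: hr)
  finally have fin: "finite_measure \<nu>" using h(2) by (intro finite_measureI) simp
  define w where "w b x = (1 / sqrt (r x)) *\<^sub>R W b x" for b x
  show ?thesis
  proof (rule efficientI[where X = X and M = M and \<nu> = \<nu> and B = B and w = w, OF bounded_op_dual dual_unital fin _ _ _ B(1,2)])
    show "sets X \<subseteq> sets \<nu>" "space X = space \<nu>" by (auto simp: \<nu>_def sets_\<mu> space_\<mu>)
    show "\<exists>F'\<in>sets X. AE x in \<nu>. x \<in> F \<longleftrightarrow> x \<in> F'" if "F \<in> sets \<nu>" for F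
    proof -
      have F: "F \<in> sets (completion \<mu>)" using that by (simp add: \<nu>_def)
      \<comment> \<open>Measurable sets of \<open>\<nu>\<close> lie in the completed sigma-algebra;
        \<open>main_part\<close> picks a set of \<open>sets X\<close> that differs by a null
        set.\<close>
      have "AE x in \<nu>. x \<in> F \<longleftrightarrow> x \<in> main_part \<mu> F"
        unfolding \<nu>_def using r_meas AE_in_main_part[OF F]
        by (subst AE_density) (auto intro: AE_completion elim: eventually_mono)
      then show ?thesis using main_part_sets[OF F] sets_\<mu> by blast
    qed
    show "(\<lambda>x. cinner c (w b x)) \<in> borel_measurable \<nu>" if b: "b \<in> B" for b c
    proof -
      note [measurable] = measurable_W[OF b, of c] r_meas
      have "(\<lambda>x. complex_of_real (1 / sqrt (r x)) * cinner c (W b x)) \<in> borel_measurable (completion \<mu>)"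
        by measurable
      then show ?thesis by (simp add: \<nu>_def w_def scaleR_scaleC cinner_scaleC_right)
    qed
    show "has_bochner_integral \<nu> (\<lambda>x. indicator F x *\<^sub>R cinner (w b x) (A (w b' x))) (cinner b (dual F A b'))"
      if b: "b \<in> B" "b' \<in> B" and F: "F \<in> sets X" and A: "bounded_op A" for b b' F A
      unfolding \<nu>_def
    proof (rule has_bochner_integral_density)
      have "has_bochner_integral (completion \<mu>) (\<lambda>x. indicator F x *\<^sub>R cinner (W b x) (A (W b' x))) (cinner b (dual F A b'))"
      proof (rule has_bochner_integral_completion_cong_AE[OF integral_VV[OF _ _ F A]])
        show "b \<in> D" "b' \<in> D" using b B(3) by auto
        show "AE x in \<mu>. indicator F x *\<^sub>R cinner (VV x b) (amplify A (VV x b')) = indicator F x *\<^sub>R cinner (W b x) (A (W b' x))"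
          using R by eventually_elim (simp add: cinner_W b A)
      qed
      moreover have "r x *\<^sub>R (indicator F x *\<^sub>R cinner (w b x) (A (w b' x))) = indicator F x *\<^sub>R cinner (W b x) (A (W b' x))"
        if "x \<in> space \<mu>" for x
      proof -
        have "complex_of_real (1 / sqrt (r x)) * complex_of_real (1 / sqrt (r x)) * complex_of_real (r x) = 1"
          using r_pos[OF that] by (simp flip: of_real_mult of_real_divide)
        then show ?thesis
          by (simp add: w_def scaleR_scaleC cinner_scaleC_left cinner_scaleC_right bounded_op_scaleC[OF A] scaleC_complex_def mult_ac)
      qed
      ultimately show int: "has_bochner_integral (completion \<mu>) (\<lambda>x. r x *\<^sub>R (indicator F x *\<^sub>R cinner (w b x) (A (w b' x)))) (cinner b (dual F A b'))"
        by (subst has_bochner_integral_cong[OF refl _ refl]) auto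
      have "(\<lambda>x. (1 / r x) *\<^sub>R (r x *\<^sub>R (indicator F x *\<^sub>R cinner (w b x) (A (w b' x))))) \<in> borel_measurable (completion \<mu>)"
      proof (rule borel_measurable_scaleR)
        show "(\<lambda>x. 1 / r x) \<in> borel_measurable (completion \<mu>)" using r_meas by measurable
        show "(\<lambda>x. r x *\<^sub>R (indicator F x *\<^sub>R cinner (w b x) (A (w b' x)))) \<in> borel_measurable (completion \<mu>)"
          using int unfolding has_bochner_integral_iff by (blast intro: borel_measurable_integrable)
      qed
      then show "(\<lambda>x. indicator F x *\<^sub>R cinner (w b x) (A (w b' x))) \<in> borel_measurable (completion \<mu>)"
        by (rule measurable_cong[THEN iffD1, rotated]) (use r_pos in force)
      show "r \<in> borel_measurable (completion \<mu>)" by (rule r_meas)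
      show "AE x in completion \<mu>. 0 \<le> r x" by (simp add: r_def)
    qed
  qed
qed

end

lemma completion_ex_borel_measurable_complex:
  fixes g :: "'a \<Rightarrow> complex"
  assumes g: "g \<in> borel_measurable (completion M)"
  obtains g' where "g' \<in> borel_measurable M" "AE x in M. g x = g' x"
proof -
  have "(\<lambda>x. Re (g x)) \<in> borel_measurable (completion M)" "(\<lambda>x. Im (g x)) \<in> borel_measurable (completion M)"
    using g by measurable
  then obtain u v where [measurable]: "u \<in> borel_measurable M" "v \<in> borel_measurable M"
    and uv: "AE x in M. Re (g x) = u x" "AE x in M. Im (g x) = v x"
    by (metis completion_ex_borel_measurable_real)
  have "(\<lambda>x. Complex (u x) (v x)) \<in> borel_measurable M"
    unfolding Complex_eq by measurable
  moreover have "AE x in M. g x = Complex (u x) (v x)"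
    using uv by eventually_elim (simp add: complex_eq_iff)
  ultimately show thesis using that by blast
qed

lemma has_bochner_integral_completion_iff:
  fixes f :: "'a \<Rightarrow> 'b::{banach, second_countable_topology}"
  assumes "f \<in> borel_measurable M"
  shows "has_bochner_integral (completion M) f I \<longleftrightarrow> has_bochner_integral M f I"
  using assms by (simp add: has_bochner_integral_iff integrable_completion integral_completion)

lemma norm_zero_square_iff: "cinner f (amplify (\<lambda>x. x) f) = complex_of_real ((norm f)\<^sup>2)"
  by (simp add: amplify_id cinner_self)

context kraus
begin

text \<open>If at most \<open>V 1 x\<close> is nonzero, then \<open>VV x b\<close> is
  \<open>V 1 x b\<close> tensored with the unit vector of index \<open>1\<close>; all slices lie on
  one line and Cauchy-Schwarz is an equality.\<close>

lemma nonzero_on_if_not_rank_le_one: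
  assumes R: "\<not> rank_le_one x" and reg: "\<And>b. b \<in> B \<Longrightarrow> reg x b"
  shows "\<exists>k\<ge>2. nonzero_on D (V k x)"
proof (rule ccontr)
  assume z: "\<not> (\<exists>k\<ge>2. nonzero_on D (V k x))"
  have VV: "VV x b = tensor_vec (V 1 x b) (unit_l2 1)" if b: "b \<in> B" for b
  proof (rule l2_eqI)
    fix k :: nat
    have "V k x b = 0" if "k \<ge> 2" using z that b B(3) by (auto simp: nonzero_on_def)
    then show "Rep_l2 (VV x b) k = Rep_l2 (tensor_vec (V 1 x b) (unit_l2 1)) k"
      by (cases "k = 0 \<or> k = 1") (auto simp: Rep_VV reg b tensor_vec.rep_eq unit_l2.rep_eq)
  qed
  have n: "norm (unit_l2 1 :: (nat, complex) l2) = 1"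
  proof -
    have "complex_of_real ((norm (unit_l2 1 :: (nat, complex) l2))\<^sup>2) = 1"
      by (simp only: cinner_self[symmetric] cinner_unit_l2) (simp add: unit_l2.rep_eq)
    then have "(norm (unit_l2 1 :: (nat, complex) l2))\<^sup>2 = 1" by (simp only: of_real_eq_1_iff)
    then show ?thesis by (intro power2_eq_imp_eq[of _ 1]) simp_all
  qed
  have "rank_le_one x"
    unfolding rank_le_one_def
    by (simp add: VV slice_tensor_vec cinner_scaleC_left cinner_scaleC_right cinner_self n n[unfolded One_nat_def] norm_scaleC norm_mult power_mult_distrib)
  with R show False ..
qed

text \<open>If proportionality held almost everywhere the instrument would be efficient, so the set
  of failure is not null. There some \<open>V k x\<close> with \<open>k \<ge> 2\<close> is nonzero,
  and the ordering in the normalization makes \<open>V 2 x\<close> nonzero.\<close>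

lemma strong_set:
  assumes nrm: "kraus_normalized \<mu> D V" and neff: "\<not> efficient X M"
  obtains Fs where "Fs \<in> sets X" "\<exists>T. trace_class T \<and> M Fs T \<noteq> (\<lambda>_. 0)"
    "\<And>x. x \<in> Fs \<Longrightarrow> nonzero_on D (V 2 x)" "\<And>x. x \<in> Fs \<Longrightarrow> \<not> rank_le_one x"
    "\<And>x b. x \<in> Fs \<Longrightarrow> b \<in> B \<Longrightarrow> reg x b"
proof -
  define good where "good x \<longleftrightarrow> (\<forall>b\<in>B. reg x b) \<and>
    (\<forall>k\<ge>1. \<not> nonzero_on D (V k x) \<longrightarrow> (\<forall>k'>k. \<not> nonzero_on D (V k' x)))" for x
  have "AE x in \<mu>. \<forall>b\<in>B. reg x b"
    using AE_reg B(2,3) by (subst AE_ball_countable) auto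
  moreover have "AE x in \<mu>. \<forall>k\<ge>1. \<not> nonzero_on D (V k x) \<longrightarrow> (\<forall>k'>k. \<not> nonzero_on D (V k' x))"
    using nrm unfolding kraus_normalized_def by eventually_elim blast
  ultimately have "AE x in \<mu>. good x" unfolding good_def by eventually_elim blast
  then obtain N where N: "{x \<in> space \<mu>. \<not> good x} \<subseteq> N" "emeasure \<mu> N = 0" "N \<in> sets \<mu>"
    by (rule AE_E)
  define G where "G = {x \<in> space \<mu>. \<not> rank_le_one x}"
  have "{x \<in> space (completion \<mu>). \<not> rank_le_one x} \<in> sets (completion \<mu>)"
    using measurable_rank_le_one by measurable
  then have G: "G \<in> sets (completion \<mu>)" by (simp add: G_def)
  \<comment> \<open>The set of failure is measurable only for the completion; its
    \<open>main_part\<close> without \<open>N\<close> is a set in \<open>sets X\<close> on which the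
    properties hold without exception.\<close>
  define Fs where "Fs = main_part \<mu> G - N"
  have Fs: "Fs \<in> sets X" unfolding Fs_def using main_part_sets[OF G] N(3) sets_\<mu> by auto
  have sub: "main_part \<mu> G \<subseteq> G" using main_part_null_part_Un[OF G] by blast
  have "N \<in> null_sets \<mu>" using N by auto
  have AE_Fs: "AE x in \<mu>. x \<in> Fs \<longleftrightarrow> \<not> rank_le_one x"
    using AE_in_main_part[OF G] AE_not_in[OF \<open>N \<in> null_sets \<mu>\<close>] AE_space[of \<mu>] unfolding Fs_def
    by eventually_elim (auto simp: G_def)
  have Fs_rank: "\<not> rank_le_one x" if "x \<in> Fs" for x using that sub by (auto simp: Fs_def G_def)
  have Fs_good: "good x" if "x \<in> Fs" for x
    using that sub N(1) by (auto simp: Fs_def G_def)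
  have not_null: "\<not> (AE x in \<mu>. x \<notin> Fs)"
  proof
    assume "AE x in \<mu>. x \<notin> Fs"
    with AE_Fs have "AE x in \<mu>. rank_le_one x" by eventually_elim blast
    with neff efficient_if_rank_le_one show False by blast
  qed
  \<comment> \<open>If \<open>M Fs\<close> vanished, \<open>VV x b\<close> would be \<open>0\<close>
    for all \<open>b\<close> at almost every outcome of \<open>Fs\<close>, making
    \<open>rank_le_one\<close> trivially true there.\<close>
  have "\<exists>T. trace_class T \<and> M Fs T \<noteq> (\<lambda>_. 0)"
  proof (rule ccontr)
    assume "\<not> (\<exists>T. trace_class T \<and> M Fs T \<noteq> (\<lambda>_. 0))"
    then have zero: "M Fs T = (\<lambda>_. 0)" if "trace_class T" for T using that by blast
    have "AE x in \<mu>. x \<in> Fs \<longrightarrow> VV x b = 0" if b: "b \<in> B" for b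
    proof -
      have bD: "b \<in> D" using b B(3) by blast
      have "cinner b (dual Fs (\<lambda>x. x) b) = trace ((\<lambda>x. x) \<circ> M Fs (ket_bra b b))"
        using Fs by (simp add: trace_dual bounded_op_id trace_class_ket_bra trace_compose_ket_bra bounded_op_dual)
      also have "\<dots> = 0" by (simp add: zero trace_class_ket_bra o_def trace_def)
      finally have "has_bochner_integral (completion \<mu>) (\<lambda>x. indicator Fs x *\<^sub>R cinner (VV x b) (amplify (\<lambda>x. x) (VV x b))) 0"
        using integral_VV_diag[OF bD Fs bounded_op_id] by simp
      from has_bochner_integral_bounded_linear[OF bounded_linear_Re this]
      have I: "has_bochner_integral (completion \<mu>) (\<lambda>x. indicator Fs x * (norm (VV x b))\<^sup>2) 0"
        by (simp add: norm_zero_square_iff del: of_real_power)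
      then have "AE x in completion \<mu>. indicator Fs x * (norm (VV x b))\<^sup>2 = 0"
        by (subst integral_nonneg_eq_0_iff_AE[symmetric]) (auto simp: has_bochner_integral_iff)
      then show ?thesis unfolding AE_completion_iff by eventually_elim (auto simp: indicator_def)
    qed
    then have "AE x in \<mu>. \<forall>b\<in>B. x \<in> Fs \<longrightarrow> VV x b = 0"
      using B(2) by (subst AE_ball_countable) auto
    then have "AE x in \<mu>. x \<notin> Fs"
    proof eventually_elim
      case (elim x)
      then have "rank_le_one x" if "x \<in> Fs" using that by (simp add: rank_le_one_def)
      then show ?case using Fs_rank by blast
    qed
    with not_null show False ..
  qed
  moreover have "nonzero_on D (V 2 x)" if x: "x \<in> Fs" for x
  proof -
    obtain k where k: "k \<ge> 2" "nonzero_on D (V k x)"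
      using nonzero_on_if_not_rank_le_one[OF Fs_rank[OF x]] Fs_good[OF x] unfolding good_def by blast
    show ?thesis
    proof (rule ccontr)
      assume n: "\<not> nonzero_on D (V 2 x)"
      then have "\<not> nonzero_on D (V k x)" if "k > 2"
        using Fs_good[OF x] that unfolding good_def by (metis one_le_numeral)
      then show False using k n by (cases "k = 2") auto
    qed
  qed
  ultimately show thesis using that[OF Fs] Fs_rank Fs_good unfolding good_def by blast
qed

section \<open>Posteriori measures and posteriori states\<close>

lemma
  assumes \<rho>: "trace_class \<rho>" "positive_op \<rho>"
  shows sets_posteriori: "sets (posteriori_measure X M \<rho>) = sets X"
    and space_posteriori: "space (posteriori_measure X M \<rho>) = space X"
    and emeasure_posteriori: "F \<in> sets X \<Longrightarrow> emeasure (posteriori_measure X M \<rho>) F = ennreal (Re (trace (M F \<rho>)))"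
proof -
  show "sets (posteriori_measure X M \<rho>) = sets X" "space (posteriori_measure X M \<rho>) = space X"
    by (simp_all add: posteriori_measure_def sets.space_closed)
  have nonneg: "0 \<le> Re (trace (M F \<rho>))" if "F \<in> sets X" for F
    by (rule Re_trace_nonneg[OF instrument_parts(4)[OF that \<rho>(1)]
        completely_positive_positive[OF instrument_parts(2)[OF that] \<rho>]])
  have sums: "(\<lambda>n::nat. trace (M (F n) \<rho>)) sums trace (M (\<Union>n. F n) \<rho>)"
    if "disjoint_family F" "range F \<subseteq> sets X" for F
  proof -
    have "\<forall>A T. bounded_op A \<and> trace_class T \<longrightarrow>
        (\<lambda>n::nat. trace (A \<circ> M (F n) T)) sums trace (A \<circ> M (\<Union>n. F n) T)"
      by (rule conjunct1[OF conjunct2[OF inst[unfolded instrument_def]], THEN spec, THEN mp, OF conjI[OF that]])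
    from this[rule_format, of "\<lambda>x. x" \<rho>] show ?thesis using \<rho>(1) bounded_op_id by (simp add: o_def)
  qed
  \<comment> \<open>Additivity for a sequence of empty sets gives a convergent constant series,
    whose terms must vanish.\<close>
  have empty: "trace (M {} \<rho>) = 0"
  proof -
    have "(\<lambda>n::nat. trace (M {} \<rho>)) sums trace (M (\<Union>n::nat. {}) \<rho>)"
      by (rule sums[of "\<lambda>_. {}"]) (auto simp: disjoint_family_on_def)
    then have "summable (\<lambda>n::nat. trace (M {} \<rho>))" by (rule sums_summable)
    then show ?thesis by (simp add: summable_const_iff)
  qed
  show "emeasure (posteriori_measure X M \<rho>) F = ennreal (Re (trace (M F \<rho>)))" if "F \<in> sets X"
    unfolding posteriori_measure_def
  proof (rule emeasure_measure_of_sigma[OF sets.sigma_algebra_axioms _ _ that])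
    show "positive (sets X) (\<lambda>F. ennreal (Re (trace (M F \<rho>))))" by (simp add: positive_def empty)
    show "countably_additive (sets X) (\<lambda>F. ennreal (Re (trace (M F \<rho>))))"
      unfolding countably_additive_def
    proof safe
      fix F :: "nat \<Rightarrow> 'x set" assume F: "range F \<subseteq> sets X" "disjoint_family F"
      have s: "(\<lambda>n. Re (trace (M (F n) \<rho>))) sums Re (trace (M (\<Union>n. F n) \<rho>))"
        by (intro sums_Re sums F)
      have "(\<Sum>n. ennreal (Re (trace (M (F n) \<rho>)))) = ennreal (\<Sum>n. Re (trace (M (F n) \<rho>)))"
        using F s by (intro suminf_ennreal2 nonneg) (auto simp: sums_iff)
      then show "(\<Sum>n. ennreal (Re (trace (M (F n) \<rho>)))) = ennreal (Re (trace (M (\<Union>n. F n) \<rho>)))"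
        using s by (simp add: sums_iff)
    qed
  qed
qed

lemma dual_null:
  assumes N: "N \<in> sets X" "emeasure \<mu> N = 0" and A: "bounded_op A"
  shows "dual N A = (\<lambda>_. 0)"
proof (rule bounded_op_eq_on_dense_form[OF bounded_op_dual[OF N(1) A] _ D])
  show "bounded_op (\<lambda>_. 0 :: 'h)" by (rule bounded_opI[where K = 0]) auto
  fix \<phi> assume \<phi>: "\<phi> \<in> D"
  have "N \<in> null_sets \<mu>" using N sets_\<mu> by auto
  then have "AE x in \<mu>. x \<notin> N" by (rule AE_not_in)
  then have "AE x in \<mu>. indicator N x *\<^sub>R cinner (VV x \<phi>) (amplify A (VV x \<phi>)) = 0"
    by eventually_elim simp
  from has_bochner_integral_completion_cong_AE[OF integral_VV_diag[OF \<phi> N(1) A] this]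
  have "has_bochner_integral (completion \<mu>) (\<lambda>_. 0 :: complex) (cinner \<phi> (dual N A \<phi>))" .
  then show "cinner \<phi> (dual N A \<phi>) = cinner \<phi> 0" by (simp add: has_bochner_integral_iff)
qed

text \<open>Absolute continuity with respect to \<open>\<mu>\<close>: on a \<open>\<mu>\<close>-null
  set the quadratic forms over \<open>D\<close> vanish, and with them the dual map.\<close>

lemma AE_posteriori:
  assumes \<rho>: "trace_class \<rho>" "positive_op \<rho>" and P: "AE x in \<mu>. P x"
  shows "AE x in posteriori_measure X M \<rho>. P x"
proof -
  obtain N where N: "{x \<in> space \<mu>. \<not> P x} \<subseteq> N" "emeasure \<mu> N = 0" "N \<in> sets \<mu>"
    using P by (rule AE_E)
  have NX: "N \<in> sets X" using N sets_\<mu> by simp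
  have "trace (M N \<rho>) = trace (dual N (\<lambda>x. x) \<circ> \<rho>)"
    using trace_dual[OF NX bounded_op_id \<rho>(1)] by (simp add: o_def)
  also have "\<dots> = 0" by (simp add: dual_null[OF NX N(2) bounded_op_id] o_def trace_def)
  finally have "emeasure (posteriori_measure X M \<rho>) N = 0"
    by (simp add: emeasure_posteriori[OF \<rho> NX])
  then show ?thesis
    using N(1) NX by (intro AE_I[of _ _ N]) (auto simp: sets_posteriori[OF \<rho>] space_posteriori[OF \<rho>] space_\<mu>)
qed

end

text \<open>The partial trace of \<open>|\<eta>\<rangle>\<langle>\<eta>|\<close> over \<open>\<ell>\<^sup>2\<close>.\<close>

definition reduced :: "(nat, 'h::complex_hilbert) l2 \<Rightarrow> 'h \<Rightarrow> 'h" where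
  "reduced \<eta> z = (\<Sum>n. ket_bra (Rep_l2 \<eta> n) (Rep_l2 \<eta> n) z)"

lemma nuclear_rep_reduced: "nuclear_rep (reduced \<eta>) (Rep_l2 \<eta>) (Rep_l2 \<eta>)"
proof -
  have "summable (\<lambda>n. (norm (Rep_l2 \<eta> n))\<^sup>2)"
    using summable_Rep_l2 by (rule summable_on_imp_summable)
  then have "summable (\<lambda>n. norm (Rep_l2 \<eta> n) * norm (Rep_l2 \<eta> n))" by (simp add: power2_eq_square)
  from nuclear_rep_exists[OF this] show ?thesis by (simp add: reduced_def[abs_def])
qed

lemma trace_compose_reduced:
  fixes \<eta> :: "(nat, 'h::{complex_hilbert, second_countable_topology}) l2"
  assumes A: "bounded_op A" shows "trace (A \<circ> reduced \<eta>) = cinner \<eta> (amplify A \<eta>)"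
proof -
  have "(\<lambda>n. cinner (Rep_l2 \<eta> n) (A (Rep_l2 \<eta> n))) sums trace (A \<circ> reduced \<eta>)"
    by (intro nuclear_rep_trace(2) nuclear_rep_compose A nuclear_rep_reduced)
  moreover have "(\<lambda>n. cinner (Rep_l2 \<eta> n) (A (Rep_l2 \<eta> n))) sums cinner \<eta> (amplify A \<eta>)"
    using has_sum_imp_sums[OF has_sum_cinner_l2[of \<eta> "amplify A \<eta>"]] by (simp add: Rep_amplify A)
  ultimately show ?thesis by (rule sums_unique2)
qed

lemma state_reduced:
  fixes \<eta> :: "(nat, 'h::{complex_hilbert, second_countable_topology}) l2"
  assumes "norm \<eta> = 1" shows "state (reduced \<eta>)"
proof -
  have "trace (reduced \<eta>) = 1"
    using trace_compose_reduced[OF bounded_op_id, of \<eta>] assms by (simp add: o_def amplify_id cinner_self)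
  moreover have "trace_class (reduced \<eta>)" using nuclear_rep_reduced trace_class_iff by blast
  ultimately show ?thesis
    using positive_op_nuclear_rep[OF nuclear_rep_reduced] by (simp add: state_def)
qed

text \<open>If the partial trace is \<open>|y\<rangle>\<langle>y|\<close>, its form vanishes at the
  component \<open>z\<close> of a coordinate orthogonal to \<open>y\<close>. That form is a sum of
  squares, one of which is \<open>\<parallel>z\<parallel>^4\<close>.\<close>

lemma reduced_pure:
  assumes "pure_state (reduced \<eta>)"
  obtains y where "\<eta> = tensor_vec y (slice y \<eta>)"
proof -
  obtain y where y: "norm y = 1" "reduced \<eta> = ket_bra y y" using assms by (auto simp: pure_state_def)
  have "Rep_l2 \<eta> k = cinner y (Rep_l2 \<eta> k) *\<^sub>C y" for k
  proof -
    define z where "z = Rep_l2 \<eta> k - cinner y (Rep_l2 \<eta> k) *\<^sub>C y"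
    have yz: "cinner y z = 0" by (simp add: z_def cinner_diff_right cinner_scaleC_right cinner_self y)
    have "((\<lambda>n. complex_of_real ((cmod (cinner z (Rep_l2 \<eta> n)))\<^sup>2)) has_sum cinner z (reduced \<eta> z)) UNIV"
      using nuclear_rep_has_sum[OF nuclear_rep_reduced[of \<eta>], of z z] by (simp only: cinner_mult_commute)
    moreover have "cinner z (reduced \<eta> z) = 0" by (simp add: y ket_bra_def yz)
    ultimately have "((\<lambda>n. (cmod (cinner z (Rep_l2 \<eta> n)))\<^sup>2) has_sum 0) UNIV"
      by (metis has_sum_of_real_iff of_real_0)
    then have "(cmod (cinner z (Rep_l2 \<eta> k)))\<^sup>2 = 0"
      by (rule nonneg_has_sum_le_0D[of _ UNIV, OF _ _ _ UNIV_I]) auto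
    moreover have "cinner z (Rep_l2 \<eta> k) = cinner z z"
      using yz cinner_eq_zero_commute[of y z] by (simp add: z_def[of] cinner_diff_right cinner_scaleC_right)
    ultimately have "z = 0" by simp
    then show ?thesis by (simp add: z_def)
  qed
  then have "\<eta> = tensor_vec y (slice y \<eta>)"
    by (intro l2_eqI) (simp add: tensor_vec.rep_eq slice.rep_eq)
  with that show thesis by blast
qed

context kraus
begin

text \<open>Where \<open>VV x \<phi> = 0\<close> this is not a state, but such outcomes are null for
  the posteriori measure, whose density is
  \<open>\<parallel>VV x \<phi>\<parallel>^2\<close>.\<close>

definition posterior :: "'h \<Rightarrow> 'x \<Rightarrow> 'h \<Rightarrow> 'h" where
  "posterior \<phi> x = reduced (sgn (VV x \<phi>))"

text \<open>The case \<open>A = 1\<close> identifies the density of the posteriori measure; for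
  general \<open>A\<close> the same density cancels the normalization in \<open>posterior\<close>.
  The second claim translates null sets accordingly.\<close>

lemma posteriori_states_posterior:
  assumes \<phi>: "\<phi> \<in> D" and n1: "norm \<phi> = 1"
  shows "posteriori_states X M (ket_bra \<phi> \<phi>) (posterior \<phi>)"
    and "(AE x in posteriori_measure X M (ket_bra \<phi> \<phi>). P x) \<longleftrightarrow> (AE x in \<mu>. VV x \<phi> \<noteq> 0 \<longrightarrow> P x)"
proof -
  let ?\<rho> = "ket_bra \<phi> \<phi>" and ?m = "posteriori_measure X M (ket_bra \<phi> \<phi>)"
  have pos: "positive_op ?\<rho>"
    unfolding positive_op_def ket_bra_def cinner_scaleC_right
    by (metis cinner_mult_commute mult.commute nonneg_Reals_of_real_iff zero_le_power2)
  note \<rho> = trace_class_ket_bra[of \<phi> \<phi>] pos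
  have dens: "has_bochner_integral (completion \<mu>) (\<lambda>x. indicator F x *\<^sub>R (norm (VV x \<phi>))\<^sup>2) (Re (trace (M F ?\<rho>)))"
    if F: "F \<in> sets X" for F
  proof -
    have "cinner \<phi> (dual F (\<lambda>x. x) \<phi>) = trace (M F ?\<rho>)"
      using trace_dual[OF F bounded_op_id \<rho>(1)] trace_compose_ket_bra[OF bounded_op_dual[OF F bounded_op_id], of \<phi> \<phi>]
      by (simp add: fun.map_ident[abs_def] o_def[of "\<lambda>x. x"])
    with has_bochner_integral_bounded_linear[OF bounded_linear_Re integral_VV_diag[OF \<phi> F bounded_op_id]]
    show ?thesis by (simp add: norm_zero_square_iff del: of_real_power)
  qed
  have "has_bochner_integral (completion \<mu>) (\<lambda>x. (norm (VV x \<phi>))\<^sup>2) (Re (trace (M (space X) ?\<rho>)))"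
    using dens[OF sets.top] by (subst has_bochner_integral_cong[OF refl _ refl]) (auto simp: space_\<mu>)
  then have nm: "(\<lambda>x. (norm (VV x \<phi>))\<^sup>2) \<in> borel_measurable (completion \<mu>)"
    by (auto simp: has_bochner_integral_iff)
  obtain f0 where f0: "f0 \<in> borel_measurable \<mu>" "AE x in \<mu>. (norm (VV x \<phi>))\<^sup>2 = f0 x"
    using completion_ex_borel_measurable_real[OF nm] by blast
  \<comment> \<open>The density has to be measurable for \<open>\<mu>\<close> itself, not only for
    its completion; \<open>max\<close> keeps this version nonnegative.\<close>
  define f where "f x = max 0 (f0 x)" for x
  have f [measurable]: "f \<in> borel_measurable \<mu>" unfolding f_def using f0(1) by measurable
  have f_eq: "AE x in \<mu>. (norm (VV x \<phi>))\<^sup>2 = f x"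
    using f0(2) by eventually_elim (metis f_def max.absorb2 zero_le_power2)
  have f_nonneg: "0 \<le> f x" for x by (simp add: f_def)
  have m_eq: "?m = density \<mu> (\<lambda>x. ennreal (f x))"
  proof (rule measure_eqI)
    show "sets ?m = sets (density \<mu> (\<lambda>x. ennreal (f x)))" by (simp add: sets_posteriori[OF \<rho>] sets_\<mu>)
    fix F assume "F \<in> sets ?m"
    then have F: "F \<in> sets X" by (simp add: sets_posteriori[OF \<rho>])
    then have F' [measurable]: "F \<in> sets \<mu>" by (simp add: sets_\<mu>)
    have "has_bochner_integral (completion \<mu>) (\<lambda>x. indicator F x *\<^sub>R f x) (Re (trace (M F ?\<rho>)))"
      by (rule has_bochner_integral_completion_cong_AE[OF dens[OF F]])
        (use f_eq in eventually_elim, simp)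
    then have "has_bochner_integral \<mu> (\<lambda>x. indicator F x *\<^sub>R f x) (Re (trace (M F ?\<rho>)))"
      by (subst (asm) has_bochner_integral_completion_iff) measurable
    then have "(\<integral>\<^sup>+x. ennreal (indicator F x * f x) \<partial>\<mu>) = ennreal (Re (trace (M F ?\<rho>)))"
      by (subst nn_integral_eq_integral) (auto simp: has_bochner_integral_iff f_nonneg)
    then have "emeasure (density \<mu> (\<lambda>x. ennreal (f x))) F = ennreal (Re (trace (M F ?\<rho>)))"
      using F' by (subst emeasure_density) (auto simp: ennreal_indicator ennreal_mult' mult.commute f_nonneg)
    then show "emeasure ?m F = emeasure (density \<mu> (\<lambda>x. ennreal (f x))) F"
      by (simp add: emeasure_posteriori[OF \<rho> F])
  qed
  have AE_m: "(AE x in ?m. P x) \<longleftrightarrow> (AE x in \<mu>. VV x \<phi> \<noteq> 0 \<longrightarrow> P x)" for P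
  proof -
    have "(AE x in ?m. P x) \<longleftrightarrow> (AE x in \<mu>. 0 < f x \<longrightarrow> P x)"
      unfolding m_eq by (subst AE_density) auto
    also have "\<dots> \<longleftrightarrow> (AE x in \<mu>. VV x \<phi> \<noteq> 0 \<longrightarrow> P x)"
    proof -
      have e: "AE x in \<mu>. 0 < f x \<longleftrightarrow> VV x \<phi> \<noteq> 0"
        using f_eq by eventually_elim (metis norm_eq_zero zero_eq_power2 zero_le_power2 order_le_less order_less_irrefl)
      show ?thesis
      proof
        assume "AE x in \<mu>. 0 < f x \<longrightarrow> P x" with e show "AE x in \<mu>. VV x \<phi> \<noteq> 0 \<longrightarrow> P x" by eventually_elim simp
      next
        assume "AE x in \<mu>. VV x \<phi> \<noteq> 0 \<longrightarrow> P x" with e show "AE x in \<mu>. 0 < f x \<longrightarrow> P x" by eventually_elim simp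
      qed
    qed
    finally show ?thesis .
  qed
  then show "(AE x in ?m. P x) \<longleftrightarrow> (AE x in \<mu>. VV x \<phi> \<noteq> 0 \<longrightarrow> P x)" .
  \<comment> \<open>Valid also where \<open>VV x \<phi> = 0\<close>, since both sides are then
    \<open>0\<close>.\<close>
  have tr: "(norm (VV x \<phi>))\<^sup>2 *\<^sub>R trace (A \<circ> posterior \<phi> x) = cinner (VV x \<phi>) (amplify A (VV x \<phi>))"
    if A: "bounded_op A" for A x
  proof (cases "VV x \<phi> = 0")
    case False
    have "cinner (VV x \<phi>) (amplify A (VV x \<phi>))
        = cinner (norm (VV x \<phi>) *\<^sub>R sgn (VV x \<phi>)) (amplify A (norm (VV x \<phi>) *\<^sub>R sgn (VV x \<phi>)))"
      using False by (simp add: sgn_div_norm)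
    also have "\<dots> = (norm (VV x \<phi>))\<^sup>2 *\<^sub>R cinner (sgn (VV x \<phi>)) (amplify A (sgn (VV x \<phi>)))"
      by (simp add: scaleR_scaleC cinner_scaleC_left cinner_scaleC_right bounded_op_scaleC[OF bounded_op_amplify[OF A]]
        scaleC_complex_def power2_eq_square)
    finally show ?thesis by (simp add: posterior_def trace_compose_reduced A)
  qed simp
  show "posteriori_states X M ?\<rho> (posterior \<phi>)"
    unfolding posteriori_states_def
  proof (intro conjI allI impI ballI)
    show "AE x in ?m. state (posterior \<phi> x)"
      unfolding AE_m posterior_def by (intro AE_I2 impI state_reduced) (simp add: norm_sgn)
    fix A :: "'h \<Rightarrow> 'h" assume A: "bounded_op A"
    define g where "g x = trace (A \<circ> posterior \<phi> x)" for x
    have [measurable]: "(\<lambda>x. cinner (VV x \<phi>) (amplify A (VV x \<phi>))) \<in> borel_measurable (completion \<mu>)"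
      by (rule measurable_VV[OF \<phi> \<phi> A])
    note [measurable] = nm
    have h_meas: "(\<lambda>x. cinner (VV x \<phi>) (amplify A (VV x \<phi>)) / complex_of_real ((norm (VV x \<phi>))\<^sup>2)) \<in> borel_measurable (completion \<mu>)"
      by measurable
    obtain g' where g' [measurable]: "g' \<in> borel_measurable \<mu>"
      and g'_eq: "AE x in \<mu>. cinner (VV x \<phi>) (amplify A (VV x \<phi>)) / complex_of_real ((norm (VV x \<phi>))\<^sup>2) = g' x"
      using completion_ex_borel_measurable_complex[OF h_meas] by blast
    have g_eq: "AE x in ?m. g' x = g x"
      unfolding AE_m using g'_eq
    proof eventually_elim
      case (elim x)
      show ?case
      proof
        assume "VV x \<phi> \<noteq> 0"
        then have "g x = cinner (VV x \<phi>) (amplify A (VV x \<phi>)) / complex_of_real ((norm (VV x \<phi>))\<^sup>2)"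
          using tr[OF A, of x] by (simp add: g_def scaleR_conv_of_real field_simps)
        then show "g' x = g x" using elim by simp
      qed
    qed
    have g'm: "g' \<in> borel_measurable ?m" unfolding m_eq by simp
    show "(\<lambda>x. trace (A \<circ> posterior \<phi> x)) \<in> borel_measurable (completion ?m)"
      using measurable_completion_AE[OF measurable_completion[OF g'm] g_eq] by (simp add: g_def)
    fix F assume F: "F \<in> sets X"
    then have F' [measurable]: "F \<in> sets \<mu>" by (simp add: sets_\<mu>)
    have "cinner \<phi> (dual F A \<phi>) = trace (A \<circ> M F ?\<rho>)"
      using trace_dual[OF F A \<rho>(1)] by (simp add: trace_compose_ket_bra bounded_op_dual F A)
    with integral_VV_diag[OF \<phi> F A]
    have I: "has_bochner_integral (completion \<mu>) (\<lambda>x. indicator F x *\<^sub>R cinner (VV x \<phi>) (amplify A (VV x \<phi>))) (trace (A \<circ> M F ?\<rho>))"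
      by simp
    have eq: "AE x in \<mu>. indicator F x *\<^sub>R cinner (VV x \<phi>) (amplify A (VV x \<phi>)) = f x *\<^sub>R (indicator F x *\<^sub>R g' x)"
      using f_eq g'_eq
    proof eventually_elim
      case (elim x)
      show ?case
        by (cases "VV x \<phi> = 0") (simp_all add: elim(1)[symmetric] elim(2)[symmetric] scaleR_conv_of_real)
    qed
    have "has_bochner_integral (completion \<mu>) (\<lambda>x. f x *\<^sub>R (indicator F x *\<^sub>R g' x)) (trace (A \<circ> M F ?\<rho>))"
      by (rule has_bochner_integral_completion_cong_AE[OF I eq])
    then have "has_bochner_integral \<mu> (\<lambda>x. f x *\<^sub>R (indicator F x *\<^sub>R g' x)) (trace (A \<circ> M F ?\<rho>))"
      by (subst (asm) has_bochner_integral_completion_iff) measurable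
    then have "has_bochner_integral ?m (\<lambda>x. indicator F x *\<^sub>R g' x) (trace (A \<circ> M F ?\<rho>))"
      unfolding m_eq by (intro has_bochner_integral_density) (auto simp: f_nonneg)
    then have "has_bochner_integral (completion ?m) (\<lambda>x. indicator F x *\<^sub>R g' x) (trace (A \<circ> M F ?\<rho>))"
      by (subst has_bochner_integral_completion_iff) (auto simp: has_bochner_integral_iff)
    then show "has_bochner_integral (completion ?m) (\<lambda>x. indicator F x *\<^sub>R trace (A \<circ> posterior \<phi> x)) (trace (A \<circ> M F ?\<rho>))"
      by (rule has_bochner_integral_completion_cong_AE) (use g_eq in eventually_elim, simp add: g_def)
  qed
qed

text \<open>For the normalized vector, irreducibility makes \<open>posterior\<close> pure wherever
  \<open>VV x\<close> is nonzero, and \<open>reduced_pure\<close> gives an elementary tensor. Where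
  \<open>VV x\<close> vanishes it is one as well.\<close>

lemma AE_tensor_vec_if_irreducible:
  assumes irr: "irreducible_instrument X M" and \<phi>: "\<phi> \<in> D"
  shows "AE x in \<mu>. \<exists>y \<alpha>. VV x \<phi> = tensor_vec y \<alpha>"
proof (cases "\<phi> = 0")
  case True
  have "AE x in \<mu>. reg x 0" using AE_reg D(1) complex_vector.subspace_0 by blast
  then show ?thesis
  proof eventually_elim
    case (elim x)
    have "VV x \<phi> = tensor_vec 0 0" using VV_scaleC[OF elim, of 0] True by simp
    then show ?case by blast
  qed
next
  case False
  define \<phi>1 where "\<phi>1 = complex_of_real (inverse (norm \<phi>)) *\<^sub>C \<phi>"
  have \<phi>1: "\<phi>1 \<in> D" using D(1) \<phi> by (simp add: \<phi>1_def complex_vector.subspace_scale)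
  have n1: "norm \<phi>1 = 1" using False by (simp add: \<phi>1_def norm_scaleC norm_inverse)
  have "pure_state (ket_bra \<phi>1 \<phi>1)" using n1 by (auto simp: pure_state_def)
  then have "AE x in posteriori_measure X M (ket_bra \<phi>1 \<phi>1). pure_state (posterior \<phi>1 x)"
    using irr posteriori_states_posterior(1)[OF \<phi>1 n1] unfolding irreducible_instrument_def by blast
  then have "AE x in \<mu>. VV x \<phi>1 \<noteq> 0 \<longrightarrow> pure_state (posterior \<phi>1 x)"
    by (rule posteriori_states_posterior(2)[OF \<phi>1 n1, THEN iffD1])
  then show ?thesis using AE_reg[OF \<phi>1]
  proof eventually_elim
    case (elim x)
    have "\<phi> = complex_of_real (norm \<phi>) *\<^sub>C \<phi>1"
      using False by (simp add: \<phi>1_def scaleC_scaleC flip: of_real_mult)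
    then have VV: "VV x \<phi> = complex_of_real (norm \<phi>) *\<^sub>C VV x \<phi>1"
      using VV_scaleC[OF elim(2)] by metis
    show ?case
    proof (cases "VV x \<phi>1 = 0")
      case True
      then have "VV x \<phi> = tensor_vec 0 0" using VV by simp
      then show ?thesis by blast
    next
      case False
      then obtain y where y: "sgn (VV x \<phi>1) = tensor_vec y (slice y (sgn (VV x \<phi>1)))"
        using reduced_pure elim(1) unfolding posterior_def by blast
      have "VV x \<phi>1 = complex_of_real (norm (VV x \<phi>1)) *\<^sub>C sgn (VV x \<phi>1)"
        using False by (simp add: sgn_div_norm scaleR_scaleC[symmetric])
      then have "VV x \<phi> = tensor_vec (complex_of_real (norm \<phi>) *\<^sub>C complex_of_real (norm (VV x \<phi>1)) *\<^sub>C y) (slice y (sgn (VV x \<phi>1)))"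
        unfolding VV tensor_vec_scaleC_left using y by metis
      then show ?thesis by blast
    qed
  qed
qed

end

section \<open>Irreducible instruments\<close>

text \<open>Linear dependence of two vectors, zero vectors included; hence transitivity requires a
  nonzero middle vector.\<close>

definition parallel :: "'a::complex_hilbert \<Rightarrow> 'a \<Rightarrow> bool" where
  "parallel a b \<longleftrightarrow> (\<exists>t. a = t *\<^sub>C b) \<or> b = 0"

lemma parallel_sym: "parallel a b \<Longrightarrow> parallel b a"
proof -
  assume "parallel a b"
  then consider "b = 0" | t where "a = t *\<^sub>C b" by (auto simp: parallel_def)
  then show ?thesis
  proof cases
    case 1 then have "b = 0 *\<^sub>C a" by simp
    then show ?thesis unfolding parallel_def by blast
  next
    case (2 t)
    show ?thesis
    proof (cases "t = 0")
      case False
      then have "b = inverse t *\<^sub>C a" by (simp add: 2 scaleC_scaleC)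
      then show ?thesis unfolding parallel_def by blast
    qed (simp add: 2 parallel_def)
  qed
qed

lemma parallel_trans: "parallel a b \<Longrightarrow> parallel b c \<Longrightarrow> b \<noteq> 0 \<Longrightarrow> parallel a c"
  unfolding parallel_def by (metis scaleC_scaleC)

lemma parallel_cauchy_schwarz:
  assumes "parallel u v" shows "(cmod (cinner u v))\<^sup>2 = (norm u)\<^sup>2 * (norm v)\<^sup>2"
  using assms
  by (auto simp: parallel_def cinner_scaleC_left cinner_self norm_mult norm_scaleC power_mult_distrib power2_eq_square)

text \<open>The component of \<open>y\<close> orthogonal to \<open>y'\<close> separates
  them.\<close>

lemma not_parallel_separate:
  fixes y y' :: "'a::complex_hilbert"
  assumes "\<not> parallel y y'"
  obtains c where "cinner c y \<noteq> 0" "cinner c y' = 0"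
proof -
  have y': "y' \<noteq> 0" using assms by (auto simp: parallel_def)
  define t where "t = cinner y' y / complex_of_real ((norm y')\<^sup>2)"
  define c where "c = y - t *\<^sub>C y'"
  have z: "cinner y' c = 0"
    using y' by (simp add: c_def t_def cinner_diff_right cinner_scaleC_right cinner_self)
  then have z': "cinner c y' = 0" using cinner_eq_zero_commute by blast
  have "c \<noteq> 0" using assms by (auto simp: c_def parallel_def)
  moreover have "cinner c y = cinner c c"
    using z' by (simp add: c_def[of] cinner_diff_right cinner_scaleC_right)
  ultimately have "cinner c y \<noteq> 0" by simp
  then show thesis using that z' by blast
qed

text \<open>The linear algebra behind the theorem: a sum of two elementary tensors is elementary only
  if the two share a factor.\<close>

lemma tensor_vec_sum_rank_one:
  assumes eq: "tensor_vec y \<alpha> + tensor_vec y' \<alpha>' = tensor_vec y'' \<alpha>''"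
  shows "parallel y y' \<or> parallel \<alpha> \<alpha>'"
proof (rule ccontr)
  assume n: "\<not> (parallel y y' \<or> parallel \<alpha> \<alpha>')"
  then obtain c where c: "cinner c y \<noteq> 0" "cinner c y' = 0" using not_parallel_separate by blast
  have "\<not> parallel y' y" using n parallel_sym by blast
  then obtain d where d: "cinner d y' \<noteq> 0" "cinner d y = 0" using not_parallel_separate by blast
  \<comment> \<open>Slicing with \<open>c\<close> leaves only \<open>\<alpha>\<close>, slicing with
    \<open>d\<close> only \<open>\<alpha>'\<close>; both are therefore multiples of
    \<open>\<alpha>''\<close>.\<close>
  have s: "cinner e y *\<^sub>C \<alpha> + cinner e y' *\<^sub>C \<alpha>' = cinner e y'' *\<^sub>C \<alpha>''" for e
    using arg_cong[OF eq, of "slice e"] by (simp add: slice_add slice_tensor_vec)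
  have "\<alpha> = inverse (cinner c y) *\<^sub>C (cinner c y *\<^sub>C \<alpha>)" using c by (simp add: scaleC_scaleC)
  also have "cinner c y *\<^sub>C \<alpha> = cinner c y'' *\<^sub>C \<alpha>''" using s[of c] c by simp
  finally have 1: "\<exists>t. \<alpha> = t *\<^sub>C \<alpha>''" by (auto simp: scaleC_scaleC)
  have "\<alpha>' = inverse (cinner d y') *\<^sub>C (cinner d y' *\<^sub>C \<alpha>')" using d by (simp add: scaleC_scaleC)
  also have "cinner d y' *\<^sub>C \<alpha>' = cinner d y'' *\<^sub>C \<alpha>''" using s[of d] d by simp
  finally have 2: "\<exists>t. \<alpha>' = t *\<^sub>C \<alpha>''" by (auto simp: scaleC_scaleC)
  have "\<alpha>'' \<noteq> 0"
  proof
    assume "\<alpha>'' = 0" then have "\<alpha>' = 0" using 2 by simp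
    then show False using n by (simp add: parallel_def)
  qed
  then have "parallel \<alpha> \<alpha>'"
    using 1 2 parallel_trans[of \<alpha> \<alpha>'' \<alpha>'] parallel_sym[of \<alpha>' \<alpha>''] by (simp add: parallel_def)
  with n show False by blast
qed

text \<open>For a unit vector \<open>u\<close> this says that \<open>f\<close> lies in
  \<open>u \<otimes> \<ell>\<^sup>2(I)\<close>; the second factor is recovered by slicing, which
  avoids an existential.\<close>

definition in_line :: "'a::complex_hilbert \<Rightarrow> ('i, 'a) l2 \<Rightarrow> bool" where
  "in_line u f \<longleftrightarrow> f = tensor_vec u (slice u f)"

lemma in_line_tensor_vec:
  assumes "norm u = 1" "parallel y u" shows "in_line u (tensor_vec y \<alpha>)"
proof -
  have "u \<noteq> 0" using assms(1) by auto
  then obtain t where "y = t *\<^sub>C u" using assms(2) by (auto simp: parallel_def)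
  then show ?thesis
    using assms(1)
    by (simp add: in_line_def slice_tensor_vec slice_scaleC cinner_self tensor_vec_scaleC_left tensor_vec_scaleC_right)
qed

lemma in_line_parallel:
  assumes "in_line u f" "in_line v f" "f \<noteq> 0" shows "parallel u v"
proof -
  have "slice v f \<noteq> 0" using assms(2,3) unfolding in_line_def by (metis tensor_vec_zero(2))
  then have nz: "cinner (slice v f) (slice v f) \<noteq> 0" by simp
  have nz': "slice u f \<noteq> 0" using assms(1,3) unfolding in_line_def by (metis tensor_vec_zero(2))
  have eq: "tensor_vec u (slice u f) = tensor_vec v (slice v f)" using assms(1,2) unfolding in_line_def by metis
  show ?thesis
  proof (rule ccontr)
    assume "\<not> parallel u v"
    then obtain c where c: "cinner c u \<noteq> 0" "cinner c v = 0" using not_parallel_separate by blast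
    from arg_cong[OF eq, of "slice c"] c have "cinner c u *\<^sub>C slice u f = 0" by (simp add: slice_tensor_vec)
    then show False using c nz' by (metis norm_eq_zero norm_scaleC mult_eq_0_iff)
  qed
qed

text \<open>The pair violating Cauchy-Schwarz has factors \<open>\<alpha>1\<close>,
  \<open>\<alpha>2\<close> that are not parallel, so \<open>y1\<close> and \<open>y2\<close> are. A
  further \<open>\<alpha> \<noteq> 0\<close> cannot be parallel to both, so its \<open>y\<close> is
  parallel to \<open>y1\<close> or \<open>y2\<close>, which span the same line.\<close>

lemma common_line:
  fixes f :: "'b \<Rightarrow> ('i, 'a::complex_hilbert) l2"
  assumes t1: "\<And>b. b \<in> C \<Longrightarrow> \<exists>y \<alpha>. f b = tensor_vec y \<alpha>"
    and t2: "\<And>b b'. b \<in> C \<Longrightarrow> b' \<in> C \<Longrightarrow> \<exists>y \<alpha>. f b + f b' = tensor_vec y \<alpha>"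
    and b: "b1 \<in> C" "b2 \<in> C"
    and cs: "(cmod (cinner (slice c1 (f b1)) (slice c2 (f b2))))\<^sup>2 \<noteq> (norm (slice c1 (f b1)))\<^sup>2 * (norm (slice c2 (f b2)))\<^sup>2"
  obtains u where "norm u = 1" "\<And>b. b \<in> C \<Longrightarrow> in_line u (f b)"
proof -
  obtain y1 \<alpha>1 where f1: "f b1 = tensor_vec y1 \<alpha>1" using t1[OF b(1)] by blast
  obtain y2 \<alpha>2 where f2: "f b2 = tensor_vec y2 \<alpha>2" using t1[OF b(2)] by blast
  have np: "\<not> parallel \<alpha>1 \<alpha>2"
  proof
    assume "parallel \<alpha>1 \<alpha>2"
    from parallel_cauchy_schwarz[OF this] cs show False
      by (simp add: f1 f2 slice_tensor_vec cinner_scaleC_left cinner_scaleC_right norm_mult norm_scaleC power_mult_distrib)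
  qed
  have nz: "y1 \<noteq> 0" "y2 \<noteq> 0" using cs by (auto simp: f1 f2)
  have az: "\<alpha>1 \<noteq> 0" "\<alpha>2 \<noteq> 0" using cs by (auto simp: f1 f2 slice_tensor_vec)
  have y12: "parallel y1 y2"
    using t2[OF b] np tensor_vec_sum_rank_one unfolding f1 f2 by blast
  define u where "u = sgn y1"
  have u: "norm u = 1" using nz by (simp add: u_def norm_sgn)
  have y1u: "parallel y1 u"
  proof -
    have "y1 = complex_of_real (norm y1) *\<^sub>C u" using nz by (simp add: u_def sgn_div_norm flip: scaleR_scaleC)
    then show ?thesis unfolding parallel_def by blast
  qed
  have "in_line u (f b)" if bC: "b \<in> C" for b
  proof -
    obtain y \<alpha> where f: "f b = tensor_vec y \<alpha>" using t1[OF bC] by blast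
    show ?thesis
    proof (cases "\<alpha> = 0")
      case True
      then show ?thesis by (simp add: f in_line_def)
    next
      case False
      have "parallel y y1 \<or> parallel \<alpha> \<alpha>1"
        using t2[OF bC b(1)] tensor_vec_sum_rank_one unfolding f f1 by blast
      moreover have "parallel y y2 \<or> parallel \<alpha> \<alpha>2"
        using t2[OF bC b(2)] tensor_vec_sum_rank_one unfolding f f2 by blast
      moreover have "\<not> (parallel \<alpha> \<alpha>1 \<and> parallel \<alpha> \<alpha>2)"
        using np parallel_trans[of \<alpha>1 \<alpha> \<alpha>2] parallel_sym[of \<alpha> \<alpha>1] False by blast
      moreover have "parallel y y1" if "parallel y y2"
        using that parallel_trans[of y y2 y1] parallel_sym[OF y12] nz by blast
      ultimately have "parallel y y1" by blast
      then have "parallel y u" using parallel_trans[of y y1 u] y1u nz by blast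
      with u show ?thesis unfolding f by (rule in_line_tensor_vec)
    qed
  qed
  with u that show thesis by blast
qed

text \<open>Apart from the factor \<open>\<parallel>f\<parallel>^2\<close> the value does not depend
  on \<open>f\<close>: this is why posteriori expectations forget the a priori state.\<close>

lemma cinner_in_line:
  assumes "in_line u f" "norm u = 1" "bounded_op A"
  shows "cinner f (amplify A f) = cinner u (A u) * complex_of_real ((norm f)\<^sup>2)"
proof -
  have f: "f = tensor_vec u (slice u f)" using assms(1) by (simp add: in_line_def)
  have "norm f = norm (slice u f)" by (subst f) (simp add: norm_tensor_vec assms(2))
  moreover have "cinner f (amplify A f) = cinner u (A u) * cinner (slice u f) (slice u f)"
    by (subst (1 2) f) (simp add: amplify_tensor_vec assms(3) cinner_tensor_vec)
  ultimately show ?thesis by (simp add: cinner_self)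
qed

lemma trace_ket_bra_compose:
  fixes T :: "'h::{complex_hilbert, second_countable_topology} \<Rightarrow> 'h"
  assumes "trace_class T" shows "trace (ket_bra c d \<circ> T) = cinner d (T c)"
proof -
  obtain a b where T: "nuclear_rep T a b" using assms trace_class_iff by blast
  have "(\<lambda>n. cinner (b n) (ket_bra c d (a n))) sums trace (ket_bra c d \<circ> T)"
    by (intro nuclear_rep_trace(2) nuclear_rep_compose bounded_op_ket_bra T)
  moreover have "(\<lambda>n. cinner d (a n) * cinner (b n) c) sums cinner d (T c)"
    by (intro has_sum_imp_sums nuclear_rep_has_sum T)
  ultimately show ?thesis
    by (auto simp: ket_bra_def cinner_scaleC_right intro: sums_unique2)
qed

locale irreducible_kraus = kraus +
  fixes Fs
  assumes irr: "irreducible_instrument X M"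
    and Fs: "Fs \<in> sets X" "\<And>x. x \<in> Fs \<Longrightarrow> nonzero_on D (V 2 x)" "\<And>x. x \<in> Fs \<Longrightarrow> \<not> rank_le_one x"
      "\<And>x b. x \<in> Fs \<Longrightarrow> b \<in> B \<Longrightarrow> reg x b"
begin

text \<open>Chosen from \<open>B\<close> alone, so that one function serves all
  \<open>\<phi>\<close>. The implication inside the choice keeps \<open>\<psi> x\<close> a unit
  vector even at outcomes of \<open>Fs\<close> without a common line.\<close>

definition \<psi> :: "'a \<Rightarrow> 'b" where
  "\<psi> x = (SOME u. norm u = 1 \<and>
    ((\<exists>v. norm v = 1 \<and> (\<forall>b\<in>B. in_line v (VV x b))) \<longrightarrow> (\<forall>b\<in>B. in_line u (VV x b))))"

lemma
  assumes x: "x \<in> Fs"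
  shows norm_\<psi>: "norm (\<psi> x) = 1"
    and in_line_\<psi>: "norm v = 1 \<Longrightarrow> (\<And>b. b \<in> B \<Longrightarrow> in_line v (VV x b)) \<Longrightarrow> b \<in> B \<Longrightarrow> in_line (\<psi> x) (VV x b)"
proof -
  \<comment> \<open>A nonzero value of \<open>V 2 x\<close> shows that the space contains unit
    vectors at all.\<close>
  obtain \<phi> where "V 2 x \<phi> \<noteq> 0" using Fs(2)[OF x] by (auto simp: nonzero_on_def)
  then have "norm (sgn (V 2 x \<phi>)) = 1" by (simp add: norm_sgn)
  then have "\<exists>u. norm u = 1 \<and>
      ((\<exists>v. norm v = 1 \<and> (\<forall>b\<in>B. in_line v (VV x b))) \<longrightarrow> (\<forall>b\<in>B. in_line u (VV x b)))"
    by blast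
  then have "norm (\<psi> x) = 1 \<and>
      ((\<exists>v. norm v = 1 \<and> (\<forall>b\<in>B. in_line v (VV x b))) \<longrightarrow> (\<forall>b\<in>B. in_line (\<psi> x) (VV x b)))"
    unfolding \<psi>_def by (rule someI_ex)
  then show "norm (\<psi> x) = 1"
    "norm v = 1 \<Longrightarrow> (\<And>b. b \<in> B \<Longrightarrow> in_line v (VV x b)) \<Longrightarrow> b \<in> B \<Longrightarrow> in_line (\<psi> x) (VV x b)" by blast+
qed

text \<open>\<open>common_line\<close> is applied to \<open>B\<close> with \<open>\<phi>\<close>
  added. The line found may depend on \<open>\<phi>\<close>, but it shares the nonzero vector
  \<open>VV x b1\<close> with the line of \<open>\<psi> x\<close>, so the two agree.\<close>

lemma AE_in_line:
  assumes \<phi>: "\<phi> \<in> D"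
  shows "AE x in \<mu>. x \<in> Fs \<longrightarrow> reg x \<phi> \<and> in_line (\<psi> x) (VV x \<phi>)"
proof -
  define C where "C = insert \<phi> B"
  have C: "countable C" "C \<subseteq> D" using B \<phi> by (auto simp: C_def)
  have "AE x in \<mu>. \<forall>c\<in>C. reg x c"
    using C AE_reg by (subst AE_ball_countable) auto
  moreover have "AE x in \<mu>. \<forall>c\<in>C. \<exists>y \<alpha>. VV x c = tensor_vec y \<alpha>"
    using C by (subst AE_ball_countable) (auto intro: AE_tensor_vec_if_irreducible[OF irr])
  moreover have "AE x in \<mu>. \<forall>c\<in>C. \<forall>c'\<in>C. \<exists>y \<alpha>. VV x (c + c') = tensor_vec y \<alpha>"
    using C D(1)
    by (subst AE_ball_countable, simp, intro ballI, subst AE_ball_countable)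
      (auto intro!: AE_tensor_vec_if_irreducible[OF irr] complex_vector.subspace_add)
  ultimately show ?thesis
  proof eventually_elim
    case (elim x)
    show ?case
    proof
      assume x: "x \<in> Fs"
      obtain b1 c1 b2 c2 where b: "b1 \<in> B" "b2 \<in> B"
        and cs: "(cmod (cinner (slice c1 (VV x b1)) (slice c2 (VV x b2))))\<^sup>2 \<noteq> (norm (slice c1 (VV x b1)))\<^sup>2 * (norm (slice c2 (VV x b2)))\<^sup>2"
        using Fs(3)[OF x] unfolding rank_le_one_def by blast
      have bC: "b1 \<in> C" "b2 \<in> C" using b by (auto simp: C_def)
      have t2: "\<exists>y \<alpha>. VV x c + VV x c' = tensor_vec y \<alpha>" if "c \<in> C" "c' \<in> C" for c c'
        using elim(1,3) that VV_add[of x c c'] by metis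
      have t1: "\<exists>y \<alpha>. VV x c = tensor_vec y \<alpha>" if "c \<in> C" for c using elim(2) that by blast
      obtain u where u: "norm u = 1" "\<And>c. c \<in> C \<Longrightarrow> in_line u (VV x c)"
        using common_line[of C "VV x", OF t1 t2 bC cs] by blast
      have \<psi>B: "in_line (\<psi> x) (VV x b)" if "b \<in> B" for b
        using in_line_\<psi>[OF x u(1) _ that] u(2) by (auto simp: C_def)
      have "VV x b1 \<noteq> 0" using cs by auto
      then have "parallel u (\<psi> x)" using in_line_parallel[OF u(2)[OF bC(1)] \<psi>B[OF b(1)]] by blast
      moreover have "VV x \<phi> = tensor_vec u (slice u (VV x \<phi>))" using u(2)[of \<phi>] by (simp add: C_def in_line_def)
      ultimately have "in_line (\<psi> x) (VV x \<phi>)"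
        using in_line_tensor_vec[OF norm_\<psi>[OF x]] by metis
      then show "reg x \<phi> \<and> in_line (\<psi> x) (VV x \<phi>)" using elim(1) by (auto simp: C_def)
    qed
  qed
qed

text \<open>Set to \<open>0\<close> where \<open>V k x\<close> is not linear, so that
  \<open>\<omega> k x\<close> is a linear functional for every \<open>x\<close>, not only for almost
  every one.\<close>

definition \<omega> :: "nat \<Rightarrow> 'a \<Rightarrow> 'b \<Rightarrow> complex" where
  "\<omega> k x \<phi> = (if clinear_on D (V k x) then cinner (\<psi> x) (V k x \<phi>) else 0)"

lemma clinear_on_\<omega>: "clinear_on D (\<omega> k x)"
proof (cases "clinear_on D (V k x)")
  case True
  then have "\<omega> k x = (\<lambda>\<phi>. cinner (\<psi> x) (V k x \<phi>))" by (simp add: \<omega>_def fun_eq_iff)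
  with True show ?thesis
    by (simp add: clinear_on_def cinner_add_right cinner_scaleC_right scaleC_complex_def)
next
  case False
  then have "\<omega> k x = (\<lambda>\<phi>. 0)" by (simp add: \<omega>_def fun_eq_iff)
  then show ?thesis by (simp add: clinear_on_def)
qed

lemma V_eq_\<omega>:
  assumes "reg x \<phi>" "in_line (\<psi> x) (VV x \<phi>)" "1 \<le> k"
  shows "V k x \<phi> = \<omega> k x \<phi> *\<^sub>C \<psi> x"
proof -
  have "Rep_l2 (VV x \<phi>) k = Rep_l2 (tensor_vec (\<psi> x) (slice (\<psi> x) (VV x \<phi>))) k"
    using assms(2) unfolding in_line_def by simp
  moreover have "clinear_on D (V k x)" using assms(1,3) by (simp add: reg_def)
  ultimately show ?thesis
    using assms(3) by (simp add: tensor_vec.rep_eq slice.rep_eq Rep_VV[OF assms(1)] \<omega>_def)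
qed

lemma AE_V_eq_\<omega>:
  assumes "\<phi> \<in> D" shows "AE x in \<mu>. x \<in> Fs \<longrightarrow> (\<forall>k\<ge>1. V k x \<phi> = \<omega> k x \<phi> *\<^sub>C \<psi> x)"
  using AE_in_line[OF assms] by eventually_elim (auto intro: V_eq_\<omega>)

text \<open>A countable set spanning \<open>D\<close> algebraically lets the exceptional null sets
  be united into one; linearity then carries the identity from \<open>C\<close> to
  \<open>D\<close>.\<close>

lemma AE_range_V:
  assumes C: "countable C" "D = cspan C"
  shows "AE x in \<mu>. x \<in> Fs \<longrightarrow> (\<forall>k\<ge>1. (nonzero_on D (V k x) \<longrightarrow> V k x ` D = cspan {\<psi> x}) \<and>
    (\<forall>\<phi>\<in>D. V k x \<phi> = \<omega> k x \<phi> *\<^sub>C \<psi> x))"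
proof -
  have CD: "C \<subseteq> D" using C(2) complex_vector.span_superset by blast
  have lin: "AE x in \<mu>. \<forall>k\<ge>1. clinear_on D (V k x)"
    using rep by (simp add: kraus_representation_def)
  have "AE x in \<mu>. \<forall>c\<in>C. x \<in> Fs \<longrightarrow> (\<forall>k\<ge>1. V k x c = \<omega> k x c *\<^sub>C \<psi> x)"
    using C(1) CD AE_V_eq_\<omega> by (subst AE_ball_countable) auto
  with lin show ?thesis
  proof eventually_elim
    case (elim x)
    show ?case
    proof (intro impI allI)
      fix k :: nat assume x: "x \<in> Fs" and k: "1 \<le> k"
      have l: "clinear_on D (V k x)" using elim(1) k by blast
      have eq: "V k x \<phi> = \<omega> k x \<phi> *\<^sub>C \<psi> x" if "\<phi> \<in> D" for \<phi>
      proof -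
        have "cspan C \<subseteq> {\<phi> \<in> D. V k x \<phi> = \<omega> k x \<phi> *\<^sub>C \<psi> x}"
        proof (rule complex_vector.span_minimal)
          show "C \<subseteq> {\<phi> \<in> D. V k x \<phi> = \<omega> k x \<phi> *\<^sub>C \<psi> x}" using elim(2) x k CD by blast
          have add: "V k x (a + b) = V k x a + V k x b" "\<omega> k x (a + b) = \<omega> k x a + \<omega> k x b" if "a \<in> D" "b \<in> D" for a b
            using l clinear_on_\<omega> that unfolding clinear_on_def by blast+
          have scale: "V k x (c *\<^sub>C a) = c *\<^sub>C V k x a" "\<omega> k x (c *\<^sub>C a) = c * \<omega> k x a" if "a \<in> D" for a c
            using l clinear_on_\<omega>[of k x] that unfolding clinear_on_def scaleC_complex_def by blast+
          have zero: "V k x 0 = 0" using scale(1)[of 0 0] D(1) complex_vector.subspace_0 by force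
          have zero': "\<omega> k x 0 = 0" using scale(2)[of 0 0] D(1) complex_vector.subspace_0 by force
          show "complex_vector.subspace {\<phi> \<in> D. V k x \<phi> = \<omega> k x \<phi> *\<^sub>C \<psi> x}"
            unfolding complex_vector.subspace_def
          proof (intro conjI allI ballI)
            show "0 \<in> {\<phi> \<in> D. V k x \<phi> = \<omega> k x \<phi> *\<^sub>C \<psi> x}"
              using D(1) complex_vector.subspace_0 by (auto simp: zero zero')
          next
            fix a b assume "a \<in> {\<phi> \<in> D. V k x \<phi> = \<omega> k x \<phi> *\<^sub>C \<psi> x}" "b \<in> {\<phi> \<in> D. V k x \<phi> = \<omega> k x \<phi> *\<^sub>C \<psi> x}"
            then show "a + b \<in> {\<phi> \<in> D. V k x \<phi> = \<omega> k x \<phi> *\<^sub>C \<psi> x}"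
              using D(1) by (simp add: add complex_vector.subspace_add scaleC_add_left)
          next
            fix c a assume "a \<in> {\<phi> \<in> D. V k x \<phi> = \<omega> k x \<phi> *\<^sub>C \<psi> x}"
            then show "c *\<^sub>C a \<in> {\<phi> \<in> D. V k x \<phi> = \<omega> k x \<phi> *\<^sub>C \<psi> x}"
              using D(1) by (simp add: scale complex_vector.subspace_scale scaleC_scaleC)
          qed
        qed
        then show ?thesis using that C(2) by blast
      qed
      moreover have "V k x ` D = cspan {\<psi> x}" if nz: "nonzero_on D (V k x)"
      proof
        show "V k x ` D \<subseteq> cspan {\<psi> x}"
          using eq by (auto simp: complex_vector.span_singleton)
        obtain \<phi> where \<phi>: "\<phi> \<in> D" "V k x \<phi> \<noteq> 0" using nz by (auto simp: nonzero_on_def)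
        then have \<omega>0: "\<omega> k x \<phi> \<noteq> 0" using eq by auto
        show "cspan {\<psi> x} \<subseteq> V k x ` D"
        proof
          fix z assume "z \<in> cspan {\<psi> x}"
          then obtain c where z: "z = c *\<^sub>C \<psi> x" by (auto simp: complex_vector.span_singleton)
          have "V k x ((c / \<omega> k x \<phi>) *\<^sub>C \<phi>) = (c / \<omega> k x \<phi>) *\<^sub>C V k x \<phi>"
            using l \<phi>(1) by (simp add: clinear_on_def)
          also have "\<dots> = z" using \<omega>0 by (simp add: eq[OF \<phi>(1)] scaleC_scaleC z)
          finally show "z \<in> V k x ` D"
            using \<phi>(1) D(1) complex_vector.subspace_scale by (metis image_eqI)
        qed
      qed
      ultimately show "(nonzero_on D (V k x) \<longrightarrow> V k x ` D = cspan {\<psi> x}) \<and>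
          (\<forall>\<phi>\<in>D. V k x \<phi> = \<omega> k x \<phi> *\<^sub>C \<psi> x)" by blast
    qed
  qed
qed

lemma integral_\<omega>:
  assumes \<phi>: "\<phi> \<in> D" and A: "bounded_op A" and F: "F \<in> sets X" "F \<subseteq> Fs"
  shows "has_bochner_integral (completion \<mu>)
    (\<lambda>x. indicator F x *\<^sub>R (cinner (\<psi> x) (A (\<psi> x)) * complex_of_real (\<Sum>\<^sub>\<infinity>k\<in>{1..}. (cmod (\<omega> k x \<phi>))\<^sup>2)))
    (cinner \<phi> (dual F A \<phi>))"
proof (rule has_bochner_integral_completion_cong_AE[OF integral_VV_diag[OF \<phi> F(1) A]])
  show "AE x in \<mu>. indicator F x *\<^sub>R cinner (VV x \<phi>) (amplify A (VV x \<phi>))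
      = indicator F x *\<^sub>R (cinner (\<psi> x) (A (\<psi> x)) * complex_of_real (\<Sum>\<^sub>\<infinity>k\<in>{1..}. (cmod (\<omega> k x \<phi>))\<^sup>2))"
    using AE_in_line[OF \<phi>]
  proof eventually_elim
    case (elim x)
    show ?case
    proof (cases "x \<in> F")
      case True
      then have x: "x \<in> Fs" and r: "reg x \<phi>" and l: "in_line (\<psi> x) (VV x \<phi>)" using F(2) elim by auto
      have "(norm (VV x \<phi>))\<^sup>2 = (\<Sum>\<^sub>\<infinity>k. (norm (Rep_l2 (VV x \<phi>) k))\<^sup>2)"
        using has_sum_norm_l2 by (rule infsumI[symmetric])
      also have "\<dots> = (\<Sum>\<^sub>\<infinity>k\<in>{1..}. (cmod (\<omega> k x \<phi>))\<^sup>2)"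
        by (rule infsum_cong_neutral)
          (auto simp: Rep_VV[OF r] V_eq_\<omega>[OF r l] norm_scaleC norm_\<psi>[OF x])
      finally show ?thesis
        by (simp only: cinner_in_line[OF l norm_\<psi>[OF x] A])
    qed simp
  qed
qed

text \<open>Where \<open>\<langle>\<psi>\<^sub>x|A\<psi>\<^sub>x\<rangle> \<le> t\<close>, the effects satisfy \<open>\<MM>\<^sup>*(F)[A] \<le> t \<MM>\<^sup>*(F)[1]\<close>
  on \<open>D\<close>, hence everywhere.\<close>

lemma trace_le_on_sublevel:
  assumes \<rho>: "trace_class \<rho>" "positive_op \<rho>" and A: "bounded_op A" and F: "F \<in> sets X" "F \<subseteq> Fs"
    and le: "\<And>x. x \<in> F \<Longrightarrow> in_line (\<psi> x) (VV x b) \<Longrightarrow> Re (cinner (\<psi> x) (A (\<psi> x))) \<le> t" and b: "b \<in> B"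
  shows "Re (trace (A \<circ> M F \<rho>)) \<le> t * Re (trace (M F \<rho>))"
proof -
  let ?S = "{\<phi>. Re (cinner \<phi> (dual F A \<phi>)) \<le> t * Re (cinner \<phi> (dual F (\<lambda>x. x) \<phi>))}"
  have "D \<subseteq> ?S"
  proof
    fix \<phi> assume \<phi>: "\<phi> \<in> D"
    have "b \<in> D" using b B by blast
    note I1 = has_bochner_integral_bounded_linear[OF bounded_linear_Re integral_VV_diag[OF \<phi> F(1) A]]
    note I2 = has_bochner_integral_bounded_linear[OF bounded_linear_Re integral_VV_diag[OF \<phi> F(1) bounded_op_id]]
    have "Re (cinner \<phi> (dual F A \<phi>)) = (LINT x|completion \<mu>. Re (indicator F x *\<^sub>R cinner (VV x \<phi>) (amplify A (VV x \<phi>))))"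
      using I1 by (simp add: has_bochner_integral_iff)
    also have "\<dots> \<le> (LINT x|completion \<mu>. t * Re (indicator F x *\<^sub>R cinner (VV x \<phi>) (amplify (\<lambda>x. x) (VV x \<phi>))))"
    proof (rule integral_mono_AE)
      show "integrable (completion \<mu>) (\<lambda>x. Re (indicator F x *\<^sub>R cinner (VV x \<phi>) (amplify A (VV x \<phi>))))"
        using I1 unfolding has_bochner_integral_iff by blast
      show "integrable (completion \<mu>) (\<lambda>x. t * Re (indicator F x *\<^sub>R cinner (VV x \<phi>) (amplify (\<lambda>x. x) (VV x \<phi>))))"
        using I2 unfolding has_bochner_integral_iff by (intro integrable_mult_right) blast
      have "AE x in \<mu>. Re (indicator F x *\<^sub>R cinner (VV x \<phi>) (amplify A (VV x \<phi>)))
          \<le> t * Re (indicator F x *\<^sub>R cinner (VV x \<phi>) (amplify (\<lambda>x. x) (VV x \<phi>)))"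
        using AE_in_line[OF \<phi>] AE_in_line[OF \<open>b \<in> D\<close>]
      proof eventually_elim
        case (elim x)
        show ?case
        proof (cases "x \<in> F")
          case True
          then have x: "x \<in> Fs" and l: "in_line (\<psi> x) (VV x \<phi>)" and t: "Re (cinner (\<psi> x) (A (\<psi> x))) \<le> t"
            using F(2) elim le by auto
          show ?thesis
            using True mult_right_mono[OF t zero_le_power2[of "norm (VV x \<phi>)"]]
            by (simp add: cinner_in_line[OF l norm_\<psi>[OF x] A] norm_zero_square_iff del: of_real_power)
        qed simp
      qed
      then show "AE x in completion \<mu>. Re (indicator F x *\<^sub>R cinner (VV x \<phi>) (amplify A (VV x \<phi>)))
          \<le> t * Re (indicator F x *\<^sub>R cinner (VV x \<phi>) (amplify (\<lambda>x. x) (VV x \<phi>)))"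
        by (rule AE_completion)
    qed
    also have "\<dots> = t * Re (cinner \<phi> (dual F (\<lambda>x. x) \<phi>))"
      using I2 by (simp add: has_bochner_integral_iff)
    finally show "\<phi> \<in> ?S" by simp
  qed
  moreover have "closed ?S"
    by (intro closed_Collect_le continuous_intros continuous_on_bounded_op bounded_op_dual F A bounded_op_id)
  ultimately have all: "Re (cinner \<phi> (dual F A \<phi>)) \<le> t * Re (cinner \<phi> (dual F (\<lambda>x. x) \<phi>))" for \<phi>
    using closure_minimal[of D ?S] D(2) by blast
  obtain q where q: "nuclear_rep \<rho> q q" "(\<lambda>n. (norm (q n))\<^sup>2) sums Re (trace \<rho>)"
    using positive_trace_class_decomposition[OF \<rho>] by blast
  have s: "(\<lambda>n. Re (cinner (q n) (dual F A' (q n)))) sums Re (trace (A' \<circ> M F \<rho>))" if "bounded_op A'" for A'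
    unfolding trace_dual[OF F(1) that \<rho>(1)]
    by (intro sums_Re nuclear_rep_trace(2) nuclear_rep_compose bounded_op_dual F(1) that q(1))
  \<comment> \<open>The inequality of forms is summed over the decomposition of
    \<open>\<rho>\<close>, whose vectors need not lie in \<open>D\<close>.\<close>
  have "Re (trace (A \<circ> M F \<rho>)) \<le> t * Re (trace ((\<lambda>x. x) \<circ> M F \<rho>))"
    by (rule sums_le[OF all s[OF A] sums_mult[OF s[OF bounded_op_id]]])
  then show ?thesis by (simp add: o_def)
qed

text \<open>The condition on \<open>VV x b\<close> is a measurable substitute for
  \<open>\<langle>\<psi> x|A \<psi> x\<rangle> \<le> t\<close>, equivalent to it where
  \<open>VV x b\<close> is nonzero and in the line of \<open>\<psi> x\<close>. If the posteriori
  expectation exceeded \<open>t\<close> on a part \<open>K\<close> of positive measure,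
  \<open>trace_le_on_sublevel\<close> would fail for \<open>K\<close>.\<close>

lemma AE_trace_le:
  assumes \<rho>: "state \<rho>" and r: "posteriori_states X M \<rho> r" and A: "bounded_op A" and b: "b \<in> B"
  shows "AE x in posteriori_measure X M \<rho>. x \<in> Fs \<and> VV x b \<noteq> 0 \<and>
    Re (cinner (VV x b) (amplify A (VV x b))) \<le> t * (norm (VV x b))\<^sup>2 \<longrightarrow> Re (trace (A \<circ> r x)) \<le> t"
proof -
  let ?m = "posteriori_measure X M \<rho>"
  have \<rho>': "trace_class \<rho>" "positive_op \<rho>" "trace \<rho> = 1" using \<rho> by (auto simp: state_def)
  have bD: "b \<in> D" using b B by blast
  define S where "S = {x \<in> space (completion \<mu>). x \<in> Fs \<and> VV x b \<noteq> 0 \<and>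
    Re (cinner (VV x b) (amplify A (VV x b))) \<le> t * (norm (VV x b))\<^sup>2}"
  have S: "S \<in> sets (completion \<mu>)"
  proof -
    note [measurable] = measurable_VV[OF bD bD A] measurable_VV[OF bD bD bounded_op_id]
    have [measurable]: "Fs \<in> sets (completion \<mu>)" using Fs(1) sets_\<mu> by auto
    have "(\<lambda>x. Re (cinner (VV x b) (amplify (\<lambda>x. x) (VV x b)))) \<in> borel_measurable (completion \<mu>)" by measurable
    then have [measurable]: "(\<lambda>x. (norm (VV x b))\<^sup>2) \<in> borel_measurable (completion \<mu>)"
      by (simp add: norm_zero_square_iff del: of_real_power)
    have "{x \<in> space (completion \<mu>). x \<in> Fs \<and> (norm (VV x b))\<^sup>2 \<noteq> 0 \<and>
        Re (cinner (VV x b) (amplify A (VV x b))) \<le> t * (norm (VV x b))\<^sup>2} \<in> sets (completion \<mu>)"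
      by measurable
    then show ?thesis by (simp add: S_def)
  qed
  define F0 where "F0 = main_part \<mu> S"
  have F0: "F0 \<in> sets X" "F0 \<subseteq> S"
    using main_part_sets[OF S] sets_\<mu> main_part_null_part_Un[OF S] by (auto simp: F0_def)
  have m_sets: "sets ?m = sets X" and m_space: "space ?m = space X"
    using sets_posteriori[OF \<rho>'(1,2)] space_posteriori[OF \<rho>'(1,2)] by auto
  have fin: "finite_measure ?m"
    by (rule finite_measureI) (simp add: m_space emeasure_posteriori[OF \<rho>'(1,2) sets.top])
  then interpret m: finite_measure ?m .
  have le: "Re (cinner (\<psi> x) (A (\<psi> x))) \<le> t" if x: "x \<in> F0" and l: "in_line (\<psi> x) (VV x b)" for x
  proof -
    have xS: "x \<in> Fs" "VV x b \<noteq> 0" "Re (cinner (VV x b) (amplify A (VV x b))) \<le> t * (norm (VV x b))\<^sup>2"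
      using x F0(2) by (auto simp: S_def)
    have "Re (cinner (\<psi> x) (A (\<psi> x))) * (norm (VV x b))\<^sup>2 \<le> t * (norm (VV x b))\<^sup>2"
      using xS(3) by (simp add: cinner_in_line[OF l norm_\<psi>[OF xS(1)] A] del: of_real_power)
    then show ?thesis using xS(2) by simp
  qed
  have rA: "(\<lambda>x. trace (A \<circ> r x)) \<in> borel_measurable (completion ?m)"
    and rI: "\<And>F. F \<in> sets X \<Longrightarrow> has_bochner_integral (completion ?m) (\<lambda>x. indicator F x *\<^sub>R trace (A \<circ> r x)) (trace (A \<circ> M F \<rho>))"
    using r A unfolding posteriori_states_def by auto
  have "(\<lambda>x. Re (trace (A \<circ> r x))) \<in> borel_measurable (completion ?m)" using rA by measurable
  \<comment> \<open>A version measurable before completion, so that \<open>K\<close> becomes a set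
    in \<open>sets X\<close> to which \<open>M\<close> applies.\<close>
  then obtain g where g: "g \<in> borel_measurable ?m" "AE x in ?m. Re (trace (A \<circ> r x)) = g x"
    using completion_ex_borel_measurable_real by blast
  define K where "K = {x \<in> space ?m. x \<in> F0 \<and> t < g x}"
  have Km: "K \<in> sets ?m"
  proof -
    have [measurable]: "F0 \<in> sets ?m" "g \<in> borel_measurable ?m" using F0(1) m_sets g by auto
    show ?thesis unfolding K_def by measurable
  qed
  then have K: "K \<in> sets X" using m_sets by simp
  have KFs: "K \<subseteq> Fs" "K \<subseteq> F0" using F0(2) by (auto simp: K_def S_def)
  have "has_bochner_integral (completion ?m) (\<lambda>x. indicator K x * g x) (Re (trace (A \<circ> M K \<rho>)))"
    by (rule has_bochner_integral_completion_cong_AE[OF has_bochner_integral_bounded_linear[OF bounded_linear_Re rI[OF K]]])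
      (use g(2) in eventually_elim, simp)
  then have I1: "has_bochner_integral ?m (\<lambda>x. indicator K x * g x) (Re (trace (A \<circ> M K \<rho>)))"
    by (subst (asm) has_bochner_integral_completion_iff) (rule borel_measurable_times[OF borel_measurable_indicator[OF Km] g(1)])
  have "measure ?m K = Re (trace (M K \<rho>))"
  proof -
    have "0 \<le> Re (trace (M K \<rho>))"
      by (rule Re_trace_nonneg[OF instrument_parts(4)[OF K \<rho>'(1)]
        completely_positive_positive[OF instrument_parts(2)[OF K] \<rho>'(1,2)]])
    then show ?thesis by (simp add: measure_def emeasure_posteriori[OF \<rho>'(1,2) K])
  qed
  then have I2: "has_bochner_integral ?m (\<lambda>x. indicator K x * t) (Re (trace (M K \<rho>)) * t)"
    using Km by (simp add: has_bochner_integral_iff m.emeasure_finite less_top[symmetric])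
  have I: "has_bochner_integral ?m (\<lambda>x. indicator K x * g x - indicator K x * t) (Re (trace (A \<circ> M K \<rho>)) - Re (trace (M K \<rho>)) * t)"
    by (rule has_bochner_integral_diff[OF I1 I2])
  have "Re (trace (A \<circ> M K \<rho>)) \<le> t * Re (trace (M K \<rho>))"
    by (rule trace_le_on_sublevel[OF \<rho>'(1,2) A K KFs(1) _ b]) (use le KFs in auto)
  then have "(LINT x|?m. indicator K x * g x - indicator K x * t) \<le> 0"
    using I by (simp add: has_bochner_integral_iff mult.commute)
  \<comment> \<open>The integrand is nonnegative by the choice of \<open>K\<close>, while its
    integral is at most \<open>0\<close>.\<close>
  moreover have nn: "0 \<le> indicator K x * g x - indicator K x * t" for x
    by (auto simp: indicator_def K_def)
  moreover have "0 \<le> (LINT x|?m. indicator K x * g x - indicator K x * t)"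
    by (rule Bochner_Integration.integral_nonneg) (rule nn)
  ultimately have "(LINT x|?m. indicator K x * g x - indicator K x * t) = 0" by simp
  then have "AE x in ?m. indicator K x * g x - indicator K x * t = 0"
    using I nn by (subst integral_nonneg_eq_0_iff_AE[symmetric]) (auto simp: has_bochner_integral_iff)
  then have "AE x in ?m. x \<notin> K"
    by eventually_elim (auto simp: K_def indicator_def split: if_splits)
  moreover have "AE x in ?m. x \<in> F0 \<longleftrightarrow> x \<in> S"
    unfolding F0_def by (intro AE_posteriori[OF \<rho>'(1,2)] AE_in_main_part S)
  ultimately show ?thesis using g(2) AE_space
    by eventually_elim (auto simp: S_def K_def m_space space_\<mu>)
qed

text \<open>The tests \<open>s |c\<rangle>\<langle>c|\<close> with \<open>s\<close> equal to
  \<open>1\<close> or \<open>-1\<close>, \<open>c\<close> in a countable dense set and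
  \<open>t\<close> rational are countably many, so one null set serves them all. The two signs give
  equality of the quadratic forms on the dense set, and these determine the operator.\<close>

lemma AE_posteriori_eq:
  assumes \<rho>: "state \<rho>" and r: "posteriori_states X M \<rho> r"
  shows "AE x in posteriori_measure X M \<rho>. x \<in> Fs \<longrightarrow> r x = ket_bra (\<psi> x) (\<psi> x)"
proof -
  let ?m = "posteriori_measure X M \<rho>"
  have \<rho>': "trace_class \<rho>" "positive_op \<rho>" using \<rho> by (auto simp: state_def)
  obtain Q :: "'b set" where Q: "countable Q" "\<And>U. open U \<Longrightarrow> U \<noteq> {} \<Longrightarrow> \<exists>d\<in>Q. d \<in> U"
    using countable_dense_exists[where 'a = 'b] by auto
  have Q_dense: "closure Q = UNIV"
    using Q(2)[of "- closure Q"] closure_subset[of Q] by blast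
  have "AE x in ?m. \<forall>c\<in>Q. \<forall>b\<in>B. \<forall>t\<in>\<rat>. \<forall>s\<in>{1, -1::complex}. x \<in> Fs \<and> VV x b \<noteq> 0 \<and>
      Re (cinner (VV x b) (amplify (\<lambda>z. s *\<^sub>C ket_bra c c z) (VV x b))) \<le> t * (norm (VV x b))\<^sup>2
      \<longrightarrow> Re (trace ((\<lambda>z. s *\<^sub>C ket_bra c c z) \<circ> r x)) \<le> t"
    using Q(1) B(2)
    by (simp only: AE_ball_countable countable_rat countable_finite finite.intros)
      (intro ballI AE_trace_le[OF \<rho> r] bounded_op_comp_scaleC bounded_op_ket_bra)
  moreover have "AE x in ?m. \<forall>b\<in>B. x \<in> Fs \<longrightarrow> reg x b \<and> in_line (\<psi> x) (VV x b)"
    using B by (intro AE_posteriori[OF \<rho>'], subst AE_ball_countable) (auto intro: AE_in_line)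
  moreover have "AE x in ?m. state (r x)" using r by (simp add: posteriori_states_def)
  ultimately show ?thesis
  proof eventually_elim
    case (elim x)
    show ?case
    proof
      assume x: "x \<in> Fs"
      have rx: "trace_class (r x)" "positive_op (r x)" using elim(3) by (auto simp: state_def)
      \<comment> \<open>If all \<open>VV x b\<close> vanished, \<open>rank_le_one\<close> would
        hold. The vector \<open>b\<close> may depend on \<open>x\<close> because the tests range
        over all of \<open>B\<close>.\<close>
      obtain b where b: "b \<in> B" "VV x b \<noteq> 0"
        using Fs(3)[OF x] unfolding rank_le_one_def by (metis mult_zero_left norm_zero slice_zero(1) cinner_zero_left zero_eq_power2)
      have l: "in_line (\<psi> x) (VV x b)" using elim(2) b x by blast
      have le: "Re (s * cinner c (r x c)) \<le> Re (s * cinner (\<psi> x) (ket_bra c c (\<psi> x)))" if c: "c \<in> Q" and s: "s \<in> {1, -1}" for c s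
      proof (rule dense_ge)
        fix u assume u: "Re (s * cinner (\<psi> x) (ket_bra c c (\<psi> x))) < u"
        obtain t where t: "t \<in> \<rat>" "Re (s * cinner (\<psi> x) (ket_bra c c (\<psi> x))) < t" "t < u"
          using Rats_dense_in_real[OF u] by blast
        have A: "bounded_op (\<lambda>z. s *\<^sub>C ket_bra c c z)" by (intro bounded_op_comp_scaleC bounded_op_ket_bra)
        have "Re (s * cinner (\<psi> x) (ket_bra c c (\<psi> x))) * (norm (VV x b))\<^sup>2 \<le> t * (norm (VV x b))\<^sup>2"
          using t(2) by (intro mult_right_mono) auto
        then have "Re (cinner (VV x b) (amplify (\<lambda>z. s *\<^sub>C ket_bra c c z) (VV x b))) \<le> t * (norm (VV x b))\<^sup>2"
          by (simp add: cinner_in_line[OF l norm_\<psi>[OF x] A] cinner_scaleC_right del: of_real_power)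
        then have "Re (trace ((\<lambda>z. s *\<^sub>C ket_bra c c z) \<circ> r x)) \<le> t"
          using elim(1) c b t(1) s x by blast
        moreover have "trace ((\<lambda>z. s *\<^sub>C ket_bra c c z) \<circ> r x) = s * cinner c (r x c)"
          using trace_scaleC[OF trace_class_compose[OF bounded_op_ket_bra rx(1)], of s c c]
          by (simp add: o_def trace_ket_bra_compose[OF rx(1), unfolded o_def])
        ultimately show "Re (s * cinner c (r x c)) \<le> u" using t(3) by simp
      qed
      have eqQ: "cinner c (r x c) = cinner c (ket_bra (\<psi> x) (\<psi> x) c)" if c: "c \<in> Q" for c
      proof -
        have "Re (cinner c (r x c)) = Re (cinner (\<psi> x) (ket_bra c c (\<psi> x)))"
          using le[OF c, of 1] le[OF c, of "-1"] by simp
        moreover have "cinner (\<psi> x) (ket_bra c c (\<psi> x)) = complex_of_real ((cmod (cinner c (\<psi> x)))\<^sup>2)"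
          unfolding ket_bra_def cinner_scaleC_right using cinner_mult_commute by blast
        moreover have "cinner c (ket_bra (\<psi> x) (\<psi> x) c) = complex_of_real ((cmod (cinner c (\<psi> x)))\<^sup>2)"
          unfolding ket_bra_def cinner_scaleC_right using cinner_mult_commute[of "\<psi> x" c]
          by (simp add: cmod_cinner_commute)
        moreover have "Im (cinner c (r x c)) = 0"
          using rx(2) by (simp add: positive_op_def nonneg_complex_iff)
        ultimately show ?thesis by (simp add: complex_eq_iff del: of_real_power)
      qed
      have "closed {c. cinner c (r x c) = cinner c (ket_bra (\<psi> x) (\<psi> x) c)}"
        by (intro closed_Collect_eq continuous_on_cinner continuous_on_id continuous_on_bounded_op
          trace_class_bounded_op[OF rx(1)] bounded_op_ket_bra)
      then have "cinner c (r x c) = cinner c (ket_bra (\<psi> x) (\<psi> x) c)" for c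
        using closure_minimal[of Q "{c. cinner c (r x c) = cinner c (ket_bra (\<psi> x) (\<psi> x) c)}"] eqQ Q_dense by blast
      then show "r x = ket_bra (\<psi> x) (\<psi> x)"
        by (intro bounded_op_eq_on_dense_form[OF trace_class_bounded_op[OF rx(1)] bounded_op_ket_bra, where S = UNIV])
          (auto simp: complex_vector.subspace_UNIV)
    qed
  qed
qed

end

text \<open>The factorization is stated for each \<open>\<phi>\<close> with its own null set,
  because the integrals constrain the operators one vector at a time; with a countable algebraic
  spanning set of \<open>D\<close> a single null set serves all vectors, and the ranges are then
  determined as well.\<close>

theorem proposition5:
  fixes X \<mu> :: "'x measure"
    and M :: "'x set \<Rightarrow> ('h::{complex_hilbert, second_countable_topology} \<Rightarrow> 'h) \<Rightarrow> ('h \<Rightarrow> 'h)"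
    and D :: "'h set"
    and V :: "nat \<Rightarrow> 'x \<Rightarrow> 'h \<Rightarrow> 'h"
  assumes "instrument X M"
    and "kraus_representation X M \<mu> D V"
    and "kraus_normalized \<mu> D V"
    and "\<not> efficient X M"
  shows "\<exists>Fs\<in>sets X.
    (\<exists>T. trace_class T \<and> M Fs T \<noteq> (\<lambda>_. 0)) \<and>
    (\<forall>x\<in>Fs. nonzero_on D (V 2 x)) \<and>
    (irreducible_instrument X M \<longrightarrow>
      (\<exists>(\<omega> :: nat \<Rightarrow> 'x \<Rightarrow> 'h \<Rightarrow> complex) (\<psi> :: 'x \<Rightarrow> 'h).
        (\<forall>x\<in>Fs. norm (\<psi> x) = 1 \<and> (\<forall>k\<ge>1. clinear_on D (\<omega> k x))) \<and>
        ((\<exists>B. countable B \<and> D = cspan B) \<longrightarrow>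
          (AE x in \<mu>. x \<in> Fs \<longrightarrow>
            (\<forall>k\<ge>1. (nonzero_on D (V k x) \<longrightarrow> V k x ` D = cspan {\<psi> x}) \<and>
              (\<forall>\<phi>\<in>D. V k x \<phi> = \<omega> k x \<phi> *\<^sub>C \<psi> x)))) \<and>
        (\<forall>\<phi>\<in>D. AE x in \<mu>. x \<in> Fs \<longrightarrow> (\<forall>k\<ge>1. V k x \<phi> = \<omega> k x \<phi> *\<^sub>C \<psi> x)) \<and>
        (\<forall>\<phi>\<in>D. \<forall>A. bounded_op A \<longrightarrow> (\<forall>F\<in>sets X. F \<subseteq> Fs \<longrightarrow>
          has_bochner_integral (completion \<mu>)
            (\<lambda>x. indicator F x *\<^sub>R (cinner (\<psi> x) (A (\<psi> x)) *
              complex_of_real (\<Sum>\<^sub>\<infinity>k\<in>{1..}. (cmod (\<omega> k x \<phi>))\<^sup>2)))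
            (cinner \<phi> (dual_map (M F) A \<phi>)))) \<and>
        (\<forall>\<rho> r. state \<rho> \<and> posteriori_states X M \<rho> r \<longrightarrow>
          (AE x in posteriori_measure X M \<rho>. x \<in> Fs \<longrightarrow> r x = ket_bra (\<psi> x) (\<psi> x)))))"
proof -
  have "csubspace D" "closure D = UNIV" using assms(2) by (auto simp: kraus_representation_def)
  then obtain B where B: "countable B" "B \<subseteq> D" "is_onb B" by (rule onb_exists_in_dense)
  interpret kraus X \<mu> M D V B by unfold_locales (use assms B in auto)
  obtain Fs where Fs: "Fs \<in> sets X" "\<exists>T. trace_class T \<and> M Fs T \<noteq> (\<lambda>_. 0)"
    "\<And>x. x \<in> Fs \<Longrightarrow> nonzero_on D (V 2 x)" "\<And>x. x \<in> Fs \<Longrightarrow> \<not> rank_le_one x"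
    "\<And>x b. x \<in> Fs \<Longrightarrow> b \<in> B \<Longrightarrow> reg x b"
    using strong_set[OF assms(3,4)] by blast
  show ?thesis
  proof (intro bexI[OF _ Fs(1)] conjI impI Fs(2) ballI)
    show "nonzero_on D (V 2 x)" if "x \<in> Fs" for x using Fs(3)[OF that] .
    assume "irreducible_instrument X M"
    then interpret I: irreducible_kraus X \<mu> M D V B Fs
      by unfold_locales (use Fs in auto)
    show "\<exists>(\<omega> :: nat \<Rightarrow> 'x \<Rightarrow> 'h \<Rightarrow> complex) (\<psi> :: 'x \<Rightarrow> 'h).
        (\<forall>x\<in>Fs. norm (\<psi> x) = 1 \<and> (\<forall>k\<ge>1. clinear_on D (\<omega> k x))) \<and>
        ((\<exists>B. countable B \<and> D = cspan B) \<longrightarrow>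
          (AE x in \<mu>. x \<in> Fs \<longrightarrow>
            (\<forall>k\<ge>1. (nonzero_on D (V k x) \<longrightarrow> V k x ` D = cspan {\<psi> x}) \<and>
              (\<forall>\<phi>\<in>D. V k x \<phi> = \<omega> k x \<phi> *\<^sub>C \<psi> x)))) \<and>
        (\<forall>\<phi>\<in>D. AE x in \<mu>. x \<in> Fs \<longrightarrow> (\<forall>k\<ge>1. V k x \<phi> = \<omega> k x \<phi> *\<^sub>C \<psi> x)) \<and>
        (\<forall>\<phi>\<in>D. \<forall>A. bounded_op A \<longrightarrow> (\<forall>F\<in>sets X. F \<subseteq> Fs \<longrightarrow>
          has_bochner_integral (completion \<mu>)
            (\<lambda>x. indicator F x *\<^sub>R (cinner (\<psi> x) (A (\<psi> x)) *
              complex_of_real (\<Sum>\<^sub>\<infinity>k\<in>{1..}. (cmod (\<omega> k x \<phi>))\<^sup>2)))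
            (cinner \<phi> (dual_map (M F) A \<phi>)))) \<and>
        (\<forall>\<rho> r. state \<rho> \<and> posteriori_states X M \<rho> r \<longrightarrow>
          (AE x in posteriori_measure X M \<rho>. x \<in> Fs \<longrightarrow> r x = ket_bra (\<psi> x) (\<psi> x)))"
      using I.norm_\<psi> I.clinear_on_\<omega> I.AE_range_V I.AE_V_eq_\<omega> I.integral_\<omega> I.AE_posteriori_eq
      by (intro exI[of _ I.\<omega>] exI[of _ I.\<psi>]) blast
  qed
qed

end
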